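(* In the category $\mathtt{Ste}^\circledast$ of stereotype algebras: (a) each algebra $A$ has an envelope in the class $\mathrm{Epi}$ of all epimorphisms (respectively, in the class $\mathrm{SEpi}$ of all strong epimorphisms) of $\mathtt{Ste}^\circledast$ with respect to an arbitrary set (respectively, class) of morphisms $\varPhi$ going from $A$; in addition, (i) if $\varPhi$ differs morphisms on the outside in $\mathtt{Ste}^\circledast$, then the envelope in $\mathrm{Epi}$ is an envelope in the class $\mathrm{Bim}$ of all bimorphisms: $\mathrm{env}_\varPhi^{\mathrm{Epi}}A=\mathrm{env}_\varPhi^{\mathrm{Bim}}A$; (ii) if $\varPhi$ differs morphisms on the outside and is a right ideal in $\mathtt{Ste}^\circledast$, then the envelope in $\mathrm{Epi}$ is also an envelope in any other class $\varOmega$ of morphisms containing $\mathrm{Bim}$ (for example, in the class $\mathrm{Mor}$ of all morphisms): $\mathrm{env}_\varPhi^{\mathrm{Epi}}A=\mathrm{env}_\varPhi^{\mathrm{Bim}}A=\mathrm{env}_\varPhi^{\varOmega}A=\mathrm{env}_\varPhi^{\mathrm{Mor}}A$ for $\varOmega\supseteq\mathrm{Bim}$. (b) each algebra $A$ has a refinement in the class $\mathrm{Mono}$ of all monomorphisms (respectively, in the class $\mathrm{SMono}$ of all strong monomorphisms) of $\mathtt{Ste}^\circledast$ by means of an arbitrary class $\varPhi$ of morphisms going to $A$; in addition, (i) if $\varPhi$ differs morphisms on the inside in $\mathtt{Ste}^\circledast$, then the refinement in $\mathrm{Mono}$ is also a refinement in $\mathrm{Bim}$: $\mathrm{ref}_\varPhi^{\mathrm{Mono}}A=\mathrm{ref}_\varPhi^{\mathrm{Bim}}A$;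 (ii) if $\varPhi$ differs morphisms on the inside and is a left ideal in $\mathtt{Ste}^\circledast$, then the refinement in $\mathrm{Mono}$ is also a refinement in any other class $\varGamma$ of morphisms containing $\mathrm{Bim}$ (for example, in $\mathrm{Mor}$): $\mathrm{ref}_\varPhi^{\mathrm{Mono}}A=\mathrm{ref}_\varPhi^{\mathrm{Bim}}A=\mathrm{ref}_\varPhi^{\varGamma}A=\mathrm{ref}_\varPhi^{\mathrm{Mor}}A$ for $\varGamma\supseteq\mathrm{Bim}$.
   Context: All locally convex spaces are Hausdorff and over $\mathbb{C}$. For a locally convex space $X$, $X^\star$ is the space of continuous linear functionals on $X$ with the topology of uniform convergence on totally bounded sets; $X$ is stereotype if the natural map $X\to(X^\star)^\star$ is an isomorphism of locally convex spaces. A stereotype algebra is a stereotype space $A$ with a structure of unital associative $\mathbb{C}$-algebra such that for every compact $K\subseteq A$ and every neighbourhood of zero $U$ in $A$ there is a neighbourhood of zero $V$ in $A$ with $K\cdot V\subseteq U$ and $V\cdot K\subseteq U$. $\mathtt{Ste}^\circledast$ is the category of stereotype algebras and continuous unital algebra homomorphisms. A class $\varPhi$ goes from (goes to) $A$ if it contains a morphism with domain (respectively, range) $A$. A bimorphism is a morphism that is a monomorphism and an epimorphism. A monomorphism $\mu:C\to D$ is strong if for every epimorphism $\varepsilon:P\to Q$ and all $\alpha:P\to C$, $\beta:Q\to D$ with $\beta\circ\varepsilon=\mu\circ\alpha$ there is $\delta:Q\to C$ with $\delta\circ\varepsilon=\alpha$, $\mu\circ\delta=\beta$; strong epimorphisms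 are defined dually. Envelope: $\sigma:X\to X'$ is an extension of $X$ in $\varOmega$ with respect to $\varPhi$ if $\sigma\in\varOmega$ and for every $\varphi:X\to B$ in $\varPhi$ there is a unique $\varphi':X'\to B$ with $\varphi=\varphi'\circ\sigma$. An extension $\rho:X\to E$ is an envelope $\mathrm{env}_\varPhi^\varOmega X$ if for every extension $\sigma:X\to X'$ there is a unique $\upsilon:X'\to E$ with $\rho=\upsilon\circ\sigma$. Refinement: $\sigma:X'\to X$ is an enrichment of $X$ in $\varGamma$ by means of $\varPhi$ if $\sigma\in\varGamma$ and for every $\varphi:B\to X$ in $\varPhi$ there is a unique $\varphi':B\to X'$ with $\varphi=\sigma\circ\varphi'$. An enrichment $\rho:E\to X$ is a refinement $\mathrm{ref}_\varPhi^\varGamma X$ if for every enrichment $\sigma:X'\to X$ there is a unique $\upsilon:E\to X'$ with $\rho=\sigma\circ\upsilon$. Equalities of envelopes (refinements) mean that all of them exist and coincide (up to isomorphism). $\varPhi$ differs morphisms on the outside (inside) if for any two different parallel morphisms $\alpha\ne\beta:X\to Y$ there is $\varphi\in\varPhi$, $\varphi:Y\to M$ with $\varphi\circ\alpha\ne\varphi\circ\beta$ (respectively, $\varphi:M\to X$ with $\alpha\circ\varphi\ne\beta\circ\varphi$). $\varPhi$ is a right (left) ideal if $\varphi\circ\mu\in\varPhi$ (respectively, $\mu\circ\varphi\in\varPhi$) for all $\varphi\in\varPhi$ and all composable morphisms $\mu$. *)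

theory Defs
  imports "HOL-Analysis.Analysis" "HOL-Algebra.Module" "HOL-Algebra.Coset"
begin

unbundle cardinal_syntax

section \<open>Abstract categories\<close>

record ('o, 'm) category_data =
  Obj :: "'o set"
  Mor :: "'m set"
  Dom :: "'m \<Rightarrow> 'o"
  Cod :: "'m \<Rightarrow> 'o"
  Id :: "'o \<Rightarrow> 'm"
  Comp :: "'m \<Rightarrow> 'm \<Rightarrow> 'm" (infixr \<open>\<cdot>\<index>\<close> 75)

definition Hom :: "('o, 'm) category_data \<Rightarrow> 'o \<Rightarrow> 'o \<Rightarrow> 'm set" where
  "Hom C X Y = {f \<in> Mor C. Dom C f = X \<and> Cod C f = Y}"

locale category =
  fixes C :: "('o, 'm) category_data" (structure)
  assumes dom_obj: "f \<in> Mor C \<Longrightarrow> Dom C f \<in> Obj C"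
    and cod_obj: "f \<in> Mor C \<Longrightarrow> Cod C f \<in> Obj C"
    and id_hom: "X \<in> Obj C \<Longrightarrow> Id C X \<in> Hom C X X"
    and comp_hom: "f \<in> Hom C X Y \<Longrightarrow> g \<in> Hom C Y Z \<Longrightarrow> g \<cdot> f \<in> Hom C X Z"
    and comp_id_right: "f \<in> Hom C X Y \<Longrightarrow> f \<cdot> Id C X = f"
    and comp_id_left: "f \<in> Hom C X Y \<Longrightarrow> Id C Y \<cdot> f = f"
    and comp_assoc: "f \<in> Hom C W X \<Longrightarrow> g \<in> Hom C X Y \<Longrightarrow> h \<in> Hom C Y Z
      \<Longrightarrow> (h \<cdot> g) \<cdot> f = h \<cdot> (g \<cdot> f)"

definition Monos :: "('o, 'm) category_data \<Rightarrow> 'm set" where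
  "Monos C = {\<mu> \<in> Mor C. \<forall>X. \<forall>\<alpha>\<in>Hom C X (Dom C \<mu>). \<forall>\<beta>\<in>Hom C X (Dom C \<mu>).
     \<mu> \<cdot>\<^bsub>C\<^esub> \<alpha> = \<mu> \<cdot>\<^bsub>C\<^esub> \<beta> \<longrightarrow> \<alpha> = \<beta>}"

definition Epis :: "('o, 'm) category_data \<Rightarrow> 'm set" where
  "Epis C = {\<epsilon> \<in> Mor C. \<forall>Y. \<forall>\<alpha>\<in>Hom C (Cod C \<epsilon>) Y. \<forall>\<beta>\<in>Hom C (Cod C \<epsilon>) Y.
     \<alpha> \<cdot>\<^bsub>C\<^esub> \<epsilon> = \<beta> \<cdot>\<^bsub>C\<^esub> \<epsilon> \<longrightarrow> \<alpha> = \<beta>}"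

definition Bims :: "('o, 'm) category_data \<Rightarrow> 'm set" where
  "Bims C = Monos C \<inter> Epis C"

definition SMonos :: "('o, 'm) category_data \<Rightarrow> 'm set" where
  "SMonos C = {\<mu> \<in> Monos C. \<forall>\<epsilon>\<in>Epis C. \<forall>\<alpha>\<in>Hom C (Dom C \<epsilon>) (Dom C \<mu>). \<forall>\<beta>\<in>Hom C (Cod C \<epsilon>) (Cod C \<mu>).
     \<beta> \<cdot>\<^bsub>C\<^esub> \<epsilon> = \<mu> \<cdot>\<^bsub>C\<^esub> \<alpha> \<longrightarrow>
     (\<exists>\<delta>\<in>Hom C (Cod C \<epsilon>) (Dom C \<mu>). \<delta> \<cdot>\<^bsub>C\<^esub> \<epsilon> = \<alpha> \<and> \<mu> \<cdot>\<^bsub>C\<^esub> \<delta> = \<beta>)}"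

definition SEpis :: "('o, 'm) category_data \<Rightarrow> 'm set" where
  "SEpis C = {\<epsilon> \<in> Epis C. \<forall>\<mu>\<in>Monos C. \<forall>\<alpha>\<in>Hom C (Dom C \<epsilon>) (Dom C \<mu>). \<forall>\<beta>\<in>Hom C (Cod C \<epsilon>) (Cod C \<mu>).
     \<beta> \<cdot>\<^bsub>C\<^esub> \<epsilon> = \<mu> \<cdot>\<^bsub>C\<^esub> \<alpha> \<longrightarrow>
     (\<exists>\<delta>\<in>Hom C (Cod C \<epsilon>) (Dom C \<mu>). \<delta> \<cdot>\<^bsub>C\<^esub> \<epsilon> = \<alpha> \<and> \<mu> \<cdot>\<^bsub>C\<^esub> \<delta> = \<beta>)}"

definition goes_from :: "('o, 'm) category_data \<Rightarrow> 'm set \<Rightarrow> 'o \<Rightarrow> bool" where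
  "goes_from C \<Phi> X \<longleftrightarrow> (\<exists>\<phi>\<in>\<Phi>. Dom C \<phi> = X)"

definition goes_to :: "('o, 'm) category_data \<Rightarrow> 'm set \<Rightarrow> 'o \<Rightarrow> bool" where
  "goes_to C \<Phi> X \<longleftrightarrow> (\<exists>\<phi>\<in>\<Phi>. Cod C \<phi> = X)"

definition differs_outside :: "('o, 'm) category_data \<Rightarrow> 'm set \<Rightarrow> bool" where
  "differs_outside C \<Phi> \<longleftrightarrow> (\<forall>X Y. \<forall>\<alpha>\<in>Hom C X Y. \<forall>\<beta>\<in>Hom C X Y. \<alpha> \<noteq> \<beta> \<longrightarrow>
     (\<exists>\<phi>\<in>\<Phi>. Dom C \<phi> = Y \<and> \<phi> \<cdot>\<^bsub>C\<^esub> \<alpha> \<noteq> \<phi> \<cdot>\<^bsub>C\<^esub> \<beta>))"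

definition differs_inside :: "('o, 'm) category_data \<Rightarrow> 'm set \<Rightarrow> bool" where
  "differs_inside C \<Phi> \<longleftrightarrow> (\<forall>X Y. \<forall>\<alpha>\<in>Hom C X Y. \<forall>\<beta>\<in>Hom C X Y. \<alpha> \<noteq> \<beta> \<longrightarrow>
     (\<exists>\<phi>\<in>\<Phi>. Cod C \<phi> = X \<and> \<alpha> \<cdot>\<^bsub>C\<^esub> \<phi> \<noteq> \<beta> \<cdot>\<^bsub>C\<^esub> \<phi>))"

definition right_ideal :: "('o, 'm) category_data \<Rightarrow> 'm set \<Rightarrow> bool" where
  "right_ideal C \<Phi> \<longleftrightarrow> (\<forall>\<phi>\<in>\<Phi>. \<forall>\<mu>\<in>Mor C. Cod C \<mu> = Dom C \<phi> \<longrightarrow> \<phi> \<cdot>\<^bsub>C\<^esub> \<mu> \<in> \<Phi>)"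

definition left_ideal :: "('o, 'm) category_data \<Rightarrow> 'm set \<Rightarrow> bool" where
  "left_ideal C \<Phi> \<longleftrightarrow> (\<forall>\<phi>\<in>\<Phi>. \<forall>\<mu>\<in>Mor C. Dom C \<mu> = Cod C \<phi> \<longrightarrow> \<mu> \<cdot>\<^bsub>C\<^esub> \<phi> \<in> \<Phi>)"

definition extension :: "('o, 'm) category_data \<Rightarrow> 'm set \<Rightarrow> 'm set \<Rightarrow> 'o \<Rightarrow> 'm \<Rightarrow> bool" where
  "extension C \<Omega> \<Phi> X \<sigma> \<longleftrightarrow> \<sigma> \<in> \<Omega> \<and> Dom C \<sigma> = X \<and>
     (\<forall>\<phi>\<in>\<Phi>. Dom C \<phi> = X \<longrightarrow> (\<exists>!\<phi>'. \<phi>' \<in> Hom C (Cod C \<sigma>) (Cod C \<phi>) \<and> \<phi> = \<phi>' \<cdot>\<^bsub>C\<^esub> \<sigma>))"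

definition enrichment :: "('o, 'm) category_data \<Rightarrow> 'm set \<Rightarrow> 'm set \<Rightarrow> 'o \<Rightarrow> 'm \<Rightarrow> bool" where
  "enrichment C \<Gamma> \<Phi> X \<sigma> \<longleftrightarrow> \<sigma> \<in> \<Gamma> \<and> Cod C \<sigma> = X \<and>
     (\<forall>\<phi>\<in>\<Phi>. Cod C \<phi> = X \<longrightarrow> (\<exists>!\<phi>'. \<phi>' \<in> Hom C (Dom C \<phi>) (Dom C \<sigma>) \<and> \<phi> = \<sigma> \<cdot>\<^bsub>C\<^esub> \<phi>'))"

text \<open>Envelopes and refinements are determined only up to isomorphism, so \<open>Env\<close> and \<open>Ref\<close> are
  the sets of all of them. An equation \<open>Env C \<Omega>\<^sub>1 \<Phi> X = Env C \<Omega>\<^sub>2 \<Phi> X\<close> says that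
  the envelopes in \<open>\<Omega>\<^sub>1\<close> are exactly the envelopes in \<open>\<Omega>\<^sub>2\<close>; existence is
  nonemptiness.\<close>

definition Env :: "('o, 'm) category_data \<Rightarrow> 'm set \<Rightarrow> 'm set \<Rightarrow> 'o \<Rightarrow> 'm set" where
  "Env C \<Omega> \<Phi> X = {\<rho>. extension C \<Omega> \<Phi> X \<rho> \<and>
     (\<forall>\<sigma>. extension C \<Omega> \<Phi> X \<sigma> \<longrightarrow> (\<exists>!\<upsilon>. \<upsilon> \<in> Hom C (Cod C \<sigma>) (Cod C \<rho>) \<and> \<rho> = \<upsilon> \<cdot>\<^bsub>C\<^esub> \<sigma>))}"

definition Ref :: "('o, 'm) category_data \<Rightarrow> 'm set \<Rightarrow> 'm set \<Rightarrow> 'o \<Rightarrow> 'm set" where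
  "Ref C \<Gamma> \<Phi> X = {\<rho>. enrichment C \<Gamma> \<Phi> X \<rho> \<and>
     (\<forall>\<sigma>. enrichment C \<Gamma> \<Phi> X \<sigma> \<longrightarrow> (\<exists>!\<upsilon>. \<upsilon> \<in> Hom C (Dom C \<rho>) (Dom C \<sigma>) \<and> \<rho> = \<sigma> \<cdot>\<^bsub>C\<^esub> \<upsilon>))}"


section \<open>Locally convex spaces and stereotype spaces\<close>

text \<open>As usual for the \<open>module\<close> record, a space that carries no product ignores the ring
  fields \<open>mult\<close> and \<open>one\<close>.\<close>

record 'a top_module = "(complex, 'a) module" +
  topol :: "'a topology"

definition complex_field :: "complex ring" where
  "complex_field = \<lparr>carrier = UNIV, mult = (*), one = 1, zero = 0, add = (+)\<rparr>"

definition nbhd_zero :: "'a top_module \<Rightarrow> 'a set \<Rightarrow> bool" where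
  "nbhd_zero X U \<longleftrightarrow> U \<subseteq> carrier X \<and> (\<exists>W. openin (topol X) W \<and> \<zero>\<^bsub>X\<^esub> \<in> W \<and> W \<subseteq> U)"

definition convex_in :: "'a top_module \<Rightarrow> 'a set \<Rightarrow> bool" where
  "convex_in X V \<longleftrightarrow> (\<forall>x\<in>V. \<forall>y\<in>V. \<forall>t\<in>{0..1::real}.
     (of_real (1 - t) \<odot>\<^bsub>X\<^esub> x) \<oplus>\<^bsub>X\<^esub> (of_real t \<odot>\<^bsub>X\<^esub> y) \<in> V)"

definition locally_convex_space :: "'a top_module \<Rightarrow> bool" where
  "locally_convex_space X \<longleftrightarrow>
     module complex_field X \<and>
     topspace (topol X) = carrier X \<and>
     Hausdorff_space (topol X) \<and>
     continuous_map (prod_topology (topol X) (topol X)) (topol X) (\<lambda>(x, y). x \<oplus>\<^bsub>X\<^esub> y) \<and>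
     continuous_map (prod_topology euclidean (topol X)) (topol X) (\<lambda>(c, x). c \<odot>\<^bsub>X\<^esub> x) \<and>
     (\<forall>U. nbhd_zero X U \<longrightarrow> (\<exists>V. nbhd_zero X V \<and> convex_in X V \<and> V \<subseteq> U))"

definition totally_bounded_in :: "'a top_module \<Rightarrow> 'a set \<Rightarrow> bool" where
  "totally_bounded_in X S \<longleftrightarrow> S \<subseteq> carrier X \<and>
     (\<forall>U. nbhd_zero X U \<longrightarrow> (\<exists>F. finite F \<and> F \<subseteq> carrier X \<and> S \<subseteq> (\<Union>x\<in>F. (\<lambda>u. x \<oplus>\<^bsub>X\<^esub> u) ` U)))"

text \<open>Functionals are normalised to be \<open>undefined\<close> outside the carrier, so that equal
  functionals are equal functions.\<close>

definition functionals :: "'a top_module \<Rightarrow> ('a \<Rightarrow> complex) set" where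
  "functionals X = {f \<in> extensional (carrier X).
     (\<forall>x\<in>carrier X. \<forall>y\<in>carrier X. f (x \<oplus>\<^bsub>X\<^esub> y) = f x + f y) \<and>
     (\<forall>c. \<forall>x\<in>carrier X. f (c \<odot>\<^bsub>X\<^esub> x) = c * f x) \<and>
     continuous_map (topol X) euclidean f}"

definition dual_topology :: "'a top_module \<Rightarrow> ('a \<Rightarrow> complex) topology" where
  "dual_topology X = topology (\<lambda>G. G \<subseteq> functionals X \<and>
     (\<forall>f\<in>G. \<exists>S \<epsilon>. totally_bounded_in X S \<and> 0 < \<epsilon> \<and>
        {g \<in> functionals X. \<forall>x\<in>S. cmod (g x - f x) \<le> \<epsilon>} \<subseteq> G))"

definition dual_space :: "'a top_module \<Rightarrow> ('a \<Rightarrow> complex) top_module" where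
  "dual_space X = \<lparr>carrier = functionals X, mult = undefined, one = undefined,
     zero = (\<lambda>x\<in>carrier X. 0),
     add = (\<lambda>f g. \<lambda>x\<in>carrier X. f x + g x),
     smult = (\<lambda>c f. \<lambda>x\<in>carrier X. c * f x),
     topol = dual_topology X\<rparr>"

definition lcs_isomorphism :: "'a top_module \<Rightarrow> 'b top_module \<Rightarrow> ('a \<Rightarrow> 'b) \<Rightarrow> bool" where
  "lcs_isomorphism X Y h \<longleftrightarrow>
     (\<forall>x\<in>carrier X. \<forall>y\<in>carrier X. h (x \<oplus>\<^bsub>X\<^esub> y) = h x \<oplus>\<^bsub>Y\<^esub> h y) \<and>
     (\<forall>c. \<forall>x\<in>carrier X. h (c \<odot>\<^bsub>X\<^esub> x) = c \<odot>\<^bsub>Y\<^esub> h x) \<and>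
     homeomorphic_map (topol X) (topol Y) h"

definition bidual_map :: "'a top_module \<Rightarrow> 'a \<Rightarrow> (('a \<Rightarrow> complex) \<Rightarrow> complex)" where
  "bidual_map X x = (\<lambda>f\<in>functionals X. f x)"

definition stereotype_space :: "'a top_module \<Rightarrow> bool" where
  "stereotype_space X \<longleftrightarrow> locally_convex_space X \<and>
     lcs_isomorphism X (dual_space (dual_space X)) (bidual_map X)"


section \<open>The category of stereotype algebras\<close>

definition stereotype_algebra :: "'a top_module \<Rightarrow> bool" where
  "stereotype_algebra A \<longleftrightarrow>
     stereotype_space A \<and>
     ring A \<and>
     (\<forall>c. \<forall>x\<in>carrier A. \<forall>y\<in>carrier A.
        (c \<odot>\<^bsub>A\<^esub> x) \<otimes>\<^bsub>A\<^esub> y = c \<odot>\<^bsub>A\<^esub> (x \<otimes>\<^bsub>A\<^esub> y) \<and>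
        x \<otimes>\<^bsub>A\<^esub> (c \<odot>\<^bsub>A\<^esub> y) = c \<odot>\<^bsub>A\<^esub> (x \<otimes>\<^bsub>A\<^esub> y)) \<and>
     (\<forall>K U. compactin (topol A) K \<and> nbhd_zero A U \<longrightarrow>
        (\<exists>V. nbhd_zero A V \<and> K <#>\<^bsub>A\<^esub> V \<subseteq> U \<and> V <#>\<^bsub>A\<^esub> K \<subseteq> U))"

text \<open>A type \<open>'u\<close> of strongly inaccessible cardinality plays the role of the set-theoretic
  universe: sets, as opposed to proper classes, are the collections of fewer than \<open>|'u|\<close>
  elements. Up to isomorphism, the objects below are the stereotype algebras that lie in a
  Grothendieck universe.\<close>

definition small :: "'u itself \<Rightarrow> 'b set \<Rightarrow> bool" where
  "small (_ :: 'u itself) S \<longleftrightarrow> |S| <o |UNIV :: 'u set|"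

definition inaccessible :: "'u itself \<Rightarrow> bool" where
  "inaccessible u \<longleftrightarrow>
     small u (UNIV :: nat set) \<and>
     regularCard |UNIV :: 'u set| \<and>
     (\<forall>S :: 'u set. small u S \<longrightarrow> small u (Pow S))"

record 'u ste_arrow =
  source :: "'u top_module"
  target :: "'u top_module"
  map_of_arrow :: "'u \<Rightarrow> 'u"

definition ste_objects :: "'u top_module set" where
  "ste_objects = {A. stereotype_algebra A \<and> small TYPE('u) (carrier A)}"

definition ste_homs :: "'u top_module \<Rightarrow> 'u top_module \<Rightarrow> ('u \<Rightarrow> 'u) set" where
  "ste_homs A B = {h \<in> ring_hom A B.
     h \<in> extensional (carrier A) \<and>
     (\<forall>c. \<forall>x\<in>carrier A. h (c \<odot>\<^bsub>A\<^esub> x) = c \<odot>\<^bsub>B\<^esub> h x) \<and>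
     continuous_map (topol A) (topol B) h}"

definition Ste :: "('u top_module, 'u ste_arrow) category_data" where
  "Ste = \<lparr>
     Obj = ste_objects,
     Mor = {f. source f \<in> ste_objects \<and> target f \<in> ste_objects \<and>
               map_of_arrow f \<in> ste_homs (source f) (target f)},
     Dom = source,
     Cod = target,
     Id = (\<lambda>A. \<lparr>source = A, target = A, map_of_arrow = (\<lambda>x\<in>carrier A. x)\<rparr>),
     Comp = (\<lambda>g f. \<lparr>source = source f, target = target g,
               map_of_arrow = compose (carrier (source f)) (map_of_arrow g) (map_of_arrow f)\<rparr>)\<rparr>"


section \<open>Well-definedness\<close>

lemma field_complex_field: "field complex_field"
proof -
  have "\<exists>y. x + y = 0" for x :: complex
    using add.right_inverse by blast
  moreover have "x \<noteq> 0 \<Longrightarrow> \<exists>y. x * y = 1" for x :: complex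
    by (rule exI[of _ "inverse x"]) auto
  ultimately show ?thesis
    unfolding complex_field_def using add.right_inverse
    by unfold_locales (auto simp: algebra_simps Units_def)
qed

lemma totally_bounded_in_Un:
  assumes "totally_bounded_in X S" "totally_bounded_in X T"
  shows "totally_bounded_in X (S \<union> T)"
  unfolding totally_bounded_in_def
proof (intro conjI allI impI)
  show "S \<union> T \<subseteq> carrier X"
    using assms unfolding totally_bounded_in_def by blast
  fix U assume "nbhd_zero X U"
  then obtain F G where
    F: "finite F" "F \<subseteq> carrier X" "S \<subseteq> (\<Union>x\<in>F. (\<lambda>u. x \<oplus>\<^bsub>X\<^esub> u) ` U)" and
    G: "finite G" "G \<subseteq> carrier X" "T \<subseteq> (\<Union>x\<in>G. (\<lambda>u. x \<oplus>\<^bsub>X\<^esub> u) ` U)"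
    using assms unfolding totally_bounded_in_def by metis
  show "\<exists>F. finite F \<and> F \<subseteq> carrier X \<and> S \<union> T \<subseteq> (\<Union>x\<in>F. (\<lambda>u. x \<oplus>\<^bsub>X\<^esub> u) ` U)"
    using F G by (intro exI[of _ "F \<union> G"]) auto
qed

lemma openin_dual_topology:
  "openin (dual_topology X) G \<longleftrightarrow> G \<subseteq> functionals X \<and>
     (\<forall>f\<in>G. \<exists>S \<epsilon>. totally_bounded_in X S \<and> 0 < \<epsilon> \<and>
        {g \<in> functionals X. \<forall>x\<in>S. cmod (g x - f x) \<le> \<epsilon>} \<subseteq> G)"
proof -
  let ?B = "\<lambda>f S \<epsilon>. {g \<in> functionals X. \<forall>x\<in>S. cmod (g x - f x) \<le> \<epsilon>}"
  let ?P = "\<lambda>G. G \<subseteq> functionals X \<and>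
     (\<forall>f\<in>G. \<exists>S \<epsilon>. totally_bounded_in X S \<and> 0 < \<epsilon> \<and> ?B f S \<epsilon> \<subseteq> G)"
  have "istopology ?P"
    unfolding istopology_def
  proof (rule conjI; intro allI impI)
    fix G H assume G: "?P G" and H: "?P H"
    show "?P (G \<inter> H)"
    proof (intro conjI ballI)
      show "G \<inter> H \<subseteq> functionals X" using G by blast
      fix f assume f: "f \<in> G \<inter> H"
      obtain S d where S: "totally_bounded_in X S" "0 < d" "?B f S d \<subseteq> G"
        using G f by blast
      obtain T e where T: "totally_bounded_in X T" "0 < e" "?B f T e \<subseteq> H"
        using H f by blast
      have "?B f (S \<union> T) (min d e) \<subseteq> G \<inter> H"
        using S(3) T(3) by auto
      then show "\<exists>S \<epsilon>. totally_bounded_in X S \<and> 0 < \<epsilon> \<and> ?B f S \<epsilon> \<subseteq> G \<inter> H"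
        using totally_bounded_in_Un[OF S(1) T(1)] S(2) T(2)
        by (intro exI[of _ "S \<union> T"] exI[of _ "min d e"]) simp
    qed
  next
    fix \<K> assume K: "\<forall>G\<in>\<K>. ?P G"
    show "?P (\<Union>\<K>)"
    proof (intro conjI ballI)
      show "\<Union>\<K> \<subseteq> functionals X" using K by blast
      fix f assume "f \<in> \<Union>\<K>"
      then obtain G where G: "G \<in> \<K>" "f \<in> G" by blast
      then obtain S e where "totally_bounded_in X S" "0 < e" "?B f S e \<subseteq> G"
        using K by blast
      then show "\<exists>S \<epsilon>. totally_bounded_in X S \<and> 0 < \<epsilon> \<and> ?B f S \<epsilon> \<subseteq> \<Union>\<K>"
        using G(1) by blast
    qed
  qed
  then show ?thesis
    unfolding dual_topology_def by (simp add: topology_inverse')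
qed

lemma category_Ste: "category Ste"
proof
  fix f g h :: "'u ste_arrow" and W X Y Z
  show "f \<in> Mor Ste \<Longrightarrow> Dom Ste f \<in> Obj Ste" and "f \<in> Mor Ste \<Longrightarrow> Cod Ste f \<in> Obj Ste"
    by (auto simp: Ste_def)
  {
    assume X: "X \<in> Obj Ste"
    have "topspace (topol X) = carrier X"
      using X by (auto simp: Ste_def ste_objects_def stereotype_algebra_def stereotype_space_def
          locally_convex_space_def)
    moreover have "ring X" "module complex_field X"
      using X by (auto simp: Ste_def ste_objects_def stereotype_algebra_def stereotype_space_def
          locally_convex_space_def)
    moreover have "continuous_map (topol X) (topol X) (\<lambda>x\<in>topspace (topol X). x)"
      by (rule continuous_map_eq[OF continuous_map_id]) auto
    ultimately show "Id Ste X \<in> Hom Ste X X"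
      using X
      by (auto simp: Ste_def Hom_def ste_homs_def ring_hom_def ring.ring_simprules
          module.smult_closed complex_field_def)
  }
  assume f: "f \<in> Hom Ste X Y"
  {
    assume g: "g \<in> Hom Ste Y Z"
    have sp: "topspace (topol X) = carrier X" "ring X" "module complex_field X"
      using f by (auto simp: Ste_def Hom_def ste_objects_def stereotype_algebra_def stereotype_space_def
          locally_convex_space_def)
    have "continuous_map (topol X) (topol Z) (compose (carrier X) (map_of_arrow g) (map_of_arrow f))"
    proof (rule continuous_map_eq)
      show "continuous_map (topol X) (topol Z) (map_of_arrow g \<circ> map_of_arrow f)"
        using f g by (auto simp: Ste_def Hom_def ste_homs_def intro: continuous_map_compose)
    qed (simp add: sp compose_def)
    moreover have "compose (carrier X) (map_of_arrow g) (map_of_arrow f) \<in> ring_hom X Z"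
      using f g sp(2)
      by (auto simp: Ste_def Hom_def ste_homs_def ring_hom_def compose_def Pi_iff ring.ring_simprules)
    moreover have "map_of_arrow f x \<in> carrier Y" if "x \<in> carrier X" for x
      using f that by (auto simp: Ste_def Hom_def ste_homs_def ring_hom_def)
    moreover have "c \<odot>\<^bsub>X\<^esub> x \<in> carrier X" if "x \<in> carrier X" for c x
      using module.smult_closed[OF sp(3)] that by (simp add: complex_field_def)
    ultimately show "g \<cdot>\<^bsub>Ste\<^esub> f \<in> Hom Ste X Z"
      using f g by (auto simp: Ste_def Hom_def ste_homs_def compose_def)
  }
  show "f \<cdot>\<^bsub>Ste\<^esub> Id Ste X = f" and "Id Ste Y \<cdot>\<^bsub>Ste\<^esub> f = f"
    using f by (auto simp: Ste_def Hom_def ste_homs_def ring_hom_def compose_def Pi_iff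
        extensional_def restrict_def fun_eq_iff intro!: ste_arrow.equality)
next
  fix f g h :: "'u ste_arrow" and W X Y Z
  assume "f \<in> Hom Ste W X" "g \<in> Hom Ste X Y" "h \<in> Hom Ste Y Z"
  then show "(h \<cdot>\<^bsub>Ste\<^esub> g) \<cdot>\<^bsub>Ste\<^esub> f = h \<cdot>\<^bsub>Ste\<^esub> (g \<cdot>\<^bsub>Ste\<^esub> f)"
    by (auto simp: Ste_def Hom_def ste_homs_def ring_hom_def compose_def Pi_iff restrict_def
        fun_eq_iff)
qed

end

theory Submission
  imports Defs
begin

text \<open>Limits of stereotype algebras are closed subalgebras of products, with a finer topology. Its functionals
  are obtained from the coordinate functionals by closing under linear combinations and under passing
  to any linear form bounded by \<open>1\<close> on the polar of a set of functionals that is precompact on each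
  totally bounded set; the polars of such sets are the neighbourhoods of zero. The resulting space is
  stereotype and has the same totally bounded sets as before, so multiplication stays continuous.

  Kernel pairs then show that monomorphisms are injective. Hence the limit that defines the intersection
  of a whole class of subobjects of \<open>A\<close> injects into \<open>A\<close> and is small. The refinement is the
  intersection of all enrichments, and smallest subobjects factor every morphism into an epimorphism and
  a strong monomorphism, or into a strong epimorphism and a monomorphism. The envelope in \<open>Epi\<close> is the
  first factor of the morphism from \<open>A\<close> to the product of the codomains of the elements of \<open>\<Phi>\<close>. Strong
  epimorphisms have dense image, so for the envelope in \<open>SEpi\<close> the product can be replaced by the closure
  of the image of \<open>A\<close> in it, which is small for each class \<open>\<Phi>\<close>.

  If \<open>\<Phi>\<close> differs morphisms on the outside, then every extension is a monomorphism, and also an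
  epimorphism if \<open>\<Phi>\<close> is a right ideal; enrichments are dual.\<close>

section \<open>Precompact pairings\<close>

text \<open>A closed subalgebra of a product has a locally convex topology for which the bidual map
  need not be a homeomorphism. Refining it can create new functionals, which call for a further
  refinement, and so on transfinitely. The inductive set \<open>F\<close> replaces this iteration by
  one least fixed point; the danger is that nothing is known about its members. Density removes it:
  on each set of \<open>TB\<close> every element of \<open>F\<close> is a uniform limit of linear
  combinations of coordinate functionals, because a bipolar argument at a finite net approximates
  each new form by the absolutely convex hull of old ones. Hence statements about totally bounded
  sets, points of the bidual and products can be tested on coordinates. Total boundedness in a space
  and in its dual are both read as precompactness of the single pairing \<open>f x\<close>, so that
  passing between them is the symmetry \<open>precomp_sym\<close>. The second obstacle is size: a
  product over a proper class need not be small, whereas the closure of the image of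
  \<open>A\<close> is bounded by a double power set, and an intersection of subobjects by
  \<open>A\<close> itself.\<close>

lemma cmod_diff_three: "cmod (a - d) \<le> cmod (a - b) + cmod (b - c) + cmod (d - c)"
  using dist_triangle[of a d b] dist_triangle2[of b d c] unfolding dist_norm by linarith

text \<open>The functions \<open>u s\<close> on \<open>H\<close>, for \<open>s\<close> in
  \<open>S\<close>, form a totally bounded family for the uniform distance. Pieces of small diameter
  are used instead of balls because they remain small when two covers are intersected, see
  \<open>precomp_common_cover\<close>.\<close>

definition precomp :: "('a \<Rightarrow> 'b \<Rightarrow> complex) \<Rightarrow> 'a set \<Rightarrow> 'b set \<Rightarrow> bool" where
  "precomp u S H \<longleftrightarrow> (\<forall>\<epsilon>>0. \<exists>\<C>. finite \<C> \<and> S \<subseteq> \<Union>\<C> \<and>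
     (\<forall>C\<in>\<C>. C \<subseteq> S \<and> (\<forall>s\<in>C. \<forall>t\<in>C. \<forall>f\<in>H. cmod (u s f - u t f) \<le> \<epsilon>)))"

lemma precompD:
  assumes "precomp u S H" "0 < \<epsilon>"
  obtains \<C> where "finite \<C>" "S \<subseteq> \<Union>\<C>" "\<forall>C\<in>\<C>. C \<subseteq> S"
    "\<forall>C\<in>\<C>. \<forall>s\<in>C. \<forall>t\<in>C. \<forall>f\<in>H. cmod (u s f - u t f) \<le> \<epsilon>"
proof -
  have "\<exists>\<C>. finite \<C> \<and> S \<subseteq> \<Union>\<C> \<and>
     (\<forall>C\<in>\<C>. C \<subseteq> S \<and> (\<forall>s\<in>C. \<forall>t\<in>C. \<forall>f\<in>H. cmod (u s f - u t f) \<le> \<epsilon>))"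
    using assms unfolding precomp_def by simp
  then show thesis using that by (elim exE conjE) (metis (no_types, lifting))
qed

lemma precomp_net:
  assumes "precomp u S H" "0 < \<epsilon>"
  obtains N where "finite N" "N \<subseteq> S" "\<forall>s\<in>S. \<exists>n\<in>N. \<forall>f\<in>H. cmod (u s f - u n f) \<le> \<epsilon>"
proof -
  obtain \<C> where \<C>: "finite \<C>" "S \<subseteq> \<Union>\<C>" "\<forall>C\<in>\<C>. C \<subseteq> S"
    "\<forall>C\<in>\<C>. \<forall>s\<in>C. \<forall>t\<in>C. \<forall>f\<in>H. cmod (u s f - u t f) \<le> \<epsilon>"
    by (rule precompD[OF assms])
  let ?N = "(\<lambda>C. SOME s. s \<in> C) ` {C\<in>\<C>. C \<noteq> {}}"
  have some: "(SOME s. s \<in> C) \<in> C" if "C \<noteq> {}" for C :: "'a set"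
    using that by (simp add: some_in_eq)
  show thesis
  proof (rule that)
    show "finite ?N" using \<C>(1) by simp
    show "?N \<subseteq> S" using some \<C>(3) by blast
    show "\<forall>s\<in>S. \<exists>n\<in>?N. \<forall>f\<in>H. cmod (u s f - u n f) \<le> \<epsilon>"
    proof
      fix s assume "s \<in> S"
      then obtain C where C: "C \<in> \<C>" "s \<in> C" using \<C>(2) by blast
      then show "\<exists>n\<in>?N. \<forall>f\<in>H. cmod (u s f - u n f) \<le> \<epsilon>"
        using \<C>(4) C some[of C] by (intro bexI[of _ "SOME s. s \<in> C"]) auto
    qed
  qed
qed

text \<open>The centres may be arbitrary functions on \<open>H\<close>, not only members of the
  family. Half the radius turns the balls around them into pieces of the required diameter.\<close>

lemma precompI_net:
  assumes "\<And>\<epsilon>. 0 < \<epsilon> \<Longrightarrow> \<exists>N. finite N \<and> (\<forall>s\<in>S. \<exists>v\<in>N. \<forall>f\<in>H. cmod (u s f - v f) \<le> \<epsilon>)"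
  shows "precomp u S H"
  unfolding precomp_def
proof (intro allI impI)
  fix \<epsilon> :: real assume "0 < \<epsilon>"
  then obtain N where N: "finite N" "\<forall>s\<in>S. \<exists>v\<in>N. \<forall>f\<in>H. cmod (u s f - v f) \<le> \<epsilon> / 2"
    using assms[of "\<epsilon> / 2"] by auto
  let ?C = "\<lambda>v. {s\<in>S. \<forall>f\<in>H. cmod (u s f - v f) \<le> \<epsilon> / 2}"
  have "cmod (u s f - u t f) \<le> \<epsilon>" if "s \<in> ?C v" "t \<in> ?C v" "f \<in> H" for s t f v
  proof -
    have "cmod (u s f - u t f) \<le> cmod (u s f - v f) + cmod (u t f - v f)"
      by (metis dist_norm dist_triangle2)
    also have "\<dots> \<le> \<epsilon> / 2 + \<epsilon> / 2" using that by (intro add_mono) auto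
    finally show ?thesis by simp
  qed
  then have "\<forall>C\<in>?C ` N. C \<subseteq> S \<and> (\<forall>s\<in>C. \<forall>t\<in>C. \<forall>f\<in>H. cmod (u s f - u t f) \<le> \<epsilon>)"
    by blast
  moreover have "S \<subseteq> \<Union>(?C ` N)" using N(2) by blast
  ultimately show "\<exists>\<C>. finite \<C> \<and> S \<subseteq> \<Union>\<C> \<and>
     (\<forall>C\<in>\<C>. C \<subseteq> S \<and> (\<forall>s\<in>C. \<forall>t\<in>C. \<forall>f\<in>H. cmod (u s f - u t f) \<le> \<epsilon>))"
    using N(1) by blast
qed

lemma precomp_cong: "(\<And>s f. s \<in> S \<Longrightarrow> f \<in> H \<Longrightarrow> u s f = v s f) \<Longrightarrow> precomp u S H = precomp v S H"
proof -
  have "precomp v S H" if uv: "precomp u S H" "\<And>s f. s \<in> S \<Longrightarrow> f \<in> H \<Longrightarrow> u s f = v s f" for u v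
  proof (rule precompI_net)
    fix e :: real assume "0 < e"
    then obtain N where "finite N" "N \<subseteq> S" "\<forall>s\<in>S. \<exists>n\<in>N. \<forall>f\<in>H. cmod (u s f - u n f) \<le> e"
      by (rule precomp_net[OF uv(1)])
    then show "\<exists>N. finite N \<and> (\<forall>s\<in>S. \<exists>w\<in>N. \<forall>f\<in>H. cmod (v s f - w f) \<le> e)"
      using uv(2) by (intro exI[of _ "u ` N"]) (auto simp: subset_iff)
  qed
  then show "(\<And>s f. s \<in> S \<Longrightarrow> f \<in> H \<Longrightarrow> u s f = v s f) \<Longrightarrow> precomp u S H = precomp v S H"
    by metis
qed

lemma precomp_image: "precomp u (p ` S) (q ` H) \<longleftrightarrow> precomp (\<lambda>s f. u (p s) (q f)) S H"
proof
  assume *: "precomp u (p ` S) (q ` H)"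
  show "precomp (\<lambda>s f. u (p s) (q f)) S H"
  proof (rule precompI_net)
    fix e :: real assume "0 < e"
    then obtain N where "finite N" "N \<subseteq> p ` S"
      "\<forall>s\<in>p ` S. \<exists>n\<in>N. \<forall>f\<in>q ` H. cmod (u s f - u n f) \<le> e"
      by (rule precomp_net[OF *])
    then show "\<exists>N. finite N \<and> (\<forall>s\<in>S. \<exists>v\<in>N. \<forall>f\<in>H. cmod (u (p s) (q f) - v f) \<le> e)"
      by (intro exI[of _ "(\<lambda>n f. u n (q f)) ` N"]) auto
  qed
next
  assume *: "precomp (\<lambda>s f. u (p s) (q f)) S H"
  show "precomp u (p ` S) (q ` H)"
  proof (rule precompI_net)
    fix e :: real assume "0 < e"
    then obtain N where "finite N" "N \<subseteq> S"
      "\<forall>s\<in>S. \<exists>n\<in>N. \<forall>f\<in>H. cmod (u (p s) (q f) - u (p n) (q f)) \<le> e"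
      by (rule precomp_net[OF *])
    then show "\<exists>N. finite N \<and> (\<forall>s\<in>p ` S. \<exists>v\<in>N. \<forall>f\<in>q ` H. cmod (u s f - v f) \<le> e)"
      by (intro exI[of _ "(\<lambda>n f. u (p n) f) ` N"]) auto
  qed
qed

lemma precomp_Un_left: "precomp u S H \<Longrightarrow> precomp u T H \<Longrightarrow> precomp u (S \<union> T) H"
proof (rule precompI_net)
  fix e :: real assume *: "precomp u S H" "precomp u T H" and e: "0 < e"
  obtain M where "finite M" "M \<subseteq> S" "\<forall>s\<in>S. \<exists>n\<in>M. \<forall>f\<in>H. cmod (u s f - u n f) \<le> e"
    by (rule precomp_net[OF *(1) e])
  moreover obtain N where "finite N" "N \<subseteq> T" "\<forall>s\<in>T. \<exists>n\<in>N. \<forall>f\<in>H. cmod (u s f - u n f) \<le> e"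
    by (rule precomp_net[OF *(2) e])
  ultimately show "\<exists>N. finite N \<and> (\<forall>s\<in>S \<union> T. \<exists>v\<in>N. \<forall>f\<in>H. cmod (u s f - v f) \<le> e)"
    by (intro exI[of _ "u ` (M \<union> N)"]) (simp, blast)
qed

text \<open>One cover that serves two pairings at once is what makes linear combinations and unions
  on the right precompact.\<close>

lemma precomp_common_cover:
  assumes "precomp u S H" "precomp v S G" "0 < \<epsilon>"
  obtains \<C> where "finite \<C>" "S \<subseteq> \<Union>\<C>" "\<forall>C\<in>\<C>. C \<subseteq> S"
    "\<forall>C\<in>\<C>. \<forall>s\<in>C. \<forall>t\<in>C. \<forall>f\<in>H. cmod (u s f - u t f) \<le> \<epsilon>"
    "\<forall>C\<in>\<C>. \<forall>s\<in>C. \<forall>t\<in>C. \<forall>f\<in>G. cmod (v s f - v t f) \<le> \<epsilon>"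
proof -
  obtain \<C> where \<C>: "finite \<C>" "S \<subseteq> \<Union>\<C>" "\<forall>C\<in>\<C>. C \<subseteq> S"
    "\<forall>C\<in>\<C>. \<forall>s\<in>C. \<forall>t\<in>C. \<forall>f\<in>H. cmod (u s f - u t f) \<le> \<epsilon>"
    by (rule precompD[OF assms(1,3)])
  obtain \<D> where \<D>: "finite \<D>" "S \<subseteq> \<Union>\<D>" "\<forall>C\<in>\<D>. C \<subseteq> S"
    "\<forall>C\<in>\<D>. \<forall>s\<in>C. \<forall>t\<in>C. \<forall>f\<in>G. cmod (v s f - v t f) \<le> \<epsilon>"
    by (rule precompD[OF assms(2,3)])
  let ?\<E> = "(\<lambda>(C, D). C \<inter> D) ` (\<C> \<times> \<D>)"
  show thesis
  proof (rule that[of ?\<E>])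
    show "finite ?\<E>" using \<C>(1) \<D>(1) by simp
    show "S \<subseteq> \<Union>?\<E>"
    proof
      fix s assume "s \<in> S"
      then obtain C D where "C \<in> \<C>" "s \<in> C" "D \<in> \<D>" "s \<in> D" using \<C>(2) \<D>(2) by blast
      then show "s \<in> \<Union>?\<E>" by blast
    qed
    show "\<forall>C\<in>?\<E>. C \<subseteq> S" using \<C>(3) by blast
    show "\<forall>C\<in>?\<E>. \<forall>s\<in>C. \<forall>t\<in>C. \<forall>f\<in>H. cmod (u s f - u t f) \<le> \<epsilon>"
      using \<C>(4) by blast
    show "\<forall>C\<in>?\<E>. \<forall>s\<in>C. \<forall>t\<in>C. \<forall>f\<in>G. cmod (v s f - v t f) \<le> \<epsilon>"
      using \<D>(4) by blast
  qed
qed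

lemma precomp_lincomb:
  assumes "precomp u S H" "precomp v S H"
  shows "precomp (\<lambda>s f. a * u s f + b * v s f) S H"
  unfolding precomp_def
proof (intro allI impI)
  fix \<epsilon> :: real assume e: "0 < \<epsilon>"
  \<comment> \<open>The summand 1 keeps \<open>c\<close> positive when both coefficients
    vanish.\<close>
  define c where "c = cmod a + cmod b + 1"
  have c: "c > 0" unfolding c_def by (simp add: add_nonneg_pos)
  obtain \<C> where \<C>: "finite \<C>" "S \<subseteq> \<Union>\<C>" "\<forall>C\<in>\<C>. C \<subseteq> S"
    "\<forall>C\<in>\<C>. \<forall>s\<in>C. \<forall>t\<in>C. \<forall>f\<in>H. cmod (u s f - u t f) \<le> \<epsilon> / c"
    "\<forall>C\<in>\<C>. \<forall>s\<in>C. \<forall>t\<in>C. \<forall>f\<in>H. cmod (v s f - v t f) \<le> \<epsilon> / c"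
    by (rule precomp_common_cover[OF assms, of "\<epsilon> / c"]) (use e c in \<open>simp\<close>)
  have "cmod (a * u s f + b * v s f - (a * u t f + b * v t f)) \<le> \<epsilon>"
    if "C \<in> \<C>" "s \<in> C" "t \<in> C" "f \<in> H" for C s t f
  proof -
    have "cmod (a * u s f + b * v s f - (a * u t f + b * v t f))
        = cmod (a * (u s f - u t f) + b * (v s f - v t f))" by (simp add: algebra_simps)
    also have "\<dots> \<le> cmod a * cmod (u s f - u t f) + cmod b * cmod (v s f - v t f)"
      by (metis norm_mult norm_triangle_ineq)
    also have "\<dots> \<le> cmod a * (\<epsilon> / c) + cmod b * (\<epsilon> / c)"
      using \<C>(4,5) that by (intro add_mono mult_left_mono) auto
    also have "\<dots> = (cmod a + cmod b) * (\<epsilon> / c)" by (simp add: algebra_simps)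
    also have "\<dots> \<le> c * (\<epsilon> / c)" using e c by (intro mult_right_mono) (auto simp: c_def)
    also have "\<dots> = \<epsilon>" using c by simp
    finally show ?thesis .
  qed
  then show "\<exists>\<C>. finite \<C> \<and> S \<subseteq> \<Union>\<C> \<and> (\<forall>C\<in>\<C>. C \<subseteq> S \<and>
     (\<forall>s\<in>C. \<forall>t\<in>C. \<forall>f\<in>H. cmod (a * u s f + b * v s f - (a * u t f + b * v t f)) \<le> \<epsilon>))"
    using \<C>(1,2,3) by (intro exI[of _ \<C>]) simp
qed

lemma precomp_Un_right:
  assumes "precomp u S H" "precomp u S G"
  shows "precomp u S (H \<union> G)"
  unfolding precomp_def
proof (intro allI impI)
  fix \<epsilon> :: real assume e: "0 < \<epsilon>"
  show "\<exists>\<C>. finite \<C> \<and> S \<subseteq> \<Union>\<C> \<and>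
     (\<forall>C\<in>\<C>. C \<subseteq> S \<and> (\<forall>s\<in>C. \<forall>t\<in>C. \<forall>f\<in>H \<union> G. cmod (u s f - u t f) \<le> \<epsilon>))"
    by (rule precomp_common_cover[OF assms e], rule exI, intro conjI) (assumption+, simp add: ball_Un)
qed

lemma precomp_finite_left:
  assumes "finite S" shows "precomp u S H"
proof (rule precompI_net)
  fix e :: real assume "0 < e"
  then show "\<exists>N. finite N \<and> (\<forall>s\<in>S. \<exists>v\<in>N. \<forall>f\<in>H. cmod (u s f - v f) \<le> e)"
    using assms by (intro exI[of _ "u ` S"]) (simp, metis diff_self norm_zero order_less_imp_le)
qed

lemma precomp_singleton_right:
  assumes "bounded ((\<lambda>s. u s f) ` S)"
  shows "precomp u S {f}"
proof (rule precompI_net)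
  fix e :: real assume e: "0 < e"
  have "compact (closure ((\<lambda>s. u s f) ` S))"
    using assms by (simp add: compact_closure)
  then obtain k where k: "finite k" "closure ((\<lambda>s. u s f) ` S) \<subseteq> (\<Union>x\<in>k. ball x e)"
    using e unfolding compact_eq_totally_bounded by meson
  have "\<exists>v\<in>(\<lambda>x _. x) ` k. \<forall>f\<in>{f}. cmod (u s f - v f) \<le> e" if "s \<in> S" for s
  proof -
    have "u s f \<in> closure ((\<lambda>s. u s f) ` S)"
      using that closure_subset[of "(\<lambda>s. u s f) ` S"] by blast
    then obtain x where "x \<in> k" "u s f \<in> ball x e" using k(2) by blast
    then show ?thesis by (auto simp: dist_norm norm_minus_commute intro!: bexI[of _ x])
  qed
  then show "\<exists>N. finite N \<and> (\<forall>s\<in>S. \<exists>v\<in>N. \<forall>f\<in>{f}. cmod (u s f - v f) \<le> e)"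
    using k(1) by (intro exI[of _ "(\<lambda>x _. x) ` k"]) auto
qed

lemma precomp_finite_right:
  assumes "finite H" "\<And>f. f \<in> H \<Longrightarrow> bounded ((\<lambda>s. u s f) ` S)"
  shows "precomp u S H"
  using assms
proof (induction H)
  case empty
  show ?case by (rule precompI_net) (auto intro!: exI[of _ "{\<lambda>_. 0}"])
next
  case (insert f H)
  then have "precomp u S ({f} \<union> H)" by (intro precomp_Un_right precomp_singleton_right) auto
  then show ?case by simp
qed

text \<open>The symmetry behind the theorem of Arzela and Ascoli.\<close>

lemma precomp_sym:
  assumes pc: "precomp u S H" and b: "\<And>s. s \<in> S \<Longrightarrow> bounded (u s ` H)"
  shows "precomp (\<lambda>f s. u s f) H S"
proof (rule precompI_net)
  fix e :: real assume e: "0 < e"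
  obtain N where N: "finite N" "N \<subseteq> S" "\<forall>s\<in>S. \<exists>n\<in>N. \<forall>f\<in>H. cmod (u s f - u n f) \<le> e / 3"
    by (rule precomp_net[OF pc, of "e / 3"]) (use e in simp)
  \<comment> \<open>Restricted to the finite net \<open>N\<close>, the elements of \<open>H\<close>
    become a bounded subset of a finite power of the scalars, by the hypothesis
    \<open>b\<close>.\<close>
  have "precomp (\<lambda>f s. u s f) H N"
    using N b by (intro precomp_finite_right) auto
  then obtain M where M: "finite M" "M \<subseteq> H" "\<forall>f\<in>H. \<exists>g\<in>M. \<forall>s\<in>N. cmod (u s f - u s g) \<le> e / 3"
    by (rule precomp_net[of "\<lambda>f s. u s f" H N "e / 3"]) (use e in simp)
  have "\<exists>v\<in>(\<lambda>g s. u s g) ` M. \<forall>s\<in>S. cmod (u s f - v s) \<le> e" if f: "f \<in> H" for f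
  proof -
    obtain g where g: "g \<in> M" "\<forall>s\<in>N. cmod (u s f - u s g) \<le> e / 3" using bspec[OF M(3) f] by (elim bexE)
    have "cmod (u s f - u s g) \<le> e" if s: "s \<in> S" for s
    proof -
      obtain n where n: "n \<in> N" "\<forall>f\<in>H. cmod (u s f - u n f) \<le> e / 3" using bspec[OF N(3) s] by (elim bexE)
      have "cmod (u s f - u s g) \<le> cmod (u s f - u n f) + cmod (u n f - u n g) + cmod (u s g - u n g)"
        by (rule cmod_diff_three)
      also have "\<dots> \<le> e / 3 + e / 3 + e / 3"
        using n g f M(2) by (intro add_mono) auto
      finally show ?thesis by simp
    qed
    then have "\<forall>s\<in>S. cmod (u s f - u s g) \<le> e" by (rule ballI)
    then show ?thesis unfolding bex_simps using g(1) by (rule bexI)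
  qed
  then have "\<forall>f\<in>H. \<exists>v\<in>(\<lambda>g s. u s g) ` M. \<forall>s\<in>S. cmod (u s f - v s) \<le> e" by (rule ballI)
  then show "\<exists>N. finite N \<and> (\<forall>f\<in>H. \<exists>v\<in>N. \<forall>s\<in>S. cmod (u s f - v s) \<le> e)"
    using finite_imageI[OF M(1)] by (intro exI[of _ "(\<lambda>g s. u s g) ` M"] conjI)
qed

lemma precomp_bounded:
  assumes "precomp u S H" "f \<in> H"
  shows "bounded ((\<lambda>s. u s f) ` S)"
proof -
  obtain N where N: "finite N" "N \<subseteq> S" "\<forall>s\<in>S. \<exists>n\<in>N. \<forall>f\<in>H. cmod (u s f - u n f) \<le> 1"
    by (rule precomp_net[OF assms(1), of 1]) simp
  have "(\<lambda>s. u s f) ` S \<subseteq> (\<Union>n\<in>N. cball (u n f) 1)"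
    using N(3) assms(2) by (simp add: image_subset_iff dist_norm norm_minus_commute) blast
  then show ?thesis using N(1) by (meson bounded_UN bounded_cball bounded_subset)
qed

section \<open>Absolutely convex hulls and a bipolar theorem\<close>

lemma rotate_to_cmod:
  obtains w where "cmod w = 1" "w * z = complex_of_real (cmod z)"
proof (cases "z = 0")
  case True
  then show thesis using that[of 1] by simp
next
  case False
  have "cnj z * z = complex_of_real ((cmod z)\<^sup>2)" by (metis complex_norm_square mult.commute)
  then show thesis using False by (intro that[of "cnj z / cmod z"]) (simp_all add: norm_divide power2_eq_square)
qed

text \<open>The absolutely convex hull, generated by binary combinations so that estimates follow by
  induction. The rule \<open>zero\<close> makes it nonempty even for empty \<open>H\<close>, so that
  infima over it make sense.\<close>

inductive_set ach :: "('a \<Rightarrow> complex) set \<Rightarrow> ('a \<Rightarrow> complex) set" for H where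
  zero: "(\<lambda>_. 0) \<in> ach H"
| base: "h \<in> H \<Longrightarrow> h \<in> ach H"
| comb: "f \<in> ach H \<Longrightarrow> g \<in> ach H \<Longrightarrow> cmod a + cmod b \<le> 1 \<Longrightarrow> (\<lambda>x. a * f x + b * g x) \<in> ach H"

lemma ach_bound:
  assumes "f \<in> ach H" "\<And>h. h \<in> H \<Longrightarrow> cmod (h x) \<le> r" "0 \<le> r"
  shows "cmod (f x) \<le> r"
  using assms
proof induction
  case (comb f g a b)
  have "cmod (a * f x + b * g x) \<le> cmod a * cmod (f x) + cmod b * cmod (g x)"
    by (metis norm_mult norm_triangle_ineq)
  also have "\<dots> \<le> cmod a * r + cmod b * r"
    using comb by (intro add_mono mult_left_mono) auto
  also have "\<dots> = (cmod a + cmod b) * r" by (simp add: algebra_simps)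
  also have "\<dots> \<le> 1 * r" using comb by (intro mult_right_mono) auto
  finally show ?case by simp
qed auto

text \<open>Passing to the hull does not increase the oscillation between two points, so a net of
  points that is fine for \<open>H\<close> is equally fine for \<open>ach H\<close>.\<close>

lemma ach_bound_diff:
  assumes "f \<in> ach H" "\<And>h. h \<in> H \<Longrightarrow> cmod (h x - h y) \<le> r" "0 \<le> r"
  shows "cmod (f x - f y) \<le> r"
  using assms
proof induction
  case (comb f g a b)
  have "cmod ((a * f x + b * g x) - (a * f y + b * g y)) = cmod (a * (f x - f y) + b * (g x - g y))"
    by (simp add: algebra_simps)
  also have "\<dots> \<le> cmod a * cmod (f x - f y) + cmod b * cmod (g x - g y)"
    by (metis norm_mult norm_triangle_ineq)
  also have "\<dots> \<le> cmod a * r + cmod b * r"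
    using comb by (intro add_mono mult_left_mono) auto
  also have "\<dots> = (cmod a + cmod b) * r" by (simp add: algebra_simps)
  also have "\<dots> \<le> 1 * r" using comb by (intro mult_right_mono) auto
  finally show ?case by simp
qed auto

text \<open>An almost nearest point \<open>h\<close> of the hull to \<open>f\<close> yields the coefficients
  \<open>cnj (f j - h j)\<close> of a linear form separating \<open>f\<close> from the hull.\<close>

lemma ach_approximates:
  fixes H :: "('a \<Rightarrow> complex) set"
  assumes J: "finite J" and bd: "\<And>j. j \<in> J \<Longrightarrow> bounded ((\<lambda>h. h j) ` H)"
    and polar: "\<And>c. (\<And>h. h \<in> H \<Longrightarrow> cmod (\<Sum>j\<in>J. c j * h j) \<le> 1) \<Longrightarrow> cmod (\<Sum>j\<in>J. c j * f j) \<le> 1"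
    and e: "0 < \<epsilon>"
  obtains h where "h \<in> ach H" "\<And>j. j \<in> J \<Longrightarrow> cmod (f j - h j) \<le> \<epsilon>"
proof -
  define D where "D h = (\<Sum>j\<in>J. (cmod (f j - h j))\<^sup>2)" for h :: "'a \<Rightarrow> complex"
  \<comment> \<open>The squared distance from \<open>f\<close> to the hull on \<open>J\<close>. The
    infimum need not be attained, so \<open>near\<close> supplies almost minimizers.\<close>
  define d where "d = Inf (D ` ach H)"
  have D0: "0 \<le> D h" for h unfolding D_def by (simp add: sum_nonneg)
  have bb: "bdd_below (D ` ach H)" using D0 by (auto intro: bdd_belowI[of _ 0])
  have dle: "d \<le> D h" if "h \<in> ach H" for h
    unfolding d_def using that by (intro cInf_lower bb) auto
  have near: "\<exists>h\<in>ach H. D h < d + \<eta>" if "0 < \<eta>" for \<eta>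
  proof -
    have "D ` ach H \<noteq> {}" using ach.zero by blast
    then show ?thesis
      using cInf_lessD[of "D ` ach H" "d + \<eta>"] that unfolding d_def by auto
  qed
  have d0: "0 \<le> d" unfolding d_def using D0 ach.zero by (intro cInf_greatest) auto
  have "\<exists>R. \<forall>h\<in>H. \<forall>j\<in>J. cmod (h j) \<le> R"
  proof -
    have "\<forall>j\<in>J. \<exists>R. \<forall>h\<in>H. cmod (h j) \<le> R" using bd unfolding bounded_iff by auto
    then obtain R where R: "\<forall>j\<in>J. \<forall>h\<in>H. cmod (h j) \<le> R j" by metis
    have "\<forall>h\<in>H. \<forall>j\<in>J. cmod (h j) \<le> (\<Sum>j\<in>J. \<bar>R j\<bar>)"
    proof (intro ballI)
      fix h j assume "h \<in> H" "j \<in> J"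
      then have "cmod (h j) \<le> \<bar>R j\<bar>" using R by fastforce
      also have "\<dots> \<le> (\<Sum>j\<in>J. \<bar>R j\<bar>)" using \<open>j \<in> J\<close> J by (intro member_le_sum) auto
      finally show "cmod (h j) \<le> (\<Sum>j\<in>J. \<bar>R j\<bar>)" .
    qed
    then show ?thesis by blast
  qed
  then obtain R where "\<forall>h\<in>H. \<forall>j\<in>J. cmod (h j) \<le> R" by blast
  then have R: "cmod (h j) \<le> max R 0" if "h \<in> ach H" "j \<in> J" for h j
    using that ach_bound[of h H j "max R 0"] by (metis \<open>\<forall>h\<in>H. \<forall>j\<in>J. cmod (h j) \<le> R\<close> max.cobounded1 max.cobounded2 order_trans)
  \<comment> \<open>\<open>M\<close> bounds the squared distances within the hull; the summand 1
    gives \<open>M \<ge> 1\<close>, which is used in \<open>1 + M \<le> 2 * M\<close> and when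
    dividing by \<open>M\<close>.\<close>
  define M where "M = (\<Sum>j\<in>J. (2 * max R 0)\<^sup>2) + 1"
  have M1: "M \<ge> 1" unfolding M_def by (simp add: sum_nonneg)
  have M: "(\<Sum>j\<in>J. (cmod (k j - h j))\<^sup>2) \<le> M" if "k \<in> ach H" "h \<in> ach H" for k h
  proof -
    have "cmod (k j - h j) \<le> 2 * max R 0" if "j \<in> J" for j
      using norm_triangle_ineq4[of "k j" "h j"] R[OF \<open>k \<in> ach H\<close> that] R[OF \<open>h \<in> ach H\<close> that] by linarith
    then have "(\<Sum>j\<in>J. (cmod (k j - h j))\<^sup>2) \<le> (\<Sum>j\<in>J. (2 * max R 0)\<^sup>2)"
      by (intro sum_mono power_mono) auto
    then show ?thesis unfolding M_def by linarith
  qed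
  have key: "d \<le> t * M" if t: "0 < t" "t \<le> 1" for t
  proof -
    \<comment> \<open>The error \<open>t\<^sup>2\<close> has the order of the quadratic term of a
      step of length \<open>t\<close>, so it does not spoil the first-order comparison
      below.\<close>
    obtain h where h: "h \<in> ach H" "D h < d + t\<^sup>2" using near[of "t\<^sup>2"] t by auto
    define c where "c j = cnj (f j - h j)" for j
    define r where "r = Re (\<Sum>j\<in>J. c j * h j) + t * M"
    have Rek: "Re (\<Sum>j\<in>J. c j * k j) \<le> r" if k: "k \<in> ach H" for k
    proof -
      \<comment> \<open>A step from \<open>h\<close> towards \<open>k\<close> stays in the hull and
        cannot bring \<open>D\<close> below \<open>d\<close>. Comparing first-order terms bounds the
        real part of the form at \<open>k\<close> by \<open>r\<close>.\<close>
      have "(\<lambda>j. complex_of_real (1 - t) * h j + complex_of_real t * k j) \<in> ach H"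
      proof (rule ach.comb[OF h(1) k])
        show "cmod (complex_of_real (1 - t)) + cmod (complex_of_real t) \<le> 1"
          using t unfolding norm_of_real by simp
      qed
      then have "d \<le> D (\<lambda>j. complex_of_real (1 - t) * h j + complex_of_real t * k j)" by (rule dle)
      also have "\<dots> = (\<Sum>j\<in>J. (cmod (f j - h j))\<^sup>2 - 2 * t * Re (c j * (k j - h j)) + t\<^sup>2 * (cmod (k j - h j))\<^sup>2)"
        unfolding D_def
      proof (rule sum.cong[OF refl])
        fix j
        show "(cmod (f j - (complex_of_real (1 - t) * h j + complex_of_real t * k j)))\<^sup>2 =
          (cmod (f j - h j))\<^sup>2 - 2 * t * Re (c j * (k j - h j)) + t\<^sup>2 * (cmod (k j - h j))\<^sup>2"
          unfolding cmod_power2 c_def by (simp add: algebra_simps power2_eq_square)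
      qed
      also have "\<dots> = D h - 2 * t * Re (\<Sum>j\<in>J. c j * (k j - h j)) + t\<^sup>2 * (\<Sum>j\<in>J. (cmod (k j - h j))\<^sup>2)"
        unfolding D_def by (simp only: sum.distrib sum_subtractf sum_distrib_left[symmetric] Re_sum)
      also have "\<dots> \<le> (d + t\<^sup>2) - 2 * t * Re (\<Sum>j\<in>J. c j * (k j - h j)) + t\<^sup>2 * M"
        using h(2) M[OF k h(1)] t by (intro add_mono diff_mono mult_left_mono) auto
      finally have "2 * t * Re (\<Sum>j\<in>J. c j * (k j - h j)) \<le> t * (t * (1 + M))"
        by (simp add: power2_eq_square algebra_simps)
      then have "2 * Re (\<Sum>j\<in>J. c j * (k j - h j)) \<le> t * (1 + M)"
        using t by (simp add: mult.assoc mult.left_commute)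
      also have "\<dots> \<le> t * (2 * M)" using M1 t by (intro mult_left_mono) auto
      finally have "Re (\<Sum>j\<in>J. c j * (k j - h j)) \<le> t * M" by simp
      then show ?thesis unfolding r_def by (simp add: algebra_simps sum_subtractf)
    qed
    have bdk: "cmod (\<Sum>j\<in>J. c j * k j) \<le> r" if k: "k \<in> ach H" for k
    proof -
      let ?z = "\<Sum>j\<in>J. c j * k j"
      obtain w where w: "cmod w = 1" "w * ?z = complex_of_real (cmod ?z)"
        by (rule rotate_to_cmod)
      \<comment> \<open>Stability of the hull under the unimodular factor \<open>w\<close> turns the
        bound on the real part into a bound on the modulus.\<close>
      have "(\<lambda>j. w * k j + 0 * k j) \<in> ach H" by (rule ach.comb[OF k k]) (simp add: w)
      then have "Re (\<Sum>j\<in>J. c j * (w * k j + 0 * k j)) \<le> r" by (rule Rek)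
      also have "(\<Sum>j\<in>J. c j * (w * k j + 0 * k j)) = w * ?z"
        by (simp add: sum_distrib_left mult.left_commute)
      finally show ?thesis by (simp add: w)
    qed
    have r0: "0 \<le> r" using bdk[OF ach.zero] by simp
    \<comment> \<open>\<open>r\<close> may vanish, so the form is divided by \<open>r + s\<close>
      before \<open>polar\<close> is applied.\<close>
    have fr: "cmod (\<Sum>j\<in>J. c j * f j) \<le> r + s" if s: "0 < s" for s
    proof -
      have rs: "0 < r + s" using r0 s by simp
      have "cmod (\<Sum>j\<in>J. c j / complex_of_real (r + s) * f j) \<le> 1"
      proof (rule polar)
        fix k assume "k \<in> H"
        then have "cmod (\<Sum>j\<in>J. c j * k j) \<le> r + s" using bdk[OF ach.base] s by fastforce
        moreover have "(\<Sum>j\<in>J. c j / complex_of_real (r + s) * k j) = (\<Sum>j\<in>J. c j * k j) / complex_of_real (r + s)"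
          by (simp add: sum_divide_distrib)
        ultimately show "cmod (\<Sum>j\<in>J. c j / complex_of_real (r + s) * k j) \<le> 1"
          using rs by (simp add: norm_divide del: of_real_add)
      qed
      moreover have "(\<Sum>j\<in>J. c j / complex_of_real (r + s) * f j) = (\<Sum>j\<in>J. c j * f j) / complex_of_real (r + s)"
          by (simp add: sum_divide_distrib)
      ultimately show ?thesis using rs by (simp add: norm_divide del: of_real_add)
    qed
    then have "cmod (\<Sum>j\<in>J. c j * f j) \<le> r" by (rule field_le_epsilon)
    then have "Re (\<Sum>j\<in>J. c j * f j) \<le> r" using complex_Re_le_cmod order_trans by blast
    \<comment> \<open>With these coefficients the real parts of the form at \<open>f\<close> and at
      \<open>h\<close> differ by exactly \<open>D h\<close>, so the bound by \<open>r\<close> forces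
      \<open>D h\<close> to be small.\<close>
    moreover have "Re (\<Sum>j\<in>J. c j * f j) = Re (\<Sum>j\<in>J. c j * h j) + D h"
    proof -
      have "(\<Sum>j\<in>J. c j * f j) = (\<Sum>j\<in>J. c j * h j) + (\<Sum>j\<in>J. c j * (f j - h j))"
        by (simp add: algebra_simps sum_subtractf)
      moreover have "c j * (f j - h j) = complex_of_real ((cmod (f j - h j))\<^sup>2)" for j
        unfolding c_def by (metis complex_norm_square mult.commute)
      ultimately show ?thesis unfolding D_def by simp
    qed
    ultimately have "D h \<le> t * M" unfolding r_def by simp
    then show ?thesis using dle[OF h(1)] by simp
  qed
  have "d \<le> 0"
  proof (rule ccontr)
    assume "\<not> d \<le> 0"
    then have "0 < min 1 (d / (2 * M))" using M1 by simp
    then have "d \<le> min 1 (d / (2 * M)) * M" by (intro key) auto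
    also have "\<dots> \<le> d / (2 * M) * M" using M1 by (intro mult_right_mono) auto
    also have "\<dots> = d / 2" using M1 by simp
    finally show False using \<open>\<not> d \<le> 0\<close> by simp
  qed
  then obtain h where h: "h \<in> ach H" "D h < \<epsilon>\<^sup>2" using near[of "\<epsilon>\<^sup>2"] e d0 by auto
  show ?thesis
  proof (rule that[OF h(1)])
    fix j assume "j \<in> J"
    then have "(cmod (f j - h j))\<^sup>2 \<le> D h" unfolding D_def using J by (intro member_le_sum) auto
    then have "(cmod (f j - h j))\<^sup>2 \<le> \<epsilon>\<^sup>2" using h(2) by simp
    then show "cmod (f j - h j) \<le> \<epsilon>" using e by (simp add: power2_le_iff_abs_le)
  qed
qed

section \<open>Polar topologies\<close>

definition polar_ball :: "'a set \<Rightarrow> ('a \<Rightarrow> complex) set \<Rightarrow> real \<Rightarrow> 'a \<Rightarrow> 'a set" where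
  "polar_ball E H \<epsilon> x = {y \<in> E. \<forall>f\<in>H. cmod (f y - f x) \<le> \<epsilon>}"

text \<open>Uniform convergence on the members of \<open>\<H>\<close>, when points are regarded as
  functions of functionals. The radius is a separate parameter, so scalar multiples of the members
  of \<open>\<H>\<close> do not enter.\<close>

definition polar_topology :: "'a set \<Rightarrow> ('a \<Rightarrow> complex) set set \<Rightarrow> 'a topology" where
  "polar_topology E \<H> = topology (\<lambda>U. U \<subseteq> E \<and>
     (\<forall>x\<in>U. \<exists>H\<in>\<H>. \<exists>\<epsilon>>0. polar_ball E H \<epsilon> x \<subseteq> U))"

text \<open>Directedness: the intersection of two balls around a point contains a third.\<close>

definition union_closed :: "'a set set \<Rightarrow> bool" where
  "union_closed \<H> \<longleftrightarrow> \<H> \<noteq> {} \<and> (\<forall>H\<in>\<H>. \<forall>G\<in>\<H>. H \<union> G \<in> \<H>)"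

lemma polar_ball_mono: "H \<subseteq> G \<Longrightarrow> d \<le> \<epsilon> \<Longrightarrow> polar_ball E G d x \<subseteq> polar_ball E H \<epsilon> x"
  unfolding polar_ball_def by (auto intro: order_trans)

lemma polar_ball_subset: "polar_ball E H \<epsilon> x \<subseteq> E"
  unfolding polar_ball_def by blast

lemma polar_ball_Int:
  assumes "union_closed \<H>" "H \<in> \<H>" "G \<in> \<H>" "0 < d" "0 < \<epsilon>"
    "polar_ball E H d x \<subseteq> U" "polar_ball E G \<epsilon> x \<subseteq> V"
  shows "\<exists>K\<in>\<H>. \<exists>e>0. polar_ball E K e x \<subseteq> U \<inter> V"
proof (intro bexI[of _ "H \<union> G"] exI[of _ "min d \<epsilon>"] conjI)
  show "polar_ball E (H \<union> G) (min d \<epsilon>) x \<subseteq> U \<inter> V"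
    using polar_ball_mono[of H "H \<union> G" "min d \<epsilon>" d E x]
      polar_ball_mono[of G "H \<union> G" "min d \<epsilon>" \<epsilon> E x] assms(6,7)
    by (meson Int_greatest Un_upper1 Un_upper2 min.cobounded1 min.cobounded2 order_trans)
qed (use assms in \<open>simp_all add: union_closed_def\<close>)

lemma openin_polar_topology:
  assumes "union_closed \<H>"
  shows "openin (polar_topology E \<H>) U \<longleftrightarrow> U \<subseteq> E \<and>
    (\<forall>x\<in>U. \<exists>H\<in>\<H>. \<exists>\<epsilon>>0. polar_ball E H \<epsilon> x \<subseteq> U)"
proof -
  let ?P = "\<lambda>U. U \<subseteq> E \<and> (\<forall>x\<in>U. \<exists>H\<in>\<H>. \<exists>\<epsilon>>0. polar_ball E H \<epsilon> x \<subseteq> U)"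
  have "istopology ?P"
    unfolding istopology_def
  proof (rule conjI; intro allI impI)
    fix U V assume U: "?P U" and V: "?P V"
    have "\<exists>K\<in>\<H>. \<exists>e>0. polar_ball E K e x \<subseteq> U \<inter> V" if x: "x \<in> U \<inter> V" for x
    proof -
      obtain H d where "H \<in> \<H>" "0 < d" "polar_ball E H d x \<subseteq> U" using U x by (meson IntD1)
      moreover obtain G e where "G \<in> \<H>" "0 < e" "polar_ball E G e x \<subseteq> V" using V x by (meson IntD2)
      ultimately show ?thesis using polar_ball_Int[OF assms] by metis
    qed
    then show "?P (U \<inter> V)" using U by blast
  next
    fix \<K> assume K: "\<forall>U\<in>\<K>. ?P U"
    have "\<exists>H\<in>\<H>. \<exists>\<epsilon>>0. polar_ball E H \<epsilon> x \<subseteq> \<Union>\<K>" if x: "x \<in> \<Union>\<K>" for x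
    proof -
      obtain U where U: "U \<in> \<K>" "x \<in> U" using x by (elim UnionE)
      then obtain H e where "H \<in> \<H>" "0 < e" "polar_ball E H e x \<subseteq> U" using K by metis
      then show ?thesis using Union_upper[OF U(1)] by (meson order_trans)
    qed
    moreover have "\<Union>\<K> \<subseteq> E" using K by (simp add: Sup_le_iff)
    ultimately show "?P (\<Union>\<K>)" by (intro conjI ballI)
  qed
  then show ?thesis unfolding polar_topology_def by (simp add: topology_inverse')
qed

lemma topspace_polar_topology:
  assumes "union_closed \<H>" shows "topspace (polar_topology E \<H>) = E"
proof -
  obtain H where H: "H \<in> \<H>" using assms unfolding union_closed_def by (elim conjE) (meson ex_in_conv)
  have "\<forall>x\<in>E. \<exists>H\<in>\<H>. \<exists>\<epsilon>>0. polar_ball E H \<epsilon> x \<subseteq> E"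
    using polar_ball_subset[of E] H by (meson zero_less_one)
  then have "openin (polar_topology E \<H>) E"
    using openin_polar_topology[OF assms] by simp
  moreover have "openin (polar_topology E \<H>) U \<Longrightarrow> U \<subseteq> E" for U
    using openin_polar_topology[OF assms] by simp
  ultimately show ?thesis by (meson openin_subset openin_topspace subset_antisym)
qed

lemma polar_ball_nbhd:
  assumes uc: "union_closed \<H>" and H: "H \<in> \<H>" and x: "x \<in> E" and e: "0 < \<epsilon>"
  shows "\<exists>W. openin (polar_topology E \<H>) W \<and> x \<in> W \<and> W \<subseteq> polar_ball E H \<epsilon> x"
proof -
  \<comment> \<open>The balls are defined by weak inequalities and need not be open. The centres of
    balls of the same \<open>H\<close> inside the given one form an open set, as one sees by halving
    radii.\<close>
  define W where "W = {y \<in> E. \<exists>d>0. polar_ball E H d y \<subseteq> polar_ball E H \<epsilon> x}"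
  have self: "y \<in> polar_ball E H d y" if "y \<in> E" "0 < d" for y d
    using that unfolding polar_ball_def by simp
  have "\<exists>H\<in>\<H>. \<exists>e>0. polar_ball E H e y \<subseteq> W" if y: "y \<in> W" for y
  proof -
    obtain d where d: "0 < d" "polar_ball E H d y \<subseteq> polar_ball E H \<epsilon> x" using y unfolding W_def by blast
    have "polar_ball E H (d / 2) y \<subseteq> W"
    proof
      fix z assume z: "z \<in> polar_ball E H (d / 2) y"
      have "polar_ball E H (d / 2) z \<subseteq> polar_ball E H d y"
      proof
        fix w assume w: "w \<in> polar_ball E H (d / 2) z"
        have "cmod (f w - f y) \<le> d" if f: "f \<in> H" for f
        proof -
          have "cmod (f w - f y) \<le> cmod (f w - f z) + cmod (f z - f y)"
            by (metis dist_norm dist_triangle)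
          also have "\<dots> \<le> d / 2 + d / 2"
            using w z f unfolding polar_ball_def by (intro add_mono) auto
          finally show ?thesis by simp
        qed
        then show "w \<in> polar_ball E H d y" using w unfolding polar_ball_def by simp
      qed
      then show "z \<in> W" using z d unfolding W_def polar_ball_def
        by (intro CollectI conjI exI[of _ "d / 2"]) auto
    qed
    then show ?thesis using H d(1) by (intro bexI[of _ H] exI[of _ "d / 2"]) auto
  qed
  then have "openin (polar_topology E \<H>) W"
    using openin_polar_topology[OF uc, of E W] unfolding W_def by blast
  moreover have "x \<in> W" using x e unfolding W_def by blast
  moreover have "W \<subseteq> polar_ball E H \<epsilon> x" using self unfolding W_def by blast
  ultimately show ?thesis by blast
qed

lemma polar_nbhd_iff:
  assumes uc: "union_closed \<H>" and x: "x \<in> E"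
  shows "(\<exists>W. openin (polar_topology E \<H>) W \<and> x \<in> W \<and> W \<subseteq> U) \<longleftrightarrow>
    (\<exists>H\<in>\<H>. \<exists>\<epsilon>>0. polar_ball E H \<epsilon> x \<subseteq> U)"
proof
  assume "\<exists>W. openin (polar_topology E \<H>) W \<and> x \<in> W \<and> W \<subseteq> U"
  then obtain W where W: "openin (polar_topology E \<H>) W" "x \<in> W" "W \<subseteq> U" by (elim exE conjE)
  then obtain H e where "H \<in> \<H>" "0 < e" "polar_ball E H e x \<subseteq> W"
    unfolding openin_polar_topology[OF uc] by blast
  then show "\<exists>H\<in>\<H>. \<exists>\<epsilon>>0. polar_ball E H \<epsilon> x \<subseteq> U"
    using W(3) by (meson order_trans)
next
  assume "\<exists>H\<in>\<H>. \<exists>\<epsilon>>0. polar_ball E H \<epsilon> x \<subseteq> U"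
  then obtain H e where He: "H \<in> \<H>" "0 < e" "polar_ball E H e x \<subseteq> U" by blast
  show "\<exists>W. openin (polar_topology E \<H>) W \<and> x \<in> W \<and> W \<subseteq> U"
    using polar_ball_nbhd[OF uc He(1) x He(2)] He(3) by (meson order_trans)
qed

lemma Hausdorff_polar_topology:
  assumes uc: "union_closed \<H>"
    and sep: "\<And>x y. x \<in> E \<Longrightarrow> y \<in> E \<Longrightarrow> (\<And>H f. H \<in> \<H> \<Longrightarrow> f \<in> H \<Longrightarrow> f x = f y) \<Longrightarrow> x = y"
  shows "Hausdorff_space (polar_topology E \<H>)"
  unfolding Hausdorff_space_def topspace_polar_topology[OF uc]
proof (intro allI impI)
  fix x y assume "x \<in> E \<and> y \<in> E \<and> x \<noteq> y"
  then have x: "x \<in> E" and y: "y \<in> E" and ne: "x \<noteq> y" by auto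
  obtain H f where H: "H \<in> \<H>" "f \<in> H" "f x \<noteq> f y" using sep[OF x y] ne by blast
  define e where "e = cmod (f x - f y) / 3"
  have e: "0 < e" unfolding e_def using H(3) by simp
  obtain U where U: "openin (polar_topology E \<H>) U" "x \<in> U" "U \<subseteq> polar_ball E H e x"
    using polar_ball_nbhd[OF uc H(1) x e] by blast
  obtain V where V: "openin (polar_topology E \<H>) V" "y \<in> V" "V \<subseteq> polar_ball E H e y"
    using polar_ball_nbhd[OF uc H(1) y e] by blast
  have "False" if z: "z \<in> U" "z \<in> V" for z
  proof -
    have "cmod (f z - f x) \<le> e" "cmod (f z - f y) \<le> e"
      using z U(3) V(3) H(2) unfolding polar_ball_def by blast+
    moreover have "cmod (f x - f y) \<le> cmod (f z - f x) + cmod (f z - f y)"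
      by (metis dist_norm dist_triangle3 dist_commute)
    ultimately show False using e unfolding e_def by linarith
  qed
  then have "disjnt U V" unfolding disjnt_def by blast
  then show "\<exists>U V. openin (polar_topology E \<H>) U \<and> openin (polar_topology E \<H>) V \<and> x \<in> U \<and> y \<in> V \<and> disjnt U V"
    using U V by blast
qed

text \<open>For a linear \<open>f\<close> on a polar space this is continuity, see
  \<open>functionals_polar\<close>.\<close>

definition polar_bounded :: "'a set \<Rightarrow> ('a \<Rightarrow> complex) set set \<Rightarrow> ('a \<Rightarrow> complex) \<Rightarrow> bool" where
  "polar_bounded E \<H> f \<longleftrightarrow> (\<exists>H\<in>\<H>. \<exists>\<epsilon>>0. \<forall>x\<in>E. (\<forall>h\<in>H. cmod (h x) \<le> \<epsilon>) \<longrightarrow> cmod (f x) \<le> 1)"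

section \<open>Modules over the complex numbers\<close>

lemma complex_field_simps [simp]:
  "carrier complex_field = UNIV" "zero complex_field = 0" "one complex_field = 1"
  "add complex_field = (+)" "mult complex_field = (*)"
  by (simp_all add: complex_field_def)

definition linear_on :: "'a top_module \<Rightarrow> ('a \<Rightarrow> complex) \<Rightarrow> bool" where
  "linear_on X f \<longleftrightarrow>
     (\<forall>x\<in>carrier X. \<forall>y\<in>carrier X. f (x \<oplus>\<^bsub>X\<^esub> y) = f x + f y) \<and>
     (\<forall>c. \<forall>x\<in>carrier X. f (c \<odot>\<^bsub>X\<^esub> x) = c * f x)"

text \<open>Subtraction through the scalar -1 is evaluated by linear forms using
  \<open>smult\<close> alone, without the inverse of the additive group.\<close>

definition vsub :: "'a top_module \<Rightarrow> 'a \<Rightarrow> 'a \<Rightarrow> 'a" where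
  "vsub X x y = x \<oplus>\<^bsub>X\<^esub> ((-1) \<odot>\<^bsub>X\<^esub> y)"

locale cmodule =
  fixes X :: "'a top_module" (structure)
  assumes mod: "module complex_field X"
begin

sublocale module complex_field X by (rule mod)

lemma csmult_closed [simp, intro]: "x \<in> carrier X \<Longrightarrow> c \<odot> x \<in> carrier X"
  by simp

lemma vsub_closed [simp, intro]: "x \<in> carrier X \<Longrightarrow> y \<in> carrier X \<Longrightarrow> vsub X x y \<in> carrier X"
  unfolding vsub_def by simp

lemma smult_minus_one: "y \<in> carrier X \<Longrightarrow> (-1) \<odot> y = \<ominus> y"
proof -
  assume y: "y \<in> carrier X"
  have "((-1) \<odot> y) \<oplus> y = ((-1) + 1) \<odot> y"
    using smult_l_distr[of "-1" 1 y] smult_one[OF y] y by simp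
  also have "\<dots> = \<zero>" using smult_l_null[OF y] by simp
  finally show ?thesis using y by (intro M.minus_equality[symmetric]) auto
qed

lemma add_vsub: "x \<in> carrier X \<Longrightarrow> y \<in> carrier X \<Longrightarrow> y \<oplus> vsub X x y = x"
  unfolding vsub_def by (simp add: smult_minus_one M.a_ac M.r_neg M.r_neg1 M.r_neg2)

end

lemma linear_on_add: "linear_on X f \<Longrightarrow> x \<in> carrier X \<Longrightarrow> y \<in> carrier X \<Longrightarrow> f (x \<oplus>\<^bsub>X\<^esub> y) = f x + f y"
  and linear_on_smult: "linear_on X f \<Longrightarrow> x \<in> carrier X \<Longrightarrow> f (c \<odot>\<^bsub>X\<^esub> x) = c * f x"
  unfolding linear_on_def by blast+

lemma (in cmodule) linear_on_zero: "linear_on X f \<Longrightarrow> f \<zero> = 0"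
  using linear_on_smult[of X f \<zero> 0] smult_l_null[of \<zero>] by simp

lemma (in cmodule) linear_on_vsub:
  "linear_on X f \<Longrightarrow> x \<in> carrier X \<Longrightarrow> y \<in> carrier X \<Longrightarrow> f (vsub X x y) = f x - f y"
  unfolding vsub_def by (simp add: linear_on_add linear_on_smult)

text \<open>Homogeneity converts a bound by 1 on a polar into small increments; this is how
  boundedness on polars enters the later approximation arguments.\<close>

lemma (in cmodule) polar_scale:
  assumes lin: "\<And>h. h \<in> H \<Longrightarrow> linear_on X h" and f: "linear_on X f"
    and bd: "\<forall>x\<in>carrier X. (\<forall>h\<in>H. cmod (h x) \<le> d) \<longrightarrow> cmod (f x) \<le> 1"
    and x: "x \<in> carrier X" "\<forall>h\<in>H. cmod (h x) \<le> d * e" and e: "0 < e"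
  shows "cmod (f x) \<le> e"
proof -
  let ?y = "complex_of_real (1 / e) \<odot> x"
  have "cmod (h ?y) \<le> d" if h: "h \<in> H" for h
  proof -
    have "cmod (h ?y) = cmod (h x) / e"
      using linear_on_smult[OF lin[OF h] x(1)] e by (simp add: norm_divide)
    also have "\<dots> \<le> (d * e) / e" using x(2) h e by (intro divide_right_mono) auto
    finally show ?thesis using e by simp
  qed
  then have "cmod (f ?y) \<le> 1" using bd x(1) by blast
  moreover have "cmod (f ?y) = cmod (f x) / e"
    using linear_on_smult[OF f x(1)] e by (simp add: norm_divide)
  ultimately have "cmod (f x) / e \<le> 1" by simp
  then show ?thesis using e by (simp add: divide_le_eq_1)
qed

text \<open>One vector realizes the combination for all linear forms simultaneously. It turns the
  coefficients of a separating form into a point, to which a hypothesis about polars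
  applies.\<close>

lemma (in cmodule) linear_combination:
  assumes "finite J" "\<And>j. j \<in> J \<Longrightarrow> p j \<in> carrier X"
  shows "\<exists>x\<in>carrier X. \<forall>f. linear_on X f \<longrightarrow> f x = (\<Sum>j\<in>J. c j * f (p j))"
  using assms
proof (induction J)
  case empty
  show ?case using linear_on_zero by (intro bexI[of _ \<zero>]) auto
next
  case (insert j J)
  then obtain x where x: "x \<in> carrier X" "\<forall>f. linear_on X f \<longrightarrow> f x = (\<Sum>j\<in>J. c j * f (p j))" by auto
  show ?case
    using insert x by (intro bexI[of _ "(c j \<odot> p j) \<oplus> x"]) (auto simp: linear_on_add linear_on_smult)
qed

lemma functionals_linear: "f \<in> functionals X \<Longrightarrow> linear_on X f"
  and functionals_ext: "f \<in> functionals X \<Longrightarrow> f \<in> extensional (carrier X)"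
  unfolding functionals_def linear_on_def by blast+

lemma functionals_iff: "f \<in> functionals X \<longleftrightarrow>
    f \<in> extensional (carrier X) \<and> linear_on X f \<and> continuous_map (topol X) euclidean f"
  unfolding functionals_def linear_on_def by blast

section \<open>Polar spaces\<close>

text \<open>The common frame for stereotype spaces with \<open>dual_tb X\<close>, for dual spaces
  with \<open>evals X\<close>, and for limits with \<open>HH\<close>.\<close>

locale polar_space = cmodule X for X :: "'a top_module" (structure) +
  fixes \<H> :: "('a \<Rightarrow> complex) set set"
  assumes top: "topol X = polar_topology (carrier X) \<H>"
    and uc: "union_closed \<H>"
    and lin: "H \<in> \<H> \<Longrightarrow> f \<in> H \<Longrightarrow> linear_on X f"
begin

lemma topspace_carrier: "topspace (topol X) = carrier X"
  unfolding top by (rule topspace_polar_topology[OF uc])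

lemma openin_iff: "openin (topol X) U \<longleftrightarrow> U \<subseteq> carrier X \<and>
    (\<forall>x\<in>U. \<exists>H\<in>\<H>. \<exists>\<epsilon>>0. polar_ball (carrier X) H \<epsilon> x \<subseteq> U)"
  unfolding top by (rule openin_polar_topology[OF uc])

lemma nbhd_iff: "x \<in> carrier X \<Longrightarrow> (\<exists>W. openin (topol X) W \<and> x \<in> W \<and> W \<subseteq> U) \<longleftrightarrow>
    (\<exists>H\<in>\<H>. \<exists>\<epsilon>>0. polar_ball (carrier X) H \<epsilon> x \<subseteq> U)"
  unfolding top by (rule polar_nbhd_iff[OF uc])

lemma nbhd_zero_iff: "nbhd_zero X U \<longleftrightarrow> U \<subseteq> carrier X \<and>
    (\<exists>H\<in>\<H>. \<exists>\<epsilon>>0. polar_ball (carrier X) H \<epsilon> \<zero> \<subseteq> U)"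
  unfolding nbhd_zero_def using nbhd_iff[of \<zero> U] by simp

lemma polar_ball_zero: "H \<in> \<H> \<Longrightarrow> polar_ball (carrier X) H \<epsilon> \<zero> = {y \<in> carrier X. \<forall>f\<in>H. cmod (f y) \<le> \<epsilon>}"
  unfolding polar_ball_def
  by (intro Collect_cong conj_cong ball_cong refl) (metis diff_zero lin linear_on_zero)

lemma nbhd_zero_ball: "H \<in> \<H> \<Longrightarrow> 0 < \<epsilon> \<Longrightarrow> nbhd_zero X {y \<in> carrier X. \<forall>f\<in>H. cmod (f y) \<le> \<epsilon>}"
  unfolding nbhd_zero_iff using polar_ball_zero[of H \<epsilon>]
  by (intro conjI bexI[of _ H] exI[of _ \<epsilon>]) auto

lemma nbhd_zeroD:
  assumes "nbhd_zero X U"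
  obtains H \<epsilon> where "H \<in> \<H>" "0 < \<epsilon>" "{y \<in> carrier X. \<forall>f\<in>H. cmod (f y) \<le> \<epsilon>} \<subseteq> U"
proof -
  obtain H e where "H \<in> \<H>" "0 < e" "polar_ball (carrier X) H e \<zero> \<subseteq> U"
    using assms unfolding nbhd_zero_iff by (elim conjE bexE exE)
  then show thesis using that[of H e] polar_ball_zero[of H e] by simp
qed

lemma continuous_map_into:
  assumes "\<And>x. x \<in> topspace T \<Longrightarrow> \<phi> x \<in> carrier X"
    and "\<And>x H \<epsilon>. x \<in> topspace T \<Longrightarrow> H \<in> \<H> \<Longrightarrow> 0 < \<epsilon> \<Longrightarrow>
      \<exists>W. openin T W \<and> x \<in> W \<and> (\<forall>y\<in>W. \<forall>f\<in>H. cmod (f (\<phi> y) - f (\<phi> x)) \<le> \<epsilon>)"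
  shows "continuous_map T (topol X) \<phi>"
  unfolding continuous_map topspace_carrier
proof (intro conjI allI impI)
  show "\<phi> ` topspace T \<subseteq> carrier X" using assms(1) by blast
  fix U assume U: "openin (topol X) U"
  show "openin T {x \<in> topspace T. \<phi> x \<in> U}"
  proof (subst openin_subopen, intro ballI)
    fix x assume "x \<in> {x \<in> topspace T. \<phi> x \<in> U}"
    then have x: "x \<in> topspace T" "\<phi> x \<in> U" by auto
    obtain H e where He: "H \<in> \<H>" "0 < e" "polar_ball (carrier X) H e (\<phi> x) \<subseteq> U"
      using U x(2) unfolding openin_iff by blast
    obtain W where W: "openin T W" "x \<in> W" "\<forall>y\<in>W. \<forall>f\<in>H. cmod (f (\<phi> y) - f (\<phi> x)) \<le> e"
      using assms(2)[OF x(1) He(1,2)] by blast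
    have WT: "W \<subseteq> topspace T" using W(1) by (rule openin_subset)
    have "W \<subseteq> {x \<in> topspace T. \<phi> x \<in> U}"
    proof
      fix y assume y: "y \<in> W"
      then have "\<phi> y \<in> polar_ball (carrier X) H e (\<phi> x)"
        using W(3) WT assms(1) unfolding polar_ball_def by blast
      then show "y \<in> {x \<in> topspace T. \<phi> x \<in> U}" using y WT He(3) by blast
    qed
    then show "\<exists>T'. openin T T' \<and> x \<in> T' \<and> T' \<subseteq> {x \<in> topspace T. \<phi> x \<in> U}"
      using W by blast
  qed
qed

text \<open>A linear form bounded on one polar is small on small multiples of it, hence continuous
  at zero, and by translation everywhere.\<close>

lemma functionals_polar: "f \<in> functionals X \<longleftrightarrow>
    f \<in> extensional (carrier X) \<and> linear_on X f \<and> polar_bounded (carrier X) \<H> f"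
proof -
  have "continuous_map (topol X) euclidean f \<longleftrightarrow> polar_bounded (carrier X) \<H> f" if f: "linear_on X f"
  proof
    assume c: "continuous_map (topol X) euclidean f"
    have "openin (topol X) {x \<in> topspace (topol X). f x \<in> ball 0 1}"
      using openin_continuous_map_preimage[OF c, of "ball 0 1"] by simp
    moreover have "\<zero> \<in> {x \<in> topspace (topol X). f x \<in> ball 0 1}"
      unfolding topspace_carrier using linear_on_zero[OF f] by simp
    ultimately obtain H e where He: "H \<in> \<H>" "0 < e"
      "polar_ball (carrier X) H e \<zero> \<subseteq> {x \<in> topspace (topol X). f x \<in> ball 0 1}"
      unfolding openin_iff by blast
    then show "polar_bounded (carrier X) \<H> f"
      unfolding polar_bounded_def polar_ball_zero[OF He(1)]
      by (intro bexI[of _ H] exI[of _ e]) fastforce+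
  next
    assume "polar_bounded (carrier X) \<H> f"
    then obtain H d where H: "H \<in> \<H>" "0 < d"
        "\<forall>x\<in>carrier X. (\<forall>h\<in>H. cmod (h x) \<le> d) \<longrightarrow> cmod (f x) \<le> 1"
      unfolding polar_bounded_def by blast
    have small: "cmod (f x) \<le> e" if "x \<in> carrier X" "\<forall>h\<in>H. cmod (h x) \<le> d * e" "0 < e" for x e
      using lin[OF H(1)] f H(3) that by (rule polar_scale)
    show "continuous_map (topol X) euclidean f"
      unfolding continuous_map
    proof (intro conjI allI impI)
      show "f ` topspace (topol X) \<subseteq> topspace euclidean" by simp
      fix U :: "complex set" assume "openin euclidean U"
      then have U: "open U" by simp
      show "openin (topol X) {x \<in> topspace (topol X). f x \<in> U}"
        unfolding openin_iff topspace_carrier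
      proof (intro conjI ballI)
        fix x assume "x \<in> {x \<in> carrier X. f x \<in> U}"
        then have x: "x \<in> carrier X" "f x \<in> U" by auto
        obtain e where e: "0 < e" "cball (f x) e \<subseteq> U" using U x(2) open_contains_cball by metis
        have "polar_ball (carrier X) H (d * e) x \<subseteq> {x \<in> carrier X. f x \<in> U}"
        proof
          fix y assume y: "y \<in> polar_ball (carrier X) H (d * e) x"
          then have yc: "y \<in> carrier X" unfolding polar_ball_def by simp
          have "cmod (f (vsub X y x)) \<le> e"
            using y yc x(1) e(1) unfolding polar_ball_def
            by (intro small) (auto simp: linear_on_vsub[OF lin[OF H(1)]])
          then have "f y \<in> cball (f x) e"
            using linear_on_vsub[OF f yc x(1)] by (simp add: dist_norm norm_minus_commute)
          then show "y \<in> {x \<in> carrier X. f x \<in> U}" using e(2) yc by blast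
        qed
        moreover have "0 < d * e" using H(2) e(1) by simp
        ultimately show "\<exists>H\<in>\<H>. \<exists>\<epsilon>>0. polar_ball (carrier X) H \<epsilon> x \<subseteq> {x \<in> carrier X. f x \<in> U}"
          using H(1) by blast
      qed simp
    qed
  qed
  then show ?thesis unfolding functionals_iff by blast
qed

text \<open>By linearity \<open>s\<close> lies in the translate of a polar by \<open>n\<close> when
  all \<open>f s - f n\<close> are small. Covers by translates of neighbourhoods therefore amount to
  finite nets for the pairing.\<close>

lemma totally_bounded_polar: "totally_bounded_in X S \<longleftrightarrow>
    S \<subseteq> carrier X \<and> (\<forall>H\<in>\<H>. precomp (\<lambda>x f. f x) S H)"
proof
  assume tb: "totally_bounded_in X S"
  have "precomp (\<lambda>x f. f x) S H" if H: "H \<in> \<H>" for H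
  proof (rule precompI_net)
    fix e :: real assume e: "0 < e"
    obtain F where F: "finite F" "F \<subseteq> carrier X"
      "S \<subseteq> (\<Union>x\<in>F. (\<lambda>u. x \<oplus> u) ` {y \<in> carrier X. \<forall>f\<in>H. cmod (f y) \<le> e})"
      using tb nbhd_zero_ball[OF H e] unfolding totally_bounded_in_def by blast
    have "\<exists>v\<in>(\<lambda>x f. f x) ` F. \<forall>f\<in>H. cmod (f s - v f) \<le> e" if s: "s \<in> S" for s
    proof -
      obtain x u where xu: "x \<in> F" "u \<in> carrier X" "\<forall>f\<in>H. cmod (f u) \<le> e" "s = x \<oplus> u"
        using F(3) s by blast
      have "\<forall>f\<in>H. cmod (f s - f x) \<le> e"
        using xu F(2) linear_on_add[OF lin[OF H]] by (metis add_diff_cancel_left' subsetD)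
      then show ?thesis unfolding bex_simps using xu(1) by (rule bexI)
    qed
    then show "\<exists>N. finite N \<and> (\<forall>s\<in>S. \<exists>v\<in>N. \<forall>f\<in>H. cmod (f s - v f) \<le> e)"
      using finite_imageI[OF F(1)] by (intro exI[of _ "(\<lambda>x f. f x) ` F"] conjI ballI)
  qed
  then show "S \<subseteq> carrier X \<and> (\<forall>H\<in>\<H>. precomp (\<lambda>x f. f x) S H)"
    using tb unfolding totally_bounded_in_def by blast
next
  assume r: "S \<subseteq> carrier X \<and> (\<forall>H\<in>\<H>. precomp (\<lambda>x f. f x) S H)"
  show "totally_bounded_in X S"
    unfolding totally_bounded_in_def
  proof (intro conjI allI impI)
    show "S \<subseteq> carrier X" using r by simp
    fix U assume "nbhd_zero X U"
    then obtain H e where He: "H \<in> \<H>" "0 < e" "{y \<in> carrier X. \<forall>f\<in>H. cmod (f y) \<le> e} \<subseteq> U"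
      by (rule nbhd_zeroD)
    have "precomp (\<lambda>x f. f x) S H" using r He(1) by simp
    then obtain N where N: "finite N" "N \<subseteq> S" "\<forall>s\<in>S. \<exists>n\<in>N. \<forall>f\<in>H. cmod (f s - f n) \<le> e"
      using precomp_net He(2) by metis
    have "s \<in> (\<Union>x\<in>N. (\<lambda>u. x \<oplus> u) ` U)" if s: "s \<in> S" for s
    proof -
      obtain n where n: "n \<in> N" "\<forall>f\<in>H. cmod (f s - f n) \<le> e" using N(3) s by metis
      have c: "s \<in> carrier X" "n \<in> carrier X" using s n(1) N(2) r by auto
      have "vsub X s n \<in> U"
        using He(3) n(2) c linear_on_vsub[OF lin[OF He(1)] c] by auto
      moreover have "s = n \<oplus> vsub X s n" using add_vsub[OF c] by simp
      ultimately show ?thesis using n(1) by blast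
    qed
    then show "\<exists>F. finite F \<and> F \<subseteq> carrier X \<and> S \<subseteq> (\<Union>x\<in>F. (\<lambda>u. x \<oplus> u) ` U)"
      using N r by (intro exI[of _ N]) auto
  qed
qed

lemma compactin_precomp:
  assumes K: "compactin (topol X) K" and H: "H \<in> \<H>"
  shows "precomp (\<lambda>x f. f x) K H"
proof (rule precompI_net)
  fix e :: real assume e: "0 < e"
  have Kc: "K \<subseteq> carrier X" using K unfolding compactin_def topspace_carrier by simp
  have "\<forall>x\<in>K. \<exists>W. openin (topol X) W \<and> x \<in> W \<and> W \<subseteq> polar_ball (carrier X) H e x"
    using polar_ball_nbhd[OF uc H _ e] Kc unfolding top by blast
  then obtain W where W: "\<forall>x\<in>K. openin (topol X) (W x) \<and> x \<in> W x \<and> W x \<subseteq> polar_ball (carrier X) H e x"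
    by metis
  have "\<exists>\<F>. finite \<F> \<and> \<F> \<subseteq> W ` K \<and> K \<subseteq> \<Union>\<F>"
    using K W unfolding compactin_def by (elim conjE allE[of _ "W ` K"]) blast
  then obtain \<F> where \<F>: "finite \<F>" "\<F> \<subseteq> W ` K" "K \<subseteq> \<Union>\<F>" by blast
  obtain F where F: "F \<subseteq> K" "finite F" "\<F> = W ` F"
    using finite_subset_image[OF \<F>(1,2)] by blast
  have "\<exists>v\<in>(\<lambda>x f. f x) ` F. \<forall>f\<in>H. cmod (f s - v f) \<le> e" if s: "s \<in> K" for s
  proof -
    obtain x where x: "x \<in> F" "s \<in> W x" using \<F>(3) F(3) s by blast
    have "s \<in> polar_ball (carrier X) H e x" using W x F(1) by blast
    then have "\<forall>f\<in>H. cmod (f s - f x) \<le> e" unfolding polar_ball_def by simp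
    then show ?thesis unfolding bex_simps using x(1) by (rule bexI)
  qed
  then show "\<exists>N. finite N \<and> (\<forall>s\<in>K. \<exists>v\<in>N. \<forall>f\<in>H. cmod (f s - v f) \<le> e)"
    using finite_imageI[OF F(2)] by (intro exI[of _ "(\<lambda>x f. f x) ` F"] conjI ballI)
qed

lemma compactin_totally_bounded: "compactin (topol X) K \<Longrightarrow> totally_bounded_in X K"
  unfolding totally_bounded_polar using compactin_precomp compactin_subset_topspace topspace_carrier by blast

text \<open>The hypothesis \<open>bdd\<close> makes polars absorbing, as continuity of scalar
  multiplication demands, and \<open>sep\<close> yields the Hausdorff property. Addition and
  convexity come from linearity of the members of \<open>\<H>\<close>.\<close>

lemma locally_convex_space_polar:
  assumes bdd: "\<And>H x. H \<in> \<H> \<Longrightarrow> x \<in> carrier X \<Longrightarrow> bounded ((\<lambda>f. f x) ` H)"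
    and sep: "\<And>x y. x \<in> carrier X \<Longrightarrow> y \<in> carrier X \<Longrightarrow>
      (\<And>H f. H \<in> \<H> \<Longrightarrow> f \<in> H \<Longrightarrow> f x = f y) \<Longrightarrow> x = y"
  shows "locally_convex_space X"
  unfolding locally_convex_space_def
proof (intro conjI allI impI)
  show "module complex_field X" by (rule mod)
  show "topspace (topol X) = carrier X" by (rule topspace_carrier)
  show "Hausdorff_space (topol X)"
    unfolding top using uc sep by (rule Hausdorff_polar_topology)
  show "continuous_map (prod_topology (topol X) (topol X)) (topol X) (\<lambda>(x, y). x \<oplus> y)"
  proof (rule continuous_map_into)
    fix p assume "p \<in> topspace (prod_topology (topol X) (topol X))"
    then obtain x y where p: "p = (x, y)" "x \<in> carrier X" "y \<in> carrier X" by (auto simp: topspace_carrier)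
    then show "(\<lambda>(x, y). x \<oplus> y) p \<in> carrier X" by simp
    fix H and e :: real assume H: "H \<in> \<H>" and e: "0 < e"
    obtain U where U: "openin (topol X) U" "x \<in> U" "U \<subseteq> polar_ball (carrier X) H (e / 2) x"
      using polar_ball_nbhd[OF uc H p(2), of "e / 2"] e unfolding top by auto
    obtain V where V: "openin (topol X) V" "y \<in> V" "V \<subseteq> polar_ball (carrier X) H (e / 2) y"
      using polar_ball_nbhd[OF uc H p(3), of "e / 2"] e unfolding top by auto
    have "cmod (f (u \<oplus> v) - f (x \<oplus> y)) \<le> e" if u: "u \<in> U" and v: "v \<in> V" and f: "f \<in> H" for u v f
    proof -
      have uv: "u \<in> carrier X" "v \<in> carrier X" "cmod (f u - f x) \<le> e / 2" "cmod (f v - f y) \<le> e / 2"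
        using U(3) V(3) u v f unfolding polar_ball_def by auto
      have "f (u \<oplus> v) - f (x \<oplus> y) = (f u - f x) + (f v - f y)"
        using linear_on_add[OF lin[OF H f]] uv p by simp
      then show ?thesis using norm_triangle_ineq[of "f u - f x" "f v - f y"] uv by simp
    qed
    moreover have "openin (prod_topology (topol X) (topol X)) (U \<times> V)"
      using U(1) V(1) by (simp add: openin_prod_Times_iff)
    ultimately show "\<exists>W. openin (prod_topology (topol X) (topol X)) W \<and> p \<in> W \<and>
        (\<forall>q\<in>W. \<forall>f\<in>H. cmod (f ((\<lambda>(x, y). x \<oplus> y) q) - f ((\<lambda>(x, y). x \<oplus> y) p)) \<le> e)"
      using U(2) V(2) p(1) by (intro exI[of _ "U \<times> V"]) auto
  qed
  show "continuous_map (prod_topology euclidean (topol X)) (topol X) (\<lambda>(c, x). c \<odot> x)"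
  proof (rule continuous_map_into)
    fix p assume "p \<in> topspace (prod_topology (euclidean :: complex topology) (topol X))"
    then obtain c x where p: "p = (c, x)" "x \<in> carrier X" by (auto simp: topspace_carrier)
    then show "(\<lambda>(c, x). c \<odot> x) p \<in> carrier X" by simp
    fix H and e :: real assume H: "H \<in> \<H>" and e: "0 < e"
    obtain b where b: "\<And>f. f \<in> H \<Longrightarrow> cmod (f x) \<le> b" "0 < b"
      using bdd[OF H p(2)] unfolding bounded_pos by auto
    \<comment> \<open>The increment is split as \<open>a * (f v - f x) + (a - c) * f x\<close>. The
      bound \<open>d \<le> 1\<close> keeps \<open>cmod a\<close> below \<open>cmod c + 1\<close>,
      and \<open>r\<close> and \<open>d\<close> give each summand half of \<open>e\<close>.\<close>
    define d where "d = min 1 (e / (2 * b))"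
    have d: "0 < d" "d \<le> 1" "d * b \<le> e / 2"
      unfolding d_def using e b(2) by (auto simp: min_def field_simps)
    define r where "r = e / (2 * (cmod c + 1))"
    have r: "0 < r" "(cmod c + 1) * r = e / 2"
    proof -
      have "0 < cmod c + 1" by (simp add: add_nonneg_pos)
      then show "0 < r" "(cmod c + 1) * r = e / 2"
        unfolding r_def using e by (simp_all del: distrib_left_numeral)
    qed
    obtain V where V: "openin (topol X) V" "x \<in> V" "V \<subseteq> polar_ball (carrier X) H r x"
      using polar_ball_nbhd[OF uc H p(2) r(1)] unfolding top by auto
    have "cmod (f (a \<odot> v) - f (c \<odot> x)) \<le> e" if a: "a \<in> ball c d" and v: "v \<in> V" and f: "f \<in> H" for a v f
    proof -
      have vc: "v \<in> carrier X" "cmod (f v - f x) \<le> r"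
        using V(3) v f unfolding polar_ball_def by auto
      have ac: "cmod (a - c) \<le> d" using a by (simp add: dist_norm norm_minus_commute)
      then have ca: "cmod a \<le> cmod c + 1" using norm_triangle_sub[of a c] d by linarith
      have "f (a \<odot> v) - f (c \<odot> x) = a * (f v - f x) + (a - c) * f x"
        using linear_on_smult[OF lin[OF H f]] vc p by (simp add: algebra_simps)
      then have "cmod (f (a \<odot> v) - f (c \<odot> x)) \<le> cmod a * cmod (f v - f x) + cmod (a - c) * cmod (f x)"
        by (metis norm_mult norm_triangle_ineq)
      also have "\<dots> \<le> (cmod c + 1) * r + d * b"
        using vc ac ca b(1)[OF f] d by (intro add_mono mult_mono) auto
      also have "\<dots> \<le> e" using r d by simp
      finally show ?thesis .
    qed
    moreover have "openin (prod_topology euclidean (topol X)) (ball c d \<times> V)"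
      using V(1) by (simp add: openin_prod_Times_iff)
    ultimately show "\<exists>W. openin (prod_topology euclidean (topol X)) W \<and> p \<in> W \<and>
        (\<forall>q\<in>W. \<forall>f\<in>H. cmod (f ((\<lambda>(c, x). c \<odot> x) q) - f ((\<lambda>(c, x). c \<odot> x) p)) \<le> e)"
      using V(2) p(1) d(1) by (intro exI[of _ "ball c d \<times> V"]) auto
  qed
  fix U assume "nbhd_zero X U"
  then obtain H e where He: "H \<in> \<H>" "0 < e" "{y \<in> carrier X. \<forall>f\<in>H. cmod (f y) \<le> e} \<subseteq> U"
    by (rule nbhd_zeroD)
  have "convex_in X {y \<in> carrier X. \<forall>f\<in>H. cmod (f y) \<le> e}"
    unfolding convex_in_def
  proof (intro ballI)
    fix x y and t :: real
    assume x: "x \<in> {y \<in> carrier X. \<forall>f\<in>H. cmod (f y) \<le> e}" and y: "y \<in> {y \<in> carrier X. \<forall>f\<in>H. cmod (f y) \<le> e}"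
      and t: "t \<in> {0..1}"
    have "cmod (f (of_real (1 - t) \<odot> x \<oplus> of_real t \<odot> y)) \<le> e" if f: "f \<in> H" for f
    proof -
      have "f (of_real (1 - t) \<odot> x \<oplus> of_real t \<odot> y) = of_real (1 - t) * f x + of_real t * f y"
        using x y linear_on_add[OF lin[OF He(1) f]] linear_on_smult[OF lin[OF He(1) f]] by simp
      also have "cmod \<dots> \<le> (1 - t) * cmod (f x) + t * cmod (f y)"
        using t norm_triangle_ineq[of "of_real (1 - t) * f x" "of_real t * f y"]
        by (simp add: norm_mult del: of_real_diff)
      also have "\<dots> \<le> (1 - t) * e + t * e"
        using x y f t by (intro add_mono mult_left_mono) auto
      finally show ?thesis by (simp add: algebra_simps)
    qed
    then show "of_real (1 - t) \<odot> x \<oplus> of_real t \<odot> y \<in> {y \<in> carrier X. \<forall>f\<in>H. cmod (f y) \<le> e}"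
      using x y by simp
  qed
  then show "\<exists>V. nbhd_zero X V \<and> convex_in X V \<and> V \<subseteq> U"
    using nbhd_zero_ball[OF He(1,2)] He(3) by blast
qed

end

section \<open>Dual spaces\<close>

text \<open>The polar topology of these sets of evaluations is the topology of the dual space, see
  \<open>dual_topology_polar\<close>.\<close>

definition evals :: "'a top_module \<Rightarrow> (('a \<Rightarrow> complex) \<Rightarrow> complex) set set" where
  "evals X = (\<lambda>S. (\<lambda>x f. f x) ` S) ` {S. totally_bounded_in X S}"

text \<open>In a stereotype space these sets generate the topology of \<open>X\<close> itself, see
  \<open>topol_polar\<close>.\<close>

definition dual_tb :: "'a top_module \<Rightarrow> ('a \<Rightarrow> complex) set set" where
  "dual_tb X = {H. totally_bounded_in (dual_space X) H}"

lemma union_closed_tb: "union_closed {S. totally_bounded_in X S}"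
proof -
  have "totally_bounded_in X {}" unfolding totally_bounded_in_def by blast
  then show ?thesis unfolding union_closed_def by (auto intro: totally_bounded_in_Un)
qed

lemma union_closed_dual_tb: "union_closed (dual_tb X)"
  unfolding dual_tb_def by (rule union_closed_tb)

lemma union_closed_evals: "union_closed (evals X)"
  using union_closed_tb[of X] unfolding union_closed_def evals_def
  by (auto simp flip: image_Un)

lemma polar_ball_evals:
  "polar_ball E ((\<lambda>x f. f x) ` S) \<epsilon> f = {g \<in> E. \<forall>x\<in>S. cmod (g x - f x) \<le> \<epsilon>}"
  unfolding polar_ball_def by simp

lemma dual_topology_polar: "dual_topology X = polar_topology (functionals X) (evals X)"
  unfolding topology_eq openin_dual_topology openin_polar_topology[OF union_closed_evals]
  by (simp add: evals_def polar_ball_evals)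

lemma dual_space_simps [simp]:
  "carrier (dual_space X) = functionals X"
  "zero (dual_space X) = (\<lambda>x\<in>carrier X. 0)"
  "add (dual_space X) f g = (\<lambda>x\<in>carrier X. f x + g x)"
  "smult (dual_space X) c f = (\<lambda>x\<in>carrier X. c * f x)"
  "topol (dual_space X) = dual_topology X"
  unfolding dual_space_def by simp_all

lemma vsub_dual: "x \<in> carrier X \<Longrightarrow> vsub (dual_space X) f g x = f x - g x"
  unfolding vsub_def by simp

context cmodule
begin

lemma functionals_lincomb:
  assumes ts: "topspace (topol X) = carrier X" and f: "f \<in> functionals X" and g: "g \<in> functionals X"
  shows "(\<lambda>x\<in>carrier X. a * f x + b * g x) \<in> functionals X"
  unfolding functionals_iff
proof (intro conjI)
  show "linear_on X (\<lambda>x\<in>carrier X. a * f x + b * g x)"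
    using functionals_linear[OF f] functionals_linear[OF g]
    unfolding linear_on_def by (simp add: algebra_simps)
  have c: "continuous_map (topol X) euclidean (\<lambda>x. a * k x)" if "k \<in> functionals X" for a k
    using continuous_map_compose[of "topol X" euclidean k euclidean "\<lambda>z. a * z"] that
    unfolding functionals_iff by (auto simp: o_def intro!: continuous_intros)
  show "continuous_map (topol X) euclidean (\<lambda>x\<in>carrier X. a * f x + b * g x)"
    by (rule continuous_map_eq[OF continuous_map_add[OF c[OF f, of a] c[OF g, of b]]]) (simp add: ts)
qed simp

lemma functionals_zero:
  assumes ts: "topspace (topol X) = carrier X"
  shows "(\<lambda>x\<in>carrier X. 0) \<in> functionals X"
  unfolding functionals_iff
proof (intro conjI)
  show "continuous_map (topol X) euclidean (\<lambda>x\<in>carrier X. 0 :: complex)"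
    by (rule continuous_map_eq[of _ _ "\<lambda>_. 0"]) (auto simp: ts)
qed (auto simp: linear_on_def)

lemma functionals_add:
  assumes "topspace (topol X) = carrier X" "f \<in> functionals X" "g \<in> functionals X"
  shows "(\<lambda>x\<in>carrier X. f x + g x) \<in> functionals X"
  using functionals_lincomb[OF assms, of 1 1] by simp

lemma functionals_smult:
  assumes "topspace (topol X) = carrier X" "f \<in> functionals X"
  shows "(\<lambda>x\<in>carrier X. a * f x) \<in> functionals X"
  using functionals_lincomb[OF assms(1,2,2), of a 0] by simp

lemma dual_module:
  assumes ts: "topspace (topol X) = carrier X"
  shows "module complex_field (dual_space X)"
proof (rule moduleI)
  show "cring complex_field" using field_complex_field by (simp add: field_def domain_def)
  show "abelian_group (dual_space X)"
  proof (rule abelian_groupI)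
    fix f g h assume f: "f \<in> carrier (dual_space X)" and g: "g \<in> carrier (dual_space X)"
      and h: "h \<in> carrier (dual_space X)"
    show "f \<oplus>\<^bsub>dual_space X\<^esub> g \<in> carrier (dual_space X)"
      using functionals_add[OF ts] f g by simp
    show "f \<oplus>\<^bsub>dual_space X\<^esub> g \<oplus>\<^bsub>dual_space X\<^esub> h = f \<oplus>\<^bsub>dual_space X\<^esub> (g \<oplus>\<^bsub>dual_space X\<^esub> h)"
      by (auto simp: add.assoc)
    show "f \<oplus>\<^bsub>dual_space X\<^esub> g = g \<oplus>\<^bsub>dual_space X\<^esub> f"
      by (auto simp: add.commute)
    show "\<zero>\<^bsub>dual_space X\<^esub> \<oplus>\<^bsub>dual_space X\<^esub> f = f"
      using functionals_ext[of f X] f by (auto simp: extensional_def fun_eq_iff)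
    show "\<exists>y\<in>carrier (dual_space X). y \<oplus>\<^bsub>dual_space X\<^esub> f = \<zero>\<^bsub>dual_space X\<^esub>"
      using functionals_smult[OF ts, of f "-1"] f
      by (intro bexI[of _ "\<lambda>x\<in>carrier X. -1 * f x"]) auto
  qed (simp add: functionals_zero ts)
  fix a b :: complex and f g assume f: "f \<in> carrier (dual_space X)" and g: "g \<in> carrier (dual_space X)"
  show "a \<odot>\<^bsub>dual_space X\<^esub> f \<in> carrier (dual_space X)"
    using functionals_smult[OF ts] f by simp
  show "(a \<oplus>\<^bsub>complex_field\<^esub> b) \<odot>\<^bsub>dual_space X\<^esub> f = a \<odot>\<^bsub>dual_space X\<^esub> f \<oplus>\<^bsub>dual_space X\<^esub> b \<odot>\<^bsub>dual_space X\<^esub> f"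
    by (auto simp: algebra_simps)
  show "a \<odot>\<^bsub>dual_space X\<^esub> (f \<oplus>\<^bsub>dual_space X\<^esub> g) = a \<odot>\<^bsub>dual_space X\<^esub> f \<oplus>\<^bsub>dual_space X\<^esub> a \<odot>\<^bsub>dual_space X\<^esub> g"
    by (auto simp: algebra_simps)
  show "(a \<otimes>\<^bsub>complex_field\<^esub> b) \<odot>\<^bsub>dual_space X\<^esub> f = a \<odot>\<^bsub>dual_space X\<^esub> (b \<odot>\<^bsub>dual_space X\<^esub> f)"
    by auto
  show "\<one>\<^bsub>complex_field\<^esub> \<odot>\<^bsub>dual_space X\<^esub> f = f"
    using functionals_ext[of f X] f by (auto simp: extensional_def fun_eq_iff)
qed

lemma dual_polar_space:
  assumes ts: "topspace (topol X) = carrier X" and tb: "\<And>S. totally_bounded_in X S \<Longrightarrow> S \<subseteq> carrier X"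
  shows "polar_space (dual_space X) (evals X)"
proof -
  interpret D: cmodule "dual_space X" by (rule cmodule.intro[OF dual_module[OF ts]])
  show ?thesis
  proof (rule polar_space.intro[OF D.cmodule_axioms polar_space_axioms.intro])
    show "topol (dual_space X) = polar_topology (carrier (dual_space X)) (evals X)"
      by (simp add: dual_topology_polar)
    show "union_closed (evals X)" by (rule union_closed_evals)
    fix H f assume "H \<in> evals X" "f \<in> H"
    then obtain x where "x \<in> carrier X" "f = (\<lambda>g. g x)" using tb unfolding evals_def by blast
    then show "linear_on (dual_space X) f" unfolding linear_on_def by simp
  qed
qed

end

lemma totally_bounded_subset: "totally_bounded_in X S \<Longrightarrow> S \<subseteq> carrier X"
  unfolding totally_bounded_in_def by simp

text \<open>The pairing is that of \<open>totally_bounded_polar\<close> with its arguments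
  exchanged, which is the form to which \<open>precomp_sym\<close> applies.\<close>

lemma (in cmodule) dual_tb_iff:
  assumes ts: "topspace (topol X) = carrier X"
  shows "H \<in> dual_tb X \<longleftrightarrow> H \<subseteq> functionals X \<and>
    (\<forall>S. totally_bounded_in X S \<longrightarrow> precomp (\<lambda>f x. f x) H S)"
proof -
  interpret D: polar_space "dual_space X" "evals X"
    by (rule dual_polar_space[OF ts totally_bounded_subset])
  have "precomp (\<lambda>f G. G f) H ((\<lambda>x f. f x) ` S) \<longleftrightarrow> precomp (\<lambda>f x. f x) H S" for S
    using precomp_image[of "\<lambda>f G. G f" id H "\<lambda>x f. f x" S] by simp
  then show ?thesis
    unfolding dual_tb_def mem_Collect_eq D.totally_bounded_polar by (simp add: evals_def)
qed

lemma bidual_map_polar_ball: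
  assumes "\<forall>f\<in>H. f \<in> functionals X" "E \<subseteq> carrier X" "x \<in> E"
    and "bidual_map X ` E = G"
  shows "bidual_map X ` polar_ball E H \<epsilon> x = {g \<in> G. \<forall>f\<in>H. cmod (g f - bidual_map X x f) \<le> \<epsilon>}"
  using assms unfolding polar_ball_def bidual_map_def by (auto simp: image_iff)

text \<open>Basic sets of the bidual correspond under a bijective \<open>bidual_map\<close> to balls
  for totally bounded sets of functionals. This serves both to describe the topology of a stereotype
  space and to recognize one.\<close>

lemma openin_bidual:
  assumes bij: "bij_betw (bidual_map X) (carrier X) (functionals (dual_space X))"
    and U: "U \<subseteq> carrier X"
  shows "openin (dual_topology (dual_space X)) (bidual_map X ` U) \<longleftrightarrow>
    openin (polar_topology (carrier X) (dual_tb X)) U"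
proof -
  have inj: "inj_on (bidual_map X) (carrier X)" and im: "bidual_map X ` carrier X = functionals (dual_space X)"
    using bij unfolding bij_betw_def by auto
  have ball: "{g \<in> functionals (dual_space X). \<forall>f\<in>H. cmod (g f - bidual_map X x f) \<le> \<epsilon>} \<subseteq> bidual_map X ` U
      \<longleftrightarrow> polar_ball (carrier X) H \<epsilon> x \<subseteq> U"
    if H: "totally_bounded_in (dual_space X) H" and x: "x \<in> U" for H \<epsilon> x
  proof -
    have "\<forall>f\<in>H. f \<in> functionals X" using totally_bounded_subset[OF H] by auto
    moreover have "x \<in> carrier X" using x U by blast
    ultimately have "bidual_map X ` polar_ball (carrier X) H \<epsilon> x
        = {g \<in> functionals (dual_space X). \<forall>f\<in>H. cmod (g f - bidual_map X x f) \<le> \<epsilon>}"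
      by (intro bidual_map_polar_ball) (auto simp: im)
    then show ?thesis
      using inj_on_image_subset_iff[OF inj polar_ball_subset U] by metis
  qed
  have "openin (dual_topology (dual_space X)) (bidual_map X ` U) \<longleftrightarrow>
      (\<forall>x\<in>U. \<exists>H \<epsilon>. totally_bounded_in (dual_space X) H \<and> 0 < \<epsilon> \<and>
        {g \<in> functionals (dual_space X). \<forall>f\<in>H. cmod (g f - bidual_map X x f) \<le> \<epsilon>} \<subseteq> bidual_map X ` U)"
    unfolding openin_dual_topology using im U by auto
  also have "\<dots> \<longleftrightarrow> (\<forall>x\<in>U. \<exists>H \<epsilon>. totally_bounded_in (dual_space X) H \<and> 0 < \<epsilon> \<and>
        polar_ball (carrier X) H \<epsilon> x \<subseteq> U)"
    by (intro ball_cong ex_cong1 conj_cong refl) (rule ball)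
  also have "\<dots> \<longleftrightarrow> openin (polar_topology (carrier X) (dual_tb X)) U"
    unfolding openin_polar_topology[OF union_closed_dual_tb] unfolding dual_tb_def using U by auto
  finally show ?thesis .
qed

section \<open>Stereotype spaces\<close>

lemma topspace_dual_topology: "topspace (dual_topology X) = functionals X"
  unfolding dual_topology_polar by (rule topspace_polar_topology[OF union_closed_evals])

locale stereo =
  fixes X :: "'a top_module" (structure)
  assumes st: "stereotype_space X"
begin

lemma lcs: "locally_convex_space X"
  using st unfolding stereotype_space_def by simp

lemma ts: "topspace (topol X) = carrier X"
  using lcs unfolding locally_convex_space_def by simp

lemma bidual_bij: "bij_betw (bidual_map X) (carrier X) (functionals (dual_space X))"
proof -
  have "homeomorphic_map (topol X) (topol (dual_space (dual_space X))) (bidual_map X)"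
    using st unfolding stereotype_space_def lcs_isomorphism_def by simp
  then show ?thesis
    unfolding bij_betw_def
    using homeomorphic_imp_surjective_map homeomorphic_imp_injective_map ts
    by (metis dual_space_simps(5) topspace_dual_topology)
qed

sublocale cmodule X
  by (rule cmodule.intro) (use lcs in \<open>simp add: locally_convex_space_def\<close>)

text \<open>The homeomorphism with the bidual identifies the given topology with uniform convergence
  on totally bounded sets of functionals. Hence a stereotype space is a
  \<open>polar_space\<close>.\<close>

lemma topol_polar: "topol X = polar_topology (carrier X) (dual_tb X)"
proof -
  have hm: "homeomorphic_map (topol X) (dual_topology (dual_space X)) (bidual_map X)"
    using st unfolding stereotype_space_def lcs_isomorphism_def by simp
  have "openin (topol X) U \<longleftrightarrow> openin (polar_topology (carrier X) (dual_tb X)) U" for U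
  proof (cases "U \<subseteq> carrier X")
    case True
    then show ?thesis
      using homeomorphic_map_openness[OF hm, of U] openin_bidual[OF bidual_bij True] ts by simp
  next
    case False
    then show ?thesis
      using openin_subset[of "topol X" U] openin_subset[of "polar_topology (carrier X) (dual_tb X)" U] ts
        topspace_polar_topology[OF union_closed_dual_tb, of "carrier X" X] by auto
  qed
  then show ?thesis unfolding topology_eq by blast
qed

lemma dual_tb_functionals: "H \<in> dual_tb X \<Longrightarrow> f \<in> H \<Longrightarrow> f \<in> functionals X"
  using dual_tb_iff[OF ts] by blast

sublocale polar_space X "dual_tb X"
  by (rule polar_space.intro[OF cmodule_axioms polar_space_axioms.intro])
    (use topol_polar union_closed_dual_tb in \<open>simp_all add: functionals_linear[OF dual_tb_functionals]\<close>)

sublocale D: polar_space "dual_space X" "evals X"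
  by (rule dual_polar_space[OF ts totally_bounded_subset])

lemma separation:
  assumes "x \<in> carrier X" "y \<in> carrier X" "\<And>f. f \<in> functionals X \<Longrightarrow> f x = f y"
  shows "x = y"
proof -
  have "bidual_map X x = bidual_map X y" using assms(3) unfolding bidual_map_def by fastforce
  then show ?thesis using bidual_bij assms(1,2) unfolding bij_betw_def inj_on_def by blast
qed

lemma polar_bounded_restrict: "polar_bounded E \<H> (restrict f E) \<longleftrightarrow> polar_bounded E \<H> f"
  unfolding polar_bounded_def by simp

text \<open>Reflexivity for forms whose values matter only on the functionals: \<open>g\<close> is
  cut down to an extensional function before surjectivity of the bidual map is used.\<close>

lemma bidual_surj:
  assumes S: "totally_bounded_in X S" and g: "linear_on (dual_space X) g"
    and bd: "\<And>f. f \<in> functionals X \<Longrightarrow> (\<forall>s\<in>S. cmod (f s) \<le> 1) \<Longrightarrow> cmod (g f) \<le> 1"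
  shows "\<exists>x\<in>carrier X. \<forall>f\<in>functionals X. g f = f x"
proof -
  let ?g = "restrict g (functionals X)"
  have "linear_on (dual_space X) ?g"
    using g D.M.a_closed D.csmult_closed unfolding linear_on_def by simp
  moreover have "polar_bounded (functionals X) (evals X) ?g"
    unfolding polar_bounded_restrict unfolding polar_bounded_def evals_def
    using S bd by (auto intro!: exI[of _ S] exI[of _ "1::real"])
  ultimately have "?g \<in> functionals (dual_space X)"
    unfolding D.functionals_polar by simp
  then obtain x where "x \<in> carrier X" "?g = bidual_map X x"
    using bidual_bij unfolding bij_betw_def by blast
  then show ?thesis unfolding bidual_map_def by (metis restrict_apply)
qed

lemma finite_functionals_tb: "finite H \<Longrightarrow> H \<subseteq> functionals X \<Longrightarrow> H \<in> dual_tb X"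
  unfolding dual_tb_iff[OF ts] using precomp_finite_left by blast

lemma finite_tb: "finite S \<Longrightarrow> S \<subseteq> carrier X \<Longrightarrow> totally_bounded_in X S"
  unfolding totally_bounded_polar using precomp_finite_left by blast

lemma tb_bounded: "totally_bounded_in X S \<Longrightarrow> f \<in> functionals X \<Longrightarrow> bounded (f ` S)"
  using finite_functionals_tb[of "{f}"] precomp_bounded[of "\<lambda>x f. f x" S "{f}" f]
  unfolding totally_bounded_polar by auto

end

text \<open>If the topology is generated by \<open>dual_tb X\<close>, then
  \<open>openin_bidual\<close> makes a bijective bidual map a homeomorphism. What remains is
  injectivity from \<open>sep\<close> and surjectivity from \<open>surj\<close>.\<close>

lemma stereotype_spaceI:
  assumes ps: "polar_space X (dual_tb X)"
    and sep: "\<And>x y. x \<in> carrier X \<Longrightarrow> y \<in> carrier X \<Longrightarrow> (\<And>f. f \<in> functionals X \<Longrightarrow> f x = f y) \<Longrightarrow> x = y"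
    and surj: "\<And>g. g \<in> functionals (dual_space X) \<Longrightarrow> \<exists>x\<in>carrier X. \<forall>f\<in>functionals X. g f = f x"
  shows "stereotype_space X"
proof -
  interpret polar_space X "dual_tb X" by (rule ps)
  note ts = topspace_carrier
  interpret D: polar_space "dual_space X" "evals X"
    by (rule dual_polar_space[OF ts totally_bounded_subset])
  have single: "{f} \<in> dual_tb X" if "f \<in> functionals X" for f
    unfolding dual_tb_iff[OF ts] using that by (simp add: precomp_finite_left)
  have tb1: "totally_bounded_in X {x}" if "x \<in> carrier X" for x
    unfolding totally_bounded_polar using that by (simp add: precomp_finite_left)
  have "locally_convex_space X"
  proof (rule locally_convex_space_polar)
    show "bounded ((\<lambda>f. f x) ` H)" if "H \<in> dual_tb X" "x \<in> carrier X" for H x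
      using that tb1[of x] dual_tb_iff[OF ts, of H] precomp_bounded[of "\<lambda>f x. f x" H "{x}" x] by auto
    show "x = y" if xy: "x \<in> carrier X" "y \<in> carrier X" "\<And>H f. H \<in> dual_tb X \<Longrightarrow> f \<in> H \<Longrightarrow> f x = f y" for x y
      by (rule sep[OF xy(1,2)], rule xy(3)[OF single]) auto
  qed
  have bidual_in: "bidual_map X x \<in> functionals (dual_space X)" if x: "x \<in> carrier X" for x
    unfolding D.functionals_polar
  proof (intro conjI)
    show "bidual_map X x \<in> extensional (carrier (dual_space X))" unfolding bidual_map_def by simp
    show "linear_on (dual_space X) (bidual_map X x)"
      using x D.M.a_closed D.csmult_closed unfolding linear_on_def bidual_map_def by simp
    show "polar_bounded (carrier (dual_space X)) (evals X) (bidual_map X x)"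
      unfolding polar_bounded_def evals_def bidual_map_def
      using tb1[OF x] by (auto intro!: exI[of _ "{x}"] exI[of _ "1::real"])
  qed
  have bij: "bij_betw (bidual_map X) (carrier X) (functionals (dual_space X))"
    unfolding bij_betw_def
  proof
    show "inj_on (bidual_map X) (carrier X)"
    proof (rule inj_onI)
      fix x y assume xy: "x \<in> carrier X" "y \<in> carrier X" and eq: "bidual_map X x = bidual_map X y"
      show "x = y"
        by (rule sep[OF xy]) (use fun_cong[OF eq] in \<open>simp add: bidual_map_def restrict_def split: if_splits\<close>, metis)
    qed
    show "bidual_map X ` carrier X = functionals (dual_space X)"
    proof
      show "bidual_map X ` carrier X \<subseteq> functionals (dual_space X)" using bidual_in by blast
      show "functionals (dual_space X) \<subseteq> bidual_map X ` carrier X"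
      proof
        fix g assume g: "g \<in> functionals (dual_space X)"
        obtain x where x: "x \<in> carrier X" "\<forall>f\<in>functionals X. g f = f x" using surj[OF g] by blast
        have "g = bidual_map X x"
          using functionals_ext[OF g] x(2) unfolding bidual_map_def
          by (intro extensionalityI[of _ "functionals X"]) auto
        then show "g \<in> bidual_map X ` carrier X" using x(1) by blast
      qed
    qed
  qed
  have open_iff: "openin (dual_topology (dual_space X)) (bidual_map X ` U) \<longleftrightarrow> openin (topol X) U"
    if "U \<subseteq> carrier X" for U
    using openin_bidual[OF bij that] top by simp
  have "homeomorphic_map (topol X) (dual_topology (dual_space X)) (bidual_map X)"
  proof (rule bijective_open_imp_homeomorphic_map)
    have im: "bidual_map X ` carrier X = functionals (dual_space X)" and inj: "inj_on (bidual_map X) (carrier X)"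
      using bij unfolding bij_betw_def by auto
    show "bidual_map X ` topspace (topol X) = topspace (dual_topology (dual_space X))"
      by (simp add: ts topspace_dual_topology im)
    show "inj_on (bidual_map X) (topspace (topol X))" by (simp add: ts inj)
    show "open_map (topol X) (dual_topology (dual_space X)) (bidual_map X)"
      unfolding open_map_def using open_iff openin_subset[of "topol X"] ts by metis
    show "continuous_map (topol X) (dual_topology (dual_space X)) (bidual_map X)"
      unfolding continuous_map ts topspace_dual_topology
    proof (intro conjI allI impI)
      show "bidual_map X ` carrier X \<subseteq> functionals (dual_space X)" using im by simp
      fix V assume V: "openin (dual_topology (dual_space X)) V"
      then have "V \<subseteq> bidual_map X ` carrier X"
        using openin_subset[OF V] topspace_dual_topology im by metis
      then have "bidual_map X ` {x \<in> carrier X. bidual_map X x \<in> V} = V" by blast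
      then show "openin (topol X) {x \<in> carrier X. bidual_map X x \<in> V}"
        using open_iff[of "{x \<in> carrier X. bidual_map X x \<in> V}"] V by auto
    qed
  qed
  then show ?thesis
    using \<open>locally_convex_space X\<close> unfolding stereotype_space_def lcs_isomorphism_def
    by (auto simp: bidual_map_def linear_on_add[OF functionals_linear] linear_on_smult[OF functionals_linear] restrict_def fun_eq_iff)
qed

lemma closedin_Collect_ball:
  assumes "\<And>i. i \<in> I \<Longrightarrow> closedin T {x \<in> topspace T. Q i x}"
  shows "closedin T {x \<in> topspace T. \<forall>i\<in>I. Q i x}"
proof (cases "I = {}")
  case False
  have "{x \<in> topspace T. \<forall>i\<in>I. Q i x} = \<Inter>((\<lambda>i. {x \<in> topspace T. Q i x}) ` I)" using False by auto
  then show ?thesis using closedin_Inter[of "(\<lambda>i. {x \<in> topspace T. Q i x}) ` I" T] False assms by auto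
qed simp

context stereo
begin

text \<open>The bipolar of \<open>S\<close> is weakly compact by Tychonoff's theorem, and on it the weak topology
  agrees with the given one, because each totally bounded set of functionals is uniformly close
  to a finite set there.\<close>

lemma totally_bounded_compact:
  assumes S: "totally_bounded_in X S"
  shows "\<exists>K. compactin (topol X) K \<and> S \<subseteq> K"
proof -
  let ?F = "functionals X"
  let ?P = "product_topology (\<lambda>_. euclidean :: complex topology) ?F"
  have Sc: "S \<subseteq> carrier X" using S by (rule totally_bounded_subset)
  have "\<forall>f\<in>?F. \<exists>r>0. \<forall>s\<in>S. cmod (f s) \<le> r"
    using tb_bounded[OF S] unfolding bounded_pos by auto
  then obtain r where r: "\<forall>f\<in>?F. r f > 0 \<and> (\<forall>s\<in>S. cmod (f s) \<le> r f)" by metis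
  \<comment> \<open>\<open>Q\<close> selects the linear forms on the dual that are bounded by 1 on
    the polar of \<open>S\<close>, that is, the bipolar of \<open>S\<close>. The set
    \<open>C\<close> adds the box of radii \<open>r f\<close>, in order to lie in a compact
    product.\<close>
  define Q where "Q g \<longleftrightarrow> (\<forall>f\<in>?F. \<forall>f'\<in>?F. g (f \<oplus>\<^bsub>dual_space X\<^esub> f') = g f + g f') \<and>
    (\<forall>c. \<forall>f\<in>?F. g (c \<odot>\<^bsub>dual_space X\<^esub> f) = c * g f) \<and>
    (\<forall>f\<in>{f\<in>?F. \<forall>s\<in>S. cmod (f s) \<le> 1}. cmod (g f) \<le> 1)" for g :: "('a \<Rightarrow> complex) \<Rightarrow> complex"
  define C where "C = PiE ?F (\<lambda>f. cball 0 (r f)) \<inter> {g \<in> topspace ?P. Q g}"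
  have proj: "continuous_map ?P euclidean (\<lambda>g. g f)" if "f \<in> ?F" for f
    using continuous_map_product_projection[of f ?F "\<lambda>_. euclidean"] that by simp
  have proj2: "continuous_map ?P euclidean (\<lambda>g. c * g f)" if "f \<in> ?F" for f c
    using continuous_map_compose[OF proj[OF that], of euclidean "\<lambda>z. c * z"]
    by (auto simp: o_def intro!: continuous_intros)
  have add: "f \<oplus>\<^bsub>dual_space X\<^esub> f' \<in> ?F" if "f \<in> ?F" "f' \<in> ?F" for f f'
    using D.M.a_closed that by simp
  have smult: "c \<odot>\<^bsub>dual_space X\<^esub> f \<in> ?F" if "f \<in> ?F" for f c
    using D.csmult_closed that by simp
  \<comment> \<open>Each condition in \<open>Q\<close> compares continuous functions of finitely
    many coordinates, so it is closed for pointwise convergence.\<close>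
  have cl: "closedin ?P {g \<in> topspace ?P. Q g}"
  proof -
    have "closedin ?P {g \<in> topspace ?P. \<forall>f\<in>?F. \<forall>f'\<in>?F. g (f \<oplus>\<^bsub>dual_space X\<^esub> f') = g f + g f'}"
      by (intro closedin_Collect_ball closedin_continuous_maps_eq[of euclidean] Hausdorff_space_euclidean
          continuous_map_add proj add)
    moreover have "closedin ?P {g \<in> topspace ?P. \<forall>c\<in>UNIV. \<forall>f\<in>?F. g (c \<odot>\<^bsub>dual_space X\<^esub> f) = c * g f}"
      by (intro closedin_Collect_ball closedin_continuous_maps_eq[of euclidean] Hausdorff_space_euclidean
          proj proj2 smult)
    moreover have "closedin ?P {g \<in> topspace ?P. \<forall>f\<in>{f\<in>?F. \<forall>s\<in>S. cmod (f s) \<le> 1}. cmod (g f) \<le> 1}"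
    proof (rule closedin_Collect_ball)
      fix f assume "f \<in> {f\<in>?F. \<forall>s\<in>S. cmod (f s) \<le> 1}"
      then have "closedin ?P {g \<in> topspace ?P. g f \<in> cball 0 1}"
        by (intro closedin_continuous_map_preimage[OF proj]) auto
      then show "closedin ?P {g \<in> topspace ?P. cmod (g f) \<le> 1}" by simp
    qed
    ultimately have "closedin ?P ({g \<in> topspace ?P. \<forall>f\<in>?F. \<forall>f'\<in>?F. g (f \<oplus>\<^bsub>dual_space X\<^esub> f') = g f + g f'} \<inter>
      ({g \<in> topspace ?P. \<forall>c\<in>UNIV. \<forall>f\<in>?F. g (c \<odot>\<^bsub>dual_space X\<^esub> f) = c * g f} \<inter>
       {g \<in> topspace ?P. \<forall>f\<in>{f\<in>?F. \<forall>s\<in>S. cmod (f s) \<le> 1}. cmod (g f) \<le> 1}))"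
      by (intro closedin_Int)
    then show ?thesis
      by (rule back_subst[of "closedin ?P"]) (unfold Q_def, blast)
  qed
  have "compactin ?P (PiE ?F (\<lambda>f. cball 0 (r f)))"
    unfolding compactin_PiE by simp
  then have compC: "compactin ?P C"
    unfolding C_def using cl by (rule compact_Int_closedin)
  have linC: "linear_on (dual_space X) g" and bdC: "f \<in> ?F \<Longrightarrow> \<forall>s\<in>S. cmod (f s) \<le> 1 \<Longrightarrow> cmod (g f) \<le> 1"
    if "g \<in> C" for g f
    using that unfolding C_def Q_def linear_on_def by auto
  have "\<forall>g\<in>C. \<exists>x\<in>carrier X. \<forall>f\<in>?F. g f = f x"
  proof
    fix g assume g: "g \<in> C"
    show "\<exists>x\<in>carrier X. \<forall>f\<in>?F. g f = f x"
      using S linC[OF g] bdC[OF g] by (rule bidual_surj)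
  qed
  \<comment> \<open>By reflexivity the members of \<open>C\<close> are evaluations at points of
    \<open>X\<close>; \<open>\<theta>\<close> selects these points.\<close>
  then obtain \<theta> where \<theta>: "\<And>g. g \<in> C \<Longrightarrow> \<theta> g \<in> carrier X" "\<And>g f. g \<in> C \<Longrightarrow> f \<in> ?F \<Longrightarrow> g f = f (\<theta> g)" by metis
  have tsC: "topspace (subtopology ?P C) = C"
    using compactin_subset_topspace[OF compC] by (rule topspace_subtopology_subset)
  have "continuous_map (subtopology ?P C) (topol X) \<theta>"
  proof (rule continuous_map_into, unfold tsC)
    fix g assume g: "g \<in> C"
    then show "\<theta> g \<in> carrier X" by (rule \<theta>)
    fix H and e :: real assume H: "H \<in> dual_tb X" and e: "0 < e"
    have HF: "H \<subseteq> ?F" and pc: "precomp (\<lambda>f x. f x) H S" using H S unfolding dual_tb_iff[OF ts] by auto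
    obtain N where N: "finite N" "N \<subseteq> H" "\<forall>f\<in>H. \<exists>n\<in>N. \<forall>s\<in>S. cmod (f s - n s) \<le> e / 3"
      using precomp_net[OF pc, of "e / 3"] e by auto
    \<comment> \<open>Functionals that are close on \<open>S\<close> are close on all of
      \<open>C\<close>, uniformly in \<open>g'\<close>, because members of \<open>C\<close> are
      bounded by 1 on the polar of \<open>S\<close>.\<close>
    have near: "cmod (g' f - g' n) \<le> e / 3"
      if g': "g' \<in> C" and fn: "f \<in> ?F" "n \<in> ?F" "\<forall>s\<in>S. cmod (f s - n s) \<le> e / 3" for g' f n
    proof -
      have "cmod (g' (vsub (dual_space X) f n)) \<le> e / 3"
      proof (rule D.polar_scale[of "(\<lambda>x f. f x) ` S" g' 1])
        show "linear_on (dual_space X) h" if "h \<in> (\<lambda>x f. f x) ` S" for h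
          using that Sc unfolding linear_on_def by auto
        show "linear_on (dual_space X) g'" by (rule linC[OF g'])
        show "\<forall>x\<in>carrier (dual_space X). (\<forall>h\<in>(\<lambda>x f. f x) ` S. cmod (h x) \<le> 1) \<longrightarrow> cmod (g' x) \<le> 1"
          using bdC[OF g'] by simp
        show "vsub (dual_space X) f n \<in> carrier (dual_space X)" using fn by (intro D.vsub_closed) auto
        show "\<forall>h\<in>(\<lambda>x f. f x) ` S. cmod (h (vsub (dual_space X) f n)) \<le> 1 * (e / 3)"
          using fn(3) Sc by (auto simp: vsub_dual subset_iff)
      qed (use e in simp)
      then show ?thesis using D.linear_on_vsub[OF linC[OF g']] fn by simp
    qed
    \<comment> \<open>Only the finitely many coordinates in \<open>N\<close> are restricted, so this
      set is relatively open for pointwise convergence.\<close>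
    let ?W = "C \<inter> {g' \<in> topspace ?P. \<forall>n\<in>N. g' n \<in> ball (g n) (e / 3)}"
    have "openin ?P {g' \<in> topspace ?P. \<forall>n\<in>N. g' n \<in> ball (g n) (e / 3)}"
    proof (cases "N = {}")
      case False
      have "{g' \<in> topspace ?P. \<forall>n\<in>N. g' n \<in> ball (g n) (e / 3)} =
          \<Inter>((\<lambda>n. {g' \<in> topspace ?P. g' n \<in> ball (g n) (e / 3)}) ` N)" using False by auto
      moreover have "openin ?P {g' \<in> topspace ?P. g' n \<in> ball (g n) (e / 3)}" if "n \<in> N" for n
        using that N(2) HF by (intro openin_continuous_map_preimage[OF proj]) auto
      ultimately show ?thesis using openin_Inter[of "(\<lambda>n. {g' \<in> topspace ?P. g' n \<in> ball (g n) (e / 3)}) ` N" ?P] N(1) False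
        by auto
    next
      case True
      then show ?thesis using openin_topspace[of ?P] by (simp del: topspace_product_topology)
    qed
    then have "openin (subtopology ?P C) ?W" by (rule openin_subtopology_Int2)
    moreover have "g \<in> ?W"
      using g e subsetD[OF compactin_subset_topspace[OF compC] g] by (simp del: topspace_product_topology)
    moreover have "cmod (f (\<theta> g') - f (\<theta> g)) \<le> e" if g': "g' \<in> ?W" and f: "f \<in> H" for g' f
    proof -
      obtain n where n: "n \<in> N" "\<forall>s\<in>S. cmod (f s - n s) \<le> e / 3" using N(3) f by blast
      have F: "f \<in> ?F" "n \<in> ?F" using f n N(2) HF by auto
      have g'C: "g' \<in> C" using g' by simp
      have "cmod (g' f - g f) \<le> cmod (g' f - g' n) + cmod (g' n - g n) + cmod (g f - g n)"
        by (rule cmod_diff_three)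
      also have "\<dots> \<le> e / 3 + e / 3 + e / 3"
        using near[OF g'C F n(2)] near[OF g F n(2)] g' n(1)
        by (intro add_mono) (auto simp: dist_norm norm_minus_commute less_imp_le)
      finally show ?thesis using \<theta>(2)[OF g F(1)] \<theta>(2)[OF g'C F(1)] by simp
    qed
    ultimately show "\<exists>W. openin (subtopology ?P C) W \<and> g \<in> W \<and> (\<forall>g'\<in>W. \<forall>f\<in>H. cmod (f (\<theta> g') - f (\<theta> g)) \<le> e)"
      by blast
  qed
  moreover have "compactin (subtopology ?P C) C" using compC by (simp add: compactin_subtopology)
  ultimately have "compactin (topol X) (\<theta> ` C)" by (rule image_compactin[rotated])
  moreover have "S \<subseteq> \<theta> ` C"
  proof
    fix s assume s: "s \<in> S"
    then have sc: "s \<in> carrier X" using Sc by blast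
    let ?g = "\<lambda>f\<in>?F. f s"
    have "Q ?g" unfolding Q_def using s sc add smult by simp
    then have g: "?g \<in> C" unfolding C_def using r s by (auto simp: PiE_def)
    have "\<theta> ?g = s"
    proof (rule separation[OF \<theta>(1)[OF g] sc])
      fix f assume "f \<in> ?F"
      then show "f (\<theta> ?g) = f s" using \<theta>(2)[OF g, of f] by simp
    qed
    then show "s \<in> \<theta> ` C" using g by (metis imageI)
  qed
  ultimately show ?thesis by blast
qed

end

context polar_space
begin

lemma scale_tb:
  assumes S: "totally_bounded_in X S" shows "totally_bounded_in X ((\<lambda>x. c \<odot> x) ` S)"
  unfolding totally_bounded_polar
proof (intro conjI ballI)
  have Sc: "S \<subseteq> carrier X" by (rule totally_bounded_subset[OF S])
  then show "(\<lambda>x. c \<odot> x) ` S \<subseteq> carrier X" by auto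
  fix H assume H: "H \<in> \<H>"
  have "precomp (\<lambda>x f. f x) S H" using S H unfolding totally_bounded_polar by blast
  then have "precomp (\<lambda>x f. c * f x + 0 * f x) S H" by (intro precomp_lincomb)
  then have "precomp (\<lambda>x f. f (c \<odot> x)) S H"
    by (rule iffD1[OF precomp_cong, rotated]) (use Sc linear_on_smult[OF lin[OF H]] in \<open>simp add: subset_iff\<close>)
  then show "precomp (\<lambda>x f. f x) ((\<lambda>x. c \<odot> x) ` S) H"
    using precomp_image[of "\<lambda>x f. f x" "\<lambda>x. c \<odot> x" S id H] by simp
qed

text \<open>Continuity of \<open>g\<close> provides a totally bounded set and a radius
  \<open>e\<close>; scaling the set by \<open>1 / e\<close> normalizes the radius to 1.\<close>

lemma dual_functional_bounded:
  assumes g: "g \<in> functionals (dual_space X)"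
  shows "\<exists>S. totally_bounded_in X S \<and>
    (\<forall>f\<in>functionals X. (\<forall>s\<in>S. cmod (f s) \<le> 1) \<longrightarrow> cmod (g f) \<le> 1)"
proof -
  interpret D: polar_space "dual_space X" "evals X"
    by (rule dual_polar_space[OF topspace_carrier totally_bounded_subset])
  obtain S e where S: "totally_bounded_in X S" "0 < e"
    "\<forall>f\<in>functionals X. (\<forall>s\<in>S. cmod (f s) \<le> e) \<longrightarrow> cmod (g f) \<le> 1"
    using g unfolding D.functionals_polar polar_bounded_def evals_def by auto
  have Sc: "S \<subseteq> carrier X" by (rule totally_bounded_subset[OF S(1)])
  let ?S = "(\<lambda>x. complex_of_real (1 / e) \<odot> x) ` S"
  have "cmod (f s) \<le> e" if f: "f \<in> functionals X" "\<forall>s\<in>?S. cmod (f s) \<le> 1" and s: "s \<in> S" for f s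
  proof -
    have "cmod (f (complex_of_real (1 / e) \<odot> s)) \<le> 1" using f(2) s by blast
    moreover have "f (complex_of_real (1 / e) \<odot> s) = complex_of_real (1 / e) * f s"
      using s Sc by (intro linear_on_smult[OF functionals_linear[OF f(1)]]) auto
    ultimately show ?thesis using S(2) by (simp add: norm_mult norm_divide divide_le_eq_1)
  qed
  then show ?thesis using S scale_tb[OF S(1)] by (intro exI[of _ ?S]) blast
qed

end

section \<open>Bilinear operations\<close>

text \<open>A symmetric version of the condition on the multiplication of a stereotype algebra, so that
  it can be applied to the opposite multiplication as well.\<close>

definition hypocontinuous :: "'a top_module \<Rightarrow> ('a \<Rightarrow> 'a \<Rightarrow> 'a) \<Rightarrow> bool" where
  "hypocontinuous X m \<longleftrightarrow>
    (\<forall>x\<in>carrier X. \<forall>y\<in>carrier X. m x y \<in> carrier X) \<and>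
    (\<forall>x\<in>carrier X. \<forall>y\<in>carrier X. \<forall>z\<in>carrier X.
      m (x \<oplus>\<^bsub>X\<^esub> y) z = m x z \<oplus>\<^bsub>X\<^esub> m y z \<and> m z (x \<oplus>\<^bsub>X\<^esub> y) = m z x \<oplus>\<^bsub>X\<^esub> m z y) \<and>
    (\<forall>c. \<forall>x\<in>carrier X. \<forall>y\<in>carrier X.
      m (c \<odot>\<^bsub>X\<^esub> x) y = c \<odot>\<^bsub>X\<^esub> m x y \<and> m x (c \<odot>\<^bsub>X\<^esub> y) = c \<odot>\<^bsub>X\<^esub> m x y) \<and>
    (\<forall>K U. compactin (topol X) K \<and> nbhd_zero X U \<longrightarrow>
      (\<exists>V. nbhd_zero X V \<and> (\<forall>k\<in>K. \<forall>v\<in>V. m k v \<in> U \<and> m v k \<in> U)))"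

lemma hypocontinuous_flip: "hypocontinuous X m \<Longrightarrow> hypocontinuous X (\<lambda>x y. m y x)"
  unfolding hypocontinuous_def by (elim conjE, intro conjI) (simp_all add: conj_commute)

lemma hypocontinuous_mult:
  assumes "stereotype_algebra A" shows "hypocontinuous A (\<lambda>x y. x \<otimes>\<^bsub>A\<^esub> y)"
proof -
  have "ring A" using assms unfolding stereotype_algebra_def by simp
  then interpret ring A .
  have "\<exists>V. nbhd_zero A V \<and> (\<forall>k\<in>K. \<forall>v\<in>V. k \<otimes>\<^bsub>A\<^esub> v \<in> U \<and> v \<otimes>\<^bsub>A\<^esub> k \<in> U)"
    if KU: "compactin (topol A) K" "nbhd_zero A U" for K U
  proof -
    obtain V where "nbhd_zero A V" "K <#>\<^bsub>A\<^esub> V \<subseteq> U" "V <#>\<^bsub>A\<^esub> K \<subseteq> U"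
      using assms KU unfolding stereotype_algebra_def by blast
    then show ?thesis unfolding set_mult_def by (intro exI[of _ V]) blast
  qed
  then show ?thesis
    using assms unfolding hypocontinuous_def stereotype_algebra_def by (auto simp: l_distr r_distr)
qed

locale stereo_bilinear = stereo +
  fixes m :: "'a \<Rightarrow> 'a \<Rightarrow> 'a"
  assumes hyp: "hypocontinuous X m"
begin

lemma m_closed [simp]: "x \<in> carrier X \<Longrightarrow> y \<in> carrier X \<Longrightarrow> m x y \<in> carrier X"
  using hyp unfolding hypocontinuous_def by blast

lemma m_linear:
  assumes "linear_on X f" "k \<in> carrier X"
  shows "linear_on X (\<lambda>x. f (m k x))" "linear_on X (\<lambda>x. f (m x k))"
  using assms hyp unfolding hypocontinuous_def linear_on_def by auto

text \<open>Hypocontinuity is formulated for compact sets. Enclosing a totally bounded set in a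
  compact one extends it, in terms of polars on both sides.\<close>

lemma hypocontinuous_tb:
  assumes "totally_bounded_in X K" "H \<in> dual_tb X" "0 < \<epsilon>"
  obtains G d where "G \<in> dual_tb X" "0 < d"
    "\<And>k v f. k \<in> K \<Longrightarrow> v \<in> carrier X \<Longrightarrow> \<forall>g\<in>G. cmod (g v) \<le> d \<Longrightarrow> f \<in> H \<Longrightarrow> cmod (f (m k v)) \<le> \<epsilon> \<and> cmod (f (m v k)) \<le> \<epsilon>"
proof -
  obtain L where L: "compactin (topol X) L" "K \<subseteq> L" using totally_bounded_compact[OF assms(1)] by blast
  obtain V where V: "nbhd_zero X V" "\<forall>k\<in>L. \<forall>v\<in>V. m k v \<in> {y \<in> carrier X. \<forall>f\<in>H. cmod (f y) \<le> \<epsilon>} \<and>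
      m v k \<in> {y \<in> carrier X. \<forall>f\<in>H. cmod (f y) \<le> \<epsilon>}"
    using hyp L(1) nbhd_zero_ball[OF assms(2,3)] unfolding hypocontinuous_def by blast
  obtain G d where Gd: "G \<in> dual_tb X" "0 < d" "{y \<in> carrier X. \<forall>f\<in>G. cmod (f y) \<le> d} \<subseteq> V"
    using V(1) by (rule nbhd_zeroD)
  show thesis
  proof (rule that[OF Gd(1,2)])
    fix k v f assume "k \<in> K" "v \<in> carrier X" "\<forall>g\<in>G. cmod (g v) \<le> d" "f \<in> H"
    then show "cmod (f (m k v)) \<le> \<epsilon> \<and> cmod (f (m v k)) \<le> \<epsilon>"
      using V(2) Gd(3) L(2) by blast
  qed
qed

text \<open>Separate continuity: the singletons of \<open>k\<close> and of \<open>f\<close> are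
  totally bounded, so hypocontinuity bounds the new form on a polar.\<close>

lemma functional_m:
  assumes f: "f \<in> functionals X" and k: "k \<in> carrier X"
  shows "(\<lambda>x\<in>carrier X. f (m k x)) \<in> functionals X"
  unfolding functionals_polar
proof (intro conjI)
  show "linear_on X (\<lambda>x\<in>carrier X. f (m k x))"
    using m_linear(1)[OF functionals_linear[OF f] k] unfolding linear_on_def by simp
  have "totally_bounded_in X {k}" "{f} \<in> dual_tb X"
    using finite_tb[of "{k}"] finite_functionals_tb[of "{f}"] f k by auto
  then obtain G d where "G \<in> dual_tb X" "0 < d"
    "\<And>k' v f'. k' \<in> {k} \<Longrightarrow> v \<in> carrier X \<Longrightarrow> \<forall>g\<in>G. cmod (g v) \<le> d \<Longrightarrow> f' \<in> {f} \<Longrightarrow> cmod (f' (m k' v)) \<le> 1 \<and> cmod (f' (m v k')) \<le> 1"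
    by (rule hypocontinuous_tb[of "{k}" "{f}" 1]) auto
  then show "polar_bounded (carrier X) (dual_tb X) (\<lambda>x\<in>carrier X. f (m k x))"
    unfolding polar_bounded_def by (intro bexI[of _ G] exI[of _ d]) auto
qed simp

lemma m_diff:
  assumes "linear_on X f" "k \<in> carrier X" "x \<in> carrier X" "y \<in> carrier X"
  shows "f (m k x) - f (m k y) = f (m k (vsub X x y))" "f (m x k) - f (m y k) = f (m (vsub X x y) k)"
  using linear_on_vsub[OF m_linear(1)[OF assms(1,2)] assms(3,4)]
    linear_on_vsub[OF m_linear(2)[OF assms(1,2)] assms(3,4)] by simp_all

text \<open>With \<open>S\<close> as the fixed set, hypocontinuity makes \<open>f (m v s)\<close>
  small for all \<open>s\<close> in \<open>S\<close> once \<open>v\<close> is small. A net of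
  \<open>K\<close> for the corresponding neighbourhood therefore serves all \<open>s\<close> at
  once.\<close>

lemma precomp_orbit:
  assumes f: "f \<in> functionals X" and K: "totally_bounded_in X K" and S: "totally_bounded_in X S"
  shows "precomp (\<lambda>k s. f (m k s)) K S"
proof (rule precompI_net)
  fix e :: real assume e: "0 < e"
  have Kc: "K \<subseteq> carrier X" and Sc: "S \<subseteq> carrier X" using K S totally_bounded_subset by auto
  have "{f} \<in> dual_tb X" using finite_functionals_tb[of "{f}"] f by auto
  then obtain G d where G: "G \<in> dual_tb X" "0 < d"
    "\<And>k v f'. k \<in> S \<Longrightarrow> v \<in> carrier X \<Longrightarrow> \<forall>g\<in>G. cmod (g v) \<le> d \<Longrightarrow> f' \<in> {f} \<Longrightarrow> cmod (f' (m k v)) \<le> e \<and> cmod (f' (m v k)) \<le> e"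
    by (rule hypocontinuous_tb[OF S _ e, of "{f}"]) auto
  have "precomp (\<lambda>x f. f x) K G" using K G(1) unfolding totally_bounded_polar by blast
  then obtain N where N: "finite N" "N \<subseteq> K" "\<forall>k\<in>K. \<exists>n\<in>N. \<forall>g\<in>G. cmod (g k - g n) \<le> d"
    using precomp_net G(2) by metis
  have "\<exists>v\<in>(\<lambda>n s. f (m n s)) ` N. \<forall>s\<in>S. cmod (f (m k s) - v s) \<le> e" if k: "k \<in> K" for k
  proof -
    obtain n where n: "n \<in> N" "\<forall>g\<in>G. cmod (g k - g n) \<le> d" using N(3) k by blast
    have c: "k \<in> carrier X" "n \<in> carrier X" using k n(1) N(2) Kc by auto
    have "\<forall>g\<in>G. cmod (g (vsub X k n)) \<le> d"
      using n(2) linear_on_vsub[OF lin[OF G(1)] c] by simp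
    then have "\<forall>s\<in>S. cmod (f (m k s) - f (m n s)) \<le> e"
      using G(3)[of _ "vsub X k n" f] c Sc m_diff(2)[OF functionals_linear[OF f] _ c] by (simp add: subset_iff)
    then show ?thesis unfolding bex_simps using n(1) by (rule bexI)
  qed
  then show "\<exists>N. finite N \<and> (\<forall>k\<in>K. \<exists>v\<in>N. \<forall>s\<in>S. cmod (f (m k s) - v s) \<le> e)"
    using finite_imageI[OF N(1)] by (intro exI[of _ "(\<lambda>n s. f (m n s)) ` N"] conjI ballI)
qed

text \<open>The factor from \<open>S\<close> is replaced by a net point while the other ranges over
  \<open>K\<close>; the factor from \<open>K\<close> is replaced while the other is that net point.
  Each replacement costs \<open>e / 2\<close>, uniformly, by hypocontinuity.\<close>

lemma product_tb:
  assumes K: "totally_bounded_in X K" and S: "totally_bounded_in X S"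
  shows "totally_bounded_in X ((\<lambda>(k, s). m k s) ` (K \<times> S))"
  unfolding totally_bounded_polar
proof (intro conjI ballI)
  have Kc: "K \<subseteq> carrier X" and Sc: "S \<subseteq> carrier X" using K S totally_bounded_subset by auto
  then show "(\<lambda>(k, s). m k s) ` (K \<times> S) \<subseteq> carrier X" by (auto simp: subset_iff)
  fix H assume H: "H \<in> dual_tb X"
  show "precomp (\<lambda>x f. f x) ((\<lambda>(k, s). m k s) ` (K \<times> S)) H"
  proof (rule precompI_net)
    fix e :: real assume e: "0 < e"
    then have e2: "0 < e / 2" by simp
    \<comment> \<open>Both orders of multiplication are estimated, so that the same statement yields
      the nets of \<open>S\<close> and of \<open>K\<close>.\<close>
    have net: "\<exists>N. finite N \<and> N \<subseteq> T \<and> (\<forall>t\<in>T. \<exists>n\<in>N. \<forall>l\<in>L. \<forall>f\<in>H. cmod (f (m l (vsub X t n))) \<le> e / 2 \<and> cmod (f (m (vsub X t n) l)) \<le> e / 2)"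
      if L: "totally_bounded_in X L" and T: "totally_bounded_in X T" for L T
    proof -
      obtain G d where G: "G \<in> dual_tb X" "0 < d"
        "\<And>k v f. k \<in> L \<Longrightarrow> v \<in> carrier X \<Longrightarrow> \<forall>g\<in>G. cmod (g v) \<le> d \<Longrightarrow> f \<in> H \<Longrightarrow> cmod (f (m k v)) \<le> e / 2 \<and> cmod (f (m v k)) \<le> e / 2"
        by (rule hypocontinuous_tb[OF L H e2]) auto
      have Tc: "T \<subseteq> carrier X" by (rule totally_bounded_subset[OF T])
      have "precomp (\<lambda>x f. f x) T G" using T G(1) unfolding totally_bounded_polar by blast
      then obtain N where N: "finite N" "N \<subseteq> T" "\<forall>k\<in>T. \<exists>n\<in>N. \<forall>g\<in>G. cmod (g k - g n) \<le> d"
        using precomp_net G(2) by metis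
      have "\<exists>n\<in>N. \<forall>l\<in>L. \<forall>f\<in>H. cmod (f (m l (vsub X t n))) \<le> e / 2 \<and> cmod (f (m (vsub X t n) l)) \<le> e / 2"
        if t: "t \<in> T" for t
      proof -
        obtain n where n: "n \<in> N" "\<forall>g\<in>G. cmod (g t - g n) \<le> d" using N(3) t by blast
        have c: "t \<in> carrier X" "n \<in> carrier X" using t n(1) N(2) Tc by auto
        have "\<forall>g\<in>G. cmod (g (vsub X t n)) \<le> d" using n(2) linear_on_vsub[OF lin[OF G(1)] c] by simp
        then have "\<forall>l\<in>L. \<forall>f\<in>H. cmod (f (m l (vsub X t n))) \<le> e / 2 \<and> cmod (f (m (vsub X t n) l)) \<le> e / 2"
          using G(3)[of _ "vsub X t n"] c by simp
        then show ?thesis using n(1) by (rule bexI)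
      qed
      then show ?thesis using N(1,2) by blast
    qed
    obtain N where N: "finite N" "N \<subseteq> S"
      "\<forall>t\<in>S. \<exists>n\<in>N. \<forall>l\<in>K. \<forall>f\<in>H. cmod (f (m l (vsub X t n))) \<le> e / 2 \<and> cmod (f (m (vsub X t n) l)) \<le> e / 2"
      using net[OF K S] by (elim exE conjE)
    obtain M where M: "finite M" "M \<subseteq> K"
      "\<forall>t\<in>K. \<exists>n\<in>M. \<forall>l\<in>S. \<forall>f\<in>H. cmod (f (m l (vsub X t n))) \<le> e / 2 \<and> cmod (f (m (vsub X t n) l)) \<le> e / 2"
      using net[OF S K] by (elim exE conjE)
    have "\<exists>v\<in>(\<lambda>p f. f (m (fst p) (snd p))) ` (M \<times> N). \<forall>f\<in>H. cmod (f x - v f) \<le> e"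
      if x: "x \<in> (\<lambda>(k, s). m k s) ` (K \<times> S)" for x
    proof -
      obtain k s where ks: "k \<in> K" "s \<in> S" "x = m k s" using x by auto
      obtain n where n: "n \<in> N" "\<forall>l\<in>K. \<forall>f\<in>H. cmod (f (m l (vsub X s n))) \<le> e / 2 \<and> cmod (f (m (vsub X s n) l)) \<le> e / 2"
        using N(3) ks(2) by blast
      obtain j where j: "j \<in> M" "\<forall>l\<in>S. \<forall>f\<in>H. cmod (f (m l (vsub X k j))) \<le> e / 2 \<and> cmod (f (m (vsub X k j) l)) \<le> e / 2"
        using M(3) ks(1) by blast
      have c: "k \<in> carrier X" "s \<in> carrier X" "n \<in> carrier X" "j \<in> carrier X" "n \<in> S"
        using ks n(1) j(1) N(2) M(2) Kc Sc by auto
      have "cmod (f x - f (m j n)) \<le> e" if f: "f \<in> H" for f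
      proof -
        have 1: "cmod (f (m k s) - f (m k n)) \<le> e / 2"
          using n(2) ks(1) f m_diff(1)[OF lin[OF H f] c(1) c(2,3)] by simp
        have 2: "cmod (f (m k n) - f (m j n)) \<le> e / 2"
          using j(2) c(5) f m_diff(2)[OF lin[OF H f] c(3) c(1,4)] by simp
        show ?thesis
          using norm_triangle_ineq[of "f (m k s) - f (m k n)" "f (m k n) - f (m j n)"] 1 2 ks(3) by simp
      qed
      then have "\<forall>f\<in>H. cmod (f x - f (m (fst (j, n)) (snd (j, n)))) \<le> e" by simp
      moreover have "(j, n) \<in> M \<times> N" using j(1) n(1) by simp
      ultimately show ?thesis unfolding bex_simps by (rule bexI)
    qed
    then show "\<exists>N. finite N \<and> (\<forall>x\<in>(\<lambda>(k, s). m k s) ` (K \<times> S). \<exists>v\<in>N. \<forall>f\<in>H. cmod (f x - v f) \<le> e)"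
      using finite_imageI[OF finite_cartesian_product[OF M(1) N(1)]]
      by (intro exI[of _ "(\<lambda>p f. f (m (fst p) (snd p))) ` (M \<times> N)"] conjI ballI)
  qed
qed

end

section \<open>Limits of stereotype algebras\<close>

lemma precomp_approx:
  assumes "\<And>e. 0 < e \<Longrightarrow> \<exists>v. precomp v S H \<and> (\<forall>s\<in>S. \<forall>f\<in>H. cmod (u s f - v s f) \<le> e)"
  shows "precomp u S H"
proof (rule precompI_net)
  fix e :: real assume e: "0 < e"
  then obtain v where v: "precomp v S H" "\<forall>s\<in>S. \<forall>f\<in>H. cmod (u s f - v s f) \<le> e / 2"
    using assms[of "e / 2"] by auto
  obtain N where N: "finite N" "N \<subseteq> S" "\<forall>s\<in>S. \<exists>n\<in>N. \<forall>f\<in>H. cmod (v s f - v n f) \<le> e / 2"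
    by (rule precomp_net[OF v(1), of "e / 2"]) (use e in simp)
  have "\<exists>w\<in>v ` N. \<forall>f\<in>H. cmod (u s f - w f) \<le> e" if s: "s \<in> S" for s
  proof -
    obtain n where n: "n \<in> N" "\<forall>f\<in>H. cmod (v s f - v n f) \<le> e / 2" using N(3) s by blast
    have "cmod (u s f - v n f) \<le> e" if f: "f \<in> H" for f
      using norm_triangle_ineq[of "u s f - v s f" "v s f - v n f"] bspec[OF n(2) f] bspec[OF bspec[OF v(2) s] f]
      by simp
    then have "\<forall>f\<in>H. cmod (u s f - v n f) \<le> e" by (rule ballI)
    then show ?thesis unfolding bex_simps using n(1) by (rule bexI)
  qed
  then show "\<exists>N. finite N \<and> (\<forall>s\<in>S. \<exists>w\<in>N. \<forall>f\<in>H. cmod (u s f - w f) \<le> e)"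
    using finite_imageI[OF N(1)] by (intro exI[of _ "v ` N"] conjI ballI)
qed

text \<open>The carrier \<open>E\<close> is identified by the maps \<open>h\<close> with a closed subalgebra of the product of the
  algebras \<open>B i\<close>.\<close>

locale ste_limit =
  fixes I :: "'i set" and B :: "'i \<Rightarrow> 'b top_module" and E :: "'e set" and h :: "'i \<Rightarrow> 'e \<Rightarrow> 'b"
  assumes alg: "i \<in> I \<Longrightarrow> stereotype_algebra (B i)"
    and h_closed: "i \<in> I \<Longrightarrow> x \<in> E \<Longrightarrow> h i x \<in> carrier (B i)"
    and h_inj: "x \<in> E \<Longrightarrow> y \<in> E \<Longrightarrow> (\<And>i. i \<in> I \<Longrightarrow> h i x = h i y) \<Longrightarrow> x = y"
    and closed: "closedin (product_topology (\<lambda>i. topol (B i)) I) ((\<lambda>x. \<lambda>i\<in>I. h i x) ` E)"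
    and ex_zero: "\<exists>z\<in>E. \<forall>i\<in>I. h i z = \<zero>\<^bsub>B i\<^esub>"
    and ex_one: "\<exists>z\<in>E. \<forall>i\<in>I. h i z = \<one>\<^bsub>B i\<^esub>"
    and ex_add: "x \<in> E \<Longrightarrow> y \<in> E \<Longrightarrow> \<exists>z\<in>E. \<forall>i\<in>I. h i z = h i x \<oplus>\<^bsub>B i\<^esub> h i y"
    and ex_mult: "x \<in> E \<Longrightarrow> y \<in> E \<Longrightarrow> \<exists>z\<in>E. \<forall>i\<in>I. h i z = h i x \<otimes>\<^bsub>B i\<^esub> h i y"
    and ex_smult: "x \<in> E \<Longrightarrow> \<exists>z\<in>E. \<forall>i\<in>I. h i z = c \<odot>\<^bsub>B i\<^esub> h i x"
begin

text \<open>By \<open>h_inj\<close> an element of \<open>E\<close> is determined by its coordinates,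
  so the choice is unique whenever it is possible.\<close>

definition pick :: "('i \<Rightarrow> 'b) \<Rightarrow> 'e" where
  "pick w = (SOME z. z \<in> E \<and> (\<forall>i\<in>I. h i z = w i))"

lemma pick:
  assumes "\<exists>z\<in>E. \<forall>i\<in>I. h i z = w i"
  shows "pick w \<in> E" "i \<in> I \<Longrightarrow> h i (pick w) = w i"
  using someI_ex[of "\<lambda>z. z \<in> E \<and> (\<forall>i\<in>I. h i z = w i)"] assms unfolding pick_def by auto

text \<open>The algebra before its topology is known. The rules of \<open>F\<close> refer to
  linearity only, and \<open>L\<close> adds the topology that \<open>F\<close> determines.\<close>

definition L0 :: "'e top_module" where
  "L0 = \<lparr>carrier = E, mult = (\<lambda>x y. pick (\<lambda>i. h i x \<otimes>\<^bsub>B i\<^esub> h i y)), one = pick (\<lambda>i. \<one>\<^bsub>B i\<^esub>),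
     zero = pick (\<lambda>i. \<zero>\<^bsub>B i\<^esub>), add = (\<lambda>x y. pick (\<lambda>i. h i x \<oplus>\<^bsub>B i\<^esub> h i y)),
     smult = (\<lambda>c x. pick (\<lambda>i. c \<odot>\<^bsub>B i\<^esub> h i x)), topol = undefined\<rparr>"

text \<open>The totally bounded sets of the coarsest topology that makes all \<open>h i\<close>
  continuous. They can be fixed before \<open>F\<close>, because the refinement of the topology
  preserves them, see \<open>totally_bounded_L\<close>.\<close>

definition TB :: "'e set set" where
  "TB = {S. S \<subseteq> E \<and> (\<forall>i\<in>I. totally_bounded_in (B i) (h i ` S))}"

text \<open>The functionals of the limit. The topology generated by the functionals \<open>f \<circ> h i\<close> alone need
  not be stereotype; the rule \<open>lim\<close> performs the (transfinitely iterated) pseudosaturation.\<close>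

inductive_set F :: "('e \<Rightarrow> complex) set" where
  base: "i \<in> I \<Longrightarrow> f \<in> functionals (B i) \<Longrightarrow> (\<lambda>x\<in>E. f (h i x)) \<in> F"
| comb: "f \<in> F \<Longrightarrow> g \<in> F \<Longrightarrow> (\<lambda>x\<in>E. a * f x + b * g x) \<in> F"
| lim: "\<forall>k. k \<in> H \<longrightarrow> k \<in> F \<Longrightarrow> \<forall>S\<in>TB. precomp (\<lambda>f x. f x) H S \<Longrightarrow> f \<in> extensional E \<Longrightarrow>
    linear_on L0 f \<Longrightarrow> \<forall>x\<in>E. (\<forall>k\<in>H. cmod (k x) \<le> 1) \<longrightarrow> cmod (f x) \<le> 1 \<Longrightarrow> f \<in> F"

text \<open>The prospective totally bounded sets of the dual, with \<open>TB\<close> in the role of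
  the totally bounded sets of \<open>L\<close>; \<open>dual_tb_L\<close> confirms this.\<close>

definition HH :: "('e \<Rightarrow> complex) set set" where
  "HH = {H. H \<subseteq> F \<and> (\<forall>S\<in>TB. precomp (\<lambda>f x. f x) H S)}"

definition L :: "'e top_module" where
  "L = L0\<lparr>topol := polar_topology E HH\<rparr>"

lemma L_simps [simp]:
  "carrier L = E" "carrier L0 = E" "mult L x y = mult L0 x y" "one L = one L0" "zero L = zero L0"
  "add L x y = add L0 x y" "smult L c x = smult L0 c x" "topol L = polar_topology E HH"
  unfolding L_def L0_def by simp_all

lemma linear_on_L0: "linear_on L0 f \<longleftrightarrow> linear_on L f"
  unfolding linear_on_def by simp

lemma zero_L: "zero L0 \<in> E" "i \<in> I \<Longrightarrow> h i (zero L0) = \<zero>\<^bsub>B i\<^esub>"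
  and one_L: "one L0 \<in> E" "i \<in> I \<Longrightarrow> h i (one L0) = \<one>\<^bsub>B i\<^esub>"
  unfolding L0_def using pick[OF ex_zero] pick[OF ex_one] by simp_all

lemma add_L: "x \<in> E \<Longrightarrow> y \<in> E \<Longrightarrow> add L0 x y \<in> E"
    "x \<in> E \<Longrightarrow> y \<in> E \<Longrightarrow> i \<in> I \<Longrightarrow> h i (add L0 x y) = h i x \<oplus>\<^bsub>B i\<^esub> h i y"
  and mult_L: "x \<in> E \<Longrightarrow> y \<in> E \<Longrightarrow> mult L0 x y \<in> E"
    "x \<in> E \<Longrightarrow> y \<in> E \<Longrightarrow> i \<in> I \<Longrightarrow> h i (mult L0 x y) = h i x \<otimes>\<^bsub>B i\<^esub> h i y"
  and smult_L: "x \<in> E \<Longrightarrow> smult L0 c x \<in> E"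
    "x \<in> E \<Longrightarrow> i \<in> I \<Longrightarrow> h i (smult L0 c x) = c \<odot>\<^bsub>B i\<^esub> h i x"
  unfolding L0_def using pick[OF ex_add] pick[OF ex_mult] pick[OF ex_smult] by simp_all

section \<open>The algebraic structure of the limit\<close>

lemma stereo_B: "i \<in> I \<Longrightarrow> stereo (B i)"
  using alg unfolding stereo_def stereotype_algebra_def by simp

lemma module_B: "i \<in> I \<Longrightarrow> module complex_field (B i)"
  using stereo.lcs[OF stereo_B] unfolding locally_convex_space_def by simp

lemma ring_B: "i \<in> I \<Longrightarrow> ring (B i)"
  using alg unfolding stereotype_algebra_def by simp

text \<open>Identities hold coordinatewise and transfer by \<open>h_inj\<close>. Additive inverses
  are multiples by -1, since closure of \<open>E\<close> under negation is obtained from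
  \<open>ex_smult\<close>.\<close>

lemma module_L: "module complex_field L"
proof (rule moduleI)
  note eqI = h_inj
  note simps = add_L smult_L zero_L h_closed
  show "cring complex_field" using field_complex_field by (simp add: field_def domain_def)
  show "abelian_group L"
  proof (rule abelian_groupI)
    fix x y z assume "x \<in> carrier L" "y \<in> carrier L" "z \<in> carrier L"
    then have c: "x \<in> E" "y \<in> E" "z \<in> E" by auto
    show "x \<oplus>\<^bsub>L\<^esub> y \<in> carrier L" using c by (simp add: simps)
    show "x \<oplus>\<^bsub>L\<^esub> y \<oplus>\<^bsub>L\<^esub> z = x \<oplus>\<^bsub>L\<^esub> (y \<oplus>\<^bsub>L\<^esub> z)"
      using c ring.ring_simprules(7)[OF ring_B] by (intro eqI) (simp_all add: simps)
    show "x \<oplus>\<^bsub>L\<^esub> y = y \<oplus>\<^bsub>L\<^esub> x"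
      using c ring.ring_simprules(10)[OF ring_B] by (intro eqI) (simp_all add: simps)
    show "\<zero>\<^bsub>L\<^esub> \<oplus>\<^bsub>L\<^esub> x = x"
      using c ring.ring_simprules(8)[OF ring_B] by (intro eqI) (simp_all add: simps)
    have "((-1) \<odot>\<^bsub>B i\<^esub> v) \<oplus>\<^bsub>B i\<^esub> v = \<zero>\<^bsub>B i\<^esub>" if i: "i \<in> I" and v: "v \<in> carrier (B i)" for i v
    proof -
      interpret cmodule "B i" using module_B[OF i] by (rule cmodule.intro)
      show ?thesis using smult_minus_one[OF v] M.l_neg[OF v] by simp
    qed
    then have "((-1) \<odot>\<^bsub>L\<^esub> x) \<oplus>\<^bsub>L\<^esub> x = \<zero>\<^bsub>L\<^esub>"
      using c by (intro eqI) (simp_all add: simps)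
    then show "\<exists>y\<in>carrier L. y \<oplus>\<^bsub>L\<^esub> x = \<zero>\<^bsub>L\<^esub>"
      using c smult_L(1) by (intro bexI[of _ "(-1) \<odot>\<^bsub>L\<^esub> x"]) simp_all
  qed (simp add: simps)
  fix a b x y assume "x \<in> carrier L" "y \<in> carrier L"
  then have c: "x \<in> E" "y \<in> E" by auto
  show "a \<odot>\<^bsub>L\<^esub> x \<in> carrier L" using c by (simp add: simps)
  show "(a \<oplus>\<^bsub>complex_field\<^esub> b) \<odot>\<^bsub>L\<^esub> x = a \<odot>\<^bsub>L\<^esub> x \<oplus>\<^bsub>L\<^esub> b \<odot>\<^bsub>L\<^esub> x"
    using c module.smult_l_distr[OF module_B] by (intro eqI) (simp_all add: simps)
  show "a \<odot>\<^bsub>L\<^esub> (x \<oplus>\<^bsub>L\<^esub> y) = a \<odot>\<^bsub>L\<^esub> x \<oplus>\<^bsub>L\<^esub> a \<odot>\<^bsub>L\<^esub> y"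
    using c module.smult_r_distr[OF module_B] by (intro eqI) (simp_all add: simps)
  show "(a \<otimes>\<^bsub>complex_field\<^esub> b) \<odot>\<^bsub>L\<^esub> x = a \<odot>\<^bsub>L\<^esub> (b \<odot>\<^bsub>L\<^esub> x)"
    using c module.smult_assoc1[OF module_B] by (intro eqI) (simp_all add: simps)
  show "\<one>\<^bsub>complex_field\<^esub> \<odot>\<^bsub>L\<^esub> x = x"
    using c module.smult_one[OF module_B] by (intro eqI) (simp_all add: simps)
qed

lemma ring_L: "ring L"
proof (rule ringI)
  note simps = add_L mult_L one_L h_closed
  interpret cmodule L using module_L by (rule cmodule.intro)
  show "abelian_group L" by (rule M.abelian_group_axioms)
  show "monoid L"
  proof (rule monoidI)
    fix x y z assume "x \<in> carrier L" "y \<in> carrier L" "z \<in> carrier L"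
    then have c: "x \<in> E" "y \<in> E" "z \<in> E" by auto
    show "x \<otimes>\<^bsub>L\<^esub> y \<in> carrier L" using c by (simp add: simps)
    show "x \<otimes>\<^bsub>L\<^esub> y \<otimes>\<^bsub>L\<^esub> z = x \<otimes>\<^bsub>L\<^esub> (y \<otimes>\<^bsub>L\<^esub> z)"
      using c ring.ring_simprules(11)[OF ring_B] by (intro h_inj) (simp_all add: simps)
    show "\<one>\<^bsub>L\<^esub> \<otimes>\<^bsub>L\<^esub> x = x"
      using c ring.ring_simprules(12)[OF ring_B] by (intro h_inj) (simp_all add: simps)
    show "x \<otimes>\<^bsub>L\<^esub> \<one>\<^bsub>L\<^esub> = x"
      using c monoid.r_one[OF ring.axioms(2)[OF ring_B]] by (intro h_inj) (simp_all add: simps)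
  qed (simp add: simps)
  fix x y z assume "x \<in> carrier L" "y \<in> carrier L" "z \<in> carrier L"
  then have c: "x \<in> E" "y \<in> E" "z \<in> E" by auto
  show "(x \<oplus>\<^bsub>L\<^esub> y) \<otimes>\<^bsub>L\<^esub> z = x \<otimes>\<^bsub>L\<^esub> z \<oplus>\<^bsub>L\<^esub> y \<otimes>\<^bsub>L\<^esub> z"
    using c ring.ring_simprules(13)[OF ring_B] by (intro h_inj) (simp_all add: simps)
  show "z \<otimes>\<^bsub>L\<^esub> (x \<oplus>\<^bsub>L\<^esub> y) = z \<otimes>\<^bsub>L\<^esub> x \<oplus>\<^bsub>L\<^esub> z \<otimes>\<^bsub>L\<^esub> y"
    using c ring.ring_simprules(23)[OF ring_B] by (intro h_inj) (simp_all add: simps)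
qed

section \<open>The functionals of the limit and the topology they define\<close>

lemma F_linear: "f \<in> F \<Longrightarrow> linear_on L f"
  and F_ext: "f \<in> F \<Longrightarrow> f \<in> extensional E"
proof -
  have ext: "f \<in> extensional E" if "f \<in> F" for f
    using that by (cases rule: F.cases) auto
  have "linear_on L f" if "f \<in> F" for f
    using that
  proof induction
    case (base i f)
    then show ?case
      using linear_on_add[OF functionals_linear, of f "B i"] linear_on_smult[OF functionals_linear, of f "B i"]
      unfolding linear_on_def by (simp add: add_L smult_L h_closed )
  next
    case (comb f g a b)
    then show ?case unfolding linear_on_def by (simp add: add_L smult_L algebra_simps)
  next
    case (lim H f)
    then show ?case by (simp add: linear_on_L0)
  qed
  with ext show "f \<in> F \<Longrightarrow> linear_on L f" "f \<in> F \<Longrightarrow> f \<in> extensional E" by blast+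
qed

lemma HH_subset: "H \<in> HH \<Longrightarrow> H \<subseteq> F"
  and HH_precomp: "H \<in> HH \<Longrightarrow> S \<in> TB \<Longrightarrow> precomp (\<lambda>f x. f x) H S"
  unfolding HH_def by blast+

lemma HH_finite: "finite H \<Longrightarrow> H \<subseteq> F \<Longrightarrow> H \<in> HH"
  unfolding HH_def by (simp add: precomp_finite_left)

lemma HH_Un: "H \<in> HH \<Longrightarrow> G \<in> HH \<Longrightarrow> H \<union> G \<in> HH"
  unfolding HH_def by (simp add: precomp_Un_left)

lemma union_closed_HH: "union_closed HH"
  unfolding union_closed_def using HH_finite[of "{}"] HH_Un by auto

lemma HH_UN: "finite J \<Longrightarrow> (\<And>j. j \<in> J \<Longrightarrow> H j \<in> HH) \<Longrightarrow> (\<Union>j\<in>J. H j) \<in> HH"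
proof (induction J rule: finite_induct)
  case empty
  show ?case using HH_finite[of "{}"] by simp
next
  case (insert j J)
  then show ?case using HH_Un[of "H j" "\<Union>j\<in>J. H j"] by simp
qed

sublocale polar_space L HH
proof (rule polar_space.intro[OF cmodule.intro[OF module_L] polar_space_axioms.intro])
  show "topol L = polar_topology (carrier L) HH" by simp
  show "union_closed HH" by (rule union_closed_HH)
  show "linear_on L f" if "H \<in> HH" "f \<in> H" for H f using that HH_subset F_linear by blast
qed

lemma finite_TB: "finite S \<Longrightarrow> S \<subseteq> E \<Longrightarrow> S \<in> TB"
  unfolding TB_def by (auto intro!: stereo.finite_tb[OF stereo_B] h_closed)

lemma TB_subset: "S \<in> TB \<Longrightarrow> S \<subseteq> E"
  unfolding TB_def by blast

lemma TB_Un: "S \<in> TB \<Longrightarrow> T \<in> TB \<Longrightarrow> S \<union> T \<in> TB"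
  unfolding TB_def by (simp add: image_Un totally_bounded_in_Un)

lemma HH_smult:
  assumes H: "H \<in> HH" shows "(\<lambda>k. \<lambda>x\<in>E. a * k x) ` H \<in> HH"
  unfolding HH_def
proof (intro CollectI conjI ballI)
  show "(\<lambda>k. \<lambda>x\<in>E. a * k x) ` H \<subseteq> F"
  proof
    fix f assume "f \<in> (\<lambda>k. \<lambda>x\<in>E. a * k x) ` H"
    then obtain k where k: "k \<in> H" "f = (\<lambda>x\<in>E. a * k x)" by blast
    then have "k \<in> F" using HH_subset[OF H] by blast
    then show "f \<in> F" using comb[of k k a 0] k(2) by simp
  qed
  fix S assume S: "S \<in> TB"
  have SE: "S \<subseteq> E" by (rule TB_subset[OF S])
  have "precomp (\<lambda>f x. a * f x + 0 * f x) H S" by (intro precomp_lincomb HH_precomp H S)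
  then have "precomp (\<lambda>f x. (\<lambda>x\<in>E. a * f x) x) H S"
    by (rule iffD1[OF precomp_cong, rotated]) (use SE in \<open>simp add: subset_iff\<close>)
  then show "precomp (\<lambda>f x. f x) ((\<lambda>k. \<lambda>x\<in>E. a * k x) ` H) S"
    using precomp_image[of "\<lambda>f x. f x" "\<lambda>k. \<lambda>x\<in>E. a * k x" H id S] by simp
qed

lemma functionals_L: "functionals L = F"
proof
  show "F \<subseteq> functionals L"
  proof
    fix f assume f: "f \<in> F"
    have "{f} \<in> HH" using f by (intro HH_finite) auto
    then have "polar_bounded (carrier L) HH f"
      unfolding polar_bounded_def by (intro bexI[of _ "{f}"] exI[of _ 1]) auto
    then show "f \<in> functionals L"
      unfolding functionals_polar using F_linear[OF f] F_ext[OF f] by simp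
  qed
  show "functionals L \<subseteq> F"
  proof
    fix f assume f: "f \<in> functionals L"
    then obtain H e where H: "H \<in> HH" "0 < e" "\<forall>x\<in>E. (\<forall>k\<in>H. cmod (k x) \<le> e) \<longrightarrow> cmod (f x) \<le> 1"
      unfolding functionals_polar polar_bounded_def by auto
    define G where "G = (\<lambda>k. \<lambda>x\<in>E. complex_of_real (1 / e) * k x) ` H"
    have G: "G \<in> HH" unfolding G_def by (rule HH_smult[OF H(1)])
    have "cmod (f x) \<le> 1" if x: "x \<in> E" "\<forall>k\<in>G. cmod (k x) \<le> 1" for x
    proof -
      have "cmod (k x) \<le> e" if k: "k \<in> H" for k
      proof -
        have "cmod ((\<lambda>x\<in>E. complex_of_real (1 / e) * k x) x) \<le> 1" using x(2) k unfolding G_def by blast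
        then show ?thesis using x(1) H(2) by (simp add: norm_mult norm_divide divide_le_eq_1)
      qed
      then show ?thesis using H(3) x(1) by blast
    qed
    then show "f \<in> F"
      using lim[of G f] HH_subset[OF G] HH_precomp[OF G] functionals_ext[OF f] functionals_linear[OF f]
      by (simp add: linear_on_L0 subset_iff)
  qed
qed

text \<open>Neighbourhoods of zero in the factors pull back to neighbourhoods in \<open>L\<close>,
  so the topology of \<open>L\<close> refines the one induced by the product.\<close>

lemma base_HH:
  assumes i: "i \<in> I" and H: "H \<in> dual_tb (B i)"
  shows "(\<lambda>f. \<lambda>x\<in>E. f (h i x)) ` H \<in> HH"
  unfolding HH_def
proof (intro CollectI conjI ballI)
  interpret Bi: stereo "B i" by (rule stereo_B[OF i])
  have H': "H \<subseteq> functionals (B i)" "\<And>S. totally_bounded_in (B i) S \<Longrightarrow> precomp (\<lambda>f x. f x) H S"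
    using H unfolding Bi.dual_tb_iff[OF Bi.ts] by auto
  show "(\<lambda>f. \<lambda>x\<in>E. f (h i x)) ` H \<subseteq> F" using base[OF i] H'(1) by blast
  fix S assume S: "S \<in> TB"
  have "precomp (\<lambda>f x. f x) H (h i ` S)" using S i by (intro H'(2)) (simp add: TB_def)
  then have "precomp (\<lambda>f x. f (h i x)) H S"
    using precomp_image[of "\<lambda>f x. f x" id H "h i" S] by simp
  then have "precomp (\<lambda>f x. (\<lambda>x\<in>E. f (h i x)) x) H S"
    by (rule iffD1[OF precomp_cong, rotated]) (use TB_subset[OF S] in \<open>simp add: subset_iff\<close>)
  then show "precomp (\<lambda>f x. f x) ((\<lambda>f. \<lambda>x\<in>E. f (h i x)) ` H) S"
    using precomp_image[of "\<lambda>f x. f x" "\<lambda>f. \<lambda>x\<in>E. f (h i x)" H id S] by simp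
qed

text \<open>The linear span of the coordinate functionals, without \<open>lim\<close>. Facts that
  reduce to the factors are proved for \<open>F0\<close> and carried over to \<open>F\<close> by
  \<open>F0_dense\<close>.\<close>

inductive_set F0 :: "('e \<Rightarrow> complex) set" where
  zero: "(\<lambda>x\<in>E. 0) \<in> F0"
| base: "i \<in> I \<Longrightarrow> f \<in> functionals (B i) \<Longrightarrow> (\<lambda>x\<in>E. f (h i x)) \<in> F0"
| comb: "f \<in> F0 \<Longrightarrow> g \<in> F0 \<Longrightarrow> (\<lambda>x\<in>E. a * f x + b * g x) \<in> F0"

lemma F0_subset: "f \<in> F0 \<Longrightarrow> f \<in> F"
proof (induction rule: F0.induct)
  case zero
  show ?case using functionals_zero[OF topspace_carrier] unfolding functionals_L L_simps .
next
  case (base i f)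
  then show ?case by (rule F.base)
next
  case (comb f g a b)
  from comb.IH show ?case by (rule F.comb)
qed

lemma F0_bounded: "f \<in> F0 \<Longrightarrow> S \<in> TB \<Longrightarrow> bounded (f ` S)"
proof (induction rule: F0.induct)
  case zero
  show ?case unfolding bounded_iff using TB_subset[OF zero] by (auto intro!: exI[of _ 0])
next
  case (base i f)
  have "bounded (f ` (h i ` S))"
    using stereo.tb_bounded[OF stereo_B[OF base(1)] _ base(2)] base(1,3) unfolding TB_def by blast
  moreover have "(\<lambda>x\<in>E. f (h i x)) ` S = f ` (h i ` S)"
    using TB_subset[OF base(3)] by (auto simp: image_iff subset_iff)
  ultimately show ?case by simp
next
  case (comb f g a b)
  obtain r where r: "\<And>x. x \<in> S \<Longrightarrow> cmod (f x) \<le> r" using comb.IH(1)[OF comb.prems] unfolding bounded_iff by auto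
  obtain q where q: "\<And>x. x \<in> S \<Longrightarrow> cmod (g x) \<le> q" using comb.IH(2)[OF comb.prems] unfolding bounded_iff by auto
  have "cmod (a * f x + b * g x) \<le> cmod a * r + cmod b * q" if x: "x \<in> S" for x
  proof -
    have "cmod (a * f x + b * g x) \<le> cmod a * cmod (f x) + cmod b * cmod (g x)"
      by (metis norm_mult norm_triangle_ineq)
    also have "\<dots> \<le> cmod a * r + cmod b * q" using r[OF x] q[OF x] by (intro add_mono mult_left_mono) auto
    finally show ?thesis .
  qed
  then show ?case
    using TB_subset[OF comb.prems] unfolding bounded_iff by (intro exI[of _ "cmod a * r + cmod b * q"]) auto
qed

lemma F_approx_bounded:
  assumes "S \<in> TB" "f0 \<in> F0" "\<forall>x\<in>S. cmod (f x - f0 x) \<le> 1"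
  shows "bounded (f ` S)"
proof -
  obtain r where r: "\<And>x. x \<in> S \<Longrightarrow> cmod (f0 x) \<le> r"
    using F0_bounded[OF assms(2,1)] unfolding bounded_iff by auto
  have "cmod (f x) \<le> r + 1" if "x \<in> S" for x
    using norm_triangle_sub[of "f x" "f0 x"] r[OF that] bspec[OF assms(3) that] by linarith
  then show ?thesis unfolding bounded_iff by auto
qed

text \<open>The substance is the rule \<open>lim\<close>. A form bounded on the polar of
  \<open>H\<close> varies little where \<open>H\<close> does, so it is controlled by its values at a
  finite net of \<open>Z\<close>. There the bipolar theorem approximates it by the hull of
  \<open>H\<close>, whose members are approximable by induction.\<close>

lemma F0_dense: "f \<in> F \<Longrightarrow> \<forall>Z\<in>TB. \<forall>\<epsilon>>0. \<exists>f0\<in>F0. \<forall>x\<in>Z. cmod (f x - f0 x) \<le> \<epsilon>"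
proof (induction rule: F.induct)
  case (base i f)
  then show ?case using F0.base[OF base] by (intro ballI allI impI bexI[of _ "\<lambda>x\<in>E. f (h i x)"]) auto
next
  case (comb f g a b)
  show ?case
  proof (intro ballI allI impI)
    fix Z and e :: real assume Z: "Z \<in> TB" and e: "0 < e"
    define c where "c = cmod a + cmod b + 1"
    have c: "c > 0" unfolding c_def by (simp add: add_nonneg_pos)
    have ec: "0 < e / c" using e c by simp
    obtain f0 where f0: "f0 \<in> F0" "\<forall>x\<in>Z. cmod (f x - f0 x) \<le> e / c" using comb.IH(1) Z ec by blast
    obtain g0 where g0: "g0 \<in> F0" "\<forall>x\<in>Z. cmod (g x - g0 x) \<le> e / c" using comb.IH(2) Z ec by blast
    have "cmod ((\<lambda>x\<in>E. a * f x + b * g x) x - (\<lambda>x\<in>E. a * f0 x + b * g0 x) x) \<le> e" if x: "x \<in> Z" for x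
    proof -
      have xE: "x \<in> E" using x TB_subset[OF Z] by blast
      have "cmod ((\<lambda>x\<in>E. a * f x + b * g x) x - (\<lambda>x\<in>E. a * f0 x + b * g0 x) x)
          = cmod (a * (f x - f0 x) + b * (g x - g0 x))" using xE by (simp add: algebra_simps)
      also have "\<dots> \<le> cmod a * cmod (f x - f0 x) + cmod b * cmod (g x - g0 x)"
        by (metis norm_mult norm_triangle_ineq)
      also have "\<dots> \<le> cmod a * (e / c) + cmod b * (e / c)"
        using f0(2) g0(2) x by (intro add_mono mult_left_mono) auto
      also have "\<dots> = (cmod a + cmod b) * (e / c)" by (simp add: algebra_simps)
      also have "\<dots> \<le> c * (e / c)" using ec by (intro mult_right_mono) (auto simp: c_def)
      also have "\<dots> = e" using c by simp
      finally show ?thesis .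
    qed
    then show "\<exists>f0\<in>F0. \<forall>x\<in>Z. cmod ((\<lambda>x\<in>E. a * f x + b * g x) x - f0 x) \<le> e"
      using F0.comb[OF f0(1) g0(1)] by (intro bexI[of _ "\<lambda>x\<in>E. a * f0 x + b * g0 x"]) auto
  qed
next
  case (lim H f)
  show ?case
  proof (intro ballI allI impI)
    fix Z and e :: real assume Z: "Z \<in> TB" and e: "0 < e"
    have HF: "H \<subseteq> F" and app: "\<And>k Z e. k \<in> H \<Longrightarrow> Z \<in> TB \<Longrightarrow> 0 < e \<Longrightarrow> \<exists>f0\<in>F0. \<forall>x\<in>Z. cmod (k x - f0 x) \<le> e"
      using lim(1) by blast+
    have ZE: "Z \<subseteq> E" by (rule TB_subset[OF Z])
    have linH: "linear_on L k" if "k \<in> H" for k using HF that F_linear by blast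
    have linf: "linear_on L f" using lim by (simp add: linear_on_L0)
    have bdH: "bounded (k ` Z)" if k: "k \<in> H" for k
      \<comment> \<open>The general boundedness lemma for \<open>F\<close> depends on the density
        being proved here. For members of \<open>H\<close> it is obtained from the induction
        hypothesis, as \<open>precomp_sym\<close> demands it.\<close>
      using app[OF k Z, of 1] F_approx_bounded[OF Z] by auto
    have "precomp (\<lambda>x f. f x) Z H"
      using precomp_sym[of "\<lambda>f x. f x" H Z] lim(2) Z bdH by blast
    then obtain N where N: "finite N" "N \<subseteq> Z" "\<forall>z\<in>Z. \<exists>n\<in>N. \<forall>k\<in>H. cmod (k z - k n) \<le> e / 4"
      using e by (elim precomp_net[of _ _ _ "e / 4"]) auto
    obtain k where k: "k \<in> ach H" "\<And>n. n \<in> N \<Longrightarrow> cmod (f n - k n) \<le> e / 4"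
    proof (rule ach_approximates[OF N(1), of H f "e / 4"])
      fix n assume n: "n \<in> N"
      then have "{n} \<in> TB" using N(2) ZE by (intro finite_TB) auto
      then show "bounded ((\<lambda>k. k n) ` H)"
        using precomp_bounded[of "\<lambda>f x. f x" H "{n}" n] lim(2) by blast
    next
      fix c assume c: "\<And>k. k \<in> H \<Longrightarrow> cmod (\<Sum>j\<in>N. c j * k j) \<le> 1"
      \<comment> \<open>The coefficients become a point of \<open>E\<close>, at which the last
        premise of \<open>lim\<close> applies.\<close>
      obtain x where x: "x \<in> E" "\<forall>f. linear_on L f \<longrightarrow> f x = (\<Sum>j\<in>N. c j * f j)"
        using linear_combination[OF N(1), of "\<lambda>j. j" c] N(2) ZE by auto
      have "\<forall>k\<in>H. cmod (k x) \<le> 1" using c x(2) linH by simp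
      then have "cmod (f x) \<le> 1" using lim(5) x(1) by blast
      then show "cmod (\<Sum>j\<in>N. c j * f j) \<le> 1" using x(2) linf by simp
    qed (use e in auto)
    have "\<exists>f0\<in>F0. \<forall>x\<in>Z. cmod (k x - f0 x) \<le> e / 4"
      using k(1)
    proof (induction rule: ach.induct)
      case zero
      show ?case using F0.zero ZE e by (intro bexI[of _ "\<lambda>x\<in>E. 0"]) auto
    next
      case (base k)
      show ?case using app[OF base Z, of "e / 4"] e by simp
    next
      case (comb k l a b)
      obtain k0 where k0: "k0 \<in> F0" "\<forall>x\<in>Z. cmod (k x - k0 x) \<le> e / 4" using comb.IH(1) by blast
      obtain l0 where l0: "l0 \<in> F0" "\<forall>x\<in>Z. cmod (l x - l0 x) \<le> e / 4" using comb.IH(2) by blast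
      have "cmod (a * k x + b * l x - (\<lambda>x\<in>E. a * k0 x + b * l0 x) x) \<le> e / 4" if x: "x \<in> Z" for x
      proof -
        have xE: "x \<in> E" using x ZE by blast
        have "cmod (a * k x + b * l x - (\<lambda>x\<in>E. a * k0 x + b * l0 x) x)
            = cmod (a * (k x - k0 x) + b * (l x - l0 x))" using xE by (simp add: algebra_simps)
        also have "\<dots> \<le> cmod a * cmod (k x - k0 x) + cmod b * cmod (l x - l0 x)"
          by (metis norm_mult norm_triangle_ineq)
        also have "\<dots> \<le> cmod a * (e / 4) + cmod b * (e / 4)"
          using k0(2) l0(2) x by (intro add_mono mult_left_mono) auto
        also have "\<dots> = (cmod a + cmod b) * (e / 4)" by (simp add: algebra_simps)
        also have "\<dots> \<le> 1 * (e / 4)" using e comb.hyps by (intro mult_right_mono) auto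
        finally show ?thesis by simp
      qed
      then show ?case
        using F0.comb[OF k0(1) l0(1)] by (intro bexI[of _ "\<lambda>x\<in>E. a * k0 x + b * l0 x"]) auto
    qed
    then obtain f0 where f0: "f0 \<in> F0" "\<forall>x\<in>Z. cmod (k x - f0 x) \<le> e / 4" by blast
    \<comment> \<open>Four errors of \<open>e / 4\<close>: moving \<open>f\<close> and moving
      \<open>k\<close> between \<open>z\<close> and the net point \<open>n\<close>, exchanging
      \<open>f\<close> for \<open>k\<close> at \<open>n\<close>, and exchanging \<open>k\<close> for
      \<open>f0\<close> at \<open>z\<close>.\<close>
    have "cmod (f z - f0 z) \<le> e" if z: "z \<in> Z" for z
    proof -
      obtain n where n: "n \<in> N" "\<forall>k\<in>H. cmod (k z - k n) \<le> e / 4" using N(3) z by blast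
      have zn: "z \<in> carrier L" "n \<in> carrier L" using z n(1) N(2) ZE by auto
      have "cmod (f (vsub L z n)) \<le> e / 4"
      proof (rule polar_scale[of H f 1])
        show "\<forall>x\<in>carrier L. (\<forall>h\<in>H. cmod (h x) \<le> 1) \<longrightarrow> cmod (f x) \<le> 1" using lim(5) by simp
        show "\<forall>k\<in>H. cmod (k (vsub L z n)) \<le> 1 * (e / 4)"
          using n(2) linear_on_vsub[OF linH zn] by simp
        show "vsub L z n \<in> carrier L" by (rule vsub_closed[OF zn])
      qed (use linH linf e in auto)
      then have "cmod (f z - f n) \<le> e / 4" using linear_on_vsub[OF linf zn] by simp
      moreover have "cmod (k z - k n) \<le> e / 4"
        using ach_bound_diff[OF k(1), of z n "e / 4"] n(2) e by simp
      moreover have "cmod (f n - k n) \<le> e / 4" by (rule k(2)[OF n(1)])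
      moreover have "cmod (k z - f0 z) \<le> e / 4" using f0(2) z by blast
      moreover have "cmod (f z - k z) \<le> cmod (f z - f n) + cmod (f n - k n) + cmod (k z - k n)"
        by (rule cmod_diff_three)
      moreover have "cmod (f z - f0 z) \<le> cmod (f z - k z) + cmod (k z - f0 z)"
        using norm_triangle_ineq[of "f z - k z" "k z - f0 z"] by simp
      ultimately show ?thesis by linarith
    qed
    then show "\<exists>f0\<in>F0. \<forall>x\<in>Z. cmod (f x - f0 x) \<le> e" using f0(1) by blast
  qed
qed

lemma F_bounded: "f \<in> F \<Longrightarrow> S \<in> TB \<Longrightarrow> bounded (f ` S)"
  using F0_dense[of f] F_approx_bounded[of S _ f] by (metis zero_less_one)

text \<open>Members of \<open>HH\<close> are precompact on \<open>TB\<close> by definition, and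
  symmetry, for which \<open>F_bounded\<close> is required, makes sets of \<open>TB\<close>
  precompact for them. Conversely, testing against the sets of \<open>base_HH\<close> gives total
  boundedness in each factor.\<close>

lemma totally_bounded_L: "totally_bounded_in L S \<longleftrightarrow> S \<in> TB"
proof
  assume S: "S \<in> TB"
  have "precomp (\<lambda>x f. f x) S H" if H: "H \<in> HH" for H
    using precomp_sym[of "\<lambda>f x. f x" H S] HH_precomp[OF H S] F_bounded[OF _ S] HH_subset[OF H] by blast
  then show "totally_bounded_in L S"
    unfolding totally_bounded_polar using TB_subset[OF S] by simp
next
  assume S: "totally_bounded_in L S"
  then have SE: "S \<subseteq> E" and pc: "\<And>H. H \<in> HH \<Longrightarrow> precomp (\<lambda>x f. f x) S H"
    unfolding totally_bounded_polar by auto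
  have "totally_bounded_in (B i) (h i ` S)" if i: "i \<in> I" for i
  proof -
    interpret Bi: stereo "B i" by (rule stereo_B[OF i])
    have "precomp (\<lambda>x f. f x) (h i ` S) H" if H: "H \<in> dual_tb (B i)" for H
    proof -
      have "precomp (\<lambda>x f. f x) S ((\<lambda>f. \<lambda>x\<in>E. f (h i x)) ` H)"
        by (rule pc[OF base_HH[OF i H]])
      then have "precomp (\<lambda>x f. (\<lambda>x\<in>E. f (h i x)) x) S H"
        using precomp_image[of "\<lambda>x f. f x" id S "\<lambda>f. \<lambda>x\<in>E. f (h i x)" H] by simp
      then have "precomp (\<lambda>x f. f (h i x)) S H"
        by (rule iffD1[OF precomp_cong, rotated]) (use SE in \<open>simp add: subset_iff\<close>)
      then show ?thesis using precomp_image[of "\<lambda>x f. f x" "h i" S id H] by simp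
    qed
    then show ?thesis
      unfolding Bi.totally_bounded_polar using SE h_closed[OF i] by auto
  qed
  then show "S \<in> TB" unfolding TB_def using SE by simp
qed

text \<open>This closes the circle: \<open>HH\<close> was defined from \<open>TB\<close>, and
  \<open>TB\<close> has turned out to consist of the totally bounded sets of \<open>L\<close>. So
  the topology of \<open>L\<close> has the form that \<open>stereotype_spaceI\<close>
  demands.\<close>

lemma dual_tb_L: "dual_tb L = HH"
  unfolding set_eq_iff dual_tb_iff[OF topspace_carrier] functionals_L totally_bounded_L
  by (simp add: HH_def Ball_def)

end

section \<open>Reflexivity of the limit\<close>

context ste_limit
begin

lemma dual_L: "polar_space (dual_space L) (evals L)"
  by (rule dual_polar_space[OF topspace_carrier totally_bounded_subset])

text \<open>The argument of \<open>F0_dense\<close> with points and functionals exchanged. At a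
  finite net of \<open>H\<close> the bipolar theorem approximates \<open>g\<close> by the hull of
  the evaluations at \<open>S\<close>, and hull elements act on linear forms as evaluations at
  points of \<open>E\<close>.\<close>

lemma approximate_functional:
  assumes g: "linear_on (dual_space L) g" and S: "S \<in> TB"
    and bd: "\<And>f. f \<in> F \<Longrightarrow> \<forall>s\<in>S. cmod (f s) \<le> 1 \<Longrightarrow> cmod (g f) \<le> 1"
    and H: "H \<in> HH" and d: "0 < \<delta>"
  shows "\<exists>x\<in>E. \<forall>f\<in>H. cmod (f x - g f) \<le> \<delta>"
proof -
  interpret D: polar_space "dual_space L" "evals L" by (rule dual_L)
  have SE: "S \<subseteq> E" by (rule TB_subset[OF S])
  have HF: "H \<subseteq> F" by (rule HH_subset[OF H])
  have ev: "linear_on (dual_space L) (\<lambda>f. f s)" if "s \<in> E" for s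
    using that unfolding linear_on_def by simp
  have d3: "0 < \<delta> / 3" using d by simp
  have gdiff: "cmod (g f - g n) \<le> \<delta> / 3" if fn: "f \<in> F" "n \<in> F" "\<forall>s\<in>S. cmod (f s - n s) \<le> \<delta> / 3" for f n
  proof -
    have c: "f \<in> carrier (dual_space L)" "n \<in> carrier (dual_space L)" using fn functionals_L by auto
    have "cmod (g (vsub (dual_space L) f n)) \<le> \<delta> / 3"
    proof (rule D.polar_scale[of "(\<lambda>x f. f x) ` S" g 1])
      show "linear_on (dual_space L) h" if "h \<in> (\<lambda>x f. f x) ` S" for h
        using that SE ev by blast
      show "\<forall>x\<in>carrier (dual_space L). (\<forall>h\<in>(\<lambda>x f. f x) ` S. cmod (h x) \<le> 1) \<longrightarrow> cmod (g x) \<le> 1"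
        using bd by (simp add: functionals_L)
      show "vsub (dual_space L) f n \<in> carrier (dual_space L)" by (rule D.vsub_closed[OF c])
      show "\<forall>h\<in>(\<lambda>x f. f x) ` S. cmod (h (vsub (dual_space L) f n)) \<le> 1 * (\<delta> / 3)"
        using fn(3) SE by (auto simp: vsub_dual subset_iff)
    qed (rule g, rule d3)
    then show ?thesis using D.linear_on_vsub[OF g c] by simp
  qed
  obtain N where N: "finite N" "N \<subseteq> H" "\<forall>f\<in>H. \<exists>n\<in>N. \<forall>s\<in>S. cmod (f s - n s) \<le> \<delta> / 3"
    by (rule precomp_net[OF HH_precomp[OF H S] d3])
  let ?S = "(\<lambda>s f. f s) ` S"
  obtain k where k: "k \<in> ach ?S" "\<And>n. n \<in> N \<Longrightarrow> cmod (g n - k n) \<le> \<delta> / 3"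
  proof (rule ach_approximates[OF N(1), of ?S g "\<delta> / 3"])
    fix n assume "n \<in> N"
    then have "bounded (n ` S)" using N(2) HF F_bounded[OF _ S] by blast
    then show "bounded ((\<lambda>k. k n) ` ?S)" by (simp add: image_image)
  next
    fix c assume c: "\<And>k. k \<in> ?S \<Longrightarrow> cmod (\<Sum>j\<in>N. c j * k j) \<le> 1"
    \<comment> \<open>The coefficients now become a functional \<open>u\<close>, bounded by 1 on
      \<open>S\<close>, to which \<open>bd\<close> applies.\<close>
    obtain u where u: "u \<in> F" "\<forall>q. linear_on (dual_space L) q \<longrightarrow> q u = (\<Sum>j\<in>N. c j * q j)"
      using D.linear_combination[OF N(1), of "\<lambda>j. j" c] N(2) HF functionals_L by auto
    have "cmod (u s) \<le> 1" if s: "s \<in> S" for s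
    proof -
      have "u s = (\<Sum>j\<in>N. c j * j s)" using u(2) ev[of s] s SE by blast
      then show ?thesis using c[of "\<lambda>f. f s"] s by auto
    qed
    then have "cmod (g u) \<le> 1" using bd[OF u(1)] by blast
    then show "cmod (\<Sum>j\<in>N. c j * g j) \<le> 1" using u(2) g by simp
  qed (use d3 in auto)
  have "\<exists>x\<in>E. \<forall>f. linear_on L f \<longrightarrow> k f = f x"
    using k(1)
  proof (induction rule: ach.induct)
    case zero
    show ?case using linear_on_zero M.zero_closed by (intro bexI[of _ "\<zero>\<^bsub>L\<^esub>"]) auto
  next
    case (base k)
    then show ?case using SE by auto
  next
    case (comb k l a b)
    obtain x y where xy: "x \<in> E" "\<forall>f. linear_on L f \<longrightarrow> k f = f x" "y \<in> E" "\<forall>f. linear_on L f \<longrightarrow> l f = f y"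
      using comb.IH by blast
    have c: "smult L a x \<in> carrier L" "smult L b y \<in> carrier L" using xy smult_L(1) by simp_all
    have "a * k f + b * l f = f (add L (smult L a x) (smult L b y))" if f: "linear_on L f" for f
      using linear_on_add[OF f c] linear_on_smult[OF f, of x a] linear_on_smult[OF f, of y b] xy f by simp
    then show ?case using M.a_closed[OF c] by (intro bexI[of _ "add L (smult L a x) (smult L b y)"]) auto
  qed
  then obtain x where x: "x \<in> E" "\<forall>f. linear_on L f \<longrightarrow> k f = f x" by blast
  have "cmod (f x - g f) \<le> \<delta>" if f: "f \<in> H" for f
  proof -
    obtain n where n: "n \<in> N" "\<forall>s\<in>S. cmod (f s - n s) \<le> \<delta> / 3" using N(3) f by blast
    have F: "f \<in> F" "n \<in> F" using f n N(2) HF by auto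
    have "cmod (k f - k n) \<le> \<delta> / 3"
      using ach_bound_diff[OF k(1), of f n "\<delta> / 3"] n(2) d3 by auto
    moreover have "cmod (g n - k n) \<le> \<delta> / 3" by (rule k(2)[OF n(1)])
    moreover have "cmod (g f - g n) \<le> \<delta> / 3" by (rule gdiff[OF F n(2)])
    moreover have "cmod (k f - g f) \<le> cmod (k f - k n) + cmod (k n - g n) + cmod (g f - g n)"
      by (rule cmod_diff_three)
    ultimately show ?thesis using x(2) F_linear[OF F(1)] by (simp add: norm_minus_commute)
  qed
  then show ?thesis using x(1) by blast
qed

text \<open>Reflexivity of the factors gives the coordinates \<open>b i\<close> of the desired
  point. By \<open>approximate_functional\<close> this family is a limit of images of points of
  \<open>E\<close>, so closedness yields \<open>x\<close>. The identity holds on \<open>F0\<close>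
  by linearity and extends to \<open>F\<close> by density.\<close>

lemma bidual_L:
  assumes g: "g \<in> functionals (dual_space L)"
  shows "\<exists>x\<in>E. \<forall>f\<in>F. g f = f x"
proof -
  interpret D: polar_space "dual_space L" "evals L" by (rule dual_L)
  have gl: "linear_on (dual_space L) g" by (rule functionals_linear[OF g])
  obtain S where S: "S \<in> TB" "\<forall>f\<in>F. (\<forall>s\<in>S. cmod (f s) \<le> 1) \<longrightarrow> cmod (g f) \<le> 1"
    using dual_functional_bounded[OF g] unfolding totally_bounded_L functionals_L by blast
  have SE: "S \<subseteq> E" by (rule TB_subset[OF S(1)])
  have "\<exists>b\<in>carrier (B i). \<forall>f\<in>functionals (B i). g (\<lambda>x\<in>E. f (h i x)) = f b" if i: "i \<in> I" for i
  proof -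
    interpret Bi: stereo "B i" by (rule stereo_B[OF i])
    have fb: "(\<lambda>x\<in>E. f (h i x)) \<in> F" if "f \<in> functionals (B i)" for f using F.base[OF i that] .
    show ?thesis
    proof (rule Bi.bidual_surj[of "h i ` S"])
      show "totally_bounded_in (B i) (h i ` S)" using S(1) i unfolding TB_def by blast
      show "linear_on (dual_space (B i)) (\<lambda>f. g (\<lambda>x\<in>E. f (h i x)))"
        unfolding linear_on_def dual_space_simps(1)
      proof (intro conjI ballI allI)
        fix f f' and c :: complex
        assume f: "f \<in> functionals (B i)"
        have "(\<lambda>x\<in>E. (c \<odot>\<^bsub>dual_space (B i)\<^esub> f) (h i x)) = c \<odot>\<^bsub>dual_space L\<^esub> (\<lambda>x\<in>E. f (h i x))"
          using h_closed[OF i] by (auto simp: fun_eq_iff)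
        then show "g (\<lambda>x\<in>E. (c \<odot>\<^bsub>dual_space (B i)\<^esub> f) (h i x)) = c * g (\<lambda>x\<in>E. f (h i x))"
          using linear_on_smult[OF gl, of "\<lambda>x\<in>E. f (h i x)" c] fb[OF f] functionals_L by simp
        assume f': "f' \<in> functionals (B i)"
        have "(\<lambda>x\<in>E. (f \<oplus>\<^bsub>dual_space (B i)\<^esub> f') (h i x)) =
            (\<lambda>x\<in>E. f (h i x)) \<oplus>\<^bsub>dual_space L\<^esub> (\<lambda>x\<in>E. f' (h i x))"
          using h_closed[OF i] by (auto simp: fun_eq_iff)
        then show "g (\<lambda>x\<in>E. (f \<oplus>\<^bsub>dual_space (B i)\<^esub> f') (h i x)) = g (\<lambda>x\<in>E. f (h i x)) + g (\<lambda>x\<in>E. f' (h i x))"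
          using linear_on_add[OF gl, of "\<lambda>x\<in>E. f (h i x)" "\<lambda>x\<in>E. f' (h i x)"] fb[OF f] fb[OF f'] functionals_L by simp
      qed
      fix f assume f: "f \<in> functionals (B i)" "\<forall>s\<in>h i ` S. cmod (f s) \<le> 1"
      then have "\<forall>s\<in>S. cmod ((\<lambda>x\<in>E. f (h i x)) s) \<le> 1" using SE by (auto simp: subset_iff)
      then show "cmod (g (\<lambda>x\<in>E. f (h i x))) \<le> 1" using S(2) fb[OF f(1)] by blast
    qed
  qed
  then obtain b where b: "\<And>i. i \<in> I \<Longrightarrow> b i \<in> carrier (B i)"
    "\<And>i f. i \<in> I \<Longrightarrow> f \<in> functionals (B i) \<Longrightarrow> g (\<lambda>x\<in>E. f (h i x)) = f (b i)" by metis
  let ?P = "product_topology (\<lambda>i. topol (B i)) I" and ?im = "(\<lambda>x. \<lambda>i\<in>I. h i x) ` E"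
  have tsB: "topspace (topol (B i)) = carrier (B i)" if "i \<in> I" for i using stereo.ts[OF stereo_B[OF that]] .
  have bP: "(\<lambda>i\<in>I. b i) \<in> topspace ?P" using b(1) tsB by simp
  have "(\<lambda>i\<in>I. b i) \<in> ?im"
  proof (rule ccontr)
    assume "(\<lambda>i\<in>I. b i) \<notin> ?im"
    then have "openin ?P (topspace ?P - ?im)" "(\<lambda>i\<in>I. b i) \<in> topspace ?P - ?im"
      using closed bP by (auto simp: closedin_def)
    \<comment> \<open>A family outside the closed image has a basic neighbourhood that misses it.
      Since that neighbourhood restricts finitely many coordinates, one set in \<open>HH\<close>
      describes it.\<close>
    then obtain U where U: "finite {i\<in>I. U i \<noteq> topspace (topol (B i))}" "\<forall>i\<in>I. openin (topol (B i)) (U i)"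
      "(\<lambda>i\<in>I. b i) \<in> PiE I U" "PiE I U \<subseteq> topspace ?P - ?im"
      unfolding openin_product_topology_alt by meson
    define J where "J = {i\<in>I. U i \<noteq> topspace (topol (B i))}"
    have J: "finite J" "J \<subseteq> I" using U(1) unfolding J_def by auto
    have "\<exists>H\<in>dual_tb (B j). \<exists>e>0. polar_ball (carrier (B j)) H e (b j) \<subseteq> U j" if j: "j \<in> J" for j
    proof -
      have jI: "j \<in> I" using j J by blast
      interpret Bj: stereo "B j" by (rule stereo_B[OF jI])
      have "b j \<in> U j" using PiE_mem[OF U(3) jI] jI by simp
      moreover have "openin (topol (B j)) (U j)" using U(2) jI by blast
      ultimately show ?thesis unfolding Bj.openin_iff by blast
    qed
    then obtain H e where He: "\<And>j. j \<in> J \<Longrightarrow> H j \<in> dual_tb (B j)" "\<And>j. j \<in> J \<Longrightarrow> 0 < e j"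
      "\<And>j. j \<in> J \<Longrightarrow> polar_ball (carrier (B j)) (H j) (e j) (b j) \<subseteq> U j" by metis
    \<comment> \<open>The inserted 1 keeps the minimum defined and positive when \<open>J\<close> is
      empty.\<close>
    define d where "d = Min (insert 1 (e ` J))"
    have d: "0 < d" "\<And>j. j \<in> J \<Longrightarrow> d \<le> e j" unfolding d_def using J(1) He(2) by (auto simp: Min_gr_iff)
    let ?G = "\<lambda>j. (\<lambda>f. \<lambda>x\<in>E. f (h j x)) ` H j"
    have "(\<Union>j\<in>J. ?G j) \<in> HH" using J He(1) by (intro HH_UN base_HH) auto
    then obtain x where x: "x \<in> E" "\<forall>f\<in>(\<Union>j\<in>J. ?G j). cmod (f x - g f) \<le> d"
      using approximate_functional[OF gl S(1) _ _ d(1)] S(2) by blast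
    have "h i x \<in> U i" if i: "i \<in> I" for i
    proof (cases "i \<in> J")
      case True
      have "cmod (f (h i x) - f (b i)) \<le> e i" if f: "f \<in> H i" for f
      proof -
        have fF: "f \<in> functionals (B i)"
          using stereo.dual_tb_functionals[OF stereo_B[OF i] He(1)[OF True] f] .
        have "cmod ((\<lambda>x\<in>E. f (h i x)) x - g (\<lambda>x\<in>E. f (h i x))) \<le> d" using x(2) True f by blast
        then show ?thesis using b(2)[OF i fF] x(1) d(2)[OF True] by simp
      qed
      then have "h i x \<in> polar_ball (carrier (B i)) (H i) (e i) (b i)"
        unfolding polar_ball_def using h_closed[OF i x(1)] by simp
      then show ?thesis using He(3)[OF True] by blast
    next
      case False
      then have "U i = carrier (B i)" using i tsB unfolding J_def by auto
      then show ?thesis using h_closed[OF i x(1)] by simp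
    qed
    then have "(\<lambda>i\<in>I. h i x) \<in> PiE I U" by simp
    then show False using U(4) x(1) by blast
  qed
  then obtain x where x: "x \<in> E" "(\<lambda>i\<in>I. b i) = (\<lambda>i\<in>I. h i x)" by blast
  have bx: "b i = h i x" if "i \<in> I" for i using fun_cong[OF x(2), of i] that by simp
  have gF0: "g f = f x" if "f \<in> F0" for f
    using that
  proof (induction rule: F0.induct)
    case zero
    have "g (\<lambda>x\<in>E. 0) = 0" using D.linear_on_zero[OF gl] unfolding dual_space_simps L_simps .
    moreover have "(\<lambda>x\<in>E. 0 :: complex) x = 0" using x(1) by simp
    ultimately show ?case by (rule trans[OF _ sym])
  next
    case (base i f)
    have "f (b i) = (\<lambda>x\<in>E. f (h i x)) x" using bx[OF base(1)] x(1) by simp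
    with b(2)[OF base] show ?case by (rule trans)
  next
    case (comb f f' a c)
    have c: "f \<in> carrier (dual_space L)" "f' \<in> carrier (dual_space L)"
      using comb.hyps F0_subset functionals_L by auto
    have "(\<lambda>x\<in>E. a * f x + c * f' x) = (a \<odot>\<^bsub>dual_space L\<^esub> f) \<oplus>\<^bsub>dual_space L\<^esub> (c \<odot>\<^bsub>dual_space L\<^esub> f')"
      by auto
    then have g1: "g (\<lambda>x\<in>E. a * f x + c * f' x) = a * g f + c * g f'"
      using linear_on_add[OF gl D.csmult_closed[OF c(1), of a] D.csmult_closed[OF c(2), of c]]
        linear_on_smult[OF gl c(1), of a] linear_on_smult[OF gl c(2), of c] by metis
    have "a * g f + c * g f' = (\<lambda>x\<in>E. a * f x + c * f' x) x" using comb.IH x(1) by simp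
    with g1 show ?case by (rule trans)
  qed
  have "g f = f x" if f: "f \<in> F" for f
  proof -
    \<comment> \<open>The approximation is required on \<open>S\<close>, where it controls
      \<open>g\<close>, and at \<open>x\<close>, where it controls the evaluation.\<close>
    have Z: "insert x S \<in> TB" using TB_Un[OF finite_TB[of "{x}"] S(1)] x(1) by simp
    have "cmod (g f - f x) \<le> 0 + e" if e: "0 < e" for e
    proof -
      have e2: "0 < e / 2" using e by simp
      obtain f0 where f0: "f0 \<in> F0" "\<forall>z\<in>insert x S. cmod (f z - f0 z) \<le> e / 2"
        using F0_dense[OF f] Z e2 by meson
      have c: "f \<in> carrier (dual_space L)" "f0 \<in> carrier (dual_space L)"
        using f F0_subset[OF f0(1)] functionals_L by auto
      have "cmod (g (vsub (dual_space L) f f0)) \<le> e / 2"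
      proof (rule D.polar_scale[of "(\<lambda>x f. f x) ` S" g 1])
        show "linear_on (dual_space L) h" if "h \<in> (\<lambda>x f. f x) ` S" for h
          using that SE unfolding linear_on_def by auto
        show "\<forall>x\<in>carrier (dual_space L). (\<forall>h\<in>(\<lambda>x f. f x) ` S. cmod (h x) \<le> 1) \<longrightarrow> cmod (g x) \<le> 1"
          using S(2) by (simp add: functionals_L)
        show "vsub (dual_space L) f f0 \<in> carrier (dual_space L)" by (rule D.vsub_closed[OF c])
        show "\<forall>h\<in>(\<lambda>x f. f x) ` S. cmod (h (vsub (dual_space L) f f0)) \<le> 1 * (e / 2)"
          using f0(2) SE by (auto simp: vsub_dual subset_iff)
      qed (rule gl, rule e2)
      then have "cmod (g f - f0 x) \<le> e / 2" using D.linear_on_vsub[OF gl c] gF0[OF f0(1)] by simp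
      moreover have "cmod (f x - f0 x) \<le> e / 2" using f0(2) by blast
      ultimately show ?thesis using norm_triangle_ineq4[of "g f - f0 x" "f x - f0 x"] by simp
    qed
    then have "cmod (g f - f x) \<le> 0" by (rule field_le_epsilon)
    then show ?thesis by simp
  qed
  then show ?thesis using x(1) by blast
qed

lemma stereotype_space_L: "stereotype_space L"
proof (rule stereotype_spaceI)
  show "polar_space L (dual_tb L)" unfolding dual_tb_L by (rule polar_space_axioms)
  show "x = y" if xy: "x \<in> carrier L" "y \<in> carrier L" "\<And>f. f \<in> functionals L \<Longrightarrow> f x = f y" for x y
  proof (rule h_inj)
    show "x \<in> E" "y \<in> E" using xy by auto
    fix i assume i: "i \<in> I"
    show "h i x = h i y"
    proof (rule stereo.separation[OF stereo_B[OF i]])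
      show "h i x \<in> carrier (B i)" "h i y \<in> carrier (B i)" using h_closed[OF i] xy by auto
      fix f assume "f \<in> functionals (B i)"
      then show "f (h i x) = f (h i y)"
        using xy(3)[of "\<lambda>x\<in>E. f (h i x)"] F.base[OF i] xy(1,2) functionals_L by simp
    qed
  qed
  show "\<exists>x\<in>carrier L. \<forall>f\<in>functionals L. g f = f x" if "g \<in> functionals (dual_space L)" for g
    using bidual_L[OF that] by (simp add: functionals_L)
qed

section \<open>The universal property of the limit\<close>

lemma continuous_map_h:
  assumes i: "i \<in> I" shows "continuous_map (topol L) (topol (B i)) (h i)"
proof -
  interpret Bi: stereo "B i" by (rule stereo_B[OF i])
  show ?thesis
  proof (rule Bi.continuous_map_into)
    show "h i x \<in> carrier (B i)" if "x \<in> topspace (topol L)" for x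
      using that h_closed[OF i] unfolding topspace_carrier by simp
    fix x H and e :: real
    assume "x \<in> topspace (topol L)" and H: "H \<in> dual_tb (B i)" and e: "0 < e"
    then have x: "x \<in> E" unfolding topspace_carrier by simp
    obtain W where W: "openin (polar_topology E HH) W" "x \<in> W"
        "W \<subseteq> polar_ball E ((\<lambda>f. \<lambda>x\<in>E. f (h i x)) ` H) e x"
      using polar_ball_nbhd[OF uc base_HH[OF i H] x e] by blast
    have "cmod (f (h i y) - f (h i x)) \<le> e" if y: "y \<in> W" and f: "f \<in> H" for y f
    proof -
      have "y \<in> E" "cmod ((\<lambda>x\<in>E. f (h i x)) y - (\<lambda>x\<in>E. f (h i x)) x) \<le> e"
        using W(3) y f unfolding polar_ball_def by blast+
      then show ?thesis using x by simp
    qed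
    then show "\<exists>W. openin (topol L) W \<and> x \<in> W \<and> (\<forall>y\<in>W. \<forall>f\<in>H. cmod (f (h i y) - f (h i x)) \<le> e)"
      using W(1,2) by (intro exI[of _ W]) simp
  qed
qed

text \<open>Continuity into each factor suffices for the refined topology because \<open>D\<close>
  is stereotype. By induction on \<open>F\<close>, functionals pull back to functionals of
  \<open>D\<close>; then members of \<open>HH\<close> pull back into \<open>dual_tb D\<close>, whose
  polars are neighbourhoods of zero.\<close>

lemma continuous_map_universal:
  assumes D: "stereotype_space D" and p: "\<And>x. x \<in> carrier D \<Longrightarrow> \<psi> x \<in> E"
    and add: "\<And>i x y. i \<in> I \<Longrightarrow> x \<in> carrier D \<Longrightarrow> y \<in> carrier D \<Longrightarrow>
      h i (\<psi> (x \<oplus>\<^bsub>D\<^esub> y)) = h i (\<psi> x) \<oplus>\<^bsub>B i\<^esub> h i (\<psi> y)"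
    and smult: "\<And>i c x. i \<in> I \<Longrightarrow> x \<in> carrier D \<Longrightarrow> h i (\<psi> (c \<odot>\<^bsub>D\<^esub> x)) = c \<odot>\<^bsub>B i\<^esub> h i (\<psi> x)"
    and cont: "\<And>i. i \<in> I \<Longrightarrow> continuous_map (topol D) (topol (B i)) (\<lambda>x. h i (\<psi> x))"
  shows "continuous_map (topol D) (topol L) \<psi>"
proof -
  interpret D: stereo D using D by (rule stereo.intro)
  have padd: "\<psi> (x \<oplus>\<^bsub>D\<^esub> y) = \<psi> x \<oplus>\<^bsub>L\<^esub> \<psi> y" if "x \<in> carrier D" "y \<in> carrier D" for x y
    using that by (intro h_inj) (simp_all add: p add add_L D.M.a_closed)
  have psmult: "\<psi> (c \<odot>\<^bsub>D\<^esub> x) = c \<odot>\<^bsub>L\<^esub> \<psi> x" if "x \<in> carrier D" for x c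
    using that by (intro h_inj) (simp_all add: p smult smult_L)
  have plin: "linear_on D (\<lambda>x\<in>carrier D. f (\<psi> x))" if f: "linear_on L f" for f
    using linear_on_add[OF f] linear_on_smult[OF f] p unfolding linear_on_def by (simp add: padd psmult)
  have tb: "\<psi> ` S \<in> TB" if S: "totally_bounded_in D S" for S
    unfolding TB_def
  proof (intro CollectI conjI ballI)
    have Sc: "S \<subseteq> carrier D" by (rule totally_bounded_subset[OF S])
    then show "\<psi> ` S \<subseteq> E" using p by blast
    fix i assume i: "i \<in> I"
    interpret Bi: stereo "B i" by (rule stereo_B[OF i])
    \<comment> \<open>A compact hull is used because continuous maps preserve compactness.\<close>
    obtain K where K: "compactin (topol D) K" "S \<subseteq> K" using D.totally_bounded_compact[OF S] by blast
    have "compactin (topol (B i)) ((\<lambda>x. h i (\<psi> x)) ` K)" by (rule image_compactin[OF K(1) cont[OF i]])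
    then have "totally_bounded_in (B i) ((\<lambda>x. h i (\<psi> x)) ` K)" by (rule Bi.compactin_totally_bounded)
    moreover have "h i ` \<psi> ` S \<subseteq> (\<lambda>x. h i (\<psi> x)) ` K" using K(2) by blast
    ultimately show "totally_bounded_in (B i) (h i ` \<psi> ` S)"
      unfolding totally_bounded_in_def by (meson order_trans)
  qed
  have dtb: "(\<lambda>f. \<lambda>x\<in>carrier D. f (\<psi> x)) ` H \<in> dual_tb D"
    if H: "\<forall>f\<in>H. (\<lambda>x\<in>carrier D. f (\<psi> x)) \<in> functionals D" "\<forall>S\<in>TB. precomp (\<lambda>f x. f x) H S" for H
    unfolding D.dual_tb_iff[OF D.ts]
  proof (intro conjI allI impI)
    show "(\<lambda>f. \<lambda>x\<in>carrier D. f (\<psi> x)) ` H \<subseteq> functionals D" using H(1) by blast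
    fix S assume S: "totally_bounded_in D S"
    have Sc: "S \<subseteq> carrier D" by (rule totally_bounded_subset[OF S])
    have "precomp (\<lambda>f x. f x) H (\<psi> ` S)" using H(2) tb[OF S] by blast
    then have "precomp (\<lambda>f x. f (\<psi> x)) H S"
      using precomp_image[of "\<lambda>f x. f x" id H \<psi> S] by simp
    then have "precomp (\<lambda>f x. (\<lambda>x\<in>carrier D. f (\<psi> x)) x) H S"
      by (rule iffD1[OF precomp_cong, rotated]) (use Sc in \<open>simp add: subset_iff\<close>)
    then show "precomp (\<lambda>f x. f x) ((\<lambda>f. \<lambda>x\<in>carrier D. f (\<psi> x)) ` H) S"
      using precomp_image[of "\<lambda>f x. f x" "\<lambda>f. \<lambda>x\<in>carrier D. f (\<psi> x)" H id S] by simp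
  qed
  have pF: "(\<lambda>x\<in>carrier D. f (\<psi> x)) \<in> functionals D" if f: "f \<in> F" for f
    using f
  proof (induction rule: F.induct)
    case (base i f)
    have l: "linear_on D (\<lambda>x\<in>carrier D. (\<lambda>x\<in>E. f (h i x)) (\<psi> x))" by (rule plin[OF F_linear[OF F.base[OF base]]])
    have "continuous_map (topol D) euclidean (f \<circ> (\<lambda>x. h i (\<psi> x)))"
      using base unfolding functionals_iff by (intro continuous_map_compose[OF cont]) auto
    then have "continuous_map (topol D) euclidean (\<lambda>x\<in>carrier D. (\<lambda>x\<in>E. f (h i x)) (\<psi> x))"
      by (rule continuous_map_eq) (simp add: D.ts p)
    then show ?case unfolding functionals_iff using l by simp
  next
    case (comb f g a b)
    have "(\<lambda>x\<in>carrier D. (\<lambda>x\<in>E. a * f x + b * g x) (\<psi> x)) =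
      (\<lambda>x\<in>carrier D. a * (\<lambda>x\<in>carrier D. f (\<psi> x)) x + b * (\<lambda>x\<in>carrier D. g (\<psi> x)) x)"
      using p by (auto simp: fun_eq_iff)
    then show ?case using D.functionals_lincomb[OF D.ts comb.IH, of a b] by (simp only:)
  next
    case (lim H f)
    \<comment> \<open>The pulled back set lies in \<open>dual_tb D\<close>, so the pulled back form
      is bounded on a neighbourhood of zero of \<open>D\<close>.\<close>
    have G: "(\<lambda>f. \<lambda>x\<in>carrier D. f (\<psi> x)) ` H \<in> dual_tb D" by (rule dtb) (use lim(1,2) in blast)+
    have "polar_bounded (carrier D) (dual_tb D) (\<lambda>x\<in>carrier D. f (\<psi> x))"
      unfolding polar_bounded_def
    proof (intro bexI[OF _ G] exI[of _ 1] conjI ballI impI)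
      fix x assume x: "x \<in> carrier D" and k: "\<forall>k\<in>(\<lambda>f. \<lambda>x\<in>carrier D. f (\<psi> x)) ` H. cmod (k x) \<le> 1"
      have "\<forall>k\<in>H. cmod (k (\<psi> x)) \<le> 1" using k x by auto
      then show "cmod ((\<lambda>x\<in>carrier D. f (\<psi> x)) x) \<le> 1" using lim(5) p[OF x] x by simp
    qed simp
    moreover have "linear_on D (\<lambda>x\<in>carrier D. f (\<psi> x))" using lim(4) by (intro plin) (simp add: linear_on_L0)
    ultimately show ?case unfolding D.functionals_polar by simp
  qed
  show ?thesis
  proof (rule continuous_map_into, unfold D.ts)
    fix x H and e :: real assume x: "x \<in> carrier D" and H: "H \<in> HH" and e: "0 < e"
    have G: "(\<lambda>f. \<lambda>x\<in>carrier D. f (\<psi> x)) ` H \<in> dual_tb D"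
      using HH_subset[OF H] HH_precomp[OF H] pF by (intro dtb) auto
    obtain W where W: "openin (topol D) W" "x \<in> W"
        "W \<subseteq> polar_ball (carrier D) ((\<lambda>f. \<lambda>x\<in>carrier D. f (\<psi> x)) ` H) e x"
      using polar_ball_nbhd[OF D.uc G x e] D.top by metis
    have "cmod (f (\<psi> y) - f (\<psi> x)) \<le> e" if y: "y \<in> W" and f: "f \<in> H" for y f
    proof -
      have "y \<in> carrier D" "cmod ((\<lambda>x\<in>carrier D. f (\<psi> x)) y - (\<lambda>x\<in>carrier D. f (\<psi> x)) x) \<le> e"
        using W(3) y f unfolding polar_ball_def by blast+
      then show ?thesis using x by simp
    qed
    then show "\<exists>W. openin (topol D) W \<and> x \<in> W \<and> (\<forall>y\<in>W. \<forall>f\<in>H. cmod (f (\<psi> y) - f (\<psi> x)) \<le> e)"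
      using W(1,2) by blast
  qed (simp add: p)
qed

end

section \<open>Bilinear operations on the limit\<close>

locale ste_limit_op = ste_limit I B E h
  for I :: "'i set" and B :: "'i \<Rightarrow> 'b top_module" and E :: "'e set" and h +
  fixes m :: "'e \<Rightarrow> 'e \<Rightarrow> 'e" and n :: "'i \<Rightarrow> 'b \<Rightarrow> 'b \<Rightarrow> 'b"
  assumes m_closed: "x \<in> E \<Longrightarrow> y \<in> E \<Longrightarrow> m x y \<in> E"
    and m_h: "i \<in> I \<Longrightarrow> x \<in> E \<Longrightarrow> y \<in> E \<Longrightarrow> h i (m x y) = n i (h i x) (h i y)"
    and hyp: "i \<in> I \<Longrightarrow> hypocontinuous (B i) (n i)"
begin

lemma bilinear_B: "i \<in> I \<Longrightarrow> stereo_bilinear (B i) (n i)"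
  by (intro stereo_bilinear.intro stereo_bilinear_axioms.intro stereo_B hyp)

lemma product_TB:
  assumes K: "K \<in> TB" and S: "S \<in> TB"
  shows "(\<lambda>(k, s). m k s) ` (K \<times> S) \<in> TB"
  unfolding TB_def
proof (intro CollectI conjI ballI)
  have KE: "K \<subseteq> E" and SE: "S \<subseteq> E" using K S TB_subset by auto
  then show "(\<lambda>(k, s). m k s) ` (K \<times> S) \<subseteq> E" using m_closed by auto
  fix i assume i: "i \<in> I"
  have "totally_bounded_in (B i) ((\<lambda>(k, s). n i k s) ` (h i ` K \<times> h i ` S))"
    using K S i by (intro stereo_bilinear.product_tb[OF bilinear_B[OF i]]) (auto simp: TB_def)
  moreover have "h i ` (\<lambda>(k, s). m k s) ` (K \<times> S) = (\<lambda>(k, s). n i k s) ` (h i ` K \<times> h i ` S)"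
  proof -
    have "h i (m k s) = n i (h i k) (h i s)" if "k \<in> K" "s \<in> S" for k s
      using that KE SE m_h[OF i] by blast
    then show ?thesis by (force simp: image_iff)
  qed
  ultimately show "totally_bounded_in (B i) (h i ` (\<lambda>(k, s). m k s) ` (K \<times> S))" by simp
qed

lemma m_linear:
  assumes f: "linear_on L f" and k: "k \<in> E"
  shows "linear_on L (\<lambda>x\<in>E. f (m k x))"
proof -
  have "m k (x \<oplus>\<^bsub>L\<^esub> y) = m k x \<oplus>\<^bsub>L\<^esub> m k y" if "x \<in> E" "y \<in> E" for x y
    using that k hyp unfolding hypocontinuous_def
    by (intro h_inj) (simp_all add: m_closed m_h add_L h_closed)
  moreover have "m k (c \<odot>\<^bsub>L\<^esub> x) = c \<odot>\<^bsub>L\<^esub> m k x" if "x \<in> E" for x c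
    using that k hyp unfolding hypocontinuous_def
    by (intro h_inj) (simp_all add: m_closed m_h smult_L h_closed)
  ultimately show ?thesis
    using linear_on_add[OF f] linear_on_smult[OF f] k unfolding linear_on_def
    by (simp add: m_closed add_L smult_L)
qed

text \<open>For coordinate functionals this is separate continuity in a factor. In the case
  \<open>lim\<close>, the operation with \<open>k\<close> fixed maps \<open>TB\<close> into itself,
  so translating \<open>H\<close> preserves precompactness on \<open>TB\<close> and
  \<open>lim\<close> applies again.\<close>

lemma F_m: "f \<in> F \<Longrightarrow> k \<in> E \<Longrightarrow> (\<lambda>x\<in>E. f (m k x)) \<in> F"
proof (induction rule: F.induct)
  case (base i f)
  have hk: "h i k \<in> carrier (B i)" using base by (intro h_closed)
  have "(\<lambda>x\<in>E. (\<lambda>y\<in>carrier (B i). f (n i (h i k) y)) (h i x)) \<in> F"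
    by (intro F.base base stereo_bilinear.functional_m[OF bilinear_B] hk)
  moreover have "(\<lambda>x\<in>E. (\<lambda>x\<in>E. f (h i x)) (m k x)) = (\<lambda>x\<in>E. (\<lambda>y\<in>carrier (B i). f (n i (h i k) y)) (h i x))"
    using base by (auto simp: fun_eq_iff m_closed m_h h_closed)
  ultimately show ?case by (simp only:)
next
  case (comb f g a b)
  have "(\<lambda>x\<in>E. (\<lambda>x\<in>E. a * f x + b * g x) (m k x)) = (\<lambda>x\<in>E. a * (\<lambda>x\<in>E. f (m k x)) x + b * (\<lambda>x\<in>E. g (m k x)) x)"
    using comb.prems by (auto simp: fun_eq_iff m_closed)
  then show ?case using F.comb[OF comb.IH(1)[OF comb.prems] comb.IH(2)[OF comb.prems], of a b] by (simp only:)
next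
  case (lim H f)
  let ?G = "(\<lambda>f. \<lambda>x\<in>E. f (m k x)) ` H"
  show ?case
  proof (rule F.lim[of ?G])
    show "\<forall>k. k \<in> ?G \<longrightarrow> k \<in> F" using lim(1) lim.prems by blast
    show "\<forall>S\<in>TB. precomp (\<lambda>f x. f x) ?G S"
    proof
      fix S assume S: "S \<in> TB"
      have SE: "S \<subseteq> E" by (rule TB_subset[OF S])
      have "(\<lambda>(k, s). m k s) ` ({k} \<times> S) \<in> TB" using lim.prems by (intro product_TB S finite_TB) auto
      moreover have "(\<lambda>(k, s). m k s) ` ({k} \<times> S) = m k ` S" by auto
      ultimately have "precomp (\<lambda>f x. f x) H (m k ` S)" using lim(2) by auto
      then have "precomp (\<lambda>f x. f (m k x)) H S"
        using precomp_image[of "\<lambda>f x. f x" id H "m k" S] by simp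
      then have "precomp (\<lambda>f x. (\<lambda>x\<in>E. f (m k x)) x) H S"
        by (rule iffD1[OF precomp_cong, rotated]) (use SE in \<open>simp add: subset_iff\<close>)
      then show "precomp (\<lambda>f x. f x) ?G S"
        using precomp_image[of "\<lambda>f x. f x" "\<lambda>f. \<lambda>x\<in>E. f (m k x)" H id S] by simp
    qed
    show "linear_on L0 (\<lambda>x\<in>E. f (m k x))"
      using m_linear[OF _ lim.prems] lim(4) by (simp add: linear_on_L0)
    show "\<forall>x\<in>E. (\<forall>g\<in>?G. cmod (g x) \<le> 1) \<longrightarrow> cmod ((\<lambda>x\<in>E. f (m k x)) x) \<le> 1"
      using lim(5) lim.prems m_closed by auto
    show "(\<lambda>x\<in>E. f (m k x)) \<in> extensional E" by (rule restrict_extensional)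
  qed
qed

lemma F0_orbit:
  assumes K: "K \<in> TB" and S: "S \<in> TB"
  shows "f \<in> F0 \<Longrightarrow> precomp (\<lambda>k s. f (m k s)) K S"
proof (induction rule: F0.induct)
  have KE: "K \<subseteq> E" and SE: "S \<subseteq> E" using K S TB_subset by auto
  have mE: "m k s \<in> E" if "k \<in> K" "s \<in> S" for k s using that KE SE m_closed by blast
  case zero
  have "precomp (\<lambda>k s. 0) K S" by (rule precompI_net) (auto intro!: exI[of _ "{\<lambda>_. 0}"])
  then show ?case by (rule iffD1[OF precomp_cong, rotated]) (simp add: mE)
next
  have KE: "K \<subseteq> E" and SE: "S \<subseteq> E" using K S TB_subset by auto
  have mE: "m k s \<in> E" if "k \<in> K" "s \<in> S" for k s using that KE SE m_closed by blast
  case (base i f)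
  have "precomp (\<lambda>k s. f (n i k s)) (h i ` K) (h i ` S)"
    using base K S by (intro stereo_bilinear.precomp_orbit[OF bilinear_B]) (auto simp: TB_def)
  then have "precomp (\<lambda>k s. f (n i (h i k) (h i s))) K S"
    using precomp_image[of "\<lambda>k s. f (n i k s)" "h i" K "h i" S] by simp
  then show ?case
    by (rule iffD1[OF precomp_cong, rotated]) (use KE SE base in \<open>simp add: mE m_h subset_iff\<close>)
next
  have KE: "K \<subseteq> E" and SE: "S \<subseteq> E" using K S TB_subset by auto
  have mE: "m k s \<in> E" if "k \<in> K" "s \<in> S" for k s using that KE SE m_closed by blast
  case (comb f g a b)
  have "precomp (\<lambda>k s. a * f (m k s) + b * g (m k s)) K S" by (intro precomp_lincomb comb.IH)
  then show ?case by (rule iffD1[OF precomp_cong, rotated]) (simp add: mE)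
qed

text \<open>The case \<open>F0\<close> comes from \<open>precomp_orbit\<close> in the factors. The
  product set of \<open>K\<close> and \<open>S\<close> belongs to \<open>TB\<close>, so uniform
  approximation on it covers the rest of \<open>F\<close>.\<close>

lemma F_orbit:
  assumes K: "K \<in> TB" and S: "S \<in> TB" and f: "f \<in> F"
  shows "precomp (\<lambda>k s. f (m k s)) K S"
proof (rule precomp_approx)
  fix e :: real assume e: "0 < e"
  obtain f0 where f0: "f0 \<in> F0" "\<forall>x\<in>(\<lambda>(k, s). m k s) ` (K \<times> S). cmod (f x - f0 x) \<le> e"
    using F0_dense[OF f] product_TB[OF K S] e by meson
  then show "\<exists>v. precomp v K S \<and> (\<forall>k\<in>K. \<forall>s\<in>S. cmod (f (m k s) - v k s) \<le> e)"
    using F0_orbit[OF K S f0(1)] by (intro exI[of _ "\<lambda>k s. f0 (m k s)"]) auto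
qed

text \<open>Continuity of the multiplication in dual form. Half of the error is spent on a finite
  net of \<open>H\<close> over the product set of \<open>K\<close> and \<open>S\<close>. The other
  half is spent on a net of orbits for each member of the first net; these nets of \<open>K\<close>
  may depend on that member, as there are finitely many.\<close>

lemma HH_m:
  assumes K: "K \<in> TB" and H: "H \<in> HH"
  shows "(\<lambda>(f, k). \<lambda>x\<in>E. f (m k x)) ` (H \<times> K) \<in> HH"
  unfolding HH_def
proof (intro CollectI conjI ballI)
  have KE: "K \<subseteq> E" by (rule TB_subset[OF K])
  have HF: "H \<subseteq> F" by (rule HH_subset[OF H])
  show "(\<lambda>(f, k). \<lambda>x\<in>E. f (m k x)) ` (H \<times> K) \<subseteq> F" using F_m HF KE by auto
  fix S assume S: "S \<in> TB"
  have SE: "S \<subseteq> E" by (rule TB_subset[OF S])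
  have "precomp (\<lambda>p s. fst p (m (snd p) s)) (H \<times> K) S"
  proof (rule precompI_net)
    fix e :: real assume e: "0 < e"
    then have e2: "0 < e / 2" by simp
    obtain N where N: "finite N" "N \<subseteq> H"
        "\<forall>f\<in>H. \<exists>g\<in>N. \<forall>x\<in>(\<lambda>(k, s). m k s) ` (K \<times> S). cmod (f x - g x) \<le> e / 2"
      by (rule precomp_net[OF HH_precomp[OF H product_TB[OF K S]] e2])
    have "\<exists>M. finite M \<and> M \<subseteq> K \<and> (\<forall>k\<in>K. \<exists>j\<in>M. \<forall>s\<in>S. cmod (g (m k s) - g (m j s)) \<le> e / 2)" if g: "g \<in> N" for g
    proof -
      have "g \<in> F" using g N(2) HF by blast
      then show ?thesis using precomp_net[OF F_orbit[OF K S] e2] by metis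
    qed
    then obtain M where M: "\<And>g. g \<in> N \<Longrightarrow> finite (M g)"
      "\<And>g. g \<in> N \<Longrightarrow> \<forall>k\<in>K. \<exists>j\<in>M g. \<forall>s\<in>S. cmod (g (m k s) - g (m j s)) \<le> e / 2" by metis
    have "\<exists>v\<in>(\<lambda>q s. fst q (m (snd q) s)) ` (SIGMA g:N. M g). \<forall>s\<in>S. cmod (fst p (m (snd p) s) - v s) \<le> e"
      if p: "p \<in> H \<times> K" for p
    proof -
      obtain f k where fk: "p = (f, k)" "f \<in> H" "k \<in> K" using p by auto
      obtain g where g: "g \<in> N" "\<forall>x\<in>(\<lambda>(k, s). m k s) ` (K \<times> S). cmod (f x - g x) \<le> e / 2"
        using N(3) fk(2) by blast
      obtain j where j: "j \<in> M g" "\<forall>s\<in>S. cmod (g (m k s) - g (m j s)) \<le> e / 2" using M(2)[OF g(1)] fk(3) by blast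
      have "cmod (fst p (m (snd p) s) - fst (g, j) (m (snd (g, j)) s)) \<le> e" if s: "s \<in> S" for s
      proof -
        have "cmod (f (m k s) - g (m k s)) \<le> e / 2" using g(2) fk(3) s by blast
        moreover have "cmod (g (m k s) - g (m j s)) \<le> e / 2" using j(2) s by blast
        ultimately show ?thesis
          using norm_triangle_ineq[of "f (m k s) - g (m k s)" "g (m k s) - g (m j s)"] fk(1) by simp
      qed
      then have "\<forall>s\<in>S. cmod (fst p (m (snd p) s) - fst (g, j) (m (snd (g, j)) s)) \<le> e" by (rule ballI)
      moreover have "(g, j) \<in> (SIGMA g:N. M g)" using g(1) j(1) by simp
      ultimately show ?thesis unfolding bex_simps by (rule bexI)
    qed
    moreover have "finite (SIGMA g:N. M g)" using N(1) M(1) by (intro finite_SigmaI)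
    ultimately show "\<exists>N. finite N \<and> (\<forall>p\<in>H \<times> K. \<exists>v\<in>N. \<forall>s\<in>S. cmod (fst p (m (snd p) s) - v s) \<le> e)"
      by (intro exI[of _ "(\<lambda>q s. fst q (m (snd q) s)) ` (SIGMA g:N. M g)"] conjI finite_imageI ballI)
  qed
  then have "precomp (\<lambda>p s. (case p of (f, k) \<Rightarrow> \<lambda>x\<in>E. f (m k x)) s) (H \<times> K) S"
    by (rule iffD1[OF precomp_cong, rotated]) (use SE in \<open>auto simp: subset_iff\<close>)
  then show "precomp (\<lambda>f x. f x) ((\<lambda>(f, k). \<lambda>x\<in>E. f (m k x)) ` (H \<times> K)) S"
    using precomp_image[of "\<lambda>f x. f x" "\<lambda>(f, k). \<lambda>x\<in>E. f (m k x)" "H \<times> K" id S] by simp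
qed

text \<open>A neighbourhood of zero contains a polar of some \<open>H\<close>. By
  \<open>HH_m\<close> the translates of \<open>H\<close> by all \<open>k\<close> in \<open>K\<close>
  form a set in \<open>HH\<close>, and its polar is mapped into that of \<open>H\<close> by each
  \<open>k\<close>.\<close>

lemma m_neighbourhood:
  assumes K: "K \<in> TB" and U: "nbhd_zero L U"
  shows "\<exists>G\<in>HH. \<exists>\<epsilon>>0. \<forall>k\<in>K. \<forall>x\<in>E. (\<forall>g\<in>G. cmod (g x) \<le> \<epsilon>) \<longrightarrow> m k x \<in> U"
proof -
  obtain H e where He: "H \<in> HH" "0 < e" "{y \<in> carrier L. \<forall>f\<in>H. cmod (f y) \<le> e} \<subseteq> U"
    using U by (rule nbhd_zeroD)
  have KE: "K \<subseteq> E" by (rule TB_subset[OF K])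
  have "m k x \<in> U" if k: "k \<in> K" and x: "x \<in> E"
    and g: "\<forall>g\<in>(\<lambda>(f, k). \<lambda>x\<in>E. f (m k x)) ` (H \<times> K). cmod (g x) \<le> e" for k x
  proof -
    have "cmod (f (m k x)) \<le> e" if f: "f \<in> H" for f
    proof -
      have "(\<lambda>x\<in>E. f (m k x)) \<in> (\<lambda>(f, k). \<lambda>x\<in>E. f (m k x)) ` (H \<times> K)" using f k by force
      then have "cmod ((\<lambda>x\<in>E. f (m k x)) x) \<le> e" by (rule bspec[OF g])
      then show ?thesis using x by simp
    qed
    moreover have "m k x \<in> E" using m_closed k x KE by blast
    ultimately show ?thesis using He(3) by auto
  qed
  then show ?thesis using HH_m[OF K He(1)] He(2) by meson
qed

end

context ste_limit
begin

lemma stereotype_algebra_L: "stereotype_algebra L"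
proof -
  \<comment> \<open>One locale is interpreted for the multiplication and for its opposite; the two
    instances give the two inclusions of the algebra condition.\<close>
  interpret r: ste_limit_op I B E h "mult L0" "\<lambda>i x y. x \<otimes>\<^bsub>B i\<^esub> y"
    by (intro ste_limit_op.intro ste_limit_axioms ste_limit_op_axioms.intro mult_L hypocontinuous_mult alg)
  interpret l: ste_limit_op I B E h "\<lambda>x y. mult L0 y x" "\<lambda>i x y. y \<otimes>\<^bsub>B i\<^esub> x"
    by (intro ste_limit_op.intro ste_limit_axioms ste_limit_op_axioms.intro mult_L
        hypocontinuous_flip[OF hypocontinuous_mult] alg)
  have sm: "(c \<odot>\<^bsub>L\<^esub> x) \<otimes>\<^bsub>L\<^esub> y = c \<odot>\<^bsub>L\<^esub> (x \<otimes>\<^bsub>L\<^esub> y) \<and> x \<otimes>\<^bsub>L\<^esub> (c \<odot>\<^bsub>L\<^esub> y) = c \<odot>\<^bsub>L\<^esub> (x \<otimes>\<^bsub>L\<^esub> y)"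
    if xy: "x \<in> carrier L" "y \<in> carrier L" for c x y
  proof -
    have "\<forall>i\<in>I. \<forall>c. \<forall>x\<in>carrier (B i). \<forall>y\<in>carrier (B i).
        (c \<odot>\<^bsub>B i\<^esub> x) \<otimes>\<^bsub>B i\<^esub> y = c \<odot>\<^bsub>B i\<^esub> (x \<otimes>\<^bsub>B i\<^esub> y) \<and>
        x \<otimes>\<^bsub>B i\<^esub> (c \<odot>\<^bsub>B i\<^esub> y) = c \<odot>\<^bsub>B i\<^esub> (x \<otimes>\<^bsub>B i\<^esub> y)"
      using alg unfolding stereotype_algebra_def by blast
    then show ?thesis
      using xy by (intro conjI; intro h_inj) (simp_all add: mult_L smult_L h_closed)
  qed
  have KV: "\<exists>V. nbhd_zero L V \<and> K <#>\<^bsub>L\<^esub> V \<subseteq> U \<and> V <#>\<^bsub>L\<^esub> K \<subseteq> U"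
    if K: "compactin (topol L) K" and U: "nbhd_zero L U" for K U
  proof -
    have KT: "K \<in> TB" using compactin_totally_bounded[OF K] totally_bounded_L by simp
    obtain G d where G: "G \<in> HH" "0 < d" "\<forall>k\<in>K. \<forall>x\<in>E. (\<forall>g\<in>G. cmod (g x) \<le> d) \<longrightarrow> mult L0 k x \<in> U"
      using r.m_neighbourhood[OF KT U] by blast
    obtain H e where H: "H \<in> HH" "0 < e" "\<forall>k\<in>K. \<forall>x\<in>E. (\<forall>g\<in>H. cmod (g x) \<le> e) \<longrightarrow> mult L0 x k \<in> U"
      using l.m_neighbourhood[OF KT U] by blast
    let ?V = "{y \<in> carrier L. \<forall>f\<in>G \<union> H. cmod (f y) \<le> min d e}"
    have "nbhd_zero L ?V" using HH_Un[OF G(1) H(1)] G(2) H(2) by (intro nbhd_zero_ball) auto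
    moreover have "K <#>\<^bsub>L\<^esub> ?V \<subseteq> U" unfolding set_mult_def using G(3) by auto
    moreover have "?V <#>\<^bsub>L\<^esub> K \<subseteq> U" unfolding set_mult_def using H(3) by auto
    ultimately show ?thesis by blast
  qed
  show ?thesis
    unfolding stereotype_algebra_def using stereotype_space_L ring_L sm KV by blast
qed

end

section \<open>Small sets\<close>

lemma small_subset: "small u S \<Longrightarrow> T \<subseteq> S \<Longrightarrow> small u T"
  unfolding small_def using card_of_mono1 ordLeq_ordLess_trans by blast

lemma small_image: "small u S \<Longrightarrow> small u (f ` S)"
  unfolding small_def using card_of_image ordLeq_ordLess_trans by blast

lemma small_inj_on:
  assumes "inj_on f S" "f ` S \<subseteq> T" "small u T" shows "small u S"
  using assms card_of_ordLeq[of S T] ordLeq_ordLess_trans unfolding small_def by blast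

lemma small_embedding:
  assumes "small TYPE('u) S" obtains e :: "'b \<Rightarrow> 'u" where "inj_on e S"
  using assms card_of_ordLeq[of S "UNIV :: 'u set"] ordLess_imp_ordLeq unfolding small_def by blast

locale universe =
  fixes u :: "'u itself"
  assumes inacc: "inaccessible u"
begin

text \<open>The strong limit property is stated for subsets of the universe; an embedding carries it
  over to small sets of any type.\<close>

lemma small_Pow:
  assumes "small TYPE('u) S" shows "small TYPE('u) (Pow S)"
proof -
  obtain e :: "_ \<Rightarrow> 'u" where e: "inj_on e S" using small_embedding[OF assms] .
  have 1: "small TYPE('u) (Pow (e ` S))"
    using inacc small_image[OF assms, of e] unfolding inaccessible_def by (simp add: small_def)
  have 2: "inj_on (image e) (Pow S)" using e by (rule inj_on_image_Pow)
  have 3: "image e ` Pow S \<subseteq> Pow (e ` S)" by blast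
  show ?thesis by (rule small_inj_on[OF 2 3 1])
qed

lemma infinite_universe: "infinite (UNIV :: 'u set)"
proof -
  have "|UNIV :: nat set| <o |UNIV :: 'u set|" using inacc unfolding inaccessible_def small_def by simp
  then show ?thesis using infinite_iff_card_of_nat ordLess_imp_ordLeq by blast
qed

lemma small_finite: "finite S \<Longrightarrow> small TYPE('u) S"
  unfolding small_def
  by (rule finite_ordLess_infinite[OF card_of_Well_order card_of_Well_order])
    (simp_all add: Field_card_of infinite_universe)

text \<open>A function is recorded by its graph in the disjoint union of the sets
  \<open>S i\<close>. Regularity keeps that union small, and the strong limit property keeps its
  power set small.\<close>

lemma small_PiE:
  assumes I: "small TYPE('u) I" and S: "\<And>i. i \<in> I \<Longrightarrow> small TYPE('u) (S i :: 'u set)"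
  shows "small TYPE('u) (PiE I S)"
proof -
  obtain e :: "_ \<Rightarrow> 'u" where e: "inj_on e I" using small_embedding[OF I] .
  have st: "stable |UNIV :: 'u set|"
  proof (rule regularCard_stable)
    show "Card_order |UNIV :: 'u set|" by (rule card_of_Card_order)
    show "infinite (Field |UNIV :: 'u set| )" unfolding Field_card_of by (rule infinite_universe)
    show "regularCard |UNIV :: 'u set|" using inacc unfolding inaccessible_def by blast
  qed
  have "small TYPE('u) (SIGMA a:e ` I. S (inv_into I e a))"
    unfolding small_def
  proof (rule stable_elim[OF st])
    show "|e ` I| <o |UNIV :: 'u set|" using small_image[OF I, of e] unfolding small_def .
    show "|S (inv_into I e a)| <o |UNIV :: 'u set|" if "a \<in> e ` I" for a
      using S[OF inv_into_into[OF that]] unfolding small_def .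
  qed
  then have 1: "small TYPE('u) (Pow (SIGMA a:e ` I. S (inv_into I e a)))" by (rule small_Pow)
  have 2: "inj_on (\<lambda>f. (\<lambda>i. (e i, f i)) ` I) (PiE I S)"
  proof (rule inj_onI)
    fix f g assume f: "f \<in> PiE I S" and g: "g \<in> PiE I S" and eq: "(\<lambda>i. (e i, f i)) ` I = (\<lambda>i. (e i, g i)) ` I"
    show "f = g"
    proof (rule PiE_ext[OF f g])
      fix i assume i: "i \<in> I"
      then have "(e i, f i) \<in> (\<lambda>i. (e i, g i)) ` I" using eq by blast
      then obtain j where "j \<in> I" "e i = e j" "f i = g j" by blast
      then show "f i = g i" using e i by (metis inj_onD)
    qed
  qed
  have 3: "(\<lambda>f. (\<lambda>i. (e i, f i)) ` I) ` PiE I S \<subseteq> Pow (SIGMA a:e ` I. S (inv_into I e a))"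
    using e by (auto simp: PiE_def Pi_def)
  show ?thesis by (rule small_inj_on[OF 2 3 1])
qed

text \<open>In a Hausdorff space a point of the closure is determined by the traces of its open
  neighbourhoods on \<open>D\<close>, that is, by a set of subsets of \<open>D\<close>.\<close>

lemma small_closure:
  assumes T: "Hausdorff_space T" and D: "small TYPE('u) D"
  shows "small TYPE('u) (T closure_of D)"
proof -
  let ?c = "\<lambda>x. {D \<inter> U | U. openin T U \<and> x \<in> U}"
  have 2: "inj_on ?c (T closure_of D)"
  proof (rule inj_onI, rule ccontr)
    fix x y assume x: "x \<in> T closure_of D" and y: "y \<in> T closure_of D" and eq: "?c x = ?c y" and ne: "x \<noteq> y"
    have "x \<in> topspace T" "y \<in> topspace T" using x y closure_of_subset_topspace by fast+
    then obtain U V where UV: "openin T U" "openin T V" "x \<in> U" "y \<in> V" "disjnt U V"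
      using T ne unfolding Hausdorff_space_def by meson
    have "D \<inter> U \<in> ?c y" unfolding eq[symmetric] using UV(1,3) by blast
    then obtain W where W: "D \<inter> U = D \<inter> W" "openin T W" "y \<in> W" by blast
    have "openin T (W \<inter> V)" "y \<in> W \<inter> V" using W UV by auto
    then obtain z where "z \<in> D" "z \<in> W \<inter> V" using y unfolding in_closure_of by blast
    then show False using W(1) UV(5) unfolding disjnt_def by blast
  qed
  have 3: "?c ` (T closure_of D) \<subseteq> Pow (Pow D)" by auto
  have 1: "small TYPE('u) (Pow (Pow D))" by (intro small_Pow D)
  show ?thesis by (rule small_inj_on[OF 2 3 1])
qed

end

section \<open>Morphisms of stereotype algebras\<close>

lemma Hom_Ste_iff: "f \<in> Hom Ste X Y \<longleftrightarrow> source f = X \<and> target f = Y \<and> X \<in> ste_objects \<and> Y \<in> ste_objects \<and>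
    map_of_arrow f \<in> ste_homs X Y"
  unfolding Hom_def Ste_def by auto

lemma Ste_simps [simp]: "Obj Ste = ste_objects" "Dom Ste = source" "Cod Ste = target"
  unfolding Ste_def by simp_all

lemma Mor_Ste_Hom: "f \<in> Mor Ste \<longleftrightarrow> f \<in> Hom Ste (source f) (target f)"
  unfolding Hom_def by simp

lemma comp_Ste:
  "source (g \<cdot>\<^bsub>Ste\<^esub> f) = source f" "target (g \<cdot>\<^bsub>Ste\<^esub> f) = target g"
  "x \<in> carrier (source f) \<Longrightarrow> map_of_arrow (g \<cdot>\<^bsub>Ste\<^esub> f) x = map_of_arrow g (map_of_arrow f x)"
  unfolding Ste_def compose_def by simp_all

lemma comp_Ste_apply:
  "f \<in> Hom Ste X Y \<Longrightarrow> x \<in> carrier X \<Longrightarrow> map_of_arrow (g \<cdot>\<^bsub>Ste\<^esub> f) x = map_of_arrow g (map_of_arrow f x)"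
  using comp_Ste(3)[of x f g] by (simp add: Hom_Ste_iff)

lemma Ste_arrow_eqI:
  assumes f: "f \<in> Hom Ste X Y" and g: "g \<in> Hom Ste X Y"
    and eq: "\<And>x. x \<in> carrier X \<Longrightarrow> map_of_arrow f x = map_of_arrow g x"
  shows "f = g"
proof (rule ste_arrow.equality)
  show "map_of_arrow f = map_of_arrow g"
    using f g eq unfolding Hom_Ste_iff ste_homs_def by (intro extensionalityI[of _ "carrier X"]) auto
qed (use f g in \<open>auto simp: Hom_Ste_iff\<close>)

lemma
  assumes f: "f \<in> Hom Ste X Y"
  shows Hom_closed: "x \<in> carrier X \<Longrightarrow> map_of_arrow f x \<in> carrier Y"
    and Hom_add: "x \<in> carrier X \<Longrightarrow> y \<in> carrier X \<Longrightarrow>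
      map_of_arrow f (x \<oplus>\<^bsub>X\<^esub> y) = map_of_arrow f x \<oplus>\<^bsub>Y\<^esub> map_of_arrow f y"
    and Hom_mult: "x \<in> carrier X \<Longrightarrow> y \<in> carrier X \<Longrightarrow>
      map_of_arrow f (x \<otimes>\<^bsub>X\<^esub> y) = map_of_arrow f x \<otimes>\<^bsub>Y\<^esub> map_of_arrow f y"
    and Hom_one: "map_of_arrow f \<one>\<^bsub>X\<^esub> = \<one>\<^bsub>Y\<^esub>"
    and Hom_smult: "x \<in> carrier X \<Longrightarrow> map_of_arrow f (c \<odot>\<^bsub>X\<^esub> x) = c \<odot>\<^bsub>Y\<^esub> map_of_arrow f x"
    and Hom_continuous: "continuous_map (topol X) (topol Y) (map_of_arrow f)"
    and Hom_objects: "X \<in> ste_objects" "Y \<in> ste_objects"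
  using f unfolding Hom_Ste_iff ste_homs_def ring_hom_def by auto

lemma ste_object_ring: "X \<in> ste_objects \<Longrightarrow> ring X"
  and ste_object_stereo: "X \<in> ste_objects \<Longrightarrow> stereo X"
  and ste_object_algebra: "X \<in> ste_objects \<Longrightarrow> stereotype_algebra X"
  unfolding ste_objects_def stereo_def stereotype_algebra_def by auto

lemma Hom_zero:
  assumes f: "f \<in> Hom Ste X Y" shows "map_of_arrow f \<zero>\<^bsub>X\<^esub> = \<zero>\<^bsub>Y\<^esub>"
proof -
  interpret X: stereo X by (rule ste_object_stereo[OF Hom_objects(1)[OF f]])
  interpret Y: stereo Y by (rule ste_object_stereo[OF Hom_objects(2)[OF f]])
  have z: "\<zero>\<^bsub>X\<^esub> \<in> carrier X" by (rule X.M.zero_closed)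
  show ?thesis
    using Hom_smult[OF f z, of 0] X.smult_l_null[OF z] Y.smult_l_null[OF Hom_closed[OF f z]] by simp
qed

lemma ste_topspace: "X \<in> ste_objects \<Longrightarrow> topspace (topol X) = carrier X"
  using stereo.ts[OF ste_object_stereo] .

lemma ste_Hausdorff: "X \<in> ste_objects \<Longrightarrow> Hausdorff_space (topol X)"
  using stereo.lcs[OF ste_object_stereo] unfolding locally_convex_space_def by blast

section \<open>Limits in the category of stereotype algebras\<close>

definition subalgebra_PiE :: "'i set \<Rightarrow> ('i \<Rightarrow> 'b top_module) \<Rightarrow> ('i \<Rightarrow> 'b) set \<Rightarrow> bool" where
  "subalgebra_PiE I B P \<longleftrightarrow> P \<subseteq> (\<Pi>\<^sub>E i\<in>I. carrier (B i)) \<and>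
    (\<lambda>i\<in>I. \<zero>\<^bsub>B i\<^esub>) \<in> P \<and> (\<lambda>i\<in>I. \<one>\<^bsub>B i\<^esub>) \<in> P \<and>
    (\<forall>x\<in>P. \<forall>y\<in>P. (\<lambda>i\<in>I. x i \<oplus>\<^bsub>B i\<^esub> y i) \<in> P \<and> (\<lambda>i\<in>I. x i \<otimes>\<^bsub>B i\<^esub> y i) \<in> P) \<and>
    (\<forall>c. \<forall>x\<in>P. (\<lambda>i\<in>I. c \<odot>\<^bsub>B i\<^esub> x i) \<in> P)"

definition is_limit :: "'i set \<Rightarrow> ('i \<Rightarrow> 'u top_module) \<Rightarrow> ('i \<Rightarrow> 'u) set \<Rightarrow>
    'u top_module \<Rightarrow> ('i \<Rightarrow> 'u ste_arrow) \<Rightarrow> bool" where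
  "is_limit I B P L \<pi> \<longleftrightarrow> L \<in> ste_objects \<and> (\<forall>i\<in>I. \<pi> i \<in> Hom Ste L (B i)) \<and>
    bij_betw (\<lambda>x. \<lambda>i\<in>I. map_of_arrow (\<pi> i) x) (carrier L) P \<and>
    (\<forall>D \<psi>. D \<in> ste_objects \<longrightarrow> (\<forall>i\<in>I. \<psi> i \<in> Hom Ste D (B i)) \<longrightarrow>
      (\<forall>x\<in>carrier D. (\<lambda>i\<in>I. map_of_arrow (\<psi> i) x) \<in> P) \<longrightarrow>
      (\<exists>\<delta>\<in>Hom Ste D L. \<forall>i\<in>I. \<pi> i \<cdot>\<^bsub>Ste\<^esub> \<delta> = \<psi> i))"

lemma
  assumes "is_limit I B P L \<pi>"
  shows is_limit_proj: "i \<in> I \<Longrightarrow> \<pi> i \<in> Hom Ste L (B i)"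
    and is_limit_mem: "x \<in> carrier L \<Longrightarrow> (\<lambda>i\<in>I. map_of_arrow (\<pi> i) x) \<in> P"
    and is_limit_surj: "b \<in> P \<Longrightarrow> \<exists>x\<in>carrier L. b = (\<lambda>i\<in>I. map_of_arrow (\<pi> i) x)"
    and is_limit_inj: "x \<in> carrier L \<Longrightarrow> y \<in> carrier L \<Longrightarrow>
      (\<And>i. i \<in> I \<Longrightarrow> map_of_arrow (\<pi> i) x = map_of_arrow (\<pi> i) y) \<Longrightarrow> x = y"
    and is_limit_universal: "D \<in> ste_objects \<Longrightarrow> (\<And>i. i \<in> I \<Longrightarrow> \<psi> i \<in> Hom Ste D (B i)) \<Longrightarrow>
      (\<And>x. x \<in> carrier D \<Longrightarrow> (\<lambda>i\<in>I. map_of_arrow (\<psi> i) x) \<in> P) \<Longrightarrow>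
      \<exists>\<delta>\<in>Hom Ste D L. \<forall>i\<in>I. \<pi> i \<cdot>\<^bsub>Ste\<^esub> \<delta> = \<psi> i"
proof -
  have bij: "inj_on (\<lambda>x. \<lambda>i\<in>I. map_of_arrow (\<pi> i) x) (carrier L)"
      "(\<lambda>x. \<lambda>i\<in>I. map_of_arrow (\<pi> i) x) ` carrier L = P"
    using assms unfolding is_limit_def bij_betw_def by auto
  show "i \<in> I \<Longrightarrow> \<pi> i \<in> Hom Ste L (B i)"
    using assms unfolding is_limit_def by blast
  show "x \<in> carrier L \<Longrightarrow> (\<lambda>i\<in>I. map_of_arrow (\<pi> i) x) \<in> P"
    unfolding bij(2)[symmetric] by (rule imageI)
  show "b \<in> P \<Longrightarrow> \<exists>x\<in>carrier L. b = (\<lambda>i\<in>I. map_of_arrow (\<pi> i) x)"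
    unfolding bij(2)[symmetric] by (rule iffD1[OF image_iff])
  show "x = y" if "x \<in> carrier L" "y \<in> carrier L"
    "\<And>i. i \<in> I \<Longrightarrow> map_of_arrow (\<pi> i) x = map_of_arrow (\<pi> i) y"
    by (rule inj_onD[OF bij(1) _ that(1,2)]) (rule restrict_ext, rule that(3))
  show "D \<in> ste_objects \<Longrightarrow> (\<And>i. i \<in> I \<Longrightarrow> \<psi> i \<in> Hom Ste D (B i)) \<Longrightarrow>
      (\<And>x. x \<in> carrier D \<Longrightarrow> (\<lambda>i\<in>I. map_of_arrow (\<psi> i) x) \<in> P) \<Longrightarrow>
      \<exists>\<delta>\<in>Hom Ste D L. \<forall>i\<in>I. \<pi> i \<cdot>\<^bsub>Ste\<^esub> \<delta> = \<psi> i"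
    using assms unfolding is_limit_def by simp
qed

text \<open>\<open>P\<close> consists of functions, while objects have carriers in
  \<open>'u\<close>. Smallness provides an injection \<open>e\<close> into \<open>'u\<close>, and
  the limit is built on the image of \<open>P\<close>, with the coordinates of the decoded family as
  the maps \<open>h i\<close>.\<close>

theorem ste_limit_exists:
  fixes B :: "'i \<Rightarrow> 'u top_module"
  assumes B: "\<And>i. i \<in> I \<Longrightarrow> B i \<in> ste_objects"
    and cl: "closedin (product_topology (\<lambda>i. topol (B i)) I) P"
    and sub: "subalgebra_PiE I B P"
    and small: "small TYPE('u) P"
  shows "\<exists>L \<pi>. is_limit I B P L \<pi>"
proof -
  obtain e :: "('i \<Rightarrow> 'u) \<Rightarrow> 'u" where e: "inj_on e P" using small_embedding[OF small] .
  define d where "d = inv_into P e"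
  define E where "E = e ` P"
  have de: "d (e x) = x" if "x \<in> P" for x unfolding d_def using e that by simp
  have dP: "d v \<in> P" if "v \<in> E" for v using that de unfolding E_def by auto
  have ed: "e (d v) = v" if "v \<in> E" for v using that de unfolding E_def by auto
  have eE: "e x \<in> E" if "x \<in> P" for x using that unfolding E_def by blast
  have PE: "P \<subseteq> (\<Pi>\<^sub>E i\<in>I. carrier (B i))" using sub unfolding subalgebra_PiE_def by blast
  have dres: "(\<lambda>i\<in>I. d v i) = d v" if "v \<in> E" for v
    using dP[OF that] PE by (auto simp: fun_eq_iff PiE_def extensional_def)
  have im: "(\<lambda>v. \<lambda>i\<in>I. d v i) ` E = P"
  proof
    show "(\<lambda>v. \<lambda>i\<in>I. d v i) ` E \<subseteq> P" using dP dres by auto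
    show "P \<subseteq> (\<lambda>v. \<lambda>i\<in>I. d v i) ` E"
    proof
      fix x assume x: "x \<in> P"
      then have "(\<lambda>i\<in>I. d (e x) i) = x" using dres[OF eE[OF x]] de by simp
      then show "x \<in> (\<lambda>v. \<lambda>i\<in>I. d v i) ` E" using eE[OF x] by (metis imageI)
    qed
  qed
  interpret ste_limit I B E "\<lambda>i v. d v i"
  proof
    show "stereotype_algebra (B i)" if "i \<in> I" for i using ste_object_algebra[OF B[OF that]] .
    show "d v i \<in> carrier (B i)" if "i \<in> I" "v \<in> E" for i v
      using dP[OF that(2)] PE that(1) by (auto simp: PiE_def)
    show "v = w" if vw: "v \<in> E" "w \<in> E" and eq: "\<And>i. i \<in> I \<Longrightarrow> d v i = d w i" for v w
    proof -
      have "d v = d w" using dP vw PE eq by (intro PiE_ext[of _ I "\<lambda>i. carrier (B i)"]) auto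
      then show ?thesis using ed vw by metis
    qed
    show "closedin (product_topology (\<lambda>i. topol (B i)) I) ((\<lambda>v. \<lambda>i\<in>I. d v i) ` E)" unfolding im by (rule cl)
    have ex: "\<exists>z\<in>E. \<forall>i\<in>I. d z i = w i" if "(\<lambda>i\<in>I. w i) \<in> P" for w
      using that eE de by (intro bexI[of _ "e (\<lambda>i\<in>I. w i)"]) auto
    show "\<exists>z\<in>E. \<forall>i\<in>I. d z i = \<zero>\<^bsub>B i\<^esub>" "\<exists>z\<in>E. \<forall>i\<in>I. d z i = \<one>\<^bsub>B i\<^esub>"
      by (rule ex, use sub in \<open>simp add: subalgebra_PiE_def\<close>)+
    show "\<exists>z\<in>E. \<forall>i\<in>I. d z i = d v i \<oplus>\<^bsub>B i\<^esub> d w i" "\<exists>z\<in>E. \<forall>i\<in>I. d z i = d v i \<otimes>\<^bsub>B i\<^esub> d w i"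
      if "v \<in> E" "w \<in> E" for v w
      by (rule ex, use sub dP that in \<open>simp add: subalgebra_PiE_def\<close>)+
    show "\<exists>z\<in>E. \<forall>i\<in>I. d z i = c \<odot>\<^bsub>B i\<^esub> d v i" if "v \<in> E" for c v
      by (rule ex) (use sub dP that in \<open>simp add: subalgebra_PiE_def\<close>)
  qed
  have Lobj: "L \<in> ste_objects"
    unfolding ste_objects_def using stereotype_algebra_L small_image[OF small, of e, folded E_def] by simp
  define \<pi> where "\<pi> i = \<lparr>source = L, target = B i, map_of_arrow = (\<lambda>v\<in>E. d v i)\<rparr>" for i
  have \<pi>: "\<pi> i \<in> Hom Ste L (B i)" if i: "i \<in> I" for i
  proof -
    have "continuous_map (topol L) (topol (B i)) (\<lambda>v\<in>E. d v i)"
      by (rule continuous_map_eq[OF continuous_map_h[OF i]]) (simp add: topspace_carrier[unfolded L_simps])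
    then show ?thesis
      unfolding Hom_Ste_iff ste_homs_def ring_hom_def \<pi>_def using Lobj B[OF i] i
      by (auto simp: add_L mult_L one_L smult_L h_closed)
  qed
  have \<pi>_app: "map_of_arrow (\<pi> i) v = d v i" if "v \<in> E" for i v unfolding \<pi>_def using that by simp
  show ?thesis
    unfolding is_limit_def
  proof (intro exI[of _ L] exI[of _ \<pi>] conjI ballI Lobj \<pi> allI impI)
    have bij: "bij_betw d E P"
      unfolding bij_betw_def using ed dP de eE by (metis (no_types, lifting) image_subset_iff inj_on_inverseI subsetI subset_antisym image_eqI)
    have app: "(\<lambda>i\<in>I. map_of_arrow (\<pi> i) v) = d v" if "v \<in> E" for v
      using dres[OF that] by (simp add: \<pi>_app[OF that])
    show "bij_betw (\<lambda>v. \<lambda>i\<in>I. map_of_arrow (\<pi> i) v) (carrier L) P"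
      unfolding L_simps using bij_betw_cong[of E, OF app] bij by simp
  next
    fix D and \<psi> :: "'i \<Rightarrow> 'u ste_arrow"
    assume D: "D \<in> ste_objects" and "\<forall>i\<in>I. \<psi> i \<in> Hom Ste D (B i)"
      and "\<forall>x\<in>carrier D. (\<lambda>i\<in>I. map_of_arrow (\<psi> i) x) \<in> P"
    then have \<psi>: "\<And>i. i \<in> I \<Longrightarrow> \<psi> i \<in> Hom Ste D (B i)"
      and P: "\<And>x. x \<in> carrier D \<Longrightarrow> (\<lambda>i\<in>I. map_of_arrow (\<psi> i) x) \<in> P" by blast+
    define q where "q x = e (\<lambda>i\<in>I. map_of_arrow (\<psi> i) x)" for x
    have qE: "q x \<in> E" if "x \<in> carrier D" for x unfolding q_def by (rule eE[OF P[OF that]])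
    have dq: "d (q x) i = map_of_arrow (\<psi> i) x" if "x \<in> carrier D" "i \<in> I" for x i
      unfolding q_def using de[OF P[OF that(1)]] that(2) by simp
    interpret D: stereo D by (rule ste_object_stereo[OF D])
    interpret Dr: ring D by (rule ste_object_ring[OF D])
    have cont: "continuous_map (topol D) (topol L) q"
    proof (rule continuous_map_universal)
      show "stereotype_space D" by (rule D.st)
      fix i assume i: "i \<in> I"
      show "continuous_map (topol D) (topol (B i)) (\<lambda>x. d (q x) i)"
        by (rule continuous_map_eq[OF Hom_continuous[OF \<psi>[OF i]]]) (simp add: D.ts dq i)
    qed (simp_all add: qE dq Hom_add[OF \<psi>] Hom_smult[OF \<psi>])
    define \<delta> where "\<delta> = \<lparr>source = D, target = L, map_of_arrow = (\<lambda>x\<in>carrier D. q x)\<rparr>"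
    have "continuous_map (topol D) (topol L) (\<lambda>x\<in>carrier D. q x)"
      by (rule continuous_map_eq[OF cont]) (simp add: D.ts)
    moreover have "q (x \<oplus>\<^bsub>D\<^esub> y) = q x \<oplus>\<^bsub>L\<^esub> q y" if "x \<in> carrier D" "y \<in> carrier D" for x y
      by (rule h_inj) (simp_all add: that qE dq add_L Hom_add[OF \<psi>])
    moreover have "q (x \<otimes>\<^bsub>D\<^esub> y) = q x \<otimes>\<^bsub>L\<^esub> q y" if "x \<in> carrier D" "y \<in> carrier D" for x y
      by (rule h_inj) (simp_all add: that qE dq mult_L Hom_mult[OF \<psi>])
    moreover have "q (c \<odot>\<^bsub>D\<^esub> x) = c \<odot>\<^bsub>L\<^esub> q x" if "x \<in> carrier D" for c x
      by (rule h_inj) (simp_all add: that qE dq smult_L Hom_smult[OF \<psi>])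
    moreover have "q \<one>\<^bsub>D\<^esub> = \<one>\<^bsub>L\<^esub>"
      by (rule h_inj) (simp_all add: qE dq one_L Hom_one[OF \<psi>])
    ultimately have \<delta>: "\<delta> \<in> Hom Ste D L"
      unfolding Hom_Ste_iff ste_homs_def ring_hom_def \<delta>_def using Lobj D qE by simp
    have "\<pi> i \<cdot>\<^bsub>Ste\<^esub> \<delta> = \<psi> i" if i: "i \<in> I" for i
    proof (rule Ste_arrow_eqI[OF category.comp_hom[OF category_Ste \<delta> \<pi>[OF i]] \<psi>[OF i]])
      fix x assume x: "x \<in> carrier D"
      show "map_of_arrow (\<pi> i \<cdot>\<^bsub>Ste\<^esub> \<delta>) x = map_of_arrow (\<psi> i) x"
        unfolding comp_Ste_apply[OF \<delta> x] using x i by (simp add: \<delta>_def \<pi>_app qE dq)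
    qed
    then show "\<exists>\<delta>\<in>Hom Ste D L. \<forall>i\<in>I. \<pi> i \<cdot>\<^bsub>Ste\<^esub> \<delta> = \<psi> i" using \<delta> by blast
  qed
qed

section \<open>Pullbacks, equalizers and intersections\<close>

lemma continuous_map_coordinate:
  "i \<in> I \<Longrightarrow> continuous_map (X i) Z f \<Longrightarrow> continuous_map (product_topology X I) Z (\<lambda>b. f (b i))"
  using continuous_map_compose[OF continuous_map_product_projection[of i I X], of Z f] by (simp add: o_def)

text \<open>Each tuple in \<open>K\<close> is an equation between values of two coordinates.
  Pullbacks, equalizers and intersections are solution sets of such systems, and the empty system
  gives products.\<close>

lemma equational_closed_subalgebra:
  assumes B: "\<And>i. i \<in> I \<Longrightarrow> B i \<in> ste_objects"
    and K: "\<And>i f j g. (i, f, j, g) \<in> K \<Longrightarrow> i \<in> I \<and> j \<in> I \<and> (\<exists>Z. f \<in> Hom Ste (B i) Z \<and> g \<in> Hom Ste (B j) Z)"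
    and P: "P = {b \<in> \<Pi>\<^sub>E i\<in>I. carrier (B i). \<forall>(i, f, j, g)\<in>K. map_of_arrow f (b i) = map_of_arrow g (b j)}"
  shows "closedin (product_topology (\<lambda>i. topol (B i)) I) P" "subalgebra_PiE I B P"
proof -
  let ?T = "product_topology (\<lambda>i. topol (B i)) I"
  have ts: "topspace ?T = (\<Pi>\<^sub>E i\<in>I. carrier (B i))"
    using B ste_topspace by (auto simp: topspace_product_topology intro!: PiE_cong)
  have "closedin ?T {b \<in> topspace ?T. \<forall>k\<in>K. case k of (i, f, j, g) \<Rightarrow> map_of_arrow f (b i) = map_of_arrow g (b j)}"
  proof (rule closedin_Collect_ball)
    fix k assume "k \<in> K"
    then obtain i f j g where k: "k = (i, f, j, g)" "(i, f, j, g) \<in> K" by (cases k) auto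
    obtain Z where Z: "i \<in> I" "j \<in> I" "f \<in> Hom Ste (B i) Z" "g \<in> Hom Ste (B j) Z" using K[OF k(2)] by blast
    have "continuous_map ?T (topol Z) (\<lambda>b. map_of_arrow f (b i))"
      using Z(1) Hom_continuous[OF Z(3)] by (rule continuous_map_coordinate)
    moreover have "continuous_map ?T (topol Z) (\<lambda>b. map_of_arrow g (b j))"
      using Z(2) Hom_continuous[OF Z(4)] by (rule continuous_map_coordinate)
    ultimately have "closedin ?T {b \<in> topspace ?T. map_of_arrow f (b i) = map_of_arrow g (b j)}"
      by (rule closedin_continuous_maps_eq[OF ste_Hausdorff[OF Hom_objects(2)[OF Z(3)]]])
    then show "closedin ?T {b \<in> topspace ?T. case k of (i, f, j, g) \<Rightarrow> map_of_arrow f (b i) = map_of_arrow g (b j)}"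
      unfolding k by simp
  qed
  then show "closedin ?T P" unfolding ts P .
  show "subalgebra_PiE I B P"
    unfolding subalgebra_PiE_def
  proof (intro conjI ballI allI)
    have PiP: "(\<lambda>i\<in>I. w i) \<in> P"
      if "\<And>i. i \<in> I \<Longrightarrow> w i \<in> carrier (B i)"
        "\<And>i f j g Z. (i, f, j, g) \<in> K \<Longrightarrow> i \<in> I \<Longrightarrow> j \<in> I \<Longrightarrow> f \<in> Hom Ste (B i) Z \<Longrightarrow> g \<in> Hom Ste (B j) Z \<Longrightarrow>
          map_of_arrow f (w i) = map_of_arrow g (w j)" for w
    proof -
      have "map_of_arrow f ((\<lambda>i\<in>I. w i) i) = map_of_arrow g ((\<lambda>i\<in>I. w i) j)" if k: "(i, f, j, g) \<in> K" for i f j g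
        using K[OF k] \<open>\<And>i f j g Z. (i, f, j, g) \<in> K \<Longrightarrow> i \<in> I \<Longrightarrow> j \<in> I \<Longrightarrow> f \<in> Hom Ste (B i) Z \<Longrightarrow> g \<in> Hom Ste (B j) Z \<Longrightarrow>
          map_of_arrow f (w i) = map_of_arrow g (w j)\<close>[OF k] by auto
      then show ?thesis unfolding P using \<open>\<And>i. i \<in> I \<Longrightarrow> w i \<in> carrier (B i)\<close> by auto
    qed
    have mem: "x i \<in> carrier (B i)" if "x \<in> P" "i \<in> I" for x i
      using that unfolding P by (auto simp: PiE_def)
    have eq: "map_of_arrow f (x i) = map_of_arrow g (x j)" if "x \<in> P" "(i, f, j, g) \<in> K" for x i f j g
      using that unfolding P by fast
    show "P \<subseteq> (\<Pi>\<^sub>E i\<in>I. carrier (B i))" unfolding P by blast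
    show "(\<lambda>i\<in>I. \<zero>\<^bsub>B i\<^esub>) \<in> P"
    proof (rule PiP)
      show "\<zero>\<^bsub>B i\<^esub> \<in> carrier (B i)" if i: "i \<in> I" for i
        using ring.ring_simprules(2)[OF ste_object_ring[OF B[OF i]]] .
      fix i f j g Z assume k: "(i, f, j, g) \<in> K" and i: "i \<in> I" and j: "j \<in> I"
        and f: "f \<in> Hom Ste (B i) Z" and g: "g \<in> Hom Ste (B j) Z"
      show "map_of_arrow f (\<zero>\<^bsub>B i\<^esub>) = map_of_arrow g (\<zero>\<^bsub>B j\<^esub>)"
        unfolding Hom_zero[OF f] Hom_zero[OF g] by (rule refl)
    qed
    show "(\<lambda>i\<in>I. \<one>\<^bsub>B i\<^esub>) \<in> P"
    proof (rule PiP)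
      show "\<one>\<^bsub>B i\<^esub> \<in> carrier (B i)" if i: "i \<in> I" for i
        using ring.ring_simprules(6)[OF ste_object_ring[OF B[OF i]]] .
      fix i f j g Z assume k: "(i, f, j, g) \<in> K" and i: "i \<in> I" and j: "j \<in> I"
        and f: "f \<in> Hom Ste (B i) Z" and g: "g \<in> Hom Ste (B j) Z"
      show "map_of_arrow f (\<one>\<^bsub>B i\<^esub>) = map_of_arrow g (\<one>\<^bsub>B j\<^esub>)"
        unfolding Hom_one[OF f] Hom_one[OF g] by (rule refl)
    qed
    fix x assume x: "x \<in> P"
    show "(\<lambda>i\<in>I. c \<odot>\<^bsub>B i\<^esub> x i) \<in> P" for c
    proof (rule PiP)
      show "c \<odot>\<^bsub>B i\<^esub> x i \<in> carrier (B i)" if i: "i \<in> I" for i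
      proof -
        interpret stereo "B i" using ste_object_stereo[OF B[OF i]] .
        show ?thesis using mem[OF x i] by (rule csmult_closed)
      qed
    next
      fix i f j g Z assume k: "(i, f, j, g) \<in> K" and i: "i \<in> I" and j: "j \<in> I"
        and f: "f \<in> Hom Ste (B i) Z" and g: "g \<in> Hom Ste (B j) Z"
      show "map_of_arrow f (c \<odot>\<^bsub>B i\<^esub> x i) = map_of_arrow g (c \<odot>\<^bsub>B j\<^esub> x j)"
        unfolding Hom_smult[OF f mem[OF x i]] Hom_smult[OF g mem[OF x j]] eq[OF x k] by (rule refl)
    qed
    fix y assume y: "y \<in> P"
    show "(\<lambda>i\<in>I. x i \<oplus>\<^bsub>B i\<^esub> y i) \<in> P"
    proof (rule PiP)
      show "x i \<oplus>\<^bsub>B i\<^esub> y i \<in> carrier (B i)" if i: "i \<in> I" for i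
        using ring.ring_simprules(1)[OF ste_object_ring[OF B[OF i]] mem[OF x i] mem[OF y i]] .
    next
      fix i f j g Z assume k: "(i, f, j, g) \<in> K" and i: "i \<in> I" and j: "j \<in> I"
        and f: "f \<in> Hom Ste (B i) Z" and g: "g \<in> Hom Ste (B j) Z"
      show "map_of_arrow f (x i \<oplus>\<^bsub>B i\<^esub> y i) = map_of_arrow g (x j \<oplus>\<^bsub>B j\<^esub> y j)"
        unfolding Hom_add[OF f mem[OF x i] mem[OF y i]] Hom_add[OF g mem[OF x j] mem[OF y j]] eq[OF x k] eq[OF y k] by (rule refl)
    qed
    show "(\<lambda>i\<in>I. x i \<otimes>\<^bsub>B i\<^esub> y i) \<in> P"
    proof (rule PiP)
      show "x i \<otimes>\<^bsub>B i\<^esub> y i \<in> carrier (B i)" if i: "i \<in> I" for i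
        using ring.ring_simprules(5)[OF ste_object_ring[OF B[OF i]] mem[OF x i] mem[OF y i]] .
    next
      fix i f j g Z assume k: "(i, f, j, g) \<in> K" and i: "i \<in> I" and j: "j \<in> I"
        and f: "f \<in> Hom Ste (B i) Z" and g: "g \<in> Hom Ste (B j) Z"
      show "map_of_arrow f (x i \<otimes>\<^bsub>B i\<^esub> y i) = map_of_arrow g (x j \<otimes>\<^bsub>B j\<^esub> y j)"
        unfolding Hom_mult[OF f mem[OF x i] mem[OF y i]] Hom_mult[OF g mem[OF x j] mem[OF y j]] eq[OF x k] eq[OF y k] by (rule refl)
    qed
  qed
qed

lemma ste_equational_limit:
  fixes B :: "'i \<Rightarrow> 'u top_module"
  assumes "\<And>i. i \<in> I \<Longrightarrow> B i \<in> ste_objects"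
    and "\<And>i f j g. (i, f, j, g) \<in> K \<Longrightarrow> i \<in> I \<and> j \<in> I \<and> (\<exists>Z. f \<in> Hom Ste (B i) Z \<and> g \<in> Hom Ste (B j) Z)"
    and "P = {b \<in> \<Pi>\<^sub>E i\<in>I. carrier (B i). \<forall>(i, f, j, g)\<in>K. map_of_arrow f (b i) = map_of_arrow g (b j)}"
    and "small TYPE('u) P"
  shows "\<exists>L \<pi>. is_limit I B P L \<pi>"
  using assms by (intro ste_limit_exists equational_closed_subalgebra[of I B K P])

interpretation Ste: category Ste by (rule category_Ste)

lemma small_carrier: "X \<in> ste_objects \<Longrightarrow> small TYPE('u) (carrier (X :: 'u top_module))"
  unfolding ste_objects_def by simp

context universe
begin

text \<open>Besides the universal property the statement records the elements of \<open>R\<close>: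
  \<open>Monos_inj\<close> needs one over every pair with equal images, and
  \<open>ste_pullback_mono\<close> needs them to be determined by such pairs.\<close>

lemma ste_pullback:
  fixes f g :: "'u ste_arrow"
  assumes f: "f \<in> Hom Ste X Z" and g: "g \<in> Hom Ste Y Z"
  shows "\<exists>R p q. p \<in> Hom Ste R X \<and> q \<in> Hom Ste R Y \<and> f \<cdot>\<^bsub>Ste\<^esub> p = g \<cdot>\<^bsub>Ste\<^esub> q \<and>
    (\<forall>x\<in>carrier X. \<forall>y\<in>carrier Y. map_of_arrow f x = map_of_arrow g y \<longrightarrow>
      (\<exists>r\<in>carrier R. map_of_arrow p r = x \<and> map_of_arrow q r = y)) \<and>
    (\<forall>r\<in>carrier R. \<forall>s\<in>carrier R. map_of_arrow p r = map_of_arrow p s \<longrightarrow>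
      map_of_arrow q r = map_of_arrow q s \<longrightarrow> r = s) \<and>
    (\<forall>W a b. a \<in> Hom Ste W X \<longrightarrow> b \<in> Hom Ste W Y \<longrightarrow> f \<cdot>\<^bsub>Ste\<^esub> a = g \<cdot>\<^bsub>Ste\<^esub> b \<longrightarrow>
      (\<exists>t\<in>Hom Ste W R. p \<cdot>\<^bsub>Ste\<^esub> t = a \<and> q \<cdot>\<^bsub>Ste\<^esub> t = b))"
proof -
  let ?B = "\<lambda>c. if c then X else Y" and ?K = "{(True, f, False, g)}"
  define P where "P = {b \<in> \<Pi>\<^sub>E i\<in>UNIV. carrier (?B i). \<forall>(i, f, j, g)\<in>?K. map_of_arrow f (b i) = map_of_arrow g (b j)}"
  have B: "?B i \<in> ste_objects" for i using Hom_objects[OF f] Hom_objects[OF g] by simp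
  have K: "i \<in> UNIV \<and> j \<in> UNIV \<and> (\<exists>Z. f' \<in> Hom Ste (?B i) Z \<and> g' \<in> Hom Ste (?B j) Z)"
    if "(i, f', j, g') \<in> ?K" for i f' j g' using that f g by auto
  have "small TYPE('u) (\<Pi>\<^sub>E i\<in>UNIV. carrier (?B i))"
    using B by (intro small_PiE small_finite small_carrier) auto
  then have sm: "small TYPE('u) P" unfolding P_def by (rule small_subset) blast
  obtain R \<pi> where lim: "is_limit UNIV ?B P R \<pi>"
  proof -
    have "\<exists>L \<pi>. is_limit UNIV ?B P L \<pi>"
      by (rule ste_equational_limit[OF _ _ P_def sm]) (rule B, erule K)
    then show thesis using that by blast
  qed
  have p: "\<pi> True \<in> Hom Ste R X" and q: "\<pi> False \<in> Hom Ste R Y" using is_limit_proj[OF lim, of True] is_limit_proj[OF lim, of False] by auto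
  show ?thesis
  proof (rule exI[of _ R], rule exI[of _ "\<pi> True"], rule exI[of _ "\<pi> False"], intro conjI p q ballI allI impI)
    show "f \<cdot>\<^bsub>Ste\<^esub> \<pi> True = g \<cdot>\<^bsub>Ste\<^esub> \<pi> False"
    proof (rule Ste_arrow_eqI[OF Ste.comp_hom[OF p f] Ste.comp_hom[OF q g]])
      fix x assume x: "x \<in> carrier R"
      then have "(\<lambda>i\<in>UNIV. map_of_arrow (\<pi> i) x) \<in> P" by (rule is_limit_mem[OF lim])
      then show "map_of_arrow (f \<cdot>\<^bsub>Ste\<^esub> \<pi> True) x = map_of_arrow (g \<cdot>\<^bsub>Ste\<^esub> \<pi> False) x"
        unfolding comp_Ste_apply[OF p x] comp_Ste_apply[OF q x] P_def by simp
    qed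
  next
    fix x y assume xy: "x \<in> carrier X" "y \<in> carrier Y" "map_of_arrow f x = map_of_arrow g y"
    then have "(\<lambda>i\<in>UNIV. if i then x else y) \<in> P" unfolding P_def by auto
    then obtain r where r: "(\<lambda>i\<in>UNIV. if i then x else y) = (\<lambda>i\<in>UNIV. map_of_arrow (\<pi> i) r)" "r \<in> carrier R"
      using is_limit_surj[OF lim] by blast
    show "\<exists>r\<in>carrier R. map_of_arrow (\<pi> True) r = x \<and> map_of_arrow (\<pi> False) r = y"
      using r(2) fun_cong[OF r(1), of True] fun_cong[OF r(1), of False] by (intro bexI[of _ r]) simp_all
  next
    fix r s assume rs: "r \<in> carrier R" "s \<in> carrier R"
      and eq: "map_of_arrow (\<pi> True) r = map_of_arrow (\<pi> True) s" "map_of_arrow (\<pi> False) r = map_of_arrow (\<pi> False) s"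
    show "r = s"
    proof (rule is_limit_inj[OF lim rs])
      show "map_of_arrow (\<pi> i) r = map_of_arrow (\<pi> i) s" for i using eq by (cases i) simp_all
    qed
  next
    fix W a b assume a: "a \<in> Hom Ste W X" and b: "b \<in> Hom Ste W Y" and eq: "f \<cdot>\<^bsub>Ste\<^esub> a = g \<cdot>\<^bsub>Ste\<^esub> b"
    have "\<exists>\<delta>\<in>Hom Ste W R. \<forall>i\<in>UNIV. \<pi> i \<cdot>\<^bsub>Ste\<^esub> \<delta> = (if i then a else b)"
    proof (rule is_limit_universal[OF lim])
      show "W \<in> ste_objects" by (rule Hom_objects(1)[OF a])
      show "(if i then a else b) \<in> Hom Ste W (?B i)" for i using a b by simp
      fix x assume x: "x \<in> carrier W"
      have "map_of_arrow f (map_of_arrow a x) = map_of_arrow g (map_of_arrow b x)"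
        using comp_Ste_apply[OF a x, of f] comp_Ste_apply[OF b x, of g] eq by simp
      then show "(\<lambda>i\<in>UNIV. map_of_arrow (if i then a else b) x) \<in> P"
        unfolding P_def using Hom_closed[OF a x] Hom_closed[OF b x] by auto
    qed
    then obtain t where t: "t \<in> Hom Ste W R" "\<forall>i\<in>UNIV. \<pi> i \<cdot>\<^bsub>Ste\<^esub> t = (if i then a else b)" by (rule bexE)
    show "\<exists>t\<in>Hom Ste W R. \<pi> True \<cdot>\<^bsub>Ste\<^esub> t = a \<and> \<pi> False \<cdot>\<^bsub>Ste\<^esub> t = b"
      using t(1) bspec[OF t(2), of True] bspec[OF t(2), of False] by (intro bexI[of _ t]) simp_all
  qed
qed

lemma inj_imp_Monos:
  assumes f: "f \<in> Hom Ste X Y" and inj: "inj_on (map_of_arrow f) (carrier X)"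
  shows "f \<in> Monos Ste"
  unfolding Monos_def
proof (intro CollectI conjI allI ballI impI)
  have s: "source f = X" using f unfolding Hom_Ste_iff by simp
  show "f \<in> Mor Ste" using f unfolding Hom_def by simp
  fix W a b assume "a \<in> Hom Ste W (Dom Ste f)" "b \<in> Hom Ste W (Dom Ste f)" and eq: "f \<cdot>\<^bsub>Ste\<^esub> a = f \<cdot>\<^bsub>Ste\<^esub> b"
  then have a: "a \<in> Hom Ste W X" and b: "b \<in> Hom Ste W X" using s by auto
  show "a = b"
  proof (rule Ste_arrow_eqI[OF a b])
    fix x assume x: "x \<in> carrier W"
    have "map_of_arrow f (map_of_arrow a x) = map_of_arrow f (map_of_arrow b x)"
      using comp_Ste_apply[OF a x, of f] comp_Ste_apply[OF b x, of f] eq by simp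
    then show "map_of_arrow a x = map_of_arrow b x"
      using inj Hom_closed[OF a x] Hom_closed[OF b x] by (meson inj_onD)
  qed
qed

text \<open>The kernel pair of a monomorphism consists of two equal projections.\<close>

lemma Monos_inj:
  fixes f :: "'u ste_arrow"
  assumes "f \<in> Monos Ste" shows "inj_on (map_of_arrow f) (carrier (source f))"
proof (rule inj_onI)
  have f: "f \<in> Hom Ste (source f) (target f)" using assms unfolding Monos_def Hom_def by simp
  fix x y assume xy: "x \<in> carrier (source f)" "y \<in> carrier (source f)" "map_of_arrow f x = map_of_arrow f y"
  obtain R p q where p: "p \<in> Hom Ste R (source f)" "q \<in> Hom Ste R (source f)" "f \<cdot>\<^bsub>Ste\<^esub> p = f \<cdot>\<^bsub>Ste\<^esub> q"
    and ex: "\<forall>x\<in>carrier (source f). \<forall>y\<in>carrier (source f). map_of_arrow f x = map_of_arrow f y \<longrightarrow>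
      (\<exists>r\<in>carrier R. map_of_arrow p r = x \<and> map_of_arrow q r = y)"
    using ste_pullback[OF f f] by (elim exE conjE)
  have "p = q" using assms p unfolding Monos_def by auto
  then show "x = y" using ex xy by blast
qed

lemma ste_pullback_mono:
  fixes f g :: "'u ste_arrow"
  assumes f: "f \<in> Hom Ste X Z" and g: "g \<in> Hom Ste Y Z" and mono: "g \<in> Monos Ste"
  shows "\<exists>R p q. p \<in> Hom Ste R X \<and> q \<in> Hom Ste R Y \<and> p \<in> Monos Ste \<and> f \<cdot>\<^bsub>Ste\<^esub> p = g \<cdot>\<^bsub>Ste\<^esub> q \<and>
    (\<forall>W a b. a \<in> Hom Ste W X \<longrightarrow> b \<in> Hom Ste W Y \<longrightarrow> f \<cdot>\<^bsub>Ste\<^esub> a = g \<cdot>\<^bsub>Ste\<^esub> b \<longrightarrow>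
      (\<exists>t\<in>Hom Ste W R. p \<cdot>\<^bsub>Ste\<^esub> t = a \<and> q \<cdot>\<^bsub>Ste\<^esub> t = b))"
proof -
  obtain R p q where p: "p \<in> Hom Ste R X" and q: "q \<in> Hom Ste R Y" and eq: "f \<cdot>\<^bsub>Ste\<^esub> p = g \<cdot>\<^bsub>Ste\<^esub> q"
    and inj: "\<forall>r\<in>carrier R. \<forall>s\<in>carrier R. map_of_arrow p r = map_of_arrow p s \<longrightarrow>
      map_of_arrow q r = map_of_arrow q s \<longrightarrow> r = s"
    and univ: "\<forall>W a b. a \<in> Hom Ste W X \<longrightarrow> b \<in> Hom Ste W Y \<longrightarrow> f \<cdot>\<^bsub>Ste\<^esub> a = g \<cdot>\<^bsub>Ste\<^esub> b \<longrightarrow>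
      (\<exists>t\<in>Hom Ste W R. p \<cdot>\<^bsub>Ste\<^esub> t = a \<and> q \<cdot>\<^bsub>Ste\<^esub> t = b)"
    using ste_pullback[OF f g] by (elim exE conjE)
  have gi: "inj_on (map_of_arrow g) (carrier Y)" using Monos_inj[OF mono] g by (simp add: Hom_Ste_iff)
  have "inj_on (map_of_arrow p) (carrier R)"
  proof (rule inj_onI)
    fix r s assume rs: "r \<in> carrier R" "s \<in> carrier R" and prs: "map_of_arrow p r = map_of_arrow p s"
    have "map_of_arrow g (map_of_arrow q x) = map_of_arrow f (map_of_arrow p x)" if "x \<in> carrier R" for x
      using comp_Ste_apply[OF p that, of f] comp_Ste_apply[OF q that, of g] eq by simp
    then have "map_of_arrow g (map_of_arrow q r) = map_of_arrow g (map_of_arrow q s)" using rs prs by simp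
    then have "map_of_arrow q r = map_of_arrow q s" by (rule inj_onD[OF gi _ Hom_closed[OF q rs(1)] Hom_closed[OF q rs(2)]])
    then show "r = s" using inj rs prs by blast
  qed
  then have "p \<in> Monos Ste" by (rule inj_imp_Monos[OF p])
  then show ?thesis using p q eq univ by (intro exI conjI)
qed

lemma ste_equalizer:
  fixes f g :: "'u ste_arrow"
  assumes f: "f \<in> Hom Ste X Y" and g: "g \<in> Hom Ste X Y"
  shows "\<exists>K e. e \<in> Hom Ste K X \<and> e \<in> Monos Ste \<and> f \<cdot>\<^bsub>Ste\<^esub> e = g \<cdot>\<^bsub>Ste\<^esub> e \<and>
    (\<forall>W a. a \<in> Hom Ste W X \<longrightarrow> f \<cdot>\<^bsub>Ste\<^esub> a = g \<cdot>\<^bsub>Ste\<^esub> a \<longrightarrow> (\<exists>t\<in>Hom Ste W K. e \<cdot>\<^bsub>Ste\<^esub> t = a))"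
proof -
  let ?K = "{((), f, (), g)}"
  define P where "P = {b \<in> \<Pi>\<^sub>E i\<in>UNIV. carrier X. \<forall>(i, f, j, g)\<in>?K. map_of_arrow f (b i) = map_of_arrow g (b j)}"
  have B: "X \<in> ste_objects" using Hom_objects[OF f] by simp
  have K: "i \<in> UNIV \<and> j \<in> UNIV \<and> (\<exists>Z. f' \<in> Hom Ste X Z \<and> g' \<in> Hom Ste X Z)"
    if "(i, f', j, g') \<in> ?K" for i f' j g' using that f g by auto
  have "small TYPE('u) (\<Pi>\<^sub>E i\<in>(UNIV :: unit set). carrier X)"
    using B by (intro small_PiE small_finite small_carrier) auto
  then have sm: "small TYPE('u) P" unfolding P_def by (rule small_subset) blast
  obtain L \<pi> where lim: "is_limit UNIV (\<lambda>_. X) P L \<pi>"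
  proof -
    have "\<exists>L \<pi>. is_limit UNIV (\<lambda>_. X) P L \<pi>"
      by (rule ste_equational_limit[OF _ _ P_def sm]) (rule B, erule K)
    then show thesis using that by blast
  qed
  have e: "\<pi> () \<in> Hom Ste L X" using is_limit_proj[OF lim, of "()"] by simp
  show ?thesis
  proof (intro exI[of _ L] exI[of _ "\<pi> ()"] conjI e allI impI)
    have "inj_on (map_of_arrow (\<pi> ())) (carrier L)"
    proof (rule inj_onI)
      fix x y assume xy: "x \<in> carrier L" "y \<in> carrier L" "map_of_arrow (\<pi> ()) x = map_of_arrow (\<pi> ()) y"
      show "x = y" by (rule is_limit_inj[OF lim xy(1,2)]) (simp add: xy(3))
    qed
    then show "\<pi> () \<in> Monos Ste" by (rule inj_imp_Monos[OF e])
    show "f \<cdot>\<^bsub>Ste\<^esub> \<pi> () = g \<cdot>\<^bsub>Ste\<^esub> \<pi> ()"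
    proof (rule Ste_arrow_eqI[OF Ste.comp_hom[OF e f] Ste.comp_hom[OF e g]])
      fix x assume x: "x \<in> carrier L"
      then have "(\<lambda>i\<in>UNIV. map_of_arrow (\<pi> i) x) \<in> P" by (rule is_limit_mem[OF lim])
      then show "map_of_arrow (f \<cdot>\<^bsub>Ste\<^esub> \<pi> ()) x = map_of_arrow (g \<cdot>\<^bsub>Ste\<^esub> \<pi> ()) x"
        unfolding comp_Ste_apply[OF e x] P_def by simp
    qed
    fix W a assume a: "a \<in> Hom Ste W X" and eq: "f \<cdot>\<^bsub>Ste\<^esub> a = g \<cdot>\<^bsub>Ste\<^esub> a"
    have "\<exists>\<delta>\<in>Hom Ste W L. \<forall>i\<in>UNIV. \<pi> i \<cdot>\<^bsub>Ste\<^esub> \<delta> = a"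
    proof (rule is_limit_universal[OF lim])
      show "W \<in> ste_objects" by (rule Hom_objects(1)[OF a])
      show "a \<in> Hom Ste W X" by (rule a)
      fix x assume x: "x \<in> carrier W"
      have "map_of_arrow f (map_of_arrow a x) = map_of_arrow g (map_of_arrow a x)"
        using comp_Ste_apply[OF a x, of f] comp_Ste_apply[OF a x, of g] eq by simp
      then show "(\<lambda>i\<in>UNIV. map_of_arrow a x) \<in> P"
        unfolding P_def using Hom_closed[OF a x] by auto
    qed
    then show "\<exists>t\<in>Hom Ste W L. \<pi> () \<cdot>\<^bsub>Ste\<^esub> t = a" by blast
  qed
qed

text \<open>The identity of \<open>A\<close> is adjoined as an index, whose coordinate is the common
  image in \<open>A\<close>. Since all arrows involved are injective, this coordinate determines the
  whole family, so a proper class \<open>M\<close> causes no problem of size.\<close>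

lemma ste_intersection:
  fixes A :: "'u top_module"
  assumes A: "A \<in> ste_objects" and M: "M \<subseteq> Monos Ste" "\<And>\<sigma>. \<sigma> \<in> M \<Longrightarrow> target \<sigma> = A"
  shows "\<exists>E \<rho>. \<rho> \<in> Hom Ste E A \<and> \<rho> \<in> Monos Ste \<and>
    (\<forall>\<sigma>\<in>M. \<exists>\<upsilon>\<in>Hom Ste E (source \<sigma>). \<sigma> \<cdot>\<^bsub>Ste\<^esub> \<upsilon> = \<rho>) \<and>
    (\<forall>Q \<beta>. \<beta> \<in> Hom Ste Q A \<longrightarrow> (\<forall>\<sigma>\<in>M. \<exists>\<delta>\<in>Hom Ste Q (source \<sigma>). \<sigma> \<cdot>\<^bsub>Ste\<^esub> \<delta> = \<beta>) \<longrightarrow>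
      (\<exists>\<delta>\<in>Hom Ste Q E. \<rho> \<cdot>\<^bsub>Ste\<^esub> \<delta> = \<beta>))"
proof -
  let ?id = "Id Ste A"
  define I where "I = insert ?id M"
  have id: "?id \<in> Hom Ste A A" using Ste.id_hom[of A] A by simp
  have id_app: "map_of_arrow ?id x = x" if "x \<in> carrier A" for x using that by (simp add: Ste_def)
  have IH: "\<sigma> \<in> Hom Ste (source \<sigma>) A" if "\<sigma> \<in> I" for \<sigma>
    using that id M unfolding I_def Monos_def Mor_Ste_Hom by (auto simp: Hom_Ste_iff)
  have inj: "inj_on (map_of_arrow \<sigma>) (carrier (source \<sigma>))" if "\<sigma> \<in> I" for \<sigma>
    using that M(1) Monos_inj id_app id unfolding I_def by (auto simp: Hom_Ste_iff inj_on_def)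
  have idI: "?id \<in> I" and sid: "source ?id = A" using id unfolding I_def Hom_Ste_iff by auto
  let ?K = "(\<lambda>\<sigma>. (\<sigma>, \<sigma>, ?id, ?id)) ` I"
  define P where "P = {b \<in> \<Pi>\<^sub>E \<sigma>\<in>I. carrier (source \<sigma>). \<forall>(i, f, j, g)\<in>?K. map_of_arrow f (b i) = map_of_arrow g (b j)}"
  have P: "b \<in> P \<longleftrightarrow> b \<in> (\<Pi>\<^sub>E \<sigma>\<in>I. carrier (source \<sigma>)) \<and> (\<forall>\<sigma>\<in>I. map_of_arrow \<sigma> (b \<sigma>) = b ?id)" for b
  proof -
    have "map_of_arrow ?id (b ?id) = b ?id" if "b \<in> (\<Pi>\<^sub>E \<sigma>\<in>I. carrier (source \<sigma>))"
      using PiE_mem[OF that idI] sid id_app by simp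
    then show ?thesis unfolding P_def by auto
  qed
  have B: "source i \<in> ste_objects" if "i \<in> I" for i using Hom_objects(1)[OF IH[OF that]] .
  have K: "i \<in> I \<and> j \<in> I \<and> (\<exists>Z. f' \<in> Hom Ste (source i) Z \<and> g' \<in> Hom Ste (source j) Z)"
    if "(i, f', j, g') \<in> ?K" for i f' j g' using that IH idI by auto
  have sm: "small TYPE('u) P"
  proof (rule small_inj_on)
    show "inj_on (\<lambda>b. b ?id) P"
    proof (rule inj_onI)
      fix b c assume b: "b \<in> P" and c: "c \<in> P" and eq: "b ?id = c ?id"
      show "b = c"
      proof (rule PiE_ext)
        show "b \<in> (\<Pi>\<^sub>E \<sigma>\<in>I. carrier (source \<sigma>))" "c \<in> (\<Pi>\<^sub>E \<sigma>\<in>I. carrier (source \<sigma>))" using b c P by auto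
        fix \<sigma> assume s: "\<sigma> \<in> I"
        have "map_of_arrow \<sigma> (b \<sigma>) = map_of_arrow \<sigma> (c \<sigma>)" using b c s eq unfolding P by simp
        moreover have "b \<sigma> \<in> carrier (source \<sigma>)" "c \<sigma> \<in> carrier (source \<sigma>)" using b c s unfolding P by auto
        ultimately show "b \<sigma> = c \<sigma>" using inj[OF s] by (meson inj_onD)
      qed
    qed
    show "(\<lambda>b. b ?id) ` P \<subseteq> carrier A"
    proof
      fix x assume "x \<in> (\<lambda>b. b ?id) ` P"
      then obtain b where "b \<in> P" "x = b ?id" by blast
      then show "x \<in> carrier A" using PiE_mem[of b I "\<lambda>\<sigma>. carrier (source \<sigma>)", OF _ idI] sid unfolding P by auto
    qed
    show "small TYPE('u) (carrier A)" by (rule small_carrier[OF A])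
  qed
  obtain E \<pi> where lim: "is_limit I source P E \<pi>"
  proof -
    have "\<exists>L \<pi>. is_limit I source P L \<pi>"
      by (rule ste_equational_limit[OF _ _ P_def sm]) (erule B, erule K)
    then show thesis using that by blast
  qed
  note \<pi> = is_limit_proj[OF lim]
  have \<rho>: "\<pi> ?id \<in> Hom Ste E A" using \<pi>[OF idI] sid by simp
  note inP = is_limit_mem[OF lim]
  have \<pi>eq: "map_of_arrow \<sigma> (map_of_arrow (\<pi> \<sigma>) x) = map_of_arrow (\<pi> ?id) x" if "x \<in> carrier E" "\<sigma> \<in> I" for x \<sigma>
    using inP[OF that(1)] that(2) idI unfolding P by simp
  have \<rho>inj: "inj_on (map_of_arrow (\<pi> ?id)) (carrier E)"
  proof (rule inj_onI)
    fix x y assume xy: "x \<in> carrier E" "y \<in> carrier E" "map_of_arrow (\<pi> ?id) x = map_of_arrow (\<pi> ?id) y"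
    have "map_of_arrow (\<pi> \<sigma>) x = map_of_arrow (\<pi> \<sigma>) y" if s: "\<sigma> \<in> I" for \<sigma>
      using \<pi>eq[OF xy(1) s] \<pi>eq[OF xy(2) s] xy(3) inj[OF s] Hom_closed[OF \<pi>[OF s]] xy(1,2) by (metis inj_onD)
    then show "x = y" by (rule is_limit_inj[OF lim xy(1,2)])
  qed
  show ?thesis
  proof (intro exI[of _ E] exI[of _ "\<pi> ?id"] conjI \<rho> inj_imp_Monos[OF \<rho> \<rho>inj] ballI allI impI)
    fix \<sigma> assume "\<sigma> \<in> M"
    then have s: "\<sigma> \<in> I" unfolding I_def by simp
    have "\<sigma> \<cdot>\<^bsub>Ste\<^esub> \<pi> \<sigma> = \<pi> ?id"
    proof (rule Ste_arrow_eqI[OF Ste.comp_hom[OF \<pi>[OF s] IH[OF s]] \<rho>])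
      fix x assume x: "x \<in> carrier E"
      show "map_of_arrow (\<sigma> \<cdot>\<^bsub>Ste\<^esub> \<pi> \<sigma>) x = map_of_arrow (\<pi> ?id) x"
        unfolding comp_Ste_apply[OF \<pi>[OF s] x] by (rule \<pi>eq[OF x s])
    qed
    then show "\<exists>\<upsilon>\<in>Hom Ste E (source \<sigma>). \<sigma> \<cdot>\<^bsub>Ste\<^esub> \<upsilon> = \<pi> ?id" using \<pi>[OF s] by blast
  next
    fix Q \<beta> assume \<beta>: "\<beta> \<in> Hom Ste Q A" and ex: "\<forall>\<sigma>\<in>M. \<exists>\<delta>\<in>Hom Ste Q (source \<sigma>). \<sigma> \<cdot>\<^bsub>Ste\<^esub> \<delta> = \<beta>"
    have "?id \<cdot>\<^bsub>Ste\<^esub> \<beta> = \<beta>" by (rule Ste.comp_id_left[OF \<beta>])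
    then have "\<forall>\<sigma>\<in>I. \<exists>\<delta>\<in>Hom Ste Q (source \<sigma>). \<sigma> \<cdot>\<^bsub>Ste\<^esub> \<delta> = \<beta>"
      using ex \<beta> sid unfolding I_def by auto
    then obtain \<psi> where \<psi>: "\<And>\<sigma>. \<sigma> \<in> I \<Longrightarrow> \<psi> \<sigma> \<in> Hom Ste Q (source \<sigma>)" "\<And>\<sigma>. \<sigma> \<in> I \<Longrightarrow> \<sigma> \<cdot>\<^bsub>Ste\<^esub> \<psi> \<sigma> = \<beta>" by metis
    have \<psi>id: "\<psi> ?id = \<beta>" using \<psi>[OF idI] Ste.comp_id_left[of "\<psi> ?id" Q A] sid by simp
    have "\<exists>\<delta>\<in>Hom Ste Q E. \<forall>i\<in>I. \<pi> i \<cdot>\<^bsub>Ste\<^esub> \<delta> = \<psi> i"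
    proof (rule is_limit_universal[OF lim Hom_objects(1)[OF \<beta>] \<psi>(1)])
      fix x assume x: "x \<in> carrier Q"
      show "(\<lambda>i\<in>I. map_of_arrow (\<psi> i) x) \<in> P"
        unfolding P
      proof (intro conjI ballI)
        show "(\<lambda>i\<in>I. map_of_arrow (\<psi> i) x) \<in> (\<Pi>\<^sub>E \<sigma>\<in>I. carrier (source \<sigma>))"
          using Hom_closed[OF \<psi>(1) x] by simp
        fix \<sigma> assume s: "\<sigma> \<in> I"
        show "map_of_arrow \<sigma> ((\<lambda>i\<in>I. map_of_arrow (\<psi> i) x) \<sigma>) = (\<lambda>i\<in>I. map_of_arrow (\<psi> i) x) ?id"
          using comp_Ste_apply[OF \<psi>(1)[OF s] x, of \<sigma>] \<psi>(2)[OF s] \<psi>id s idI by simp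
      qed
    qed
    then show "\<exists>\<delta>\<in>Hom Ste Q E. \<pi> ?id \<cdot>\<^bsub>Ste\<^esub> \<delta> = \<beta>" using idI \<psi>id by metis
  qed
qed

end

section \<open>Joint factorizations\<close>

text \<open>\<open>P\<close> is left open, so that one construction covers both the full product
  over a small \<open>\<Psi>\<close> and the closure of the image of \<open>A\<close>. The price is
  the last condition on the competing family, that its values lie in \<open>P\<close>.\<close>

lemma joint_factorization:
  fixes A :: "'u top_module"
  assumes \<Psi>: "\<And>\<phi>. \<phi> \<in> \<Psi> \<Longrightarrow> \<phi> \<in> Hom Ste A (target \<phi>)" and A: "A \<in> ste_objects"
    and cl: "closedin (product_topology (\<lambda>\<phi>. topol (target \<phi>)) \<Psi>) P"
    and sub: "subalgebra_PiE \<Psi> target P" and sm: "small TYPE('u) P"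
    and im: "\<And>a. a \<in> carrier A \<Longrightarrow> (\<lambda>\<phi>\<in>\<Psi>. map_of_arrow \<phi> a) \<in> P"
  shows "\<exists>\<epsilon> E p. \<epsilon> \<in> Hom Ste A E \<and> is_limit \<Psi> target P E p \<and> (\<forall>\<phi>\<in>\<Psi>. p \<phi> \<cdot>\<^bsub>Ste\<^esub> \<epsilon> = \<phi>) \<and>
    (\<forall>X \<sigma> \<psi>. \<sigma> \<in> Hom Ste A X \<longrightarrow> (\<forall>\<phi>\<in>\<Psi>. \<psi> \<phi> \<in> Hom Ste X (target \<phi>)) \<longrightarrow>
      (\<forall>\<phi>\<in>\<Psi>. \<psi> \<phi> \<cdot>\<^bsub>Ste\<^esub> \<sigma> = \<phi>) \<longrightarrow>
      (\<forall>x\<in>carrier X. (\<lambda>\<phi>\<in>\<Psi>. map_of_arrow (\<psi> \<phi>) x) \<in> P) \<longrightarrow> (\<exists>\<delta>\<in>Hom Ste X E. \<delta> \<cdot>\<^bsub>Ste\<^esub> \<sigma> = \<epsilon>))"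
proof -
  obtain E p where lim: "is_limit \<Psi> target P E p"
  proof -
    have "\<exists>E p. is_limit \<Psi> target P E p"
      by (rule ste_limit_exists[OF _ cl sub sm]) (rule Hom_objects(2)[OF \<Psi>])
    then show thesis using that by blast
  qed
  note univ = is_limit_universal[OF lim]
  obtain \<epsilon> where \<epsilon>: "\<epsilon> \<in> Hom Ste A E" "\<And>\<phi>. \<phi> \<in> \<Psi> \<Longrightarrow> p \<phi> \<cdot>\<^bsub>Ste\<^esub> \<epsilon> = \<phi>"
    using univ[OF A \<Psi> im] by blast
  show ?thesis
  proof (intro exI[of _ \<epsilon>] exI[of _ E] exI[of _ p] conjI \<epsilon>(1) lim ballI \<epsilon>(2) allI impI)
    fix X \<sigma> \<psi> assume \<sigma>: "\<sigma> \<in> Hom Ste A X" and "\<forall>\<phi>\<in>\<Psi>. \<psi> \<phi> \<in> Hom Ste X (target \<phi>)"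
      "\<forall>\<phi>\<in>\<Psi>. \<psi> \<phi> \<cdot>\<^bsub>Ste\<^esub> \<sigma> = \<phi>" "\<forall>x\<in>carrier X. (\<lambda>\<phi>\<in>\<Psi>. map_of_arrow (\<psi> \<phi>) x) \<in> P"
    then have \<psi>: "\<And>\<phi>. \<phi> \<in> \<Psi> \<Longrightarrow> \<psi> \<phi> \<in> Hom Ste X (target \<phi>)"
      "\<And>\<phi>. \<phi> \<in> \<Psi> \<Longrightarrow> \<psi> \<phi> \<cdot>\<^bsub>Ste\<^esub> \<sigma> = \<phi>"
      "\<And>x. x \<in> carrier X \<Longrightarrow> (\<lambda>\<phi>\<in>\<Psi>. map_of_arrow (\<psi> \<phi>) x) \<in> P" by blast+
    obtain \<delta> where \<delta>: "\<delta> \<in> Hom Ste X E" "\<And>\<phi>. \<phi> \<in> \<Psi> \<Longrightarrow> p \<phi> \<cdot>\<^bsub>Ste\<^esub> \<delta> = \<psi> \<phi>"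
      using univ[OF Hom_objects(2)[OF \<sigma>] \<psi>(1,3)] by blast
    have "\<delta> \<cdot>\<^bsub>Ste\<^esub> \<sigma> = \<epsilon>"
    proof (rule Ste_arrow_eqI[OF Ste.comp_hom[OF \<sigma> \<delta>(1)] \<epsilon>(1)])
      fix a assume a: "a \<in> carrier A"
      have sa: "map_of_arrow \<sigma> a \<in> carrier X" by (rule Hom_closed[OF \<sigma> a])
      have eqp: "map_of_arrow (p \<phi>) (map_of_arrow (\<delta> \<cdot>\<^bsub>Ste\<^esub> \<sigma>) a) = map_of_arrow (p \<phi>) (map_of_arrow \<epsilon> a)"
        if f: "\<phi> \<in> \<Psi>" for \<phi>
        using comp_Ste_apply[OF \<sigma> a, of \<delta>] comp_Ste_apply[OF \<delta>(1) sa, of "p \<phi>"] \<delta>(2)[OF f]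
          comp_Ste_apply[OF \<sigma> a, of "\<psi> \<phi>"] \<psi>(2)[OF f] comp_Ste_apply[OF \<epsilon>(1) a, of "p \<phi>"] \<epsilon>(2)[OF f] by simp
      have mem: "map_of_arrow (\<delta> \<cdot>\<^bsub>Ste\<^esub> \<sigma>) a \<in> carrier E" "map_of_arrow \<epsilon> a \<in> carrier E"
        using Hom_closed[OF Ste.comp_hom[OF \<sigma> \<delta>(1)] a] Hom_closed[OF \<epsilon>(1) a] by auto
      show "map_of_arrow (\<delta> \<cdot>\<^bsub>Ste\<^esub> \<sigma>) a = map_of_arrow \<epsilon> a"
        by (rule is_limit_inj[OF lim mem]) (rule eqp)
    qed
    then show "\<exists>\<delta>\<in>Hom Ste X E. \<delta> \<cdot>\<^bsub>Ste\<^esub> \<sigma> = \<epsilon>" using \<delta>(1) by blast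
  qed
qed

text \<open>Here \<open>P\<close> is the whole product, the solution set of the empty system, so
  every competing family is admissible. Smallness of this product is the reason for assuming that
  \<open>\<Psi>\<close> is small.\<close>

lemma (in universe) small_joint_factorization:
  fixes A :: "'u top_module"
  assumes \<Psi>: "\<And>\<phi>. \<phi> \<in> \<Psi> \<Longrightarrow> \<phi> \<in> Hom Ste A (target \<phi>)" and A: "A \<in> ste_objects"
    and sm: "small TYPE('u) \<Psi>"
  shows "\<exists>E \<epsilon>. \<epsilon> \<in> Hom Ste A E \<and> (\<forall>\<phi>\<in>\<Psi>. \<exists>p\<in>Hom Ste E (target \<phi>). p \<cdot>\<^bsub>Ste\<^esub> \<epsilon> = \<phi>) \<and>
    (\<forall>X \<sigma>. \<sigma> \<in> Hom Ste A X \<longrightarrow> (\<forall>\<phi>\<in>\<Psi>. \<exists>\<psi>\<in>Hom Ste X (target \<phi>). \<psi> \<cdot>\<^bsub>Ste\<^esub> \<sigma> = \<phi>) \<longrightarrow>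
      (\<exists>\<delta>\<in>Hom Ste X E. \<delta> \<cdot>\<^bsub>Ste\<^esub> \<sigma> = \<epsilon>))"
proof -
  let ?P = "\<Pi>\<^sub>E \<phi>\<in>\<Psi>. carrier (target \<phi>)"
  have P: "?P = {b \<in> ?P. \<forall>(i, f, j, g)\<in>{}. map_of_arrow f (b i) = map_of_arrow g (b j)}" by simp
  have B: "target \<phi> \<in> ste_objects" if "\<phi> \<in> \<Psi>" for \<phi> using Hom_objects(2)[OF \<Psi>[OF that]] .
  have cs: "closedin (product_topology (\<lambda>\<phi>. topol (target \<phi>)) \<Psi>) ?P" "subalgebra_PiE \<Psi> target ?P"
    using equational_closed_subalgebra[OF B _ P] by simp_all
  have smP: "small TYPE('u) ?P" by (rule small_PiE[OF sm small_carrier[OF B]])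
  have "\<exists>\<epsilon> E p. \<epsilon> \<in> Hom Ste A E \<and> is_limit \<Psi> target ?P E p \<and> (\<forall>\<phi>\<in>\<Psi>. p \<phi> \<cdot>\<^bsub>Ste\<^esub> \<epsilon> = \<phi>) \<and>
    (\<forall>X \<sigma> \<psi>. \<sigma> \<in> Hom Ste A X \<longrightarrow> (\<forall>\<phi>\<in>\<Psi>. \<psi> \<phi> \<in> Hom Ste X (target \<phi>)) \<longrightarrow>
      (\<forall>\<phi>\<in>\<Psi>. \<psi> \<phi> \<cdot>\<^bsub>Ste\<^esub> \<sigma> = \<phi>) \<longrightarrow>
      (\<forall>x\<in>carrier X. (\<lambda>\<phi>\<in>\<Psi>. map_of_arrow (\<psi> \<phi>) x) \<in> ?P) \<longrightarrow> (\<exists>\<delta>\<in>Hom Ste X E. \<delta> \<cdot>\<^bsub>Ste\<^esub> \<sigma> = \<epsilon>))"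
  proof (rule joint_factorization[OF \<Psi> A cs smP])
    show "(\<lambda>\<phi>\<in>\<Psi>. map_of_arrow \<phi> a) \<in> ?P" if "a \<in> carrier A" for a using Hom_closed[OF \<Psi> that] by simp
  qed
  then obtain \<epsilon> E p where \<epsilon>: "\<epsilon> \<in> Hom Ste A E" and lim: "is_limit \<Psi> target ?P E p"
    and p\<epsilon>: "\<forall>\<phi>\<in>\<Psi>. p \<phi> \<cdot>\<^bsub>Ste\<^esub> \<epsilon> = \<phi>"
    and univ: "\<forall>X \<sigma> \<psi>. \<sigma> \<in> Hom Ste A X \<longrightarrow> (\<forall>\<phi>\<in>\<Psi>. \<psi> \<phi> \<in> Hom Ste X (target \<phi>)) \<longrightarrow>
      (\<forall>\<phi>\<in>\<Psi>. \<psi> \<phi> \<cdot>\<^bsub>Ste\<^esub> \<sigma> = \<phi>) \<longrightarrow>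
      (\<forall>x\<in>carrier X. (\<lambda>\<phi>\<in>\<Psi>. map_of_arrow (\<psi> \<phi>) x) \<in> ?P) \<longrightarrow> (\<exists>\<delta>\<in>Hom Ste X E. \<delta> \<cdot>\<^bsub>Ste\<^esub> \<sigma> = \<epsilon>)"
    by (elim exE conjE)
  have "\<exists>\<delta>\<in>Hom Ste X E. \<delta> \<cdot>\<^bsub>Ste\<^esub> \<sigma> = \<epsilon>"
    if \<sigma>: "\<sigma> \<in> Hom Ste A X" and ex: "\<forall>\<phi>\<in>\<Psi>. \<exists>\<psi>\<in>Hom Ste X (target \<phi>). \<psi> \<cdot>\<^bsub>Ste\<^esub> \<sigma> = \<phi>" for X \<sigma>
  proof -
    obtain \<psi> where \<psi>: "\<And>\<phi>. \<phi> \<in> \<Psi> \<Longrightarrow> \<psi> \<phi> \<in> Hom Ste X (target \<phi>)" "\<And>\<phi>. \<phi> \<in> \<Psi> \<Longrightarrow> \<psi> \<phi> \<cdot>\<^bsub>Ste\<^esub> \<sigma> = \<phi>"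
      using ex by metis
    show ?thesis
    proof (rule univ[rule_format, OF \<sigma> \<psi>])
      show "(\<lambda>\<phi>\<in>\<Psi>. map_of_arrow (\<psi> \<phi>) x) \<in> ?P" if "x \<in> carrier X" for x using Hom_closed[OF \<psi>(1) that] by simp
    qed
  qed
  moreover have "\<forall>\<phi>\<in>\<Psi>. \<exists>p\<in>Hom Ste E (target \<phi>). p \<cdot>\<^bsub>Ste\<^esub> \<epsilon> = \<phi>" using is_limit_proj[OF lim] p\<epsilon> by blast
  ultimately show ?thesis using \<epsilon> by (intro exI[of _ E] exI[of _ \<epsilon>] conjI allI impI) auto
qed

section \<open>Closures of subalgebras of products\<close>

lemma (in stereo_bilinear) continuous_map_m:
  assumes k: "k \<in> carrier X"
  shows "continuous_map (topol X) (topol X) (m k)" "continuous_map (topol X) (topol X) (\<lambda>x. m x k)"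
proof -
  have *: "\<exists>W. openin (topol X) W \<and> x \<in> W \<and>
      (\<forall>y\<in>W. \<forall>f\<in>H. cmod (f (m k y) - f (m k x)) \<le> e \<and> cmod (f (m y k) - f (m x k)) \<le> e)"
    if x: "x \<in> carrier X" and H: "H \<in> dual_tb X" and e: "0 < e" for x H and e :: real
  proof -
    obtain G d where G: "G \<in> dual_tb X" "0 < d"
      "\<And>k' v f. k' \<in> {k} \<Longrightarrow> v \<in> carrier X \<Longrightarrow> \<forall>g\<in>G. cmod (g v) \<le> d \<Longrightarrow> f \<in> H \<Longrightarrow>
        cmod (f (m k' v)) \<le> e \<and> cmod (f (m v k')) \<le> e"
      by (rule hypocontinuous_tb[OF finite_tb[of "{k}"] H e]) (use k in auto)
    obtain W where W: "openin (topol X) W" "x \<in> W" "W \<subseteq> polar_ball (carrier X) G d x"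
      using polar_ball_nbhd[OF uc G(1) x G(2)] top by metis
    have "cmod (f (m k y) - f (m k x)) \<le> e \<and> cmod (f (m y k) - f (m x k)) \<le> e" if y: "y \<in> W" and f: "f \<in> H" for y f
    proof -
      have yc: "y \<in> carrier X" "\<forall>g\<in>G. cmod (g y - g x) \<le> d" using W(3) y unfolding polar_ball_def by auto
      have "\<forall>g\<in>G. cmod (g (vsub X y x)) \<le> d" using yc linear_on_vsub[OF lin[OF G(1)] yc(1) x] by simp
      then show ?thesis
        using G(3)[of k "vsub X y x" f] f yc(1) x m_diff[OF lin[OF H f] k yc(1) x] by simp
    qed
    then show ?thesis using W(1,2) by blast
  qed
  show "continuous_map (topol X) (topol X) (m k)"
    by (rule continuous_map_into) (use k * ts in \<open>force+\<close>)
  show "continuous_map (topol X) (topol X) (\<lambda>x. m x k)"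
    by (rule continuous_map_into) (use k * ts in \<open>force+\<close>)
qed

text \<open>Multiplication is known to be continuous only in each argument separately. With one
  argument fixed in \<open>D\<close> the other may pass to the closure; with that limit point fixed
  the first may pass as well, and closures are idempotent.\<close>

lemma closure_of_closed_binary:
  assumes l: "\<And>x. x \<in> topspace T \<Longrightarrow> continuous_map T T (m x)"
    and r: "\<And>y. y \<in> topspace T \<Longrightarrow> continuous_map T T (\<lambda>x. m x y)"
    and D: "D \<subseteq> topspace T" "\<And>x y. x \<in> D \<Longrightarrow> y \<in> D \<Longrightarrow> m x y \<in> D"
    and xy: "x \<in> T closure_of D" "y \<in> T closure_of D"
  shows "m x y \<in> T closure_of D"
proof -
  have 1: "m x y \<in> T closure_of D" if x: "x \<in> T closure_of D" and y: "y \<in> D" for x y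
  proof -
    have "(\<lambda>x. m x y) ` (T closure_of D) \<subseteq> T closure_of ((\<lambda>x. m x y) ` D)"
      using D(1) y by (intro continuous_map_image_closure_subset r) blast
    also have "\<dots> \<subseteq> T closure_of D" using D(2) y by (intro closure_of_mono) blast
    finally show ?thesis using x by blast
  qed
  have xT: "x \<in> topspace T" using xy(1) closure_of_subset_topspace by fast
  have "m x ` (T closure_of D) \<subseteq> T closure_of (m x ` D)"
    by (intro continuous_map_image_closure_subset l xT)
  also have "\<dots> \<subseteq> T closure_of (T closure_of D)" using 1[OF xy(1)] by (intro closure_of_mono) blast
  also have "\<dots> = T closure_of D" by simp
  finally show ?thesis using xy(2) by blast
qed

lemma continuous_map_componentwise_self:
  assumes "\<And>i. i \<in> I \<Longrightarrow> continuous_map (X i) (X i) (F i)"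
  shows "continuous_map (product_topology X I) (product_topology X I) (\<lambda>y. \<lambda>i\<in>I. F i (y i))"
  unfolding continuous_map_componentwise
proof (intro conjI ballI)
  show "(\<lambda>y. \<lambda>i\<in>I. F i (y i)) ` topspace (product_topology X I) \<subseteq> extensional I" by auto
  fix i assume i: "i \<in> I"
  have "continuous_map (product_topology X I) (X i) (\<lambda>y. F i (y i))"
    using i assms[OF i] by (rule continuous_map_coordinate)
  then show "continuous_map (product_topology X I) (X i) (\<lambda>y. (\<lambda>i\<in>I. F i (y i)) i)"
    using i by simp
qed

lemma (in stereo) continuous_map_operations:
  shows "k \<in> carrier X \<Longrightarrow> continuous_map (topol X) (topol X) (\<lambda>x. k \<oplus> x)"
    and "continuous_map (topol X) (topol X) (\<lambda>x. c \<odot> x)"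
proof -
  have a: "continuous_map (prod_topology (topol X) (topol X)) (topol X) (\<lambda>(x, y). x \<oplus> y)"
    and s: "continuous_map (prod_topology euclidean (topol X)) (topol X) (\<lambda>(c, x). c \<odot> x)"
    using lcs unfolding locally_convex_space_def by auto
  show "continuous_map (topol X) (topol X) (\<lambda>x. k \<oplus> x)" if "k \<in> carrier X"
    using continuous_map_compose[OF _ a, of "topol X" "\<lambda>x. (k, x)"] that
    by (simp add: o_def continuous_map_paired ts)
  show "continuous_map (topol X) (topol X) (\<lambda>x. c \<odot> x)"
    using continuous_map_compose[OF _ s, of "topol X" "\<lambda>x. (c, x)"]
    by (simp add: o_def continuous_map_paired)
qed

lemma closure_subalgebra:
  assumes B: "\<And>i. i \<in> I \<Longrightarrow> B i \<in> ste_objects" and D: "subalgebra_PiE I B D"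
  shows "subalgebra_PiE I B (product_topology (\<lambda>i. topol (B i)) I closure_of D)"
proof -
  let ?T = "product_topology (\<lambda>i. topol (B i)) I"
  have ts: "topspace ?T = (\<Pi>\<^sub>E i\<in>I. carrier (B i))"
    using B ste_topspace by (auto simp: topspace_product_topology intro!: PiE_cong)
  have DT: "D \<subseteq> topspace ?T" using D unfolding subalgebra_PiE_def ts by blast
  have Dcl: "D \<subseteq> ?T closure_of D" by (rule closure_of_subset[OF DT])
  have mem: "x i \<in> carrier (B i)" if "x \<in> topspace ?T" "i \<in> I" for x i using that unfolding ts by (rule PiE_mem)
  have st: "stereo (B i)" and bl: "stereo_bilinear (B i) (\<lambda>x y. x \<otimes>\<^bsub>B i\<^esub> y)" if "i \<in> I" for i
    using ste_object_stereo[OF B[OF that]] hypocontinuous_mult[OF ste_object_algebra[OF B[OF that]]]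
    by (simp_all add: stereo_bilinear_def stereo_bilinear_axioms_def)
  have comm: "x \<oplus>\<^bsub>B i\<^esub> y = y \<oplus>\<^bsub>B i\<^esub> x" if "i \<in> I" "x \<in> carrier (B i)" "y \<in> carrier (B i)" for i x y
    using ring.ring_simprules(10)[OF ste_object_ring[OF B[OF that(1)]] that(2,3)] .
  show ?thesis
    unfolding subalgebra_PiE_def
  proof (intro conjI ballI allI)
    show "?T closure_of D \<subseteq> (\<Pi>\<^sub>E i\<in>I. carrier (B i))" unfolding ts[symmetric] by (rule closure_of_subset_topspace)
    show "(\<lambda>i\<in>I. \<zero>\<^bsub>B i\<^esub>) \<in> ?T closure_of D" "(\<lambda>i\<in>I. \<one>\<^bsub>B i\<^esub>) \<in> ?T closure_of D"
      using D Dcl unfolding subalgebra_PiE_def by blast+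
    fix x assume x: "x \<in> ?T closure_of D"
    show "(\<lambda>i\<in>I. c \<odot>\<^bsub>B i\<^esub> x i) \<in> ?T closure_of D" for c
    proof -
      have "(\<lambda>x. \<lambda>i\<in>I. c \<odot>\<^bsub>B i\<^esub> x i) ` (?T closure_of D) \<subseteq> ?T closure_of ((\<lambda>x. \<lambda>i\<in>I. c \<odot>\<^bsub>B i\<^esub> x i) ` D)"
        by (intro continuous_map_image_closure_subset continuous_map_componentwise_self
            stereo.continuous_map_operations(2) st)
      also have "\<dots> \<subseteq> ?T closure_of D" using D unfolding subalgebra_PiE_def by (intro closure_of_mono) blast
      finally show ?thesis using x by blast
    qed
    fix y assume y: "y \<in> ?T closure_of D"
    show "(\<lambda>i\<in>I. x i \<oplus>\<^bsub>B i\<^esub> y i) \<in> ?T closure_of D"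
    proof (rule closure_of_closed_binary[of ?T "\<lambda>x y. \<lambda>i\<in>I. x i \<oplus>\<^bsub>B i\<^esub> y i", OF _ _ DT _ x y])
      show l: "continuous_map ?T ?T (\<lambda>y. \<lambda>i\<in>I. x i \<oplus>\<^bsub>B i\<^esub> y i)" if "x \<in> topspace ?T" for x
        by (intro continuous_map_componentwise_self stereo.continuous_map_operations(1) st mem that)
      \<comment> \<open>Commutativity of addition reduces this argument to the other one.\<close>
      show "continuous_map ?T ?T (\<lambda>x. \<lambda>i\<in>I. x i \<oplus>\<^bsub>B i\<^esub> y i)" if y: "y \<in> topspace ?T" for y
        by (rule continuous_map_eq[OF l[OF y]]) (use comm mem y in \<open>simp cong: restrict_cong\<close>)
      show "(\<lambda>i\<in>I. x i \<oplus>\<^bsub>B i\<^esub> y i) \<in> D" if "x \<in> D" "y \<in> D" for x y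
        using D that unfolding subalgebra_PiE_def by blast
    qed
    show "(\<lambda>i\<in>I. x i \<otimes>\<^bsub>B i\<^esub> y i) \<in> ?T closure_of D"
    proof (rule closure_of_closed_binary[of ?T "\<lambda>x y. \<lambda>i\<in>I. x i \<otimes>\<^bsub>B i\<^esub> y i", OF _ _ DT _ x y])
      show "continuous_map ?T ?T (\<lambda>y. \<lambda>i\<in>I. x i \<otimes>\<^bsub>B i\<^esub> y i)" if "x \<in> topspace ?T" for x
        by (intro continuous_map_componentwise_self stereo_bilinear.continuous_map_m(1)[OF bl] mem that)
      show "continuous_map ?T ?T (\<lambda>x. \<lambda>i\<in>I. x i \<otimes>\<^bsub>B i\<^esub> y i)" if "y \<in> topspace ?T" for y
        by (intro continuous_map_componentwise_self stereo_bilinear.continuous_map_m(2)[OF bl] mem that)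
      show "(\<lambda>i\<in>I. x i \<otimes>\<^bsub>B i\<^esub> y i) \<in> D" if "x \<in> D" "y \<in> D" for x y
        using D that unfolding subalgebra_PiE_def by blast
    qed
  qed
qed

section \<open>Dense images and strong epimorphisms\<close>

context universe
begin

text \<open>\<open>D\<close> is an image of the small set \<open>carrier A\<close>, so its closure
  is small whatever the size of \<open>\<Psi>\<close>.\<close>

lemma dense_joint_factorization:
  fixes A :: "'u top_module"
  assumes \<Psi>: "\<And>\<phi>. \<phi> \<in> \<Psi> \<Longrightarrow> \<phi> \<in> Hom Ste A (target \<phi>)" and A: "A \<in> ste_objects"
  defines "T \<equiv> product_topology (\<lambda>\<phi>. topol (target \<phi>)) \<Psi>"
  defines "D \<equiv> (\<lambda>a. \<lambda>\<phi>\<in>\<Psi>. map_of_arrow \<phi> a) ` carrier A"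
  shows "closedin T (T closure_of D)" "subalgebra_PiE \<Psi> target (T closure_of D)"
    "small TYPE('u) (T closure_of D)" "D \<subseteq> T closure_of D"
proof -
  have B: "target \<phi> \<in> ste_objects" if "\<phi> \<in> \<Psi>" for \<phi> using Hom_objects(2)[OF \<Psi>[OF that]] .
  interpret A: stereo A by (rule ste_object_stereo[OF A])
  interpret Ar: ring A by (rule ste_object_ring[OF A])
  have D: "subalgebra_PiE \<Psi> target D"
    unfolding subalgebra_PiE_def
  proof (intro conjI ballI allI)
    have im: "(\<lambda>\<phi>\<in>\<Psi>. w \<phi>) \<in> D" if "a \<in> carrier A" "\<And>\<phi>. \<phi> \<in> \<Psi> \<Longrightarrow> w \<phi> = map_of_arrow \<phi> a" for w a
      unfolding D_def using that by (intro image_eqI[of _ _ a] restrict_ext) auto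
    show "D \<subseteq> (\<Pi>\<^sub>E \<phi>\<in>\<Psi>. carrier (target \<phi>))" unfolding D_def using Hom_closed[OF \<Psi>] by auto
    show "(\<lambda>\<phi>\<in>\<Psi>. \<zero>\<^bsub>target \<phi>\<^esub>) \<in> D" by (rule im[of "\<zero>\<^bsub>A\<^esub>"]) (simp_all add: Hom_zero[OF \<Psi>])
    show "(\<lambda>\<phi>\<in>\<Psi>. \<one>\<^bsub>target \<phi>\<^esub>) \<in> D" by (rule im[of "\<one>\<^bsub>A\<^esub>"]) (simp_all add: Hom_one[OF \<Psi>])
    fix x assume "x \<in> D"
    then obtain a where a: "a \<in> carrier A" "x = (\<lambda>\<phi>\<in>\<Psi>. map_of_arrow \<phi> a)" unfolding D_def by blast
    show "(\<lambda>\<phi>\<in>\<Psi>. c \<odot>\<^bsub>target \<phi>\<^esub> x \<phi>) \<in> D" for c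
      by (rule im[of "c \<odot>\<^bsub>A\<^esub> a"]) (simp_all add: a Hom_smult[OF \<Psi>])
    fix y assume "y \<in> D"
    then obtain b where b: "b \<in> carrier A" "y = (\<lambda>\<phi>\<in>\<Psi>. map_of_arrow \<phi> b)" unfolding D_def by blast
    show "(\<lambda>\<phi>\<in>\<Psi>. x \<phi> \<oplus>\<^bsub>target \<phi>\<^esub> y \<phi>) \<in> D"
      by (rule im[of "a \<oplus>\<^bsub>A\<^esub> b"]) (simp_all add: a b Hom_add[OF \<Psi>])
    show "(\<lambda>\<phi>\<in>\<Psi>. x \<phi> \<otimes>\<^bsub>target \<phi>\<^esub> y \<phi>) \<in> D"
      by (rule im[of "a \<otimes>\<^bsub>A\<^esub> b"]) (simp_all add: a b Hom_mult[OF \<Psi>])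
  qed
  show "closedin T (T closure_of D)" by simp
  show "subalgebra_PiE \<Psi> target (T closure_of D)" unfolding T_def by (rule closure_subalgebra[OF B D])
  have "Hausdorff_space T" unfolding T_def Hausdorff_space_product_topology using ste_Hausdorff[OF B] by blast
  moreover have "small TYPE('u) D" unfolding D_def by (intro small_image small_carrier A)
  ultimately show "small TYPE('u) (T closure_of D)" by (rule small_closure)
  have "topspace T = (\<Pi>\<^sub>E \<phi>\<in>\<Psi>. carrier (target \<phi>))"
    unfolding T_def topspace_product_topology by (intro PiE_cong) (simp add: ste_topspace[OF B])
  then have "D \<subseteq> topspace T" using D unfolding subalgebra_PiE_def by (simp only:)
  then show "D \<subseteq> T closure_of D" by (rule closure_of_subset)
qed

text \<open>\<open>\<sigma>\<close> factors through the limit on the closure of its image, followed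
  by an injective projection. Strength makes this projection split, so every point of the target is
  the projection of a point of that closure.\<close>

lemma SEpis_dense:
  fixes \<sigma> :: "'u ste_arrow"
  assumes \<sigma>: "\<sigma> \<in> SEpis Ste"
  shows "carrier (target \<sigma>) \<subseteq> topol (target \<sigma>) closure_of (map_of_arrow \<sigma> ` carrier (source \<sigma>))"
proof
  have "\<sigma> \<in> Mor Ste" using \<sigma> unfolding SEpis_def Epis_def by (simp only: mem_Collect_eq)
  then have \<sigma>H: "\<sigma> \<in> Hom Ste (source \<sigma>) (target \<sigma>)" unfolding Mor_Ste_Hom .
  have lift: "\<forall>\<mu>\<in>Monos Ste. \<forall>\<alpha>\<in>Hom Ste (source \<sigma>) (source \<mu>). \<forall>\<beta>\<in>Hom Ste (target \<sigma>) (target \<mu>).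
      \<beta> \<cdot>\<^bsub>Ste\<^esub> \<sigma> = \<mu> \<cdot>\<^bsub>Ste\<^esub> \<alpha> \<longrightarrow> (\<exists>\<delta>\<in>Hom Ste (target \<sigma>) (source \<mu>). \<delta> \<cdot>\<^bsub>Ste\<^esub> \<sigma> = \<alpha> \<and> \<mu> \<cdot>\<^bsub>Ste\<^esub> \<delta> = \<beta>)"
    using \<sigma> unfolding SEpis_def Ste_simps mem_Collect_eq by (rule conjunct2)
  let ?A = "source \<sigma>" and ?X = "target \<sigma>"
  have A: "?A \<in> ste_objects" and X: "?X \<in> ste_objects" using Hom_objects[OF \<sigma>H] by auto
  have \<Psi>: "\<phi> \<in> Hom Ste ?A (target \<phi>)" if "\<phi> \<in> {\<sigma>}" for \<phi> using that \<sigma>H by simp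
  let ?T = "product_topology (\<lambda>\<phi>. topol (target \<phi>)) {\<sigma>}"
  let ?D = "(\<lambda>a. \<lambda>\<phi>\<in>{\<sigma>}. map_of_arrow \<phi> a) ` carrier ?A"
  note P = dense_joint_factorization[OF \<Psi> A]
  have "\<exists>\<epsilon> E p. \<epsilon> \<in> Hom Ste ?A E \<and> is_limit {\<sigma>} target (?T closure_of ?D) E p \<and> (\<forall>\<phi>\<in>{\<sigma>}. p \<phi> \<cdot>\<^bsub>Ste\<^esub> \<epsilon> = \<phi>) \<and>
    (\<forall>X \<tau> \<psi>. \<tau> \<in> Hom Ste ?A X \<longrightarrow> (\<forall>\<phi>\<in>{\<sigma>}. \<psi> \<phi> \<in> Hom Ste X (target \<phi>)) \<longrightarrow>
      (\<forall>\<phi>\<in>{\<sigma>}. \<psi> \<phi> \<cdot>\<^bsub>Ste\<^esub> \<tau> = \<phi>) \<longrightarrow>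
      (\<forall>x\<in>carrier X. (\<lambda>\<phi>\<in>{\<sigma>}. map_of_arrow (\<psi> \<phi>) x) \<in> (?T closure_of ?D)) \<longrightarrow> (\<exists>\<delta>\<in>Hom Ste X E. \<delta> \<cdot>\<^bsub>Ste\<^esub> \<tau> = \<epsilon>))"
  proof (rule joint_factorization[OF \<Psi> A P(1,2,3)])
    show "(\<lambda>\<phi>\<in>{\<sigma>}. map_of_arrow \<phi> a) \<in> ?T closure_of ?D" if "a \<in> carrier ?A" for a using P(4) that by blast
  qed
  then obtain \<epsilon> E p where \<epsilon>: "\<epsilon> \<in> Hom Ste ?A E" and lim: "is_limit {\<sigma>} target (?T closure_of ?D) E p"
    and p\<epsilon>: "\<forall>\<phi>\<in>{\<sigma>}. p \<phi> \<cdot>\<^bsub>Ste\<^esub> \<epsilon> = \<phi>"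
    and univ: "\<forall>X \<tau> \<psi>. \<tau> \<in> Hom Ste ?A X \<longrightarrow> (\<forall>\<phi>\<in>{\<sigma>}. \<psi> \<phi> \<in> Hom Ste X (target \<phi>)) \<longrightarrow>
      (\<forall>\<phi>\<in>{\<sigma>}. \<psi> \<phi> \<cdot>\<^bsub>Ste\<^esub> \<tau> = \<phi>) \<longrightarrow>
      (\<forall>x\<in>carrier X. (\<lambda>\<phi>\<in>{\<sigma>}. map_of_arrow (\<psi> \<phi>) x) \<in> (?T closure_of ?D)) \<longrightarrow> (\<exists>\<delta>\<in>Hom Ste X E. \<delta> \<cdot>\<^bsub>Ste\<^esub> \<tau> = \<epsilon>)"
    by (elim exE conjE)
  have p: "p \<sigma> \<in> Hom Ste E ?X" using is_limit_proj[OF lim, of \<sigma>] by simp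
  have "inj_on (map_of_arrow (p \<sigma>)) (carrier E)"
  proof (rule inj_onI)
    fix x y assume xy: "x \<in> carrier E" "y \<in> carrier E" "map_of_arrow (p \<sigma>) x = map_of_arrow (p \<sigma>) y"
    show "x = y" by (rule is_limit_inj[OF lim xy(1,2)]) (use xy(3) in simp)
  qed
  then have mono: "p \<sigma> \<in> Monos Ste" by (rule inj_imp_Monos[OF p])
  have id: "Id Ste ?X \<in> Hom Ste ?X ?X" using Ste.id_hom X by simp
  have sp: "source (p \<sigma>) = E" "target (p \<sigma>) = ?X" using p unfolding Hom_Ste_iff by auto
  have "Id Ste ?X \<cdot>\<^bsub>Ste\<^esub> \<sigma> = p \<sigma> \<cdot>\<^bsub>Ste\<^esub> \<epsilon>" using Ste.comp_id_left[OF \<sigma>H] p\<epsilon> by simp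
  \<comment> \<open>The diagonal of the square with the identity of the target and the monomorphism
    \<open>p \<sigma>\<close> is a section of \<open>p \<sigma>\<close>.\<close>
  then obtain \<delta> where \<delta>: "\<delta> \<in> Hom Ste ?X E" "p \<sigma> \<cdot>\<^bsub>Ste\<^esub> \<delta> = Id Ste ?X"
    using lift[rule_format, OF mono, of \<epsilon> "Id Ste ?X"] \<epsilon> id unfolding sp by blast
  fix x assume x: "x \<in> carrier ?X"
  have dx: "map_of_arrow \<delta> x \<in> carrier E" by (rule Hom_closed[OF \<delta>(1) x])
  have px: "map_of_arrow (p \<sigma>) (map_of_arrow \<delta> x) = x"
    using comp_Ste_apply[OF \<delta>(1) x, of "p \<sigma>"] x unfolding \<delta>(2) by (simp add: Ste_def)
  have "(\<lambda>\<phi>\<in>{\<sigma>}. map_of_arrow (p \<phi>) (map_of_arrow \<delta> x)) \<in> ?T closure_of ?D"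
    by (rule is_limit_mem[OF lim dx])
  then have "(\<lambda>\<phi>\<in>{\<sigma>}. map_of_arrow (p \<phi>) (map_of_arrow \<delta> x)) \<sigma> \<in> (\<lambda>b. b \<sigma>) ` (?T closure_of ?D)" by blast
  also have "\<dots> \<subseteq> topol ?X closure_of ((\<lambda>b. b \<sigma>) ` ?D)"
    using continuous_map_product_projection[of \<sigma> "{\<sigma>}" "\<lambda>\<phi>. topol (target \<phi>)"]
    by (intro continuous_map_image_closure_subset) simp
  also have "(\<lambda>b. b \<sigma>) ` ?D = map_of_arrow \<sigma> ` carrier ?A" by (simp add: image_image)
  finally show "x \<in> topol ?X closure_of (map_of_arrow \<sigma> ` carrier ?A)" by (simp add: px)
qed

text \<open>Universality is claimed against strong epimorphisms: density of the image of
  \<open>\<sigma>\<close> and continuity of the family \<open>\<psi>\<close> keep its values in the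
  closure of the image of \<open>A\<close>.\<close>

lemma strong_joint_factorization:
  fixes A :: "'u top_module"
  assumes \<Psi>: "\<And>\<phi>. \<phi> \<in> \<Psi> \<Longrightarrow> \<phi> \<in> Hom Ste A (target \<phi>)" and A: "A \<in> ste_objects"
  shows "\<exists>E \<epsilon>. \<epsilon> \<in> Hom Ste A E \<and> (\<forall>\<phi>\<in>\<Psi>. \<exists>p\<in>Hom Ste E (target \<phi>). p \<cdot>\<^bsub>Ste\<^esub> \<epsilon> = \<phi>) \<and>
    (\<forall>X \<sigma>. \<sigma> \<in> Hom Ste A X \<longrightarrow> \<sigma> \<in> SEpis Ste \<longrightarrow>
      (\<forall>\<phi>\<in>\<Psi>. \<exists>\<psi>\<in>Hom Ste X (target \<phi>). \<psi> \<cdot>\<^bsub>Ste\<^esub> \<sigma> = \<phi>) \<longrightarrow>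
      (\<exists>\<delta>\<in>Hom Ste X E. \<delta> \<cdot>\<^bsub>Ste\<^esub> \<sigma> = \<epsilon>))"
proof -
  let ?T = "product_topology (\<lambda>\<phi>. topol (target \<phi>)) \<Psi>"
  let ?D = "(\<lambda>a. \<lambda>\<phi>\<in>\<Psi>. map_of_arrow \<phi> a) ` carrier A"
  note P = dense_joint_factorization[OF \<Psi> A]
  have "\<exists>\<epsilon> E p. \<epsilon> \<in> Hom Ste A E \<and> is_limit \<Psi> target (?T closure_of ?D) E p \<and> (\<forall>\<phi>\<in>\<Psi>. p \<phi> \<cdot>\<^bsub>Ste\<^esub> \<epsilon> = \<phi>) \<and>
    (\<forall>X \<sigma> \<psi>. \<sigma> \<in> Hom Ste A X \<longrightarrow> (\<forall>\<phi>\<in>\<Psi>. \<psi> \<phi> \<in> Hom Ste X (target \<phi>)) \<longrightarrow>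
      (\<forall>\<phi>\<in>\<Psi>. \<psi> \<phi> \<cdot>\<^bsub>Ste\<^esub> \<sigma> = \<phi>) \<longrightarrow>
      (\<forall>x\<in>carrier X. (\<lambda>\<phi>\<in>\<Psi>. map_of_arrow (\<psi> \<phi>) x) \<in> (?T closure_of ?D)) \<longrightarrow> (\<exists>\<delta>\<in>Hom Ste X E. \<delta> \<cdot>\<^bsub>Ste\<^esub> \<sigma> = \<epsilon>))"
  proof (rule joint_factorization[OF \<Psi> A P(1,2,3)])
    show "(\<lambda>\<phi>\<in>\<Psi>. map_of_arrow \<phi> a) \<in> ?T closure_of ?D" if "a \<in> carrier A" for a using P(4) that by blast
  qed
  then obtain \<epsilon> E p where \<epsilon>: "\<epsilon> \<in> Hom Ste A E" and lim: "is_limit \<Psi> target (?T closure_of ?D) E p"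
    and p\<epsilon>: "\<forall>\<phi>\<in>\<Psi>. p \<phi> \<cdot>\<^bsub>Ste\<^esub> \<epsilon> = \<phi>"
    and univ: "\<forall>X \<sigma> \<psi>. \<sigma> \<in> Hom Ste A X \<longrightarrow> (\<forall>\<phi>\<in>\<Psi>. \<psi> \<phi> \<in> Hom Ste X (target \<phi>)) \<longrightarrow>
      (\<forall>\<phi>\<in>\<Psi>. \<psi> \<phi> \<cdot>\<^bsub>Ste\<^esub> \<sigma> = \<phi>) \<longrightarrow>
      (\<forall>x\<in>carrier X. (\<lambda>\<phi>\<in>\<Psi>. map_of_arrow (\<psi> \<phi>) x) \<in> (?T closure_of ?D)) \<longrightarrow> (\<exists>\<delta>\<in>Hom Ste X E. \<delta> \<cdot>\<^bsub>Ste\<^esub> \<sigma> = \<epsilon>)"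
    by (elim exE conjE)
  have "\<exists>\<delta>\<in>Hom Ste X E. \<delta> \<cdot>\<^bsub>Ste\<^esub> \<sigma> = \<epsilon>"
    if \<sigma>: "\<sigma> \<in> Hom Ste A X" "\<sigma> \<in> SEpis Ste" and ex: "\<forall>\<phi>\<in>\<Psi>. \<exists>\<psi>\<in>Hom Ste X (target \<phi>). \<psi> \<cdot>\<^bsub>Ste\<^esub> \<sigma> = \<phi>" for X \<sigma>
  proof -
    obtain \<psi> where \<psi>: "\<And>\<phi>. \<phi> \<in> \<Psi> \<Longrightarrow> \<psi> \<phi> \<in> Hom Ste X (target \<phi>)" "\<And>\<phi>. \<phi> \<in> \<Psi> \<Longrightarrow> \<psi> \<phi> \<cdot>\<^bsub>Ste\<^esub> \<sigma> = \<phi>"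
      using ex by metis
    have st: "source \<sigma> = A" "target \<sigma> = X" using \<sigma>(1) unfolding Hom_Ste_iff by auto
    show ?thesis
    proof (rule univ[rule_format, OF \<sigma>(1) \<psi>])
      fix x assume x: "x \<in> carrier X"
      let ?m = "\<lambda>x. \<lambda>\<phi>\<in>\<Psi>. map_of_arrow (\<psi> \<phi>) x"
      have "continuous_map (topol X) ?T ?m"
        unfolding continuous_map_componentwise
      proof (intro conjI ballI)
        show "?m ` topspace (topol X) \<subseteq> extensional \<Psi>" by auto
        show "continuous_map (topol X) (topol (target \<phi>)) (\<lambda>x. ?m x \<phi>)" if "\<phi> \<in> \<Psi>" for \<phi>
          using Hom_continuous[OF \<psi>(1)[OF that]] that by simp
      qed
      then have "?m ` (topol X closure_of (map_of_arrow \<sigma> ` carrier A)) \<subseteq> ?T closure_of (?m ` map_of_arrow \<sigma> ` carrier A)"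
        by (rule continuous_map_image_closure_subset)
      moreover have "?m (map_of_arrow \<sigma> a) = (\<lambda>\<phi>\<in>\<Psi>. map_of_arrow \<phi> a)" if "a \<in> carrier A" for a
        using comp_Ste_apply[OF \<sigma>(1) that] \<psi>(2) by (intro restrict_ext) metis
      then have "?m ` map_of_arrow \<sigma> ` carrier A = ?D" by (simp add: image_image)
      ultimately show "?m x \<in> ?T closure_of ?D"
        using SEpis_dense[OF \<sigma>(2)] x unfolding st by (metis (no_types, lifting) imageI subsetD)
    qed
  qed
  moreover have "\<forall>\<phi>\<in>\<Psi>. \<exists>p\<in>Hom Ste E (target \<phi>). p \<cdot>\<^bsub>Ste\<^esub> \<epsilon> = \<phi>" using is_limit_proj[OF lim] p\<epsilon> by blast
  ultimately show ?thesis using \<epsilon> by (intro exI[of _ E] exI[of _ \<epsilon>] conjI allI impI) auto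
qed

end

section \<open>Factorizations, envelopes and refinements\<close>

lemma HomD: "f \<in> Hom C X Y \<Longrightarrow> f \<in> Mor C" "f \<in> Hom C X Y \<Longrightarrow> Dom C f = X" "f \<in> Hom C X Y \<Longrightarrow> Cod C f = Y"
  unfolding Hom_def by auto

lemma Mor_Hom: "f \<in> Mor C \<Longrightarrow> f \<in> Hom C (Dom C f) (Cod C f)"
  unfolding Hom_def by simp

lemma Monos_Mor: "\<mu> \<in> Monos C \<Longrightarrow> \<mu> \<in> Mor C" and Epis_Mor: "\<mu> \<in> Epis C \<Longrightarrow> \<mu> \<in> Mor C"
  and SMonos_Monos: "\<mu> \<in> SMonos C \<Longrightarrow> \<mu> \<in> Monos C" and SEpis_Epis: "\<mu> \<in> SEpis C \<Longrightarrow> \<mu> \<in> Epis C"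
  unfolding Monos_def Epis_def SMonos_def SEpis_def by auto

lemma Monos_cancel: "\<mu> \<in> Monos C \<Longrightarrow> \<mu> \<in> Hom C X Y \<Longrightarrow> \<alpha> \<in> Hom C W X \<Longrightarrow> \<beta> \<in> Hom C W X \<Longrightarrow>
    \<mu> \<cdot>\<^bsub>C\<^esub> \<alpha> = \<mu> \<cdot>\<^bsub>C\<^esub> \<beta> \<Longrightarrow> \<alpha> = \<beta>"
  and Epis_cancel: "\<epsilon> \<in> Epis C \<Longrightarrow> \<epsilon> \<in> Hom C X Y \<Longrightarrow> \<gamma> \<in> Hom C Y Z \<Longrightarrow> \<delta> \<in> Hom C Y Z \<Longrightarrow>
    \<gamma> \<cdot>\<^bsub>C\<^esub> \<epsilon> = \<delta> \<cdot>\<^bsub>C\<^esub> \<epsilon> \<Longrightarrow> \<gamma> = \<delta>"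
  unfolding Monos_def Epis_def Hom_def by auto

lemma MonosI: "\<mu> \<in> Hom C X Y \<Longrightarrow> (\<And>W \<alpha> \<beta>. \<alpha> \<in> Hom C W X \<Longrightarrow> \<beta> \<in> Hom C W X \<Longrightarrow>
    \<mu> \<cdot>\<^bsub>C\<^esub> \<alpha> = \<mu> \<cdot>\<^bsub>C\<^esub> \<beta> \<Longrightarrow> \<alpha> = \<beta>) \<Longrightarrow> \<mu> \<in> Monos C"
  and EpisI: "\<epsilon> \<in> Hom C X Y \<Longrightarrow> (\<And>Z \<gamma> \<delta>. \<gamma> \<in> Hom C Y Z \<Longrightarrow> \<delta> \<in> Hom C Y Z \<Longrightarrow>
    \<gamma> \<cdot>\<^bsub>C\<^esub> \<epsilon> = \<delta> \<cdot>\<^bsub>C\<^esub> \<epsilon> \<Longrightarrow> \<gamma> = \<delta>) \<Longrightarrow> \<epsilon> \<in> Epis C"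
  unfolding Monos_def Epis_def by (auto simp: HomD)

lemma SMonos_lift:
  assumes "\<mu> \<in> SMonos C" "\<mu> \<in> Hom C X Y" "\<epsilon> \<in> Epis C" "\<epsilon> \<in> Hom C P Q" "\<alpha> \<in> Hom C P X" "\<beta> \<in> Hom C Q Y"
    "\<beta> \<cdot>\<^bsub>C\<^esub> \<epsilon> = \<mu> \<cdot>\<^bsub>C\<^esub> \<alpha>"
  shows "\<exists>\<delta>\<in>Hom C Q X. \<delta> \<cdot>\<^bsub>C\<^esub> \<epsilon> = \<alpha> \<and> \<mu> \<cdot>\<^bsub>C\<^esub> \<delta> = \<beta>"
proof -
  note [simp] = HomD(2,3)[OF assms(2)] HomD(2,3)[OF assms(4)]
  have "\<forall>\<epsilon>\<in>Epis C. \<forall>\<alpha>\<in>Hom C (Dom C \<epsilon>) X. \<forall>\<beta>\<in>Hom C (Cod C \<epsilon>) Y. \<beta> \<cdot>\<^bsub>C\<^esub> \<epsilon> = \<mu> \<cdot>\<^bsub>C\<^esub> \<alpha> \<longrightarrow>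
      (\<exists>\<delta>\<in>Hom C (Cod C \<epsilon>) X. \<delta> \<cdot>\<^bsub>C\<^esub> \<epsilon> = \<alpha> \<and> \<mu> \<cdot>\<^bsub>C\<^esub> \<delta> = \<beta>)"
    using assms(1) unfolding SMonos_def by simp
  from this[rule_format, of \<epsilon> \<alpha> \<beta>] show ?thesis using assms by simp
qed

lemma SEpis_lift:
  assumes "\<epsilon> \<in> SEpis C" "\<epsilon> \<in> Hom C P Q" "\<mu> \<in> Monos C" "\<mu> \<in> Hom C X Y" "\<alpha> \<in> Hom C P X" "\<beta> \<in> Hom C Q Y"
    "\<beta> \<cdot>\<^bsub>C\<^esub> \<epsilon> = \<mu> \<cdot>\<^bsub>C\<^esub> \<alpha>"
  shows "\<exists>\<delta>\<in>Hom C Q X. \<delta> \<cdot>\<^bsub>C\<^esub> \<epsilon> = \<alpha> \<and> \<mu> \<cdot>\<^bsub>C\<^esub> \<delta> = \<beta>"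
proof -
  note [simp] = HomD(2,3)[OF assms(2)] HomD(2,3)[OF assms(4)]
  have "\<forall>\<mu>\<in>Monos C. \<forall>\<alpha>\<in>Hom C P (Dom C \<mu>). \<forall>\<beta>\<in>Hom C Q (Cod C \<mu>). \<beta> \<cdot>\<^bsub>C\<^esub> \<epsilon> = \<mu> \<cdot>\<^bsub>C\<^esub> \<alpha> \<longrightarrow>
      (\<exists>\<delta>\<in>Hom C Q (Dom C \<mu>). \<delta> \<cdot>\<^bsub>C\<^esub> \<epsilon> = \<alpha> \<and> \<mu> \<cdot>\<^bsub>C\<^esub> \<delta> = \<beta>)"
    using assms(1) unfolding SEpis_def by simp
  from this[rule_format, of \<mu> \<alpha> \<beta>] show ?thesis using assms by simp
qed

lemma SMonosI:
  assumes m: "\<mu> \<in> Monos C" "\<mu> \<in> Hom C X Y"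
    and l: "\<And>P Q \<epsilon> \<alpha> \<beta>. \<epsilon> \<in> Epis C \<Longrightarrow> \<epsilon> \<in> Hom C P Q \<Longrightarrow> \<alpha> \<in> Hom C P X \<Longrightarrow> \<beta> \<in> Hom C Q Y \<Longrightarrow>
      \<beta> \<cdot>\<^bsub>C\<^esub> \<epsilon> = \<mu> \<cdot>\<^bsub>C\<^esub> \<alpha> \<Longrightarrow> \<exists>\<delta>\<in>Hom C Q X. \<delta> \<cdot>\<^bsub>C\<^esub> \<epsilon> = \<alpha> \<and> \<mu> \<cdot>\<^bsub>C\<^esub> \<delta> = \<beta>"
  shows "\<mu> \<in> SMonos C"
  unfolding SMonos_def mem_Collect_eq HomD(2,3)[OF m(2)]
proof (intro conjI ballI impI m(1))
  fix \<epsilon> \<alpha> \<beta> assume H: "\<epsilon> \<in> Epis C" "\<alpha> \<in> Hom C (Dom C \<epsilon>) X" "\<beta> \<in> Hom C (Cod C \<epsilon>) Y" "\<beta> \<cdot>\<^bsub>C\<^esub> \<epsilon> = \<mu> \<cdot>\<^bsub>C\<^esub> \<alpha>"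
  show "\<exists>\<delta>\<in>Hom C (Cod C \<epsilon>) X. \<delta> \<cdot>\<^bsub>C\<^esub> \<epsilon> = \<alpha> \<and> \<mu> \<cdot>\<^bsub>C\<^esub> \<delta> = \<beta>"
    by (rule l[OF H(1) Mor_Hom[OF Epis_Mor[OF H(1)]] H(2-4)])
qed

lemma SEpisI:
  assumes e: "\<epsilon> \<in> Epis C" "\<epsilon> \<in> Hom C P Q"
    and l: "\<And>X Y \<mu> \<alpha> \<beta>. \<mu> \<in> Monos C \<Longrightarrow> \<mu> \<in> Hom C X Y \<Longrightarrow> \<alpha> \<in> Hom C P X \<Longrightarrow> \<beta> \<in> Hom C Q Y \<Longrightarrow>
      \<beta> \<cdot>\<^bsub>C\<^esub> \<epsilon> = \<mu> \<cdot>\<^bsub>C\<^esub> \<alpha> \<Longrightarrow> \<exists>\<delta>\<in>Hom C Q X. \<delta> \<cdot>\<^bsub>C\<^esub> \<epsilon> = \<alpha> \<and> \<mu> \<cdot>\<^bsub>C\<^esub> \<delta> = \<beta>"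
  shows "\<epsilon> \<in> SEpis C"
  unfolding SEpis_def mem_Collect_eq HomD(2,3)[OF e(2)]
proof (intro conjI ballI impI e(1))
  fix \<mu> \<alpha> \<beta> assume H: "\<mu> \<in> Monos C" "\<alpha> \<in> Hom C P (Dom C \<mu>)" "\<beta> \<in> Hom C Q (Cod C \<mu>)" "\<beta> \<cdot>\<^bsub>C\<^esub> \<epsilon> = \<mu> \<cdot>\<^bsub>C\<^esub> \<alpha>"
  show "\<exists>\<delta>\<in>Hom C Q (Dom C \<mu>). \<delta> \<cdot>\<^bsub>C\<^esub> \<epsilon> = \<alpha> \<and> \<mu> \<cdot>\<^bsub>C\<^esub> \<delta> = \<beta>"
    by (rule l[OF H(1) Mor_Hom[OF Monos_Mor[OF H(1)]] H(2-4)])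
qed

lemma extensionD:
  assumes "extension C \<Omega> \<Phi> A \<sigma>"
  shows "\<sigma> \<in> \<Omega>" "Dom C \<sigma> = A"
    "\<phi> \<in> \<Phi> \<Longrightarrow> Dom C \<phi> = A \<Longrightarrow> \<exists>\<phi>'\<in>Hom C (Cod C \<sigma>) (Cod C \<phi>). \<phi>' \<cdot>\<^bsub>C\<^esub> \<sigma> = \<phi>"
  using assms unfolding extension_def by (simp_all, metis)

lemma enrichmentD:
  assumes "enrichment C \<Gamma> \<Phi> A \<sigma>"
  shows "\<sigma> \<in> \<Gamma>" "Cod C \<sigma> = A"
    "\<phi> \<in> \<Phi> \<Longrightarrow> Cod C \<phi> = A \<Longrightarrow> \<exists>\<phi>'\<in>Hom C (Dom C \<phi>) (Dom C \<sigma>). \<sigma> \<cdot>\<^bsub>C\<^esub> \<phi>' = \<phi>"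
  using assms unfolding enrichment_def by (simp_all, metis)

text \<open>The class enters \<open>Env\<close> only through its extensions, so all comparisons of
  envelopes reduce to showing that the extensions are the same; likewise for
  \<open>Ref\<close>.\<close>

lemma Env_cong: "(\<And>\<sigma>. extension C \<Omega> \<Phi> A \<sigma> \<longleftrightarrow> extension C \<Omega>' \<Phi> A \<sigma>) \<Longrightarrow> Env C \<Omega> \<Phi> A = Env C \<Omega>' \<Phi> A"
  and Ref_cong: "(\<And>\<sigma>. enrichment C \<Gamma> \<Phi> A \<sigma> \<longleftrightarrow> enrichment C \<Gamma>' \<Phi> A \<sigma>) \<Longrightarrow> Ref C \<Gamma> \<Phi> A = Ref C \<Gamma>' \<Phi> A"
  unfolding Env_def Ref_def by simp_all

lemma extension_mono: "extension C \<Omega> \<Phi> A \<sigma> \<Longrightarrow> \<sigma> \<in> \<Omega>' \<Longrightarrow> extension C \<Omega>' \<Phi> A \<sigma>"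
  and enrichment_mono: "enrichment C \<Gamma> \<Phi> A \<sigma> \<Longrightarrow> \<sigma> \<in> \<Gamma>' \<Longrightarrow> enrichment C \<Gamma>' \<Phi> A \<sigma>"
  unfolding extension_def enrichment_def by simp_all

context category
begin

lemma Monos_comp:
  assumes "\<mu> \<in> Monos C" "\<mu> \<in> Hom C X Y" "\<nu> \<in> Monos C" "\<nu> \<in> Hom C Y Z"
  shows "\<nu> \<cdot> \<mu> \<in> Monos C"
proof (rule MonosI[OF comp_hom[OF assms(2,4)]])
  fix W \<alpha> \<beta> assume a: "\<alpha> \<in> Hom C W X" and b: "\<beta> \<in> Hom C W X" and eq: "(\<nu> \<cdot> \<mu>) \<cdot> \<alpha> = (\<nu> \<cdot> \<mu>) \<cdot> \<beta>"
  have "\<nu> \<cdot> (\<mu> \<cdot> \<alpha>) = \<nu> \<cdot> (\<mu> \<cdot> \<beta>)" using comp_assoc[OF a assms(2,4)] comp_assoc[OF b assms(2,4)] eq by simp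
  then have "\<mu> \<cdot> \<alpha> = \<mu> \<cdot> \<beta>"
    by (rule Monos_cancel[OF assms(3,4) comp_hom[OF a assms(2)] comp_hom[OF b assms(2)]])
  then show "\<alpha> = \<beta>" by (rule Monos_cancel[OF assms(1,2) a b])
qed

lemma SMonos_comp:
  assumes m: "\<mu> \<in> SMonos C" "\<mu> \<in> Hom C X Y" and n: "\<nu> \<in> SMonos C" "\<nu> \<in> Hom C Y Z"
  shows "\<nu> \<cdot> \<mu> \<in> SMonos C"
proof (rule SMonosI[OF Monos_comp[OF SMonos_Monos[OF m(1)] m(2) SMonos_Monos[OF n(1)] n(2)] comp_hom[OF m(2) n(2)]])
  fix P Q \<epsilon> \<alpha> \<beta> assume e: "\<epsilon> \<in> Epis C" "\<epsilon> \<in> Hom C P Q" and a: "\<alpha> \<in> Hom C P X" and b: "\<beta> \<in> Hom C Q Z"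
    and eq: "\<beta> \<cdot> \<epsilon> = (\<nu> \<cdot> \<mu>) \<cdot> \<alpha>"
  have "\<beta> \<cdot> \<epsilon> = \<nu> \<cdot> (\<mu> \<cdot> \<alpha>)" using eq comp_assoc[OF a m(2) n(2)] by simp
  then obtain \<gamma> where g: "\<gamma> \<in> Hom C Q Y" "\<gamma> \<cdot> \<epsilon> = \<mu> \<cdot> \<alpha>" "\<nu> \<cdot> \<gamma> = \<beta>"
    using SMonos_lift[OF n e comp_hom[OF a m(2)] b] by blast
  obtain \<delta> where d: "\<delta> \<in> Hom C Q X" "\<delta> \<cdot> \<epsilon> = \<alpha>" "\<mu> \<cdot> \<delta> = \<gamma>"
    using SMonos_lift[OF m e a g(1,2)] by blast
  show "\<exists>\<delta>\<in>Hom C Q X. \<delta> \<cdot> \<epsilon> = \<alpha> \<and> (\<nu> \<cdot> \<mu>) \<cdot> \<delta> = \<beta>"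
    using d g(3) comp_assoc[OF d(1) m(2) n(2)] by (intro bexI[of _ \<delta>]) simp_all
qed

text \<open>Arrows identified by \<open>\<sigma>\<close> are identified by every
  \<open>\<phi>\<close> in \<open>\<Phi>\<close> from \<open>A\<close>, since each of these factors
  through \<open>\<sigma>\<close>.\<close>

lemma extension_Monos:
  assumes \<Phi>: "\<Phi> \<subseteq> Mor C" "differs_outside C \<Phi>" and ext: "extension C \<Omega> \<Phi> A \<sigma>" and s: "\<sigma> \<in> Mor C"
  shows "\<sigma> \<in> Monos C"
proof -
  have \<sigma>: "\<sigma> \<in> Hom C A (Cod C \<sigma>)" using Mor_Hom[OF s] extensionD(2)[OF ext] by simp
  show ?thesis
  proof (rule MonosI[OF \<sigma>], rule ccontr)
    fix W \<alpha> \<beta> assume a: "\<alpha> \<in> Hom C W A" and b: "\<beta> \<in> Hom C W A" and eq: "\<sigma> \<cdot> \<alpha> = \<sigma> \<cdot> \<beta>" and ne: "\<alpha> \<noteq> \<beta>"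
    obtain \<phi> where f: "\<phi> \<in> \<Phi>" "Dom C \<phi> = A" "\<phi> \<cdot> \<alpha> \<noteq> \<phi> \<cdot> \<beta>"
      using \<Phi>(2) a b ne unfolding differs_outside_def by meson
    obtain \<phi>' where f': "\<phi>' \<in> Hom C (Cod C \<sigma>) (Cod C \<phi>)" "\<phi>' \<cdot> \<sigma> = \<phi>" using extensionD(3)[OF ext f(1,2)] by blast
    show False using f(3) eq comp_assoc[OF a \<sigma> f'(1)] comp_assoc[OF b \<sigma> f'(1)] f'(2) by simp
  qed
qed

text \<open>If \<open>\<alpha>\<close> and \<open>\<beta>\<close> agree after
  \<open>\<sigma>\<close>, then \<open>\<phi> \<cdot> \<alpha>\<close> and
  \<open>\<phi> \<cdot> \<beta>\<close> extend the same arrow. The ideal property puts that arrow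
  into \<open>\<Phi>\<close>, and uniqueness of its extension identifies them for every
  \<open>\<phi>\<close>.\<close>

lemma extension_Epis:
  assumes \<Phi>: "\<Phi> \<subseteq> Mor C" "differs_outside C \<Phi>" "right_ideal C \<Phi>"
    and ext: "extension C \<Omega> \<Phi> A \<sigma>" and s: "\<sigma> \<in> Mor C"
  shows "\<sigma> \<in> Epis C"
proof -
  have \<sigma>: "\<sigma> \<in> Hom C A (Cod C \<sigma>)" using Mor_Hom[OF s] extensionD(2)[OF ext] by simp
  show ?thesis
  proof (rule EpisI[OF \<sigma>], rule ccontr)
    fix Z \<alpha> \<beta> assume a: "\<alpha> \<in> Hom C (Cod C \<sigma>) Z" and b: "\<beta> \<in> Hom C (Cod C \<sigma>) Z"
      and eq: "\<alpha> \<cdot> \<sigma> = \<beta> \<cdot> \<sigma>" and ne: "\<alpha> \<noteq> \<beta>"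
    obtain \<phi> where f: "\<phi> \<in> \<Phi>" "Dom C \<phi> = Z" "\<phi> \<cdot> \<alpha> \<noteq> \<phi> \<cdot> \<beta>"
      using \<Phi>(2) a b ne unfolding differs_outside_def by meson
    have fh: "\<phi> \<in> Hom C Z (Cod C \<phi>)" using Mor_Hom[of \<phi> C] \<Phi>(1) f(1,2) by auto
    let ?\<psi> = "\<phi> \<cdot> (\<alpha> \<cdot> \<sigma>)"
    have as: "\<alpha> \<cdot> \<sigma> \<in> Hom C A Z" by (rule comp_hom[OF \<sigma> a])
    have ph: "?\<psi> \<in> Hom C A (Cod C \<phi>)" by (rule comp_hom[OF as fh])
    have "?\<psi> \<in> \<Phi>" using \<Phi>(3) f(1,2) HomD[OF as] unfolding right_ideal_def by simp
    then have ex1: "\<exists>!\<phi>'. \<phi>' \<in> Hom C (Cod C \<sigma>) (Cod C \<phi>) \<and> ?\<psi> = \<phi>' \<cdot> \<sigma>"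
      using ext HomD(2,3)[OF ph] unfolding extension_def by metis
    have "?\<psi> = (\<phi> \<cdot> \<alpha>) \<cdot> \<sigma>" "?\<psi> = (\<phi> \<cdot> \<beta>) \<cdot> \<sigma>"
      using comp_assoc[OF \<sigma> a fh] comp_assoc[OF \<sigma> b fh] eq by simp_all
    then have "\<phi> \<cdot> \<alpha> = \<phi> \<cdot> \<beta>" using ex1 comp_hom[OF a fh] comp_hom[OF b fh] by blast
    then show False using f(3) by simp
  qed
qed

lemma enrichment_Epis:
  assumes \<Phi>: "\<Phi> \<subseteq> Mor C" "differs_inside C \<Phi>" and enr: "enrichment C \<Gamma> \<Phi> A \<sigma>" and s: "\<sigma> \<in> Mor C"
  shows "\<sigma> \<in> Epis C"
proof -
  have \<sigma>: "\<sigma> \<in> Hom C (Dom C \<sigma>) A" using Mor_Hom[OF s] enrichmentD(2)[OF enr] by simp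
  show ?thesis
  proof (rule EpisI[OF \<sigma>], rule ccontr)
    fix Z \<alpha> \<beta> assume a: "\<alpha> \<in> Hom C A Z" and b: "\<beta> \<in> Hom C A Z" and eq: "\<alpha> \<cdot> \<sigma> = \<beta> \<cdot> \<sigma>" and ne: "\<alpha> \<noteq> \<beta>"
    obtain \<phi> where f: "\<phi> \<in> \<Phi>" "Cod C \<phi> = A" "\<alpha> \<cdot> \<phi> \<noteq> \<beta> \<cdot> \<phi>"
      using \<Phi>(2) a b ne unfolding differs_inside_def by meson
    obtain \<phi>' where f': "\<phi>' \<in> Hom C (Dom C \<phi>) (Dom C \<sigma>)" "\<sigma> \<cdot> \<phi>' = \<phi>" using enrichmentD(3)[OF enr f(1,2)] by blast
    show False using f(3) eq comp_assoc[OF f'(1) \<sigma> a] comp_assoc[OF f'(1) \<sigma> b] f'(2) by simp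
  qed
qed

lemma enrichment_Monos:
  assumes \<Phi>: "\<Phi> \<subseteq> Mor C" "differs_inside C \<Phi>" "left_ideal C \<Phi>"
    and enr: "enrichment C \<Gamma> \<Phi> A \<sigma>" and s: "\<sigma> \<in> Mor C"
  shows "\<sigma> \<in> Monos C"
proof -
  have \<sigma>: "\<sigma> \<in> Hom C (Dom C \<sigma>) A" using Mor_Hom[OF s] enrichmentD(2)[OF enr] by simp
  show ?thesis
  proof (rule MonosI[OF \<sigma>], rule ccontr)
    fix W \<alpha> \<beta> assume a: "\<alpha> \<in> Hom C W (Dom C \<sigma>)" and b: "\<beta> \<in> Hom C W (Dom C \<sigma>)"
      and eq: "\<sigma> \<cdot> \<alpha> = \<sigma> \<cdot> \<beta>" and ne: "\<alpha> \<noteq> \<beta>"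
    obtain \<phi> where f: "\<phi> \<in> \<Phi>" "Cod C \<phi> = W" "\<alpha> \<cdot> \<phi> \<noteq> \<beta> \<cdot> \<phi>"
      using \<Phi>(2) a b ne unfolding differs_inside_def by meson
    have fh: "\<phi> \<in> Hom C (Dom C \<phi>) W" using Mor_Hom[of \<phi> C] \<Phi>(1) f(1,2) by auto
    let ?\<psi> = "(\<sigma> \<cdot> \<alpha>) \<cdot> \<phi>"
    have sa: "\<sigma> \<cdot> \<alpha> \<in> Hom C W A" by (rule comp_hom[OF a \<sigma>])
    have ph: "?\<psi> \<in> Hom C (Dom C \<phi>) A" by (rule comp_hom[OF fh sa])
    have "?\<psi> \<in> \<Phi>" using \<Phi>(3) f(1,2) HomD[OF sa] unfolding left_ideal_def by simp
    then have ex1: "\<exists>!\<phi>'. \<phi>' \<in> Hom C (Dom C \<phi>) (Dom C \<sigma>) \<and> ?\<psi> = \<sigma> \<cdot> \<phi>'"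
      using enr HomD(2,3)[OF ph] unfolding enrichment_def by metis
    have "?\<psi> = \<sigma> \<cdot> (\<alpha> \<cdot> \<phi>)" "?\<psi> = \<sigma> \<cdot> (\<beta> \<cdot> \<phi>)"
      using comp_assoc[OF fh a \<sigma>] comp_assoc[OF fh b \<sigma>] eq by simp_all
    then have "\<alpha> \<cdot> \<phi> = \<beta> \<cdot> \<phi>" using ex1 comp_hom[OF fh a] comp_hom[OF fh b] by blast
    then show False using f(3) by simp
  qed
qed

lemma Env_Epis_Bims:
  assumes "\<Phi> \<subseteq> Mor C" "differs_outside C \<Phi>"
  shows "Env C (Epis C) \<Phi> A = Env C (Bims C) \<Phi> A"
proof (rule Env_cong)
  fix \<sigma>
  show "extension C (Epis C) \<Phi> A \<sigma> \<longleftrightarrow> extension C (Bims C) \<Phi> A \<sigma>"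
    using extension_Monos[OF assms, of "Epis C" A \<sigma>] extensionD(1)[of C "Epis C" \<Phi> A \<sigma>] extensionD(1)[of C "Bims C" \<Phi> A \<sigma>]
      Epis_Mor[of \<sigma> C] extension_mono[of C "Epis C" \<Phi> A \<sigma> "Bims C"] extension_mono[of C "Bims C" \<Phi> A \<sigma> "Epis C"]
    unfolding Bims_def by blast
qed

lemma Env_Bims_any:
  assumes "\<Phi> \<subseteq> Mor C" "differs_outside C \<Phi>" "right_ideal C \<Phi>" "Bims C \<subseteq> \<Omega>" "\<Omega> \<subseteq> Mor C"
  shows "Env C (Bims C) \<Phi> A = Env C \<Omega> \<Phi> A"
proof (rule Env_cong)
  fix \<sigma>
  show "extension C (Bims C) \<Phi> A \<sigma> \<longleftrightarrow> extension C \<Omega> \<Phi> A \<sigma>"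
    using extension_Monos[OF assms(1,2), of \<Omega> A \<sigma>] extension_Epis[OF assms(1,2,3), of \<Omega> A \<sigma>]
      extensionD(1)[of C \<Omega> \<Phi> A \<sigma>] extensionD(1)[of C "Bims C" \<Phi> A \<sigma>] assms(4,5)
      extension_mono[of C \<Omega> \<Phi> A \<sigma> "Bims C"] extension_mono[of C "Bims C" \<Phi> A \<sigma> \<Omega>]
    unfolding Bims_def by blast
qed

lemma Ref_Monos_Bims:
  assumes "\<Phi> \<subseteq> Mor C" "differs_inside C \<Phi>"
  shows "Ref C (Monos C) \<Phi> A = Ref C (Bims C) \<Phi> A"
proof (rule Ref_cong)
  fix \<sigma>
  show "enrichment C (Monos C) \<Phi> A \<sigma> \<longleftrightarrow> enrichment C (Bims C) \<Phi> A \<sigma>"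
    using enrichment_Epis[OF assms, of "Monos C" A \<sigma>] enrichmentD(1)[of C "Monos C" \<Phi> A \<sigma>] enrichmentD(1)[of C "Bims C" \<Phi> A \<sigma>]
      Monos_Mor[of \<sigma> C] enrichment_mono[of C "Monos C" \<Phi> A \<sigma> "Bims C"] enrichment_mono[of C "Bims C" \<Phi> A \<sigma> "Monos C"]
    unfolding Bims_def by blast
qed

lemma Ref_Bims_any:
  assumes "\<Phi> \<subseteq> Mor C" "differs_inside C \<Phi>" "left_ideal C \<Phi>" "Bims C \<subseteq> \<Gamma>" "\<Gamma> \<subseteq> Mor C"
  shows "Ref C (Bims C) \<Phi> A = Ref C \<Gamma> \<Phi> A"
proof (rule Ref_cong)
  fix \<sigma>
  show "enrichment C (Bims C) \<Phi> A \<sigma> \<longleftrightarrow> enrichment C \<Gamma> \<Phi> A \<sigma>"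
    using enrichment_Epis[OF assms(1,2), of \<Gamma> A \<sigma>] enrichment_Monos[OF assms(1,2,3), of \<Gamma> A \<sigma>]
      enrichmentD(1)[of C \<Gamma> \<Phi> A \<sigma>] enrichmentD(1)[of C "Bims C" \<Phi> A \<sigma>] assms(4,5)
      enrichment_mono[of C \<Gamma> \<Phi> A \<sigma> "Bims C"] enrichment_mono[of C "Bims C" \<Phi> A \<sigma> \<Gamma>]
    unfolding Bims_def by blast
qed

text \<open>\<open>\<epsilon>0\<close> need not lie in \<open>\<Omega>\<close>, but all
  \<open>\<phi>\<close> factor through it and every competitor in \<open>\<Omega>\<close> maps to
  it. Its first factor \<open>\<epsilon>\<close> inherits the factorizations, and
  \<open>lift\<close> moves the comparison arrows from \<open>E0\<close> to \<open>E\<close>.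
  Uniqueness comes from cancelling epimorphisms.\<close>

lemma Env_exists:
  assumes \<Phi>: "\<Phi> \<subseteq> Mor C" and e0: "\<epsilon>0 \<in> Hom C A E0"
    and fac: "\<And>\<phi>. \<phi> \<in> \<Phi> \<Longrightarrow> Dom C \<phi> = A \<Longrightarrow> \<exists>p\<in>Hom C E0 (Cod C \<phi>). p \<cdot> \<epsilon>0 = \<phi>"
    and univ: "\<And>X \<sigma>. \<sigma> \<in> Hom C A X \<Longrightarrow> \<sigma> \<in> \<Omega> \<Longrightarrow>
      (\<And>\<phi>. \<phi> \<in> \<Phi> \<Longrightarrow> Dom C \<phi> = A \<Longrightarrow> \<exists>\<psi>\<in>Hom C X (Cod C \<phi>). \<psi> \<cdot> \<sigma> = \<phi>) \<Longrightarrow>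
      \<exists>\<delta>\<in>Hom C X E0. \<delta> \<cdot> \<sigma> = \<epsilon>0"
    and \<Omega>: "\<Omega> \<subseteq> Epis C"
    and e: "\<epsilon> \<in> \<Omega>" "\<epsilon> \<in> Hom C A E" and r: "\<rho> \<in> Hom C E E0" "\<rho> \<cdot> \<epsilon> = \<epsilon>0"
    and lift: "\<And>X \<sigma> \<beta>. \<sigma> \<in> \<Omega> \<Longrightarrow> \<sigma> \<in> Hom C A X \<Longrightarrow> \<beta> \<in> Hom C X E0 \<Longrightarrow> \<beta> \<cdot> \<sigma> = \<rho> \<cdot> \<epsilon> \<Longrightarrow>
      \<exists>\<delta>\<in>Hom C X E. \<delta> \<cdot> \<sigma> = \<epsilon>"
  shows "\<epsilon> \<in> Env C \<Omega> \<Phi> A"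
proof -
  have eE: "\<epsilon> \<in> Epis C" using e(1) \<Omega> by blast
  have "extension C \<Omega> \<Phi> A \<epsilon>"
    unfolding extension_def HomD(2,3)[OF e(2)]
  proof (intro conjI ballI impI e(1) refl)
    fix \<phi> assume f: "\<phi> \<in> \<Phi>" "Dom C \<phi> = A"
    obtain p where p: "p \<in> Hom C E0 (Cod C \<phi>)" "p \<cdot> \<epsilon>0 = \<phi>" using fac[OF f] by blast
    have pr: "p \<cdot> \<rho> \<in> Hom C E (Cod C \<phi>)" by (rule comp_hom[OF r(1) p(1)])
    have eq: "(p \<cdot> \<rho>) \<cdot> \<epsilon> = \<phi>" using comp_assoc[OF e(2) r(1) p(1)] r(2) p(2) by simp
    show "\<exists>!\<phi>'. \<phi>' \<in> Hom C E (Cod C \<phi>) \<and> \<phi> = \<phi>' \<cdot> \<epsilon>"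
    proof (rule ex1I[of _ "p \<cdot> \<rho>"])
      show "p \<cdot> \<rho> \<in> Hom C E (Cod C \<phi>) \<and> \<phi> = (p \<cdot> \<rho>) \<cdot> \<epsilon>" using pr eq by blast
      fix \<phi>' assume "\<phi>' \<in> Hom C E (Cod C \<phi>) \<and> \<phi> = \<phi>' \<cdot> \<epsilon>"
      then show "\<phi>' = p \<cdot> \<rho>" using Epis_cancel[OF eE e(2) _ pr] eq by metis
    qed
  qed
  moreover have "\<exists>!\<upsilon>. \<upsilon> \<in> Hom C (Cod C \<sigma>) (Cod C \<epsilon>) \<and> \<epsilon> = \<upsilon> \<cdot> \<sigma>" if ext: "extension C \<Omega> \<Phi> A \<sigma>" for \<sigma>
  proof -
    have s: "\<sigma> \<in> \<Omega>" "\<sigma> \<in> Epis C" using extensionD(1)[OF ext] \<Omega> by auto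
    have sH: "\<sigma> \<in> Hom C A (Cod C \<sigma>)" using Mor_Hom[OF Epis_Mor[OF s(2)]] extensionD(2)[OF ext] by simp
    obtain \<beta> where b: "\<beta> \<in> Hom C (Cod C \<sigma>) E0" "\<beta> \<cdot> \<sigma> = \<epsilon>0" using univ[OF sH s(1) extensionD(3)[OF ext]] by blast
    obtain \<delta> where d: "\<delta> \<in> Hom C (Cod C \<sigma>) E" "\<delta> \<cdot> \<sigma> = \<epsilon>"
      using lift[OF s(1) sH b(1)] b(2) r(2) by auto
    show ?thesis
      unfolding HomD(3)[OF e(2)]
    proof (rule ex1I[of _ \<delta>])
      show "\<delta> \<in> Hom C (Cod C \<sigma>) E \<and> \<epsilon> = \<delta> \<cdot> \<sigma>" using d by simp
      fix \<upsilon> assume "\<upsilon> \<in> Hom C (Cod C \<sigma>) E \<and> \<epsilon> = \<upsilon> \<cdot> \<sigma>"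
      then show "\<upsilon> = \<delta>" using Epis_cancel[OF s(2) sH _ d(1)] d(2) by metis
    qed
  qed
  ultimately show ?thesis unfolding Env_def by blast
qed

end

text \<open>Intersections are demanded for arbitrary classes of subobjects, in place of
  well-poweredness. Equalizers are used to recognize epimorphisms, pullbacks to recognize strong
  ones.\<close>

locale mono_complete_category = category +
  assumes intersection: "A \<in> Obj C \<Longrightarrow> M \<subseteq> {\<sigma> \<in> Monos C. Cod C \<sigma> = A} \<Longrightarrow>
    \<exists>E \<rho>. \<rho> \<in> Hom C E A \<and> \<rho> \<in> Monos C \<and> (\<forall>\<sigma>\<in>M. \<exists>\<upsilon>\<in>Hom C E (Dom C \<sigma>). \<sigma> \<cdot> \<upsilon> = \<rho>) \<and>
    (\<forall>Q \<beta>. \<beta> \<in> Hom C Q A \<longrightarrow> (\<forall>\<sigma>\<in>M. \<exists>\<delta>\<in>Hom C Q (Dom C \<sigma>). \<sigma> \<cdot> \<delta> = \<beta>) \<longrightarrow>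
      (\<exists>\<delta>\<in>Hom C Q E. \<rho> \<cdot> \<delta> = \<beta>))"
    and pullback_mono: "f \<in> Hom C X Z \<Longrightarrow> g \<in> Hom C Y Z \<Longrightarrow> g \<in> Monos C \<Longrightarrow>
    \<exists>R p q. p \<in> Hom C R X \<and> q \<in> Hom C R Y \<and> p \<in> Monos C \<and> f \<cdot> p = g \<cdot> q \<and>
    (\<forall>W a b. a \<in> Hom C W X \<longrightarrow> b \<in> Hom C W Y \<longrightarrow> f \<cdot> a = g \<cdot> b \<longrightarrow>
      (\<exists>t\<in>Hom C W R. p \<cdot> t = a \<and> q \<cdot> t = b))"
    and equalizer: "f \<in> Hom C X Y \<Longrightarrow> g \<in> Hom C X Y \<Longrightarrow>
    \<exists>K e. e \<in> Hom C K X \<and> e \<in> Monos C \<and> f \<cdot> e = g \<cdot> e \<and>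
    (\<forall>W a. a \<in> Hom C W X \<longrightarrow> f \<cdot> a = g \<cdot> a \<longrightarrow> (\<exists>t\<in>Hom C W K. e \<cdot> t = a))"
begin

text \<open>For strong monomorphisms, the diagonals into the single members of \<open>M\<close>
  combine into one by the universal property of the intersection.\<close>

lemma intersection_class:
  assumes A: "A \<in> Obj C" and \<Gamma>: "\<Gamma> = Monos C \<or> \<Gamma> = SMonos C"
    and M: "M \<subseteq> {\<sigma> \<in> \<Gamma>. Cod C \<sigma> = A}"
  shows "\<exists>E \<rho>. \<rho> \<in> Hom C E A \<and> \<rho> \<in> \<Gamma> \<and> (\<forall>\<sigma>\<in>M. \<exists>\<upsilon>\<in>Hom C E (Dom C \<sigma>). \<sigma> \<cdot> \<upsilon> = \<rho>) \<and>
    (\<forall>Q \<beta>. \<beta> \<in> Hom C Q A \<longrightarrow> (\<forall>\<sigma>\<in>M. \<exists>\<delta>\<in>Hom C Q (Dom C \<sigma>). \<sigma> \<cdot> \<delta> = \<beta>) \<longrightarrow>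
      (\<exists>\<delta>\<in>Hom C Q E. \<rho> \<cdot> \<delta> = \<beta>))"
proof -
  have MM: "M \<subseteq> {\<sigma> \<in> Monos C. Cod C \<sigma> = A}" using M \<Gamma> SMonos_Monos[of _ C] by auto
  obtain \<rho> E where r: "\<rho> \<in> Hom C E A" "\<rho> \<in> Monos C" "\<forall>\<sigma>\<in>M. \<exists>\<upsilon>\<in>Hom C E (Dom C \<sigma>). \<sigma> \<cdot> \<upsilon> = \<rho>"
    and univ: "\<forall>Q \<beta>. \<beta> \<in> Hom C Q A \<longrightarrow> (\<forall>\<sigma>\<in>M. \<exists>\<delta>\<in>Hom C Q (Dom C \<sigma>). \<sigma> \<cdot> \<delta> = \<beta>) \<longrightarrow>
      (\<exists>\<delta>\<in>Hom C Q E. \<rho> \<cdot> \<delta> = \<beta>)"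
    using intersection[OF A MM] by (elim exE conjE)
  have MH: "\<sigma> \<in> Hom C (Dom C \<sigma>) A" if "\<sigma> \<in> M" for \<sigma>
    using Mor_Hom[OF Monos_Mor, of \<sigma> C] MM that by auto
  have "\<rho> \<in> SMonos C" if S: "\<Gamma> = SMonos C"
  proof (rule SMonosI[OF r(2,1)])
    fix P Q \<epsilon> \<alpha> \<beta> assume e: "\<epsilon> \<in> Epis C" "\<epsilon> \<in> Hom C P Q" and a: "\<alpha> \<in> Hom C P E" and b: "\<beta> \<in> Hom C Q A"
      and eq: "\<beta> \<cdot> \<epsilon> = \<rho> \<cdot> \<alpha>"
    have "\<exists>\<delta>\<in>Hom C Q (Dom C \<sigma>). \<sigma> \<cdot> \<delta> = \<beta>" if s: "\<sigma> \<in> M" for \<sigma>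
    proof -
      obtain \<upsilon> where u: "\<upsilon> \<in> Hom C E (Dom C \<sigma>)" "\<sigma> \<cdot> \<upsilon> = \<rho>" using r(3) s by blast
      have "\<beta> \<cdot> \<epsilon> = \<sigma> \<cdot> (\<upsilon> \<cdot> \<alpha>)" using eq comp_assoc[OF a u(1) MH[OF s]] u(2) by simp
      moreover have "\<sigma> \<in> SMonos C" using s M S by auto
      ultimately show ?thesis using SMonos_lift[OF _ MH[OF s] e comp_hom[OF a u(1)] b] by blast
    qed
    then obtain \<delta> where d: "\<delta> \<in> Hom C Q E" "\<rho> \<cdot> \<delta> = \<beta>" using univ b by blast
    have "\<rho> \<cdot> (\<delta> \<cdot> \<epsilon>) = \<rho> \<cdot> \<alpha>" using comp_assoc[OF e(2) d(1) r(1)] d(2) eq by simp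
    then have "\<delta> \<cdot> \<epsilon> = \<alpha>" by (rule Monos_cancel[OF r(2,1) comp_hom[OF e(2) d(1)] a])
    then show "\<exists>\<delta>\<in>Hom C Q E. \<delta> \<cdot> \<epsilon> = \<alpha> \<and> \<rho> \<cdot> \<delta> = \<beta>" using d by blast
  qed
  then have "\<rho> \<in> \<Gamma>" using \<Gamma> r(2) by auto
  then show ?thesis using r(1,3) univ by (intro exI conjI)
qed

text \<open>Each \<open>\<phi>\<close> factors through every enrichment, hence through their
  intersection, which is therefore itself an enrichment and lies below all others. Uniqueness comes
  from cancelling monomorphisms.\<close>

lemma Ref_exists:
  assumes A: "A \<in> Obj C" and \<Phi>: "\<Phi> \<subseteq> Mor C" and \<Gamma>: "\<Gamma> = Monos C \<or> \<Gamma> = SMonos C"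
  shows "Ref C \<Gamma> \<Phi> A \<noteq> {}"
proof -
  let ?M = "{\<sigma>. enrichment C \<Gamma> \<Phi> A \<sigma>}"
  have M: "?M \<subseteq> {\<sigma> \<in> \<Gamma>. Cod C \<sigma> = A}" using enrichmentD(1,2)[of C \<Gamma> \<Phi> A] by auto
  obtain \<rho> E where r: "\<rho> \<in> Hom C E A" "\<rho> \<in> \<Gamma>" "\<forall>\<sigma>\<in>?M. \<exists>\<upsilon>\<in>Hom C E (Dom C \<sigma>). \<sigma> \<cdot> \<upsilon> = \<rho>"
    and univ: "\<forall>Q \<beta>. \<beta> \<in> Hom C Q A \<longrightarrow> (\<forall>\<sigma>\<in>?M. \<exists>\<delta>\<in>Hom C Q (Dom C \<sigma>). \<sigma> \<cdot> \<delta> = \<beta>) \<longrightarrow>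
      (\<exists>\<delta>\<in>Hom C Q E. \<rho> \<cdot> \<delta> = \<beta>)"
    using intersection_class[OF A \<Gamma> M] by (elim exE conjE)
  have mono: "\<sigma> \<in> Monos C" if "\<sigma> \<in> \<Gamma>" for \<sigma> using that \<Gamma> SMonos_Monos[of \<sigma> C] by auto
  have "enrichment C \<Gamma> \<Phi> A \<rho>"
    unfolding enrichment_def HomD(2,3)[OF r(1)]
  proof (intro conjI ballI impI r(2) refl)
    fix \<phi> assume f: "\<phi> \<in> \<Phi>" "Cod C \<phi> = A"
    have fH: "\<phi> \<in> Hom C (Dom C \<phi>) A" using Mor_Hom[of \<phi> C] \<Phi> f by auto
    have "\<forall>\<sigma>\<in>?M. \<exists>\<delta>\<in>Hom C (Dom C \<phi>) (Dom C \<sigma>). \<sigma> \<cdot> \<delta> = \<phi>" using enrichmentD(3)[OF _ f] by blast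
    then obtain \<delta> where d: "\<delta> \<in> Hom C (Dom C \<phi>) E" "\<rho> \<cdot> \<delta> = \<phi>" using univ fH by blast
    show "\<exists>!\<phi>'. \<phi>' \<in> Hom C (Dom C \<phi>) E \<and> \<phi> = \<rho> \<cdot> \<phi>'"
    proof (rule ex1I[of _ \<delta>])
      show "\<delta> \<in> Hom C (Dom C \<phi>) E \<and> \<phi> = \<rho> \<cdot> \<delta>" using d by simp
      fix \<phi>' assume "\<phi>' \<in> Hom C (Dom C \<phi>) E \<and> \<phi> = \<rho> \<cdot> \<phi>'"
      then show "\<phi>' = \<delta>" using Monos_cancel[OF mono[OF r(2)] r(1) _ d(1)] d(2) by metis
    qed
  qed
  moreover have "\<exists>!\<upsilon>. \<upsilon> \<in> Hom C (Dom C \<rho>) (Dom C \<sigma>) \<and> \<rho> = \<sigma> \<cdot> \<upsilon>" if enr: "enrichment C \<Gamma> \<Phi> A \<sigma>" for \<sigma>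
  proof -
    have s: "\<sigma> \<in> Monos C" by (rule mono[OF enrichmentD(1)[OF enr]])
    have sH: "\<sigma> \<in> Hom C (Dom C \<sigma>) A" using Mor_Hom[OF Monos_Mor[OF s]] enrichmentD(2)[OF enr] by simp
    obtain \<upsilon> where u: "\<upsilon> \<in> Hom C E (Dom C \<sigma>)" "\<sigma> \<cdot> \<upsilon> = \<rho>" using r(3) enr by blast
    show ?thesis
      unfolding HomD(2)[OF r(1)]
    proof (rule ex1I[of _ \<upsilon>])
      show "\<upsilon> \<in> Hom C E (Dom C \<sigma>) \<and> \<rho> = \<sigma> \<cdot> \<upsilon>" using u by simp
      fix \<upsilon>' assume "\<upsilon>' \<in> Hom C E (Dom C \<sigma>) \<and> \<rho> = \<sigma> \<cdot> \<upsilon>'"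
      then show "\<upsilon>' = \<upsilon>" using Monos_cancel[OF s sH _ u(1)] u(2) by metis
    qed
  qed
  ultimately have "\<rho> \<in> Ref C \<Gamma> \<Phi> A" unfolding Ref_def by blast
  then show ?thesis by blast
qed

text \<open>\<open>\<rho>\<close> is the smallest subobject in \<open>\<Gamma>\<close> through which \<open>\<phi>\<close> factors. If \<open>\<epsilon> = m \<cdot> t\<close>, then
  \<open>\<rho> \<cdot> m\<close> is another one, so that \<open>\<rho>\<close> factors through it.\<close>

lemma image_factorization:
  assumes f: "\<phi> \<in> Hom C A B" and \<Gamma>: "\<Gamma> = Monos C \<or> \<Gamma> = SMonos C"
  obtains E \<epsilon> \<rho> where "\<epsilon> \<in> Hom C A E" "\<rho> \<in> Hom C E B" "\<rho> \<in> \<Gamma>" "\<rho> \<cdot> \<epsilon> = \<phi>"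
    "\<And>R m t. m \<in> Hom C R E \<Longrightarrow> m \<in> \<Gamma> \<Longrightarrow> t \<in> Hom C A R \<Longrightarrow> m \<cdot> t = \<epsilon> \<Longrightarrow> \<exists>s\<in>Hom C E R. m \<cdot> s = Id C E"
proof -
  let ?M = "{\<sigma> \<in> \<Gamma>. Cod C \<sigma> = B \<and> (\<exists>\<delta>\<in>Hom C A (Dom C \<sigma>). \<sigma> \<cdot> \<delta> = \<phi>)}"
  have B: "B \<in> Obj C" using cod_obj[OF HomD(1)[OF f]] HomD(3)[OF f] by simp
  have M: "?M \<subseteq> {\<sigma> \<in> \<Gamma>. Cod C \<sigma> = B}" by auto
  obtain \<rho> E where r: "\<rho> \<in> Hom C E B" "\<rho> \<in> \<Gamma>" "\<forall>\<sigma>\<in>?M. \<exists>\<upsilon>\<in>Hom C E (Dom C \<sigma>). \<sigma> \<cdot> \<upsilon> = \<rho>"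
    and univ: "\<forall>Q \<beta>. \<beta> \<in> Hom C Q B \<longrightarrow> (\<forall>\<sigma>\<in>?M. \<exists>\<delta>\<in>Hom C Q (Dom C \<sigma>). \<sigma> \<cdot> \<delta> = \<beta>) \<longrightarrow>
      (\<exists>\<delta>\<in>Hom C Q E. \<rho> \<cdot> \<delta> = \<beta>)"
    using intersection_class[OF B \<Gamma> M] by (elim exE conjE)
  have mono: "\<sigma> \<in> Monos C" if "\<sigma> \<in> \<Gamma>" for \<sigma> using that \<Gamma> SMonos_Monos[of \<sigma> C] by auto
  have "\<forall>\<sigma>\<in>?M. \<exists>\<delta>\<in>Hom C A (Dom C \<sigma>). \<sigma> \<cdot> \<delta> = \<phi>" by blast
  then obtain \<epsilon> where e: "\<epsilon> \<in> Hom C A E" "\<rho> \<cdot> \<epsilon> = \<phi>" using univ f by blast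
  have E: "E \<in> Obj C" using dom_obj[OF HomD(1)[OF r(1)]] HomD(2)[OF r(1)] by simp
  show thesis
  proof (rule that[OF e(1) r(1,2) e(2)])
    fix R m t assume m: "m \<in> Hom C R E" "m \<in> \<Gamma>" and t: "t \<in> Hom C A R" "m \<cdot> t = \<epsilon>"
    have rm: "\<rho> \<cdot> m \<in> Hom C R B" by (rule comp_hom[OF m(1) r(1)])
    have "\<rho> \<cdot> m \<in> \<Gamma>"
      using \<Gamma> Monos_comp[OF mono[OF m(2)] m(1) mono[OF r(2)] r(1)] SMonos_comp[OF _ m(1) _ r(1)] m(2) r(2) by auto
    moreover have "(\<rho> \<cdot> m) \<cdot> t = \<phi>" using comp_assoc[OF t(1) m(1) r(1)] t(2) e(2) by simp
    ultimately have "\<rho> \<cdot> m \<in> ?M" using t(1) HomD(2,3)[OF rm] by blast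
    then obtain s where s: "s \<in> Hom C E R" "(\<rho> \<cdot> m) \<cdot> s = \<rho>" using r(3) HomD(2)[OF rm] by auto
    have "\<rho> \<cdot> (m \<cdot> s) = \<rho> \<cdot> Id C E"
      using comp_assoc[OF s(1) m(1) r(1)] s(2) comp_id_right[OF r(1)] by simp
    then have "m \<cdot> s = Id C E"
      by (rule Monos_cancel[OF mono[OF r(2)] r(1) comp_hom[OF s(1) m(1)] id_hom[OF E]])
    then show "\<exists>s\<in>Hom C E R. m \<cdot> s = Id C E" using s(1) by blast
  qed
qed

text \<open>Cancelling the epimorphism \<open>\<epsilon>\<close> shows that \<open>f\<close> and
  \<open>g\<close> agree after \<open>\<beta>\<close>, so \<open>\<beta>\<close> factors through the
  equalizer.\<close>

lemma equalizer_SMonos: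
  assumes f: "f \<in> Hom C X Y" and g: "g \<in> Hom C X Y" and e: "e \<in> Hom C K X" "e \<in> Monos C" "f \<cdot> e = g \<cdot> e"
    and univ: "\<forall>W a. a \<in> Hom C W X \<longrightarrow> f \<cdot> a = g \<cdot> a \<longrightarrow> (\<exists>t\<in>Hom C W K. e \<cdot> t = a)"
  shows "e \<in> SMonos C"
proof (rule SMonosI[OF e(2,1)])
  fix P Q \<epsilon> \<alpha> \<beta> assume ep: "\<epsilon> \<in> Epis C" "\<epsilon> \<in> Hom C P Q" and a: "\<alpha> \<in> Hom C P K" and b: "\<beta> \<in> Hom C Q X"
    and eq: "\<beta> \<cdot> \<epsilon> = e \<cdot> \<alpha>"
  have "(f \<cdot> \<beta>) \<cdot> \<epsilon> = (g \<cdot> \<beta>) \<cdot> \<epsilon>"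
    using comp_assoc[OF ep(2) b f] comp_assoc[OF ep(2) b g] comp_assoc[OF a e(1) f] comp_assoc[OF a e(1) g] eq e(3)
    by simp
  then have "f \<cdot> \<beta> = g \<cdot> \<beta>" by (rule Epis_cancel[OF ep comp_hom[OF b f] comp_hom[OF b g]])
  then obtain t where t: "t \<in> Hom C Q K" "e \<cdot> t = \<beta>" using univ b by blast
  have "e \<cdot> (t \<cdot> \<epsilon>) = e \<cdot> \<alpha>" using comp_assoc[OF ep(2) t(1) e(1)] t(2) eq by simp
  then have "t \<cdot> \<epsilon> = \<alpha>" by (rule Monos_cancel[OF e(2,1) comp_hom[OF ep(2) t(1)] a])
  then show "\<exists>\<delta>\<in>Hom C Q K. \<delta> \<cdot> \<epsilon> = \<alpha> \<and> e \<cdot> \<delta> = \<beta>" using t by blast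
qed

text \<open>Two arrows that agree after \<open>\<epsilon>\<close> have an equalizer in
  \<open>\<Gamma>\<close> through which \<open>\<epsilon>\<close> factors. By \<open>ext\<close> it
  has a section, so the two arrows are equal.\<close>

lemma image_Epis:
  assumes \<Gamma>: "SMonos C \<subseteq> \<Gamma>" and e: "\<epsilon> \<in> Hom C A E"
    and ext: "\<And>R m t. m \<in> Hom C R E \<Longrightarrow> m \<in> \<Gamma> \<Longrightarrow> t \<in> Hom C A R \<Longrightarrow> m \<cdot> t = \<epsilon> \<Longrightarrow> \<exists>s\<in>Hom C E R. m \<cdot> s = Id C E"
  shows "\<epsilon> \<in> Epis C"
proof (rule EpisI[OF e])
  fix Z \<gamma> \<delta> assume g: "\<gamma> \<in> Hom C E Z" and d: "\<delta> \<in> Hom C E Z" and eq: "\<gamma> \<cdot> \<epsilon> = \<delta> \<cdot> \<epsilon>"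
  obtain K k where k: "k \<in> Hom C K E" "k \<in> Monos C" "\<gamma> \<cdot> k = \<delta> \<cdot> k"
    and univ: "\<forall>W a. a \<in> Hom C W E \<longrightarrow> \<gamma> \<cdot> a = \<delta> \<cdot> a \<longrightarrow> (\<exists>t\<in>Hom C W K. k \<cdot> t = a)"
    using equalizer[OF g d] by (elim exE conjE)
  obtain t where t: "t \<in> Hom C A K" "k \<cdot> t = \<epsilon>" using univ e eq by blast
  have "k \<in> \<Gamma>" using equalizer_SMonos[OF g d k univ] \<Gamma> by blast
  then obtain s where s: "s \<in> Hom C E K" "k \<cdot> s = Id C E" using ext[OF k(1) _ t] by blast
  have "(\<gamma> \<cdot> k) \<cdot> s = (\<delta> \<cdot> k) \<cdot> s" using k(3) by simp
  then show "\<gamma> = \<delta>"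
    using comp_assoc[OF s(1) k(1) g] comp_assoc[OF s(1) k(1) d] s(2) comp_id_right[OF g] comp_id_right[OF d] by simp
qed

lemma Epi_SMono_factorization:
  assumes f: "\<phi> \<in> Hom C A B"
  obtains E \<epsilon> \<rho> where "\<epsilon> \<in> Hom C A E" "\<rho> \<in> Hom C E B" "\<epsilon> \<in> Epis C" "\<rho> \<in> SMonos C" "\<rho> \<cdot> \<epsilon> = \<phi>"
proof (rule image_factorization[OF f, of "SMonos C"])
  fix E \<epsilon> \<rho> assume e: "\<epsilon> \<in> Hom C A E" and r: "\<rho> \<in> Hom C E B" "\<rho> \<in> SMonos C" "\<rho> \<cdot> \<epsilon> = \<phi>"
    and ext: "\<And>R m t. m \<in> Hom C R E \<Longrightarrow> m \<in> SMonos C \<Longrightarrow> t \<in> Hom C A R \<Longrightarrow> m \<cdot> t = \<epsilon> \<Longrightarrow> \<exists>s\<in>Hom C E R. m \<cdot> s = Id C E"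
  show thesis by (rule that[OF e r(1) image_Epis[OF subset_refl e ext] r(2,3)])
qed simp

lemma SEpi_Mono_factorization:
  assumes f: "\<phi> \<in> Hom C A B"
  obtains E \<epsilon> \<rho> where "\<epsilon> \<in> Hom C A E" "\<rho> \<in> Hom C E B" "\<epsilon> \<in> SEpis C" "\<rho> \<in> Monos C" "\<rho> \<cdot> \<epsilon> = \<phi>"
proof (rule image_factorization[OF f, of "Monos C"])
  fix E \<epsilon> \<rho> assume e: "\<epsilon> \<in> Hom C A E" and r: "\<rho> \<in> Hom C E B" "\<rho> \<in> Monos C" "\<rho> \<cdot> \<epsilon> = \<phi>"
    and ext: "\<And>R m t. m \<in> Hom C R E \<Longrightarrow> m \<in> Monos C \<Longrightarrow> t \<in> Hom C A R \<Longrightarrow> m \<cdot> t = \<epsilon> \<Longrightarrow> \<exists>s\<in>Hom C E R. m \<cdot> s = Id C E"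
  have "SMonos C \<subseteq> Monos C" using SMonos_Monos by (rule subsetI)
  then have ep: "\<epsilon> \<in> Epis C" by (rule image_Epis[OF _ e ext])
  have "\<epsilon> \<in> SEpis C"
  proof (rule SEpisI[OF ep e])
    fix X Y \<mu> \<alpha> \<beta> assume m: "\<mu> \<in> Monos C" "\<mu> \<in> Hom C X Y" and a: "\<alpha> \<in> Hom C A X" and b: "\<beta> \<in> Hom C E Y"
      and eq: "\<beta> \<cdot> \<epsilon> = \<mu> \<cdot> \<alpha>"
    \<comment> \<open>The pullback \<open>p\<close> of \<open>\<mu>\<close> along
      \<open>\<beta>\<close> is a monomorphism into \<open>E\<close> through which
      \<open>\<epsilon>\<close> factors, so it has a section \<open>s\<close>; the diagonal is
      \<open>q \<cdot> s\<close>.\<close>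
    obtain R p q where p: "p \<in> Hom C R E" "q \<in> Hom C R X" "p \<in> Monos C" "\<beta> \<cdot> p = \<mu> \<cdot> q"
      and univ: "\<forall>W a b. a \<in> Hom C W E \<longrightarrow> b \<in> Hom C W X \<longrightarrow> \<beta> \<cdot> a = \<mu> \<cdot> b \<longrightarrow>
        (\<exists>t\<in>Hom C W R. p \<cdot> t = a \<and> q \<cdot> t = b)"
      using pullback_mono[OF b m(2,1)] by (elim exE conjE)
    obtain t where t: "t \<in> Hom C A R" "p \<cdot> t = \<epsilon>" using univ e a eq by blast
    obtain s where s: "s \<in> Hom C E R" "p \<cdot> s = Id C E" using ext[OF p(1,3) t] by blast
    have qs: "q \<cdot> s \<in> Hom C E X" by (rule comp_hom[OF s(1) p(2)])
    have 1: "\<mu> \<cdot> (q \<cdot> s) = \<beta>"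
      using comp_assoc[OF s(1) p(2) m(2)] comp_assoc[OF s(1) p(1) b] p(4) s(2) comp_id_right[OF b] by simp
    have "\<mu> \<cdot> ((q \<cdot> s) \<cdot> \<epsilon>) = \<mu> \<cdot> \<alpha>" using comp_assoc[OF e qs m(2)] 1 eq by simp
    then have "(q \<cdot> s) \<cdot> \<epsilon> = \<alpha>" by (rule Monos_cancel[OF m comp_hom[OF e qs] a])
    then show "\<exists>\<delta>\<in>Hom C E X. \<delta> \<cdot> \<epsilon> = \<alpha> \<and> \<mu> \<cdot> \<delta> = \<beta>" using 1 qs by blast
  qed
  then show thesis by (rule that[OF e r(1) _ r(2,3)])
qed simp

end

section \<open>Existence of envelopes of stereotype algebras\<close>

context universe
begin

lemma mono_complete_Ste: "mono_complete_category (Ste :: ('u top_module, 'u ste_arrow) category_data)"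
proof (intro mono_complete_category.intro category_Ste mono_complete_category_axioms.intro)
  fix A :: "'u top_module" and M assume A: "A \<in> Obj Ste" and M: "M \<subseteq> {\<sigma> \<in> Monos Ste. Cod Ste \<sigma> = A}"
  show "\<exists>E \<rho>. \<rho> \<in> Hom Ste E A \<and> \<rho> \<in> Monos Ste \<and>
    (\<forall>\<sigma>\<in>M. \<exists>\<upsilon>\<in>Hom Ste E (Dom Ste \<sigma>). \<sigma> \<cdot>\<^bsub>Ste\<^esub> \<upsilon> = \<rho>) \<and>
    (\<forall>Q \<beta>. \<beta> \<in> Hom Ste Q A \<longrightarrow> (\<forall>\<sigma>\<in>M. \<exists>\<delta>\<in>Hom Ste Q (Dom Ste \<sigma>). \<sigma> \<cdot>\<^bsub>Ste\<^esub> \<delta> = \<beta>) \<longrightarrow>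
      (\<exists>\<delta>\<in>Hom Ste Q E. \<rho> \<cdot>\<^bsub>Ste\<^esub> \<delta> = \<beta>))"
    unfolding Ste_simps by (rule ste_intersection) (use A M in auto)
qed (rule ste_pullback_mono ste_equalizer, assumption+)+

sublocale SteM: mono_complete_category "Ste :: ('u top_module, 'u ste_arrow) category_data"
  by (rule mono_complete_Ste)

text \<open>The lift for an arbitrary epimorphism \<open>\<sigma>\<close> comes from the strength of
  the monomorphism \<open>\<rho>\<close>.\<close>

lemma Env_Epis_exists:
  fixes A :: "'u top_module"
  assumes A: "A \<in> Obj Ste" and \<Phi>: "\<Phi> \<subseteq> Mor Ste" and sm: "small TYPE('u) {\<phi> \<in> \<Phi>. Dom Ste \<phi> = A}"
  shows "Env Ste (Epis Ste) \<Phi> A \<noteq> {}"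
proof -
  let ?\<Psi> = "{\<phi> \<in> \<Phi>. Dom Ste \<phi> = A}"
  have "\<phi> \<in> Hom Ste A (target \<phi>)" if "\<phi> \<in> ?\<Psi>" for \<phi> using Mor_Hom[of \<phi> Ste] \<Phi> that by auto
  moreover have "A \<in> ste_objects" using A by simp
  ultimately obtain E0 \<epsilon>0 where e0: "\<epsilon>0 \<in> Hom Ste A E0"
    and fac: "\<forall>\<phi>\<in>?\<Psi>. \<exists>p\<in>Hom Ste E0 (target \<phi>). p \<cdot>\<^bsub>Ste\<^esub> \<epsilon>0 = \<phi>"
    and univ: "\<forall>X \<sigma>. \<sigma> \<in> Hom Ste A X \<longrightarrow> (\<forall>\<phi>\<in>?\<Psi>. \<exists>\<psi>\<in>Hom Ste X (target \<phi>). \<psi> \<cdot>\<^bsub>Ste\<^esub> \<sigma> = \<phi>) \<longrightarrow>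
      (\<exists>\<delta>\<in>Hom Ste X E0. \<delta> \<cdot>\<^bsub>Ste\<^esub> \<sigma> = \<epsilon>0)"
    using small_joint_factorization[OF _ _ sm, of A] by blast
  obtain E \<epsilon> \<rho> where e: "\<epsilon> \<in> Hom Ste A E" "\<rho> \<in> Hom Ste E E0" "\<epsilon> \<in> Epis Ste" "\<rho> \<in> SMonos Ste" "\<rho> \<cdot>\<^bsub>Ste\<^esub> \<epsilon> = \<epsilon>0"
    by (rule SteM.Epi_SMono_factorization[OF e0])
  have "\<epsilon> \<in> Env Ste (Epis Ste) \<Phi> A"
  proof (rule Ste.Env_exists[OF \<Phi> e0 _ _ subset_refl e(3,1,2,5)])
    show "\<exists>p\<in>Hom Ste E0 (Cod Ste \<phi>). p \<cdot>\<^bsub>Ste\<^esub> \<epsilon>0 = \<phi>" if "\<phi> \<in> \<Phi>" "Dom Ste \<phi> = A" for \<phi>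
      using fac that by simp
    show "\<exists>\<delta>\<in>Hom Ste X E0. \<delta> \<cdot>\<^bsub>Ste\<^esub> \<sigma> = \<epsilon>0" if "\<sigma> \<in> Hom Ste A X"
      "\<And>\<phi>. \<phi> \<in> \<Phi> \<Longrightarrow> Dom Ste \<phi> = A \<Longrightarrow> \<exists>\<psi>\<in>Hom Ste X (Cod Ste \<phi>). \<psi> \<cdot>\<^bsub>Ste\<^esub> \<sigma> = \<phi>" for X \<sigma>
      using univ that by simp
    show "\<exists>\<delta>\<in>Hom Ste X E. \<delta> \<cdot>\<^bsub>Ste\<^esub> \<sigma> = \<epsilon>"
      if "\<sigma> \<in> Epis Ste" "\<sigma> \<in> Hom Ste A X" "\<beta> \<in> Hom Ste X E0" "\<beta> \<cdot>\<^bsub>Ste\<^esub> \<sigma> = \<rho> \<cdot>\<^bsub>Ste\<^esub> \<epsilon>" for X \<sigma> \<beta>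
      using SMonos_lift[OF e(4,2) that(1,2) e(1) that(3,4)] by blast
  qed
  then show ?thesis by blast
qed

text \<open>Here the lift comes from the strength of \<open>\<sigma>\<close>, so an ordinary
  monomorphism \<open>\<rho>\<close> serves.\<close>

lemma Env_SEpis_exists:
  fixes A :: "'u top_module"
  assumes A: "A \<in> Obj Ste" and \<Phi>: "\<Phi> \<subseteq> Mor Ste"
  shows "Env Ste (SEpis Ste) \<Phi> A \<noteq> {}"
proof -
  let ?\<Psi> = "{\<phi> \<in> \<Phi>. Dom Ste \<phi> = A}"
  have "\<phi> \<in> Hom Ste A (target \<phi>)" if "\<phi> \<in> ?\<Psi>" for \<phi> using Mor_Hom[of \<phi> Ste] \<Phi> that by auto
  moreover have "A \<in> ste_objects" using A by simp
  ultimately obtain E0 \<epsilon>0 where e0: "\<epsilon>0 \<in> Hom Ste A E0"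
    and fac: "\<forall>\<phi>\<in>?\<Psi>. \<exists>p\<in>Hom Ste E0 (target \<phi>). p \<cdot>\<^bsub>Ste\<^esub> \<epsilon>0 = \<phi>"
    and univ: "\<forall>X \<sigma>. \<sigma> \<in> Hom Ste A X \<longrightarrow> \<sigma> \<in> SEpis Ste \<longrightarrow>
      (\<forall>\<phi>\<in>?\<Psi>. \<exists>\<psi>\<in>Hom Ste X (target \<phi>). \<psi> \<cdot>\<^bsub>Ste\<^esub> \<sigma> = \<phi>) \<longrightarrow>
      (\<exists>\<delta>\<in>Hom Ste X E0. \<delta> \<cdot>\<^bsub>Ste\<^esub> \<sigma> = \<epsilon>0)"
    using strong_joint_factorization[of ?\<Psi> A] by blast
  obtain E \<epsilon> \<rho> where e: "\<epsilon> \<in> Hom Ste A E" "\<rho> \<in> Hom Ste E E0" "\<epsilon> \<in> SEpis Ste" "\<rho> \<in> Monos Ste" "\<rho> \<cdot>\<^bsub>Ste\<^esub> \<epsilon> = \<epsilon>0"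
    by (rule SteM.SEpi_Mono_factorization[OF e0])
  have "\<epsilon> \<in> Env Ste (SEpis Ste) \<Phi> A"
  proof (rule Ste.Env_exists[OF \<Phi> e0 _ _ _ e(3,1,2,5)])
    show "\<exists>p\<in>Hom Ste E0 (Cod Ste \<phi>). p \<cdot>\<^bsub>Ste\<^esub> \<epsilon>0 = \<phi>" if "\<phi> \<in> \<Phi>" "Dom Ste \<phi> = A" for \<phi>
      using fac that by simp
    show "\<exists>\<delta>\<in>Hom Ste X E0. \<delta> \<cdot>\<^bsub>Ste\<^esub> \<sigma> = \<epsilon>0" if "\<sigma> \<in> Hom Ste A X" "\<sigma> \<in> SEpis Ste"
      "\<And>\<phi>. \<phi> \<in> \<Phi> \<Longrightarrow> Dom Ste \<phi> = A \<Longrightarrow> \<exists>\<psi>\<in>Hom Ste X (Cod Ste \<phi>). \<psi> \<cdot>\<^bsub>Ste\<^esub> \<sigma> = \<phi>" for X \<sigma>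
      using univ that by simp
    show "SEpis Ste \<subseteq> Epis Ste" using SEpis_Epis by (rule subsetI)
    show "\<exists>\<delta>\<in>Hom Ste X E. \<delta> \<cdot>\<^bsub>Ste\<^esub> \<sigma> = \<epsilon>"
      if "\<sigma> \<in> SEpis Ste" "\<sigma> \<in> Hom Ste A X" "\<beta> \<in> Hom Ste X E0" "\<beta> \<cdot>\<^bsub>Ste\<^esub> \<sigma> = \<rho> \<cdot>\<^bsub>Ste\<^esub> \<epsilon>" for X \<sigma> \<beta>
      using SEpis_lift[OF that(1,2) e(4,2,1) that(3,4)] by blast
  qed
  then show ?thesis by blast
qed

end

theorem theorem0p3p20:
  fixes A :: "'u top_module"
  assumes "inaccessible TYPE('u)"
    and "A \<in> Obj Ste"
  shows
    "(\<forall>\<Phi>. \<Phi> \<subseteq> Mor Ste \<and> goes_from Ste \<Phi> A \<longrightarrow>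
        (small TYPE('u) {\<phi> \<in> \<Phi>. Dom Ste \<phi> = A} \<longrightarrow> Env Ste (Epis Ste) \<Phi> A \<noteq> {}) \<and>
        Env Ste (SEpis Ste) \<Phi> A \<noteq> {} \<and>
        (differs_outside Ste \<Phi> \<longrightarrow>
           Env Ste (Epis Ste) \<Phi> A = Env Ste (Bims Ste) \<Phi> A \<and>
           (small TYPE('u) {\<phi> \<in> \<Phi>. Dom Ste \<phi> = A} \<longrightarrow> Env Ste (Bims Ste) \<Phi> A \<noteq> {})) \<and>
        (differs_outside Ste \<Phi> \<and> right_ideal Ste \<Phi> \<longrightarrow>
           (\<forall>\<Omega>. Bims Ste \<subseteq> \<Omega> \<and> \<Omega> \<subseteq> Mor Ste \<longrightarrow>
              Env Ste (Epis Ste) \<Phi> A = Env Ste (Bims Ste) \<Phi> A \<and>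
              Env Ste (Bims Ste) \<Phi> A = Env Ste \<Omega> \<Phi> A \<and>
              Env Ste \<Omega> \<Phi> A = Env Ste (Mor Ste) \<Phi> A \<and>
              (small TYPE('u) {\<phi> \<in> \<Phi>. Dom Ste \<phi> = A} \<longrightarrow> Env Ste (Mor Ste) \<Phi> A \<noteq> {})))) \<and>
     (\<forall>\<Phi>. \<Phi> \<subseteq> Mor Ste \<and> goes_to Ste \<Phi> A \<longrightarrow>
        Ref Ste (Monos Ste) \<Phi> A \<noteq> {} \<and>
        Ref Ste (SMonos Ste) \<Phi> A \<noteq> {} \<and>
        (differs_inside Ste \<Phi> \<longrightarrow>
           Ref Ste (Monos Ste) \<Phi> A = Ref Ste (Bims Ste) \<Phi> A \<and>
           Ref Ste (Bims Ste) \<Phi> A \<noteq> {}) \<and>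
        (differs_inside Ste \<Phi> \<and> left_ideal Ste \<Phi> \<longrightarrow>
           (\<forall>\<Gamma>. Bims Ste \<subseteq> \<Gamma> \<and> \<Gamma> \<subseteq> Mor Ste \<longrightarrow>
              Ref Ste (Monos Ste) \<Phi> A = Ref Ste (Bims Ste) \<Phi> A \<and>
              Ref Ste (Bims Ste) \<Phi> A = Ref Ste \<Gamma> \<Phi> A \<and>
              Ref Ste \<Gamma> \<Phi> A = Ref Ste (Mor Ste) \<Phi> A \<and>
              Ref Ste (Mor Ste) \<Phi> A \<noteq> {})))"
  (is "(\<forall>\<Phi>. ?P \<Phi> \<longrightarrow> ?E \<Phi>) \<and> (\<forall>\<Phi>. ?Q \<Phi> \<longrightarrow> ?R \<Phi>)")
proof -
  interpret universe "TYPE('u)" using assms(1) by (rule universe.intro)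
  have Bims: "Bims Ste \<subseteq> Mor Ste" using Monos_Mor unfolding Bims_def by (intro subsetI) (elim IntE)
  have E: "?E \<Phi>" if "?P \<Phi>" for \<Phi>
  proof -
    have \<Phi>: "\<Phi> \<subseteq> Mor Ste" using that by (rule conjunct1)
    let ?S = "small TYPE('u) {\<phi> \<in> \<Phi>. Dom Ste \<phi> = A}"
    have 1: "?S \<longrightarrow> Env Ste (Epis Ste) \<Phi> A \<noteq> {}" using Env_Epis_exists[OF assms(2) \<Phi>] by (rule impI)
    have 2: "Env Ste (SEpis Ste) \<Phi> A \<noteq> {}" by (rule Env_SEpis_exists[OF assms(2) \<Phi>])
    have 3: "Env Ste (Epis Ste) \<Phi> A = Env Ste (Bims Ste) \<Phi> A \<and> (?S \<longrightarrow> Env Ste (Bims Ste) \<Phi> A \<noteq> {})"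
      if "differs_outside Ste \<Phi>"
      using 1 Ste.Env_Epis_Bims[OF \<Phi> that, of A] by simp
    \<comment> \<open>The comparison with bimorphisms is applied to \<open>\<Omega>\<close> and, by
      \<open>Bims\<close>, also to \<open>Mor Ste\<close>.\<close>
    have 4: "Env Ste (Epis Ste) \<Phi> A = Env Ste (Bims Ste) \<Phi> A \<and> Env Ste (Bims Ste) \<Phi> A = Env Ste \<Omega> \<Phi> A \<and>
        Env Ste \<Omega> \<Phi> A = Env Ste (Mor Ste) \<Phi> A \<and> (?S \<longrightarrow> Env Ste (Mor Ste) \<Phi> A \<noteq> {})"
      if d: "differs_outside Ste \<Phi>" "right_ideal Ste \<Phi>" and \<Omega>: "Bims Ste \<subseteq> \<Omega>" "\<Omega> \<subseteq> Mor Ste" for \<Omega>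
      using 3[OF d(1)] Ste.Env_Bims_any[OF \<Phi> d \<Omega>, of A] Ste.Env_Bims_any[OF \<Phi> d Bims subset_refl, of A] by simp
    show ?thesis using 1 2 3 4 by blast
  qed
  have R: "?R \<Phi>" if "?Q \<Phi>" for \<Phi>
  proof -
    have \<Phi>: "\<Phi> \<subseteq> Mor Ste" using that by (rule conjunct1)
    have 1: "Ref Ste (Monos Ste) \<Phi> A \<noteq> {}" "Ref Ste (SMonos Ste) \<Phi> A \<noteq> {}"
      by (rule SteM.Ref_exists[OF assms(2) \<Phi>]; simp)+
    have 3: "Ref Ste (Monos Ste) \<Phi> A = Ref Ste (Bims Ste) \<Phi> A \<and> Ref Ste (Bims Ste) \<Phi> A \<noteq> {}"
      if "differs_inside Ste \<Phi>"
      using 1 Ste.Ref_Monos_Bims[OF \<Phi> that, of A] by simp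
    have 4: "Ref Ste (Monos Ste) \<Phi> A = Ref Ste (Bims Ste) \<Phi> A \<and> Ref Ste (Bims Ste) \<Phi> A = Ref Ste \<Gamma> \<Phi> A \<and>
        Ref Ste \<Gamma> \<Phi> A = Ref Ste (Mor Ste) \<Phi> A \<and> Ref Ste (Mor Ste) \<Phi> A \<noteq> {}"
      if d: "differs_inside Ste \<Phi>" "left_ideal Ste \<Phi>" and \<Gamma>: "Bims Ste \<subseteq> \<Gamma>" "\<Gamma> \<subseteq> Mor Ste" for \<Gamma>
      using 3[OF d(1)] Ste.Ref_Bims_any[OF \<Phi> d \<Gamma>, of A] Ste.Ref_Bims_any[OF \<Phi> d Bims subset_refl, of A] by simp
    show ?thesis using 1 3 4 by blast
  qed
  show ?thesis by (rule conjI; rule allI; rule impI) (erule E, erule R)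
qed

end
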